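(* Let $\mathbb{F}_2$ be the free group in two generators (as a discrete group). Then $A_{\mathrm{cb}}(\mathbb{F}_2)$ is operator amenable.
   Context: For a locally compact group $G$, $A(G)$ is the Fourier algebra (Eymard), with the operator space structure it has as the predual of the group von Neumann algebra $\mathrm{VN}(G)$. A multiplier of $A(G)$ is a function $f: G \to \mathbb{C}$ with $fA(G) \subset A(G)$; it is identified with the bounded operator $M_f: A(G)\to A(G)$, $g \mapsto fg$. $\mathcal{M}_{\mathrm{cb}}(A(G))$ is the algebra of those multipliers $f$ for which $M_f$ is completely bounded; it is a closed subalgebra of $\mathcal{CB}(A(G))$ (the completely bounded operators on $A(G)$, with its usual operator space structure) and carries the inherited norm and operator space structure. $A_{\mathrm{cb}}(G)$ is the closure of $A(G)$ in $\mathcal{M}_{\mathrm{cb}}(A(G))$, with the inherited operator space structure. A quantized Banach algebra is an algebra $\mathfrak{A}$ which is also a (complete) operator space such that the multiplication is completely bounded as a bilinear map (not necessarily completely contractive), in the sense that it induces a completely bounded map on the operator space projective tensor product. A quantized Banach $\mathfrak{A}$-bimodule is an $\mathfrak{A}$-bimodule $E$ which is also a (complete) operator space such that both module actions $\mathfrak{A}\times E\to E$ and $E\times\mathfrak{A}\to E$ are completely bounded bilinear maps in the same sense. Its dual $E^\ast$ is a quantized Banach $\mathfrak{A}$-bimodule via $\langle x, a\cdot\phi\rangle = \langle x\cdot a,\phi\rangle$, $\langle x,\phi\cdot a\rangle = \langle a\cdot x,\phi\rangle$ for $a \in \mathfrak{A}$, $\phi \in E^\ast$, $x \in E$. A derivation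 $D:\mathfrak{A}\to E^\ast$ is a linear map with $D(ab)=a\cdot Db+(Da)\cdot b$; it is inner if $Da=a\cdot\phi-\phi\cdot a$ for some $\phi\in E^\ast$ and all $a \in \mathfrak{A}$. $\mathfrak{A}$ is operator amenable if, for every quantized Banach $\mathfrak{A}$-bimodule $E$, every completely bounded derivation $D:\mathfrak{A}\to E^\ast$ is inner. *)

theory Defs
  imports
    "HOL-Analysis.Analysis"
    "HOL-Algebra.Group"
    "HOL-Library.Function_Algebras"
begin

section \<open>Operator spaces\<close>

text \<open>
  An operator space is carried by a linear subspace \<open>vecs V\<close> of an ambient complex vector space
  (the type \<open>'v\<close> with scalar multiplication \<open>smul V\<close>). An \<open>n \<times> n\<close> matrix over \<open>V\<close> is a function
  of two indices that vanishes unless both are below \<open>n\<close>. The size \<open>n = 0\<close> is allowed and is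
  harmless: there is one such matrix, and the axioms give it norm \<open>0\<close>.
\<close>

record 'v op_space =
  vecs :: "'v set"
  smul :: "complex \<Rightarrow> 'v \<Rightarrow> 'v"
  mnorm :: "nat \<Rightarrow> (nat \<Rightarrow> nat \<Rightarrow> 'v) \<Rightarrow> real"

definition pad :: "nat \<Rightarrow> (nat \<Rightarrow> nat \<Rightarrow> 'v::zero) \<Rightarrow> nat \<Rightarrow> nat \<Rightarrow> 'v" where
  "pad n x = (\<lambda>i j. if i < n \<and> j < n then x i j else 0)"

definition mats :: "('v::ab_group_add, 'm) op_space_scheme \<Rightarrow> nat \<Rightarrow> (nat \<Rightarrow> nat \<Rightarrow> 'v) set" where
  "mats V n = {x. (\<forall>i<n. \<forall>j<n. x i j \<in> vecs V) \<and> pad n x = x}"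

definition vnorm :: "('v::ab_group_add, 'm) op_space_scheme \<Rightarrow> 'v \<Rightarrow> real" where
  "vnorm V v = mnorm V 1 (pad 1 (\<lambda>i j. v))"

text \<open>Norm of a complex \<open>m \<times> n\<close> matrix as an operator between Hilbert spaces.\<close>

definition cmat_norm :: "nat \<Rightarrow> nat \<Rightarrow> (nat \<Rightarrow> nat \<Rightarrow> complex) \<Rightarrow> real" where
  "cmat_norm m n \<alpha> =
    Sup {sqrt (\<Sum>i<m. (cmod (\<Sum>j<n. \<alpha> i j * v j))\<^sup>2) | v. (\<Sum>j<n. (cmod (v j))\<^sup>2) \<le> 1}"

text \<open>The product \<open>\<alpha> x \<beta>\<close> with \<open>\<alpha>\<close> of size \<open>m \<times> n\<close>, \<open>x\<close> of size \<open>n \<times> n\<close>, \<open>\<beta>\<close> of size \<open>n \<times> m\<close>.\<close>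

definition sandwich ::
  "(complex \<Rightarrow> 'v::ab_group_add \<Rightarrow> 'v) \<Rightarrow> nat \<Rightarrow> nat \<Rightarrow> (nat \<Rightarrow> nat \<Rightarrow> complex) \<Rightarrow>
    (nat \<Rightarrow> nat \<Rightarrow> 'v) \<Rightarrow> (nat \<Rightarrow> nat \<Rightarrow> complex) \<Rightarrow> nat \<Rightarrow> nat \<Rightarrow> 'v" where
  "sandwich sc m n \<alpha> x \<beta> = pad m (\<lambda>i j. \<Sum>k<n. \<Sum>l<n. sc (\<alpha> i k * \<beta> l j) (x k l))"

definition dsum :: "nat \<Rightarrow> nat \<Rightarrow> (nat \<Rightarrow> nat \<Rightarrow> 'v::zero) \<Rightarrow> (nat \<Rightarrow> nat \<Rightarrow> 'v) \<Rightarrow> nat \<Rightarrow> nat \<Rightarrow> 'v" where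
  "dsum m n x y = pad (m + n) (\<lambda>i j. if i < m \<and> j < m then x i j
                                     else if m \<le> i \<and> m \<le> j then y (i - m) (j - m) else 0)"

text \<open>Complete operator spaces, by Ruan's axioms.\<close>

locale operator_space =
  fixes V :: "('v::ab_group_add, 'm) op_space_scheme"
  assumes ambient: "vector_space (smul V)"
    and subspace: "module.subspace (smul V) (vecs V)"
    and norm_nonneg: "x \<in> mats V n \<Longrightarrow> 0 \<le> mnorm V n x"
    and norm_eq_0: "x \<in> mats V n \<Longrightarrow> mnorm V n x = 0 \<longleftrightarrow> x = 0"
    and norm_add: "x \<in> mats V n \<Longrightarrow> y \<in> mats V n \<Longrightarrow> mnorm V n (x + y) \<le> mnorm V n x + mnorm V n y"
    and norm_smul: "x \<in> mats V n \<Longrightarrow> mnorm V n (\<lambda>i j. smul V c (x i j)) = cmod c * mnorm V n x"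
    and norm_dsum: "x \<in> mats V m \<Longrightarrow> y \<in> mats V n \<Longrightarrow>
          mnorm V (m + n) (dsum m n x y) = max (mnorm V m x) (mnorm V n y)"
    and norm_sandwich: "x \<in> mats V n \<Longrightarrow>
          mnorm V m (sandwich (smul V) m n \<alpha> x \<beta>) \<le> cmat_norm m n \<alpha> * mnorm V n x * cmat_norm n m \<beta>"
    and complete: "\<lbrakk>\<And>k::nat. X k \<in> vecs V;
          \<And>e. 0 < e \<Longrightarrow> \<exists>N. \<forall>k\<ge>N. \<forall>l\<ge>N. vnorm V (X k - X l) < e\<rbrakk>
          \<Longrightarrow> \<exists>x\<in>vecs V. (\<lambda>k. vnorm V (X k - x)) \<longlonglongrightarrow> 0"

definition complex_os :: "complex op_space" where
  "complex_os = \<lparr>vecs = UNIV, smul = (*), mnorm = (\<lambda>n. cmat_norm n n)\<rparr>"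


section \<open>Completely bounded maps and duals\<close>

definition lin_on :: "('v::ab_group_add, 'm) op_space_scheme \<Rightarrow> ('w::ab_group_add, 'n) op_space_scheme \<Rightarrow>
    ('v \<Rightarrow> 'w) \<Rightarrow> bool" where
  "lin_on V W T \<longleftrightarrow> (\<forall>x\<in>vecs V. T x \<in> vecs W) \<and>
     (\<forall>x\<in>vecs V. \<forall>y\<in>vecs V. T (x + y) = T x + T y) \<and>
     (\<forall>c. \<forall>x\<in>vecs V. T (smul V c x) = smul W c (T x))"

definition cb_on :: "('v::ab_group_add, 'm) op_space_scheme \<Rightarrow> ('w::ab_group_add, 'n) op_space_scheme \<Rightarrow>
    ('v \<Rightarrow> 'w) \<Rightarrow> bool" where
  "cb_on V W T \<longleftrightarrow> lin_on V W T \<and>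
     (\<exists>C. \<forall>n. \<forall>x\<in>mats V n. mnorm W n (\<lambda>i j. T (x i j)) \<le> C * mnorm V n x)"

text \<open>
  The norm of a matrix \<open>[F\<^sub>i\<^sub>j]\<close> of maps \<open>V \<rightarrow> W\<close> is its completely bounded norm as a map from \<open>V\<close> into
  the \<open>n \<times> n\<close> matrices over \<open>W\<close>, where \<open>m \<times> m\<close> matrices over the latter are read as
  \<open>nm \<times> nm\<close> matrices over \<open>W\<close>; the pair \<open>(i, k)\<close> of indices is coded as \<open>i * m + k\<close>.
\<close>

definition amplify :: "nat \<Rightarrow> nat \<Rightarrow> (nat \<Rightarrow> nat \<Rightarrow> 'v \<Rightarrow> 'w::zero) \<Rightarrow> (nat \<Rightarrow> nat \<Rightarrow> 'v) \<Rightarrow>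
    nat \<Rightarrow> nat \<Rightarrow> 'w" where
  "amplify n m F x = pad (n * m) (\<lambda>p q. F (p div m) (q div m) (x (p mod m) (q mod m)))"

definition cb_mnorm :: "('v::ab_group_add, 'm) op_space_scheme \<Rightarrow> ('w::ab_group_add, 'n) op_space_scheme \<Rightarrow>
    nat \<Rightarrow> (nat \<Rightarrow> nat \<Rightarrow> 'v \<Rightarrow> 'w) \<Rightarrow> real" where
  "cb_mnorm V W n F = Sup {mnorm W (n * m) (amplify n m F x) | m x. x \<in> mats V m \<and> mnorm V m x \<le> 1}"

text \<open>Maps defined on \<open>vecs V\<close> only are made total by the value \<open>0\<close> outside \<open>vecs V\<close>.\<close>

definition CB :: "('v::ab_group_add, 'm) op_space_scheme \<Rightarrow> ('w::ab_group_add, 'n) op_space_scheme \<Rightarrow>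
    ('v \<Rightarrow> 'w) op_space" where
  "CB V W = \<lparr>vecs = {T. cb_on V W T \<and> (\<forall>x. x \<notin> vecs V \<longrightarrow> T x = 0)},
             smul = (\<lambda>c T x. smul W c (T x)),
             mnorm = cb_mnorm V W\<rparr>"

definition os_dual :: "('v::ab_group_add, 'm) op_space_scheme \<Rightarrow> ('v \<Rightarrow> complex) op_space" where
  "os_dual V = \<lparr>vecs = {\<phi>. lin_on V complex_os \<phi> \<and> (\<exists>C. \<forall>x\<in>vecs V. cmod (\<phi> x) \<le> C * vnorm V x) \<and>
                          (\<forall>x. x \<notin> vecs V \<longrightarrow> \<phi> x = 0)},
                smul = (\<lambda>c \<phi> x. c * \<phi> x),
                mnorm = cb_mnorm V complex_os\<rparr>"


section \<open>The operator space projective tensor product\<close>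

definition bilin_on :: "('v::ab_group_add, 'm) op_space_scheme \<Rightarrow> ('w::ab_group_add, 'n) op_space_scheme \<Rightarrow>
    ('x::ab_group_add, 'k) op_space_scheme \<Rightarrow> ('v \<Rightarrow> 'w \<Rightarrow> 'x) \<Rightarrow> bool" where
  "bilin_on V W X \<Phi> \<longleftrightarrow> (\<forall>x\<in>vecs V. lin_on W X (\<Phi> x)) \<and> (\<forall>y\<in>vecs W. lin_on V X (\<lambda>x. \<Phi> x y))"

text \<open>
  The algebraic tensor product is realised inside the algebraic dual of the space of bilinear forms:
  \<open>x \<otimes> y\<close> is evaluation at \<open>(x, y)\<close>.
\<close>

definition tensor :: "('v::ab_group_add, 'm) op_space_scheme \<Rightarrow> ('w::ab_group_add, 'n) op_space_scheme \<Rightarrow>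
    'v \<Rightarrow> 'w \<Rightarrow> ('v \<Rightarrow> 'w \<Rightarrow> complex) \<Rightarrow> complex" where
  "tensor V W x y = (\<lambda>B. if bilin_on V W complex_os B then B x y else 0)"

definition mat_tensor :: "('v::ab_group_add, 'm) op_space_scheme \<Rightarrow> ('w::ab_group_add, 'n) op_space_scheme \<Rightarrow>
    nat \<Rightarrow> nat \<Rightarrow> (nat \<Rightarrow> nat \<Rightarrow> 'v) \<Rightarrow> (nat \<Rightarrow> nat \<Rightarrow> 'w) \<Rightarrow>
    nat \<Rightarrow> nat \<Rightarrow> ('v \<Rightarrow> 'w \<Rightarrow> complex) \<Rightarrow> complex" where
  "mat_tensor V W p q v w =
     pad (p * q) (\<lambda>i j. tensor V W (v (i div q) (j div q)) (w (i mod q) (j mod q)))"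

lemma vector_space_pointwise: "vector_space (\<lambda>c (f :: 'x \<Rightarrow> complex) t. c * f t)"
  by unfold_locales (auto simp: fun_eq_iff algebra_simps)

definition proj_tensor :: "('v::ab_group_add, 'm) op_space_scheme \<Rightarrow> ('w::ab_group_add, 'n) op_space_scheme \<Rightarrow>
    (('v \<Rightarrow> 'w \<Rightarrow> complex) \<Rightarrow> complex) op_space" where
  "proj_tensor V W =
     \<lparr>vecs = module.span (\<lambda>c t B. c * t B) {tensor V W x y | x y. x \<in> vecs V \<and> y \<in> vecs W},
      smul = (\<lambda>c t B. c * t B),
      mnorm = (\<lambda>n u. Inf {cmat_norm n (p * q) \<alpha> * mnorm V p v * mnorm W q w * cmat_norm (p * q) n \<beta>
        | p q \<alpha> v w \<beta>. v \<in> mats V p \<and> w \<in> mats W q \<and>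
            u = sandwich (\<lambda>c t B. c * t B) n (p * q) \<alpha> (mat_tensor V W p q v w) \<beta>})\<rparr>"

text \<open>
  A bilinear map is completely bounded if it induces a completely bounded map on the projective
  tensor product. The completion of \<open>proj_tensor V W\<close> is not formed: the target \<open>X\<close> is complete
  wherever this is used, so completely bounded maps on \<open>proj_tensor V W\<close> and on its completion
  correspond to each other by unique extension.
\<close>

definition cb_bilin :: "('v::ab_group_add, 'm) op_space_scheme \<Rightarrow> ('w::ab_group_add, 'n) op_space_scheme \<Rightarrow>
    ('x::ab_group_add, 'k) op_space_scheme \<Rightarrow> ('v \<Rightarrow> 'w \<Rightarrow> 'x) \<Rightarrow> bool" where
  "cb_bilin V W X \<Phi> \<longleftrightarrow> bilin_on V W X \<Phi> \<and>
     (\<exists>L. cb_on (proj_tensor V W) X L \<and>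
          (\<forall>x\<in>vecs V. \<forall>y\<in>vecs W. L (tensor V W x y) = \<Phi> x y))"


section \<open>Quantized Banach algebras and operator amenability\<close>

record 'a op_algebra = "'a op_space" +
  amult :: "'a \<Rightarrow> 'a \<Rightarrow> 'a"

locale quantized_banach_algebra = operator_space A
  for A :: "('a::ab_group_add, 'm) op_algebra_scheme" +
  assumes cb_mult: "cb_bilin A A A (amult A)"
    and assoc: "a \<in> vecs A \<Longrightarrow> b \<in> vecs A \<Longrightarrow> c \<in> vecs A \<Longrightarrow>
          amult A (amult A a b) c = amult A a (amult A b c)"

record ('a, 'e) op_bimodule = "'e op_space" +
  lact :: "'a \<Rightarrow> 'e \<Rightarrow> 'e"
  ract :: "'e \<Rightarrow> 'a \<Rightarrow> 'e"

locale quantized_banach_bimodule = operator_space E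
  for A :: "('a::ab_group_add, 'm) op_algebra_scheme"
    and E :: "('a, 'e::ab_group_add, 'n) op_bimodule_scheme" +
  assumes cb_lact: "cb_bilin A E E (lact E)"
    and cb_ract: "cb_bilin E A E (ract E)"
    and lact_assoc: "a \<in> vecs A \<Longrightarrow> b \<in> vecs A \<Longrightarrow> x \<in> vecs E \<Longrightarrow>
          lact E (amult A a b) x = lact E a (lact E b x)"
    and ract_assoc: "a \<in> vecs A \<Longrightarrow> b \<in> vecs A \<Longrightarrow> x \<in> vecs E \<Longrightarrow>
          ract E x (amult A a b) = ract E (ract E x a) b"
    and lact_ract: "a \<in> vecs A \<Longrightarrow> b \<in> vecs A \<Longrightarrow> x \<in> vecs E \<Longrightarrow>
          ract E (lact E a x) b = lact E a (ract E x b)"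

definition dual_lact :: "('a, 'e, 'n) op_bimodule_scheme \<Rightarrow> 'a \<Rightarrow> ('e \<Rightarrow> complex) \<Rightarrow> 'e \<Rightarrow> complex" where
  "dual_lact E a \<phi> = (\<lambda>x. if x \<in> vecs E then \<phi> (ract E x a) else 0)"

definition dual_ract :: "('a, 'e, 'n) op_bimodule_scheme \<Rightarrow> ('e \<Rightarrow> complex) \<Rightarrow> 'a \<Rightarrow> 'e \<Rightarrow> complex" where
  "dual_ract E \<phi> a = (\<lambda>x. if x \<in> vecs E then \<phi> (lact E a x) else 0)"

definition dual_derivation :: "('a::ab_group_add, 'm) op_algebra_scheme \<Rightarrow>
    ('a, 'e::ab_group_add, 'n) op_bimodule_scheme \<Rightarrow> ('a \<Rightarrow> 'e \<Rightarrow> complex) \<Rightarrow> bool" where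
  "dual_derivation A E D \<longleftrightarrow> lin_on A (os_dual E) D \<and>
     (\<forall>a\<in>vecs A. \<forall>b\<in>vecs A. D (amult A a b) = dual_lact E a (D b) + dual_ract E (D a) b)"

definition inner_derivation :: "('a::ab_group_add, 'm) op_algebra_scheme \<Rightarrow>
    ('a, 'e::ab_group_add, 'n) op_bimodule_scheme \<Rightarrow> ('a \<Rightarrow> 'e \<Rightarrow> complex) \<Rightarrow> bool" where
  "inner_derivation A E D \<longleftrightarrow>
     (\<exists>\<phi>\<in>vecs (os_dual E). \<forall>a\<in>vecs A. D a = dual_lact E a \<phi> - dual_ract E \<phi> a)"

text \<open>
  HOL has no quantification over types inside a formula, so the type \<open>'e\<close> in which the bimodules
  live is a parameter; operator amenability is the assertion for all \<open>'e\<close>, obtained by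
  leaving \<open>'e\<close> a type variable in the theorem.
\<close>

definition operator_amenable :: "'e::ab_group_add itself \<Rightarrow> ('a::ab_group_add) op_algebra \<Rightarrow> bool" where
  "operator_amenable _ A \<longleftrightarrow> quantized_banach_algebra A \<and>
     (\<forall>(E :: ('a, 'e) op_bimodule) D.
        quantized_banach_bimodule A E \<and> dual_derivation A E D \<and> cb_on A (os_dual E) D
        \<longrightarrow> inner_derivation A E D)"


section \<open>The group von Neumann algebra of a discrete group\<close>

text \<open>Functions on \<open>G\<close> are total functions that vanish outside \<open>carrier G\<close>.\<close>

definition l2 :: "('g, 'm) monoid_scheme \<Rightarrow> ('g \<Rightarrow> complex) set" where
  "l2 G = {\<xi>. (\<forall>t. t \<notin> carrier G \<longrightarrow> \<xi> t = 0) \<and> (\<lambda>t. (cmod (\<xi> t))\<^sup>2) summable_on carrier G}"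

definition l2_inner :: "('g, 'm) monoid_scheme \<Rightarrow> ('g \<Rightarrow> complex) \<Rightarrow> ('g \<Rightarrow> complex) \<Rightarrow> complex" where
  "l2_inner G \<xi> \<eta> = (\<Sum>\<^sub>\<infinity>t\<in>carrier G. \<xi> t * cnj (\<eta> t))"

definition l2_norm :: "('g, 'm) monoid_scheme \<Rightarrow> ('g \<Rightarrow> complex) \<Rightarrow> real" where
  "l2_norm G \<xi> = sqrt (\<Sum>\<^sub>\<infinity>t\<in>carrier G. (cmod (\<xi> t))\<^sup>2)"

definition l2_bounded :: "('g, 'm) monoid_scheme \<Rightarrow> (('g \<Rightarrow> complex) \<Rightarrow> 'g \<Rightarrow> complex) set" where
  "l2_bounded G = {T. (\<forall>\<xi>\<in>l2 G. T \<xi> \<in> l2 G) \<and>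
     (\<forall>\<xi>\<in>l2 G. \<forall>\<eta>\<in>l2 G. T (\<xi> + \<eta>) = T \<xi> + T \<eta>) \<and>
     (\<forall>c. \<forall>\<xi>\<in>l2 G. T (\<lambda>t. c * \<xi> t) = (\<lambda>t. c * T \<xi> t)) \<and>
     (\<exists>C. \<forall>\<xi>\<in>l2 G. l2_norm G (T \<xi>) \<le> C * l2_norm G \<xi>) \<and>
     (\<forall>\<xi>. \<xi> \<notin> l2 G \<longrightarrow> T \<xi> = 0)}"

definition commutant :: "('g, 'm) monoid_scheme \<Rightarrow> (('g \<Rightarrow> complex) \<Rightarrow> 'g \<Rightarrow> complex) set \<Rightarrow>
    (('g \<Rightarrow> complex) \<Rightarrow> 'g \<Rightarrow> complex) set" where
  "commutant G S = {T \<in> l2_bounded G. \<forall>R\<in>S. T \<circ> R = R \<circ> T}"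

definition left_regular :: "('g, 'm) monoid_scheme \<Rightarrow> 'g \<Rightarrow> ('g \<Rightarrow> complex) \<Rightarrow> 'g \<Rightarrow> complex" where
  "left_regular G s \<xi> = (\<lambda>t. if \<xi> \<in> l2 G \<and> t \<in> carrier G then \<xi> (inv\<^bsub>G\<^esub> s \<otimes>\<^bsub>G\<^esub> t) else 0)"

text \<open>The norm of a matrix over \<open>VN G\<close> is its norm as an operator on the \<open>n\<close>-fold sum of \<open>l2 G\<close>.\<close>

definition VN :: "('g, 'm) monoid_scheme \<Rightarrow> (('g \<Rightarrow> complex) \<Rightarrow> 'g \<Rightarrow> complex) op_space" where
  "VN G = \<lparr>vecs = commutant G (commutant G (left_regular G ` carrier G)),
           smul = (\<lambda>c T \<xi> t. c * T \<xi> t),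
           mnorm = (\<lambda>n T. Sup {sqrt (\<Sum>i<n. (l2_norm G (\<Sum>j<n. T i j (\<xi> j)))\<^sup>2) | \<xi>.
                     (\<forall>j<n. \<xi> j \<in> l2 G) \<and> (\<Sum>j<n. (l2_norm G (\<xi> j))\<^sup>2) \<le> 1})\<rparr>"

text \<open>The predual: the normal (ultraweakly continuous) functionals, as a subspace of the dual.\<close>

definition VN_predual :: "('g, 'm) monoid_scheme \<Rightarrow>
    ((('g \<Rightarrow> complex) \<Rightarrow> 'g \<Rightarrow> complex) \<Rightarrow> complex) op_space" where
  "VN_predual G = (os_dual (VN G))
     \<lparr>vecs := {\<lambda>T. if T \<in> vecs (VN G) then (\<Sum>n. l2_inner G (T (\<xi> n)) (\<eta> n)) else 0 | \<xi> \<eta>.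
         (\<forall>n::nat. \<xi> n \<in> l2 G \<and> \<eta> n \<in> l2 G) \<and>
         summable (\<lambda>n. (l2_norm G (\<xi> n))\<^sup>2) \<and> summable (\<lambda>n. (l2_norm G (\<eta> n))\<^sup>2)}\<rparr>"


section \<open>The Fourier algebra and its completely bounded multipliers\<close>

text \<open>A normal functional \<open>\<phi>\<close> is identified with the function \<open>s \<mapsto> \<phi> (left_regular G s)\<close>.\<close>

definition fourier_fun :: "('g, 'm) monoid_scheme \<Rightarrow>
    ((('g \<Rightarrow> complex) \<Rightarrow> 'g \<Rightarrow> complex) \<Rightarrow> complex) \<Rightarrow> 'g \<Rightarrow> complex" where
  "fourier_fun G \<phi> = (\<lambda>s. if s \<in> carrier G then \<phi> (left_regular G s) else 0)"

definition fourier_algebra :: "('g, 'm) monoid_scheme \<Rightarrow> ('g \<Rightarrow> complex) op_algebra" where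
  "fourier_algebra G =
     \<lparr>vecs = fourier_fun G ` vecs (VN_predual G),
      smul = (\<lambda>c u t. c * u t),
      mnorm = (\<lambda>n u. mnorm (VN_predual G) n
                (\<lambda>i j. the_inv_into (vecs (VN_predual G)) (fourier_fun G) (u i j))),
      amult = (\<lambda>u v t. u t * v t)\<rparr>"

definition mult_op :: "('g, 'm) monoid_scheme \<Rightarrow> ('g \<Rightarrow> complex) \<Rightarrow> ('g \<Rightarrow> complex) \<Rightarrow> 'g \<Rightarrow> complex" where
  "mult_op G f u = (if u \<in> vecs (fourier_algebra G) then (\<lambda>t. f t * u t) else 0)"

definition multiplier :: "('g, 'm) monoid_scheme \<Rightarrow> ('g \<Rightarrow> complex) \<Rightarrow> bool" where
  "multiplier G f \<longleftrightarrow> (\<forall>t. t \<notin> carrier G \<longrightarrow> f t = 0) \<and>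
     (\<forall>u\<in>vecs (fourier_algebra G). mult_op G f u \<in> vecs (fourier_algebra G))"

definition M_cb :: "('g, 'm) monoid_scheme \<Rightarrow> ('g \<Rightarrow> complex) op_algebra" where
  "M_cb G =
     \<lparr>vecs = {f. multiplier G f \<and> cb_on (fourier_algebra G) (fourier_algebra G) (mult_op G f)},
      smul = (\<lambda>c f t. c * f t),
      mnorm = (\<lambda>n f. mnorm (CB (fourier_algebra G) (fourier_algebra G)) n (\<lambda>i j. mult_op G (f i j))),
      amult = (\<lambda>f g t. f t * g t)\<rparr>"

definition A_cb :: "('g, 'm) monoid_scheme \<Rightarrow> ('g \<Rightarrow> complex) op_algebra" where
  "A_cb G = (M_cb G)
     \<lparr>vecs := {f \<in> vecs (M_cb G). \<forall>e>0. \<exists>u\<in>vecs (fourier_algebra G). vnorm (M_cb G) (f - u) < e}\<rparr>"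


section \<open>The free group on two generators\<close>

text \<open>
  Reduced words in the letters \<open>(g, s)\<close>, where \<open>g\<close> names one of the two generators and \<open>s\<close> tells
  whether the letter is the generator or its inverse.
\<close>

definition inv_letter :: "bool \<times> bool \<Rightarrow> bool \<times> bool" where
  "inv_letter x = (fst x, \<not> snd x)"

definition reduced :: "(bool \<times> bool) list \<Rightarrow> bool" where
  "reduced w \<longleftrightarrow> successively (\<lambda>x y. y \<noteq> inv_letter x) w"

fun push :: "bool \<times> bool \<Rightarrow> (bool \<times> bool) list \<Rightarrow> (bool \<times> bool) list" where
  "push x [] = [x]"
| "push x (y # w) = (if y = inv_letter x then w else x # y # w)"

definition F2 :: "(bool \<times> bool) list monoid" where
  "F2 = \<lparr>carrier = {w. reduced w}, mult = foldr push, one = []\<rparr>"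

lemma inv_letter_invol [simp]: "inv_letter (inv_letter x) = x"
  by (simp add: inv_letter_def)

lemma inv_letter_neq [simp]: "inv_letter x \<noteq> x" "x \<noteq> inv_letter x"
  by (auto simp: inv_letter_def prod_eq_iff)

lemma reduced_ConsD: "reduced (x # w) \<Longrightarrow> reduced w"
  by (cases w) (auto simp: reduced_def)

lemma reduced_push: "reduced w \<Longrightarrow> reduced (push x w)"
  by (cases w) (auto simp: reduced_def split: if_splits dest: reduced_ConsD[unfolded reduced_def])

lemma push_inv_push: "reduced w \<Longrightarrow> push x (push (inv_letter x) w) = w"
proof (cases w)
  case (Cons y v)
  assume "reduced w"
  then show ?thesis using Cons
    by (cases v) (auto simp: reduced_def)
qed simp

lemma push_reduced: "reduced (x # w) \<Longrightarrow> push x w = x # w"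
  by (cases w) (auto simp: reduced_def)

lemma reduced_foldr_push: "reduced v \<Longrightarrow> reduced (foldr push u v)"
  by (induction u) (auto intro: reduced_push)

lemma foldr_push_Nil: "reduced u \<Longrightarrow> foldr push u [] = u"
  proof (induction u)
  case (Cons x u)
  then show ?case using push_reduced[OF Cons.prems] reduced_ConsD[OF Cons.prems] by simp
qed simp

lemma foldr_push_push:
  assumes "reduced v" "reduced w"
  shows "foldr push (push x v) w = push x (foldr push v w)"
proof (cases v)
  case (Cons y v')
  have "push x (push (inv_letter x) (foldr push v' w)) = foldr push v' w"
    by (intro push_inv_push reduced_foldr_push assms)
  then show ?thesis using Cons by simp
qed simp

lemma foldr_push_assoc:
  assumes "reduced v" "reduced w"
  shows "foldr push (foldr push u v) w = foldr push u (foldr push v w)"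
  using assms by (induction u) (auto simp: foldr_push_push reduced_foldr_push)

lemma reduced_inverse: "reduced u \<Longrightarrow> reduced (rev (map inv_letter u))"
  unfolding reduced_def successively_rev successively_map
  by (erule successively_mono) auto

lemma foldr_push_inverse:
  assumes "reduced w"
  shows "foldr push (rev (map inv_letter u)) (foldr push u w) = w"
  using assms
proof (induction u arbitrary: w)
  case (Cons x u)
  have "push (inv_letter x) (push (inv_letter (inv_letter x)) (foldr push u w)) = foldr push u w"
    by (intro push_inv_push reduced_foldr_push Cons.prems)
  then show ?case using Cons by simp
qed simp

lemma group_F2: "group F2"
proof (rule groupI)
  fix u assume "u \<in> carrier F2"
  then have u: "reduced u" by (simp add: F2_def)
  have "foldr push (rev (map inv_letter u)) u = []"
    using foldr_push_inverse[of "[]" u] u by (simp add: foldr_push_Nil reduced_def)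
  then show "\<exists>v\<in>carrier F2. v \<otimes>\<^bsub>F2\<^esub> u = \<one>\<^bsub>F2\<^esub>"
    using reduced_inverse[OF u] by (auto simp: F2_def)
qed (auto simp: F2_def reduced_foldr_push foldr_push_assoc, simp add: reduced_def)

end

theory Submission
 imports Defs "HOL-Library.Sublist" "HOL-Combinatorics.Permutations"
begin

text \<open>
 Operators in \<open>VN G\<close> are bounded kernels \<open>\<alpha>(s t\<inverse>)\<close>, so all norms reduce to bounds for kernels (\<open>kbd\<close>), and
 completely bounded multipliers are exactly the Herz--Schur multipliers \<open>HSm\<close>. Truncating \<open>r ^ length s\<close> gives, by the
 geometry of the Cayley tree, finitely supported \<open>e k\<close> on the free group that tend to \<open>1\<close> and are uniformly bounded
 as multipliers; their squares form a bounded approximate identity of \<open>A_cb F2\<close>.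

 For a derivation \<open>D\<close> put \<open>trace k x = (\<Sum>s. (e k s)\<^sup>2 * D \<delta>\<^sub>s (x \<cdot> \<delta>\<^sub>s))\<close>. Then \<open>trace k (x \<cdot> a) - trace k (a \<cdot> x) = D a (x \<cdot> (e k)\<^sup>2)\<close>.
 The free group is residually finite: the matrices \<open>[e k s]\<close> at the positions \<open>(\<pi> s j, j)\<close> of a finite permutation
 representation \<open>\<pi>\<close> have multiplier norm bounded independently of \<open>k\<close>, and complete boundedness of \<open>D\<close> on them bounds
 \<open>trace k\<close> uniformly. A Banach limit of the \<open>trace k\<close>, corrected by one of \<open>D (e k)\<^sup>2 (x - x \<cdot> (e j)\<^sup>2)\<close> for the part
 of the bimodule on which the right action degenerates, is the functional that implements \<open>D\<close>.
\<close>

section \<open>Bounded kernels\<close>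

text \<open>\<open>A(F2)\<close> itself has no bounded approximate identity, since the group is not
  amenable; \<open>e k\<close> is bounded only as a multiplier, which is why the closure is taken in
  that norm. Operator amenability is usually proved with a bounded approximate diagonal in the
  projective tensor square. Here that element is never formed: \<open>trace k x\<close> is the value
  that the truncated diagonal, with weight \<open>e k\<close> on each of its two legs, takes under
  the bilinear map \<open>(a, b) \<mapsto> D a (x \<cdot> b)\<close>; the two legs account for the
  square. Its uniform bound rests on the identity
  \<open>[\<pi> s = \<pi> t] = (1/q) \<Sum>i j. v_ij(s) v_ij(t)\<close> for the permutation matrices
  \<open>v\<close> of an action on \<open>q\<close> points that separates \<open>s\<close> and
  \<open>t\<close> at every point. The indicator of the diagonal is thus a coefficient of
  \<open>v \<otimes> v\<close> at a unit vector, and \<open>v\<close> is unitary whatever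
  \<open>q\<close> is. On the support of \<open>e k\<close> a suitable finite quotient cannot be
  told from the group. A second obstacle is that bimodules are arbitrary:
  \<open>x \<cdot> (e k)^2\<close> need not tend to \<open>x\<close>.\<close>

abbreviation nrm :: "('i => complex) => 'i set => real" where
 "nrm x F \<equiv> L2_set (\<lambda>i. cmod (x i)) F"

definition kform :: "'i set => ('i => 'i => complex) => ('i => complex) => ('i => complex) => complex" where
 "kform F K x y = (\<Sum>p\<in>F. \<Sum>q\<in>F. K p q * x q * cnj (y p))"

text \<open>The norm bound of an operator on \<open>l2(S)\<close>, stated through finite sections
  only, so that no convergence question arises. \<open>0 \<le> c\<close> is demanded because for
  empty \<open>S\<close> the inequalities say nothing about \<open>c\<close>.\<close>

definition kbd :: "'i set => ('i => 'i => complex) => real => bool" where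
 "kbd S K c \<longleftrightarrow> 0 \<le> c \<and>
   (\<forall>F x y. finite F \<longrightarrow> F \<subseteq> S \<longrightarrow> cmod (kform F K x y) \<le> c * nrm x F * nrm y F)"

lemma kbd_nonneg: "kbd S K c ==> 0 \<le> c"
 by (simp add: kbd_def)

lemma kbdD: "kbd S K c ==> finite F ==> F \<subseteq> S ==> cmod (kform F K x y) \<le> c * nrm x F * nrm y F"
 by (simp add: kbd_def)

lemma kbd_mono: "kbd S K c ==> c \<le> d ==> kbd S K d"
 unfolding kbd_def by (meson L2_set_nonneg mult_right_mono order_trans)

lemma kbd_subset: "kbd S K c ==> S' \<subseteq> S ==> kbd S' K c"
 by (auto simp: kbd_def)

lemma kform_cong:
 "(\<And>p q. p \<in> F ==> q \<in> F ==> K p q = K' p q) ==> kform F K x y = kform F K' x y"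
 unfolding kform_def by (intro sum.cong refl) auto

lemma kbd_cong:
 assumes "\<And>p q. p \<in> S ==> q \<in> S ==> K p q = K' p q"
 shows "kbd S K c \<longleftrightarrow> kbd S K' c"
proof -
 have "kform F K x y = kform F K' x y" if "F \<subseteq> S" for F x y
  using that assms by (intro kform_cong) auto
 then show ?thesis unfolding kbd_def by auto
qed

lemma kbd_localI:
 "0 \<le> c ==> (\<And>F. finite F ==> F \<subseteq> S ==> kbd F K c) ==> kbd S K c"
 unfolding kbd_def by blast

lemma nrm_restrict:
 assumes "finite S" "F \<subseteq> S"
 shows "nrm (\<lambda>p. if p \<in> F then x p else 0) S = nrm x F"
proof -
 have "(\<Sum>i\<in>S. (cmod (if i \<in> F then x i else 0))\<^sup>2) = (\<Sum>i\<in>F. (cmod (x i))\<^sup>2)"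
  by (rule sum.mono_neutral_cong_right) (use assms in auto)
 then show ?thesis by (simp add: L2_set_def)
qed

lemma kform_restrict:
 assumes "finite S" "F \<subseteq> S" "F' \<subseteq> S"
 shows "kform S K (\<lambda>p. if p \<in> F then x p else 0) (\<lambda>p. if p \<in> F' then y p else 0) =
  (\<Sum>p\<in>F'. \<Sum>q\<in>F. K p q * x q * cnj (y p))"
 unfolding kform_def
 by (intro sum.mono_neutral_cong_right ballI) (use assms in auto)

text \<open>Vectors on a subset are extended by zero, which changes neither their norms nor the
  form; so for finite \<open>S\<close> the full section suffices.\<close>

lemma kbd_finiteI:
 assumes "finite S" "0 \<le> c" "\<And>x y. cmod (kform S K x y) \<le> c * nrm x S * nrm y S"
 shows "kbd S K c"
 unfolding kbd_def
proof (intro conjI allI impI)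
 fix F x y assume F: "finite F" "F \<subseteq> S"
 show "cmod (kform F K x y) \<le> c * nrm x F * nrm y F"
  using assms(3)[of "\<lambda>p. if p \<in> F then x p else 0" "\<lambda>p. if p \<in> F then y p else 0"] F
  by (simp add: kform_restrict[OF assms(1)] nrm_restrict[OF assms(1)] flip: kform_def)
qed fact

lemma kbd_rect:
 assumes "kbd S K c" "finite F" "finite F'" "F \<subseteq> S" "F' \<subseteq> S"
 shows "cmod (\<Sum>p\<in>F'. \<Sum>q\<in>F. K p q * x q * cnj (y p)) \<le> c * nrm x F * nrm y F'"
proof -
 have "finite (F \<union> F')" "F \<union> F' \<subseteq> S" using assms by auto
 from kbdD[OF assms(1) this, of "\<lambda>p. if p \<in> F then x p else 0" "\<lambda>p. if p \<in> F' then y p else 0"]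
 show ?thesis using \<open>finite (F \<union> F')\<close> assms by (simp add: kform_restrict nrm_restrict)
qed

lemma nrm_sq: "complex_of_real ((nrm z F)\<^sup>2) = (\<Sum>p\<in>F. z p * cnj (z p))"
 by (simp add: L2_set_def sum_nonneg complex_norm_square del: of_real_power)

lemma le_of_sq_le: "0 \<le> a ==> 0 \<le> b ==> a\<^sup>2 \<le> b * a ==> a \<le> (b::real)"
 by (cases "a = 0") (auto simp: power2_eq_square)

text \<open>Duality: with the image of \<open>x\<close> itself as test vector, the form is the
  squared norm of the image, and \<open>le_of_sq_le\<close> cancels one factor.\<close>

lemma kbd_apply:
 assumes "kbd S K c" "finite F" "finite F'" "F \<subseteq> S" "F' \<subseteq> S"
 shows "nrm (\<lambda>p. \<Sum>q\<in>F. K p q * x q) F' \<le> c * nrm x F"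
proof -
 let ?z = "\<lambda>p. \<Sum>q\<in>F. K p q * x q"
 have "complex_of_real ((nrm ?z F')\<^sup>2) = (\<Sum>p\<in>F'. ?z p * cnj (?z p))"
  by (rule nrm_sq)
 also have "\<dots> = (\<Sum>p\<in>F'. \<Sum>q\<in>F. K p q * x q * cnj (?z p))"
  by (intro sum.cong refl sum_distrib_right)
 finally have "cmod (complex_of_real ((nrm ?z F')\<^sup>2)) = cmod (\<Sum>p\<in>F'. \<Sum>q\<in>F. K p q * x q * cnj (?z p))"
  by (rule arg_cong)
 then have "(nrm ?z F')\<^sup>2 = cmod (\<Sum>p\<in>F'. \<Sum>q\<in>F. K p q * x q * cnj (?z p))"
  unfolding norm_of_real abs_power2 .
 also have "\<dots> \<le> c * nrm x F * nrm ?z F'"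
  by (rule kbd_rect[OF assms])
 finally show ?thesis
  by (rule le_of_sq_le[rotated 2]) (auto simp: kbd_nonneg[OF assms(1)])
qed

lemma inner_le_nrm: "cmod (\<Sum>p\<in>F. z p * cnj (y p)) \<le> nrm z F * nrm y F"
proof -
 have "cmod (\<Sum>p\<in>F. z p * cnj (y p)) \<le> (\<Sum>p\<in>F. \<bar>cmod (z p)\<bar> * \<bar>cmod (y p)\<bar>)"
  by (rule order_trans[OF norm_sum]) (simp add: norm_mult)
 also have "\<dots> \<le> nrm z F * nrm y F" by (rule L2_set_mult_ineq)
 finally show ?thesis .
qed

lemma kbd_applyI:
 assumes "0 \<le> c" "\<And>F x. finite F ==> F \<subseteq> S ==> nrm (\<lambda>p. \<Sum>q\<in>F. K p q * x q) F \<le> c * nrm x F"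
 shows "kbd S K c"
 unfolding kbd_def
proof (intro conjI allI impI)
 fix F x y assume F: "finite F" "F \<subseteq> S"
 have "cmod (kform F K x y) \<le> nrm (\<lambda>p. \<Sum>q\<in>F. K p q * x q) F * nrm y F"
  unfolding kform_def using inner_le_nrm[of "\<lambda>p. \<Sum>q\<in>F. K p q * x q" y F]
  by (simp add: sum_distrib_right)
 also have "\<dots> \<le> c * nrm x F * nrm y F" by (intro mult_right_mono assms F) auto
 finally show "cmod (kform F K x y) \<le> c * nrm x F * nrm y F" .
qed fact

lemma kform_add: "kform F (\<lambda>p q. K p q + L p q) x y = kform F K x y + kform F L x y"
 unfolding kform_def by (simp add: algebra_simps sum.distrib)

lemma kform_scale: "kform F (\<lambda>p q. a * K p q) x y = a * kform F K x y"
 unfolding kform_def by (simp add: algebra_simps sum_distrib_left)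

lemma kbd_add: "kbd S K c ==> kbd S L d ==> kbd S (\<lambda>p q. K p q + L p q) (c + d)"
 unfolding kbd_def kform_add
 by (auto simp: algebra_simps intro!: order_trans[OF norm_triangle_ineq] add_mono)

lemma kbd_scale: "kbd S K c ==> kbd S (\<lambda>p q. a * K p q) (cmod a * c)"
 unfolding kbd_def kform_scale by (auto simp: norm_mult mult.assoc intro!: mult_left_mono)

lemma kbd_zero: "0 \<le> c ==> kbd S (\<lambda>p q. 0) c"
 by (simp add: kbd_def kform_def)

lemma kbd_sum:
 assumes "finite M" "\<And>k. k \<in> M ==> kbd S (K k) (c k)"
 shows "kbd S (\<lambda>p q. \<Sum>k\<in>M. K k p q) (\<Sum>k\<in>M. c k)"
 using assms by (induction M rule: finite_induct) (auto simp: kbd_zero kbd_add)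

lemma kbd_entry:
 assumes "kbd S K c" "p \<in> S" "q \<in> S"
 shows "cmod (K p q) \<le> c"
 using kbd_rect[OF assms(1), of "{q}" "{p}" "\<lambda>_. 1" "\<lambda>_. 1"] assms by (simp add: L2_set_def)

lemma kbd_zero_iff: "kbd S K 0 \<longleftrightarrow> (\<forall>p\<in>S. \<forall>q\<in>S. K p q = 0)"
proof
 assume "\<forall>p\<in>S. \<forall>q\<in>S. K p q = 0"
 then show "kbd S K 0" by (subst kbd_cong[where K' = "\<lambda>_ _. 0"]) (auto intro: kbd_zero)
next
 assume "kbd S K 0"
 from kbd_entry[OF this] show "\<forall>p\<in>S. \<forall>q\<in>S. K p q = 0" by simp
qed

lemma kbd_reindex:
 assumes "kbd S K c" "inj_on h S'" "h ` S' \<subseteq> S"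
 shows "kbd S' (\<lambda>p q. K (h p) (h q)) c"
 unfolding kbd_def
proof (intro conjI allI impI)
 show "0 \<le> c" using assms(1) by (rule kbd_nonneg)
 fix F x y assume F: "finite F" "F \<subseteq> S'"
 then have inj: "inj_on h F" using assms(2) inj_on_subset by blast
 let ?g = "the_inv_into F h"
 have g: "?g (h p) = p" if "p \<in> F" for p using inj that by (rule the_inv_into_f_f)
 have n: "nrm (\<lambda>p. z (?g p)) (h ` F) = nrm z F" for z :: "_ => complex"
  by (simp add: L2_set_def sum.reindex[OF inj] g)
 have k: "kform (h ` F) K (\<lambda>p. x (?g p)) (\<lambda>p. y (?g p)) = kform F (\<lambda>p q. K (h p) (h q)) x y"
  unfolding kform_def by (simp add: sum.reindex[OF inj] g)
 have "finite (h ` F)" "h ` F \<subseteq> S" using F assms(3) by auto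
 then have "cmod (kform (h ` F) K (\<lambda>p. x (?g p)) (\<lambda>p. y (?g p))) \<le>
   c * nrm (\<lambda>p. x (?g p)) (h ` F) * nrm (\<lambda>p. y (?g p)) (h ` F)"
  by (rule kbdD[OF assms(1)])
 then show "cmod (kform F (\<lambda>p q. K (h p) (h q)) x y) \<le> c * nrm x F * nrm y F"
  unfolding k n[of x] n[of y] .
qed

lemma kbd_reindex_bij:
 assumes "bij_betw h S' S"
 shows "kbd S' (\<lambda>p q. K (h p) (h q)) c \<longleftrightarrow> kbd S K c"
proof
 assume "kbd S K c" then show "kbd S' (\<lambda>p q. K (h p) (h q)) c"
  by (rule kbd_reindex) (use assms in \<open>auto simp: bij_betw_def\<close>)
next
 assume *: "kbd S' (\<lambda>p q. K (h p) (h q)) c"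
 let ?g = "the_inv_into S' h"
 have g: "bij_betw ?g S S'" using assms by (rule bij_betw_the_inv_into)
 have "kbd S (\<lambda>p q. K (h (?g p)) (h (?g q))) c"
  using kbd_reindex[OF *, of ?g S] g by (auto simp: bij_betw_def)
 moreover have "h (?g p) = p" if "p \<in> S" for p
  using assms that by (auto simp: bij_betw_def intro: f_the_inv_into_f)
 ultimately show "kbd S K c"
  using kbd_cong[of S "\<lambda>p q. K (h (?g p)) (h (?g q))" K c] by simp
qed

text \<open>Each inequality in \<open>kbd\<close> involves finitely many entries, so bounds survive
  entrywise limits along any nontrivial filter. Besides sequences, nets of finite sets will
  occur.\<close>

lemma kbd_lim:
 assumes "\<And>p q. p \<in> S ==> q \<in> S ==> ((\<lambda>k. K k p q) \<longlongrightarrow> L p q) \<F>"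
  and "\<forall>\<^sub>F k in \<F>. kbd S (K k) c" "\<F> \<noteq> bot"
 shows "kbd S L c"
 unfolding kbd_def
proof (intro conjI allI impI)
 from eventually_happens[OF assms(2)] assms(3) show "0 \<le> c" by (auto simp: kbd_def)
 fix F x y assume F: "finite F" "F \<subseteq> S"
 have "((\<lambda>k. kform F (K k) x y) \<longlongrightarrow> kform F L x y) \<F>"
  unfolding kform_def using F assms(1) by (intro tendsto_intros) auto
 then have "((\<lambda>k. cmod (kform F (K k) x y)) \<longlongrightarrow> cmod (kform F L x y)) \<F>"
  by (rule tendsto_norm)
 then show "cmod (kform F L x y) \<le> c * nrm x F * nrm y F"
 proof (rule tendsto_upperbound)
  show "\<forall>\<^sub>F k in \<F>. cmod (kform F (K k) x y) \<le> c * nrm x F * nrm y F"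
   using assms(2) by (rule eventually_mono) (rule kbdD[OF _ F])
 qed fact
qed

lemma nrm_prod_sq: "(nrm x (J \<times> S))\<^sup>2 = (\<Sum>p\<in>S. (nrm (\<lambda>j. x (j, p)) J)\<^sup>2)"
proof -
 have "(nrm x (J \<times> S))\<^sup>2 = (\<Sum>j\<in>J. \<Sum>p\<in>S. (cmod (x (j, p)))\<^sup>2)"
  by (simp add: L2_set_def sum_nonneg sum.cartesian_product case_prod_beta)
 also have "\<dots> = (\<Sum>p\<in>S. \<Sum>j\<in>J. (cmod (x (j, p)))\<^sup>2)" by (rule sum.swap)
 finally show ?thesis by (simp add: L2_set_def sum_nonneg)
qed

lemma nrm_prod_le:
 assumes "0 \<le> B" "\<And>p. p \<in> S ==> nrm (\<lambda>l. X (l, p)) N \<le> B * nrm (\<lambda>j. x (j, p)) J"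
 shows "nrm X (N \<times> S) \<le> B * nrm x (J \<times> S)"
proof (rule power2_le_imp_le)
 have "(\<Sum>p\<in>S. (nrm (\<lambda>l. X (l, p)) N)\<^sup>2) \<le> (\<Sum>p\<in>S. (B * nrm (\<lambda>j. x (j, p)) J)\<^sup>2)"
  by (intro sum_mono power_mono assms) auto
 then show "(nrm X (N \<times> S))\<^sup>2 \<le> (B * nrm x (J \<times> S))\<^sup>2"
  by (simp add: nrm_prod_sq power_mult_distrib sum_distrib_left)
qed (simp add: assms)

lemma kform_prod:
 "kform (J \<times> S) K x y =
  (\<Sum>i\<in>J. \<Sum>p\<in>S. \<Sum>j\<in>J. \<Sum>q\<in>S. K (i, p) (j, q) * x (j, q) * cnj (y (i, p)))"
 unfolding kform_def by (simp add: sum.cartesian_product' flip: sum.cartesian_product)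

text \<open>The amplification \<open>1 \<otimes> K\<close>: the blocks are estimated separately and
  put together by Cauchy-Schwarz over \<open>k\<close>.\<close>

lemma kbd_blockdiag:
 assumes "kbd S K c" "finite M" "finite S"
 shows "kbd (M \<times> S) (\<lambda>(k, p) (l, q). if k = l then K p q else 0) c"
proof (rule kbd_finiteI)
 fix x y
 let ?K = "\<lambda>(k, p) (l, q). if k = l then K p q else 0"
 have "(\<Sum>l\<in>M. \<Sum>q\<in>S. (if k = l then K p q else 0) * x (l, q) * cnj (y (k, p))) =
   (\<Sum>q\<in>S. K p q * x (k, q) * cnj (y (k, p)))" if "k \<in> M" for k p
 proof -
  have "(\<Sum>q\<in>S. (if k = l then K p q else 0) * x (l, q) * cnj (y (k, p))) =
    (if k = l then \<Sum>q\<in>S. K p q * x (k, q) * cnj (y (k, p)) else 0)" for l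
   by auto
  then show ?thesis using that assms by simp
 qed
 then have "kform (M \<times> S) ?K x y = (\<Sum>k\<in>M. kform S K (\<lambda>q. x (k, q)) (\<lambda>p. y (k, p)))"
  unfolding kform_prod by (simp add: kform_def)
 then have "cmod (kform (M \<times> S) ?K x y) \<le> (\<Sum>k\<in>M. cmod (kform S K (\<lambda>q. x (k, q)) (\<lambda>p. y (k, p))))"
  using norm_sum by simp
 also have "\<dots> \<le> (\<Sum>k\<in>M. c * (\<bar>nrm (\<lambda>q. x (k, q)) S\<bar> * \<bar>nrm (\<lambda>p. y (k, p)) S\<bar>))"
  using kbdD[OF assms(1,3) order_refl] by (intro sum_mono) (simp add: mult.assoc)
 also have "\<dots> = c * (\<Sum>k\<in>M. \<bar>nrm (\<lambda>q. x (k, q)) S\<bar> * \<bar>nrm (\<lambda>p. y (k, p)) S\<bar>)"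
  by (simp add: sum_distrib_left)
 also have "\<dots> \<le> c * (L2_set (\<lambda>k. nrm (\<lambda>q. x (k, q)) S) M * L2_set (\<lambda>k. nrm (\<lambda>q. y (k, q)) S) M)"
  by (intro mult_left_mono L2_set_mult_ineq kbd_nonneg[OF assms(1)])
 also have "\<dots> = c * (nrm x (M \<times> S) * nrm y (M \<times> S))"
  by (simp add: L2_set_def sum_nonneg sum.cartesian_product case_prod_beta)
 finally show "cmod (kform (M \<times> S) ?K x y) \<le> c * nrm x (M \<times> S) * nrm y (M \<times> S)"
  by (simp add: mult.assoc)
qed (use assms kbd_nonneg in auto)

text \<open>A product of three operators whose outer factors may vary with the point of
  \<open>S\<close>. Constant factors give Ruan's sandwich axiom, varying ones give Schur
  multiplication in \<open>kbd_schur\<close>. The left factor reaches the test vector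
  \<open>y\<close> through its adjoint, hence the conjugate in the hypothesis on
  \<open>a\<close>.\<close>

lemma kbd_sandwich:
 assumes K: "kbd (N \<times> S) K c" and fin: "finite N" "finite S" "finite M"
  and a: "0 \<le> A" "\<And>p y. p \<in> S ==> nrm (\<lambda>k. \<Sum>i\<in>M. cnj (a i k p) * y i) N \<le> A * nrm y M"
  and b: "0 \<le> B" "\<And>q x. q \<in> S ==> nrm (\<lambda>l. \<Sum>j\<in>M. b l j q * x j) N \<le> B * nrm x M"
 shows "kbd (M \<times> S) (\<lambda>(i, p) (j, q). \<Sum>k\<in>N. \<Sum>l\<in>N. a i k p * K (k, p) (l, q) * b l j q) (A * c * B)"
proof (rule kbd_finiteI)
 fix x y
 let ?K = "\<lambda>(i, p) (j, q). \<Sum>k\<in>N. \<Sum>l\<in>N. a i k p * K (k, p) (l, q) * b l j q"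
 \<comment> \<open>\<open>X\<close> is the image of \<open>x\<close> under the right factor,
   \<open>Y\<close> the image of \<open>y\<close> under the adjoint of the left factor; the form of
   the product at \<open>x\<close>, \<open>y\<close> is the form of \<open>K\<close> at
   \<open>X\<close>, \<open>Y\<close>.\<close>
 define X where "X = (\<lambda>(l, q). \<Sum>j\<in>M. b l j q * x (j, q))"
 define Y where "Y = (\<lambda>(k, p). \<Sum>i\<in>M. cnj (a i k p) * y (i, p))"
 define W where "W = (\<lambda>k p. \<Sum>l\<in>N. \<Sum>q\<in>S. K (k, p) (l, q) * X (l, q))"
 have 1: "(\<Sum>j\<in>M. \<Sum>q\<in>S. (\<Sum>k\<in>N. \<Sum>l\<in>N. a i k p * K (k, p) (l, q) * b l j q) * x (j, q)) =
   (\<Sum>k\<in>N. a i k p * W k p)" for i p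
 proof -
  have "(\<Sum>j\<in>M. \<Sum>q\<in>S. (\<Sum>k\<in>N. \<Sum>l\<in>N. a i k p * K (k, p) (l, q) * b l j q) * x (j, q)) =
   (\<Sum>q\<in>S. \<Sum>j\<in>M. \<Sum>k\<in>N. \<Sum>l\<in>N. a i k p * K (k, p) (l, q) * b l j q * x (j, q))"
   by (subst sum.swap) (simp add: sum_distrib_right)
  also have "\<dots> = (\<Sum>q\<in>S. \<Sum>k\<in>N. \<Sum>l\<in>N. \<Sum>j\<in>M. a i k p * K (k, p) (l, q) * b l j q * x (j, q))"
  proof (rule sum.cong[OF refl])
   fix q
   have "(\<Sum>j\<in>M. \<Sum>k\<in>N. \<Sum>l\<in>N. f j k l) = (\<Sum>k\<in>N. \<Sum>l\<in>N. \<Sum>j\<in>M. f j k l)" for f :: "_ => _ => _ => complex"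
    by (subst sum.swap[of _ N M]) (rule sum.cong[OF refl], rule sum.swap)
   then show "(\<Sum>j\<in>M. \<Sum>k\<in>N. \<Sum>l\<in>N. a i k p * K (k, p) (l, q) * b l j q * x (j, q)) =
    (\<Sum>k\<in>N. \<Sum>l\<in>N. \<Sum>j\<in>M. a i k p * K (k, p) (l, q) * b l j q * x (j, q))" .
  qed
  also have "\<dots> = (\<Sum>q\<in>S. \<Sum>k\<in>N. \<Sum>l\<in>N. a i k p * K (k, p) (l, q) * X (l, q))"
   by (simp add: X_def sum_distrib_left mult.assoc)
  also have "\<dots> = (\<Sum>k\<in>N. \<Sum>l\<in>N. \<Sum>q\<in>S. a i k p * K (k, p) (l, q) * X (l, q))"
   by (subst sum.swap) (rule sum.cong[OF refl], rule sum.swap)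
  finally show ?thesis by (simp add: W_def sum_distrib_left mult.assoc)
 qed
 have "kform (M \<times> S) ?K x y = (\<Sum>i\<in>M. \<Sum>p\<in>S. (\<Sum>k\<in>N. a i k p * W k p) * cnj (y (i, p)))"
  unfolding kform_prod 1[symmetric] by (simp add: sum_distrib_right)
 also have "\<dots> = (\<Sum>p\<in>S. \<Sum>k\<in>N. \<Sum>i\<in>M. W k p * (a i k p * cnj (y (i, p))))"
  apply (subst sum.swap)
  apply (rule sum.cong[OF refl])
  apply (subst sum.swap[of _ M N])
  apply (simp add: sum_distrib_left sum_distrib_right mult_ac)
  done
 also have "\<dots> = (\<Sum>p\<in>S. \<Sum>k\<in>N. W k p * cnj (Y (k, p)))"
  unfolding Y_def by (simp add: sum_distrib_left)
 also have "\<dots> = kform (N \<times> S) K X Y"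
  unfolding kform_prod W_def by (subst sum.swap) (simp add: sum_distrib_right)
 finally have "cmod (kform (M \<times> S) ?K x y) \<le> c * nrm X (N \<times> S) * nrm Y (N \<times> S)"
  using kbdD[OF K] fin by auto
 also have "\<dots> \<le> c * (B * nrm x (M \<times> S)) * (A * nrm y (M \<times> S))"
  unfolding X_def Y_def using kbd_nonneg[OF K] a b
  by (intro mult_mono mult_left_mono nrm_prod_le) auto
 finally show "cmod (kform (M \<times> S) ?K x y) \<le> A * c * B * nrm x (M \<times> S) * nrm y (M \<times> S)"
  by (simp add: algebra_simps)
qed (use fin a b kbd_nonneg[OF K] in auto)

text \<open>The easy half of Grothendieck's description of Schur multipliers, in operator-valued
  form: multiplying \<open>K p q\<close> by the product of the adjoint of \<open>b\<close> at
  \<open>p\<close> with \<open>a\<close> at \<open>q\<close> means squeezing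
  \<open>1 \<otimes> K\<close> between the columns \<open>b\<close> and \<open>a\<close>.\<close>

lemma kbd_schur:
 assumes K: "kbd S K c" and fin: "finite S" "finite J" "finite M"
  and a: "0 \<le> A" "\<And>q x. q \<in> S ==> nrm (\<lambda>k. \<Sum>j\<in>J. a j k q * x j) M \<le> A * nrm x J"
  and b: "0 \<le> B" "\<And>q x. q \<in> S ==> nrm (\<lambda>k. \<Sum>j\<in>J. b j k q * x j) M \<le> B * nrm x J"
 shows "kbd (J \<times> S) (\<lambda>(i, p) (j, q). (\<Sum>k\<in>M. cnj (b i k p) * a j k q) * K p q) (A * B * c)"
proof -
 have "kbd (J \<times> S) (\<lambda>(i, p) (j, q). \<Sum>k\<in>M. \<Sum>l\<in>M. cnj (b i k p) *
   (case (k, p) of (k, p) => \<lambda>(l, q). if k = l then K p q else 0) (l, q) * a j l q) (B * c * A)"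
  by (rule kbd_sandwich[OF kbd_blockdiag[OF K fin(3,1)], where a = "\<lambda>i k p. cnj (b i k p)" and b = "\<lambda>l j q. a j l q"])
   (use fin a b in auto)
 moreover have "(\<Sum>k\<in>M. \<Sum>l\<in>M. cnj (b i k p) * (if k = l then K p q else 0) * a j l q) =
   (\<Sum>k\<in>M. cnj (b i k p) * a j k q) * K p q" for i j p q
 proof -
  have "(\<Sum>l\<in>M. cnj (b i k p) * (if k = l then K p q else 0) * a j l q) = cnj (b i k p) * a j k q * K p q"
   if "k \<in> M" for k
  proof -
   have "cnj (b i k p) * (if k = l then K p q else 0) * a j l q =
     (if k = l then cnj (b i k p) * a j k q * K p q else 0)" for l by auto
   then show ?thesis using that fin by simp
  qed
  then show ?thesis by (simp add: sum_distrib_right)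
 qed
 ultimately show ?thesis by (simp add: mult_ac)
qed

text \<open>A crude bound by the sum of all block bounds. It serves only to show that certain
  suprema are finite, never to compute a norm.\<close>

lemma kbd_block:
 assumes fin: "finite J" and K: "\<And>i j. i \<in> J ==> j \<in> J ==> kbd S (K i j) (c i j)"
 shows "kbd (J \<times> S) (\<lambda>(i, p) (j, q). K i j p q) (\<Sum>i\<in>J. \<Sum>j\<in>J. c i j)"
proof (rule kbd_localI)
 show "0 \<le> (\<Sum>i\<in>J. \<Sum>j\<in>J. c i j)" by (intro sum_nonneg kbd_nonneg[OF K])
 fix F assume F: "finite F" "F \<subseteq> J \<times> S"
 define S' where "S' = snd ` F"
 have S': "finite S'" "S' \<subseteq> S" "F \<subseteq> J \<times> S'" using F by (force simp: S'_def)+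
 have "kbd (J \<times> S') (\<lambda>(i, p) (j, q). K i j p q) (\<Sum>i\<in>J. \<Sum>j\<in>J. c i j)"
 proof (rule kbd_finiteI)
  fix x y
  have le: "nrm (\<lambda>q. z (j, q)) S' \<le> nrm z (J \<times> S')" if "j \<in> J" for z :: "_ => complex" and j
  proof -
   have "(\<Sum>q\<in>S'. (cmod (z (j, q)))\<^sup>2) \<le> (\<Sum>j\<in>J. \<Sum>q\<in>S'. (cmod (z (j, q)))\<^sup>2)"
    using that fin by (intro member_le_sum) (auto intro: sum_nonneg)
   then show ?thesis by (simp add: L2_set_def sum.cartesian_product case_prod_beta)
  qed
  have "kform (J \<times> S') (\<lambda>(i, p) (j, q). K i j p q) x y =
    (\<Sum>i\<in>J. \<Sum>j\<in>J. kform S' (K i j) (\<lambda>q. x (j, q)) (\<lambda>p. y (i, p)))"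
   unfolding kform_prod prod.case unfolding kform_def by (intro sum.cong refl sum.swap)
  also have "cmod \<dots> \<le> (\<Sum>i\<in>J. \<Sum>j\<in>J. c i j * nrm x (J \<times> S') * nrm y (J \<times> S'))"
  proof (intro order_trans[OF norm_sum] sum_mono)
   fix i j assume ij: "i \<in> J" "j \<in> J"
   have "cmod (kform S' (K i j) (\<lambda>q. x (j, q)) (\<lambda>p. y (i, p))) \<le> c i j * nrm (\<lambda>q. x (j, q)) S' * nrm (\<lambda>p. y (i, p)) S'"
    using K ij S' by (intro kbdD) auto
   also have "\<dots> \<le> c i j * nrm x (J \<times> S') * nrm y (J \<times> S')"
    using ij le kbd_nonneg[OF K[OF ij]] by (intro mult_mono mult_left_mono) auto
   finally show "cmod (kform S' (K i j) (\<lambda>q. x (j, q)) (\<lambda>p. y (i, p))) \<le> c i j * nrm x (J \<times> S') * nrm y (J \<times> S')" .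
  qed
  finally show "cmod (kform (J \<times> S') (\<lambda>(i, p) (j, q). K i j p q) x y)
    \<le> (\<Sum>i\<in>J. \<Sum>j\<in>J. c i j) * nrm x (J \<times> S') * nrm y (J \<times> S')"
   by (simp add: sum_distrib_right)
 qed (use fin S' \<open>0 \<le> _\<close> in auto)
 then show "kbd F (\<lambda>(i, p) (j, q). K i j p q) (\<Sum>i\<in>J. \<Sum>j\<in>J. c i j)"
  using S' by (blast intro: kbd_subset)
qed

section \<open>Norms of complex matrices as kernel bounds\<close>

lemma cmat_norm_bdd:
 fixes m n :: nat
 shows "bdd_above {sqrt (\<Sum>i<m. (cmod (\<Sum>j<n. \<alpha> i j * v j))\<^sup>2) | v. (\<Sum>j<n. (cmod (v j))\<^sup>2) \<le> 1}"
proof (rule bdd_aboveI)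
 fix r assume "r \<in> {sqrt (\<Sum>i<m. (cmod (\<Sum>j<n. \<alpha> i j * v j))\<^sup>2) | v. (\<Sum>j<n. (cmod (v j))\<^sup>2) \<le> 1}"
 then obtain v where r: "r = nrm (\<lambda>i. \<Sum>j<n. \<alpha> i j * v j) {..<m}" and v: "nrm v {..<n} \<le> 1"
  by (auto simp: L2_set_def)
 have vj: "cmod (v j) \<le> 1" if "j < n" for j
  using member_le_L2_set[OF finite_lessThan[of n], of j "\<lambda>j. cmod (v j)"] that v by simp
 have "r \<le> (\<Sum>i<m. cmod (\<Sum>j<n. \<alpha> i j * v j))"
  unfolding r by (rule L2_set_le_sum) simp
 also have "\<dots> \<le> (\<Sum>i<m. \<Sum>j<n. cmod (\<alpha> i j))"
  by (intro sum_mono order_trans[OF norm_sum])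
   (auto simp: norm_mult vj intro!: mult_left_le)
 finally show "r \<le> (\<Sum>i<m. \<Sum>j<n. cmod (\<alpha> i j))" .
qed

lemma cmat_norm_nonneg: "0 \<le> cmat_norm m n \<alpha>"
 unfolding cmat_norm_def
 by (rule cSup_upper[OF _ cmat_norm_bdd]) (auto intro!: exI[of _ "\<lambda>_. 0"])

lemma cmat_norm_apply: "nrm (\<lambda>i. \<Sum>j<n. \<alpha> i j * v j) {..<m} \<le> cmat_norm m n \<alpha> * nrm v {..<n}"
proof (cases "nrm v {..<n} = 0")
 case True
 then have "v j = 0" if "j < n" for j
  using that member_le_L2_set[OF finite_lessThan[of n], of j "\<lambda>j. cmod (v j)"] by simp
 then show ?thesis using True by (simp add: L2_set_def)
next
 case False
 define t where "t = nrm v {..<n}"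
 have t: "t > 0" using False unfolding t_def using L2_set_nonneg[of "\<lambda>j. cmod (v j)" "{..<n}"] by linarith
 define w where "w j = v j / of_real t" for j
 have sc: "nrm (\<lambda>i. u i / of_real t) F = nrm u F / t" for u :: "nat => complex" and F
  using t by (simp add: norm_divide divide_inverse norm_mult norm_inverse L2_set_left_distrib)
 have "nrm w {..<n} = 1" unfolding w_def sc using t by (simp add: t_def)
 then have "(\<Sum>j<n. (cmod (w j))\<^sup>2) \<le> 1" by (simp add: L2_set_def)
 then have "nrm (\<lambda>i. \<Sum>j<n. \<alpha> i j * w j) {..<m} \<le> cmat_norm m n \<alpha>"
  unfolding cmat_norm_def L2_set_def by (intro cSup_upper cmat_norm_bdd) auto
 moreover have "nrm (\<lambda>i. \<Sum>j<n. \<alpha> i j * w j) {..<m} = nrm (\<lambda>i. \<Sum>j<n. \<alpha> i j * v j) {..<m} / t"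
  unfolding sc[symmetric] w_def by (simp add: sum_divide_distrib)
 ultimately show ?thesis using t by (simp add: field_simps t_def)
qed

lemma cmat_norm_leI:
 assumes "0 \<le> c" "\<And>v. nrm (\<lambda>i. \<Sum>j<n. \<alpha> i j * v j) {..<m} \<le> c * nrm v {..<n}"
 shows "cmat_norm m n \<alpha> \<le> c"
 unfolding cmat_norm_def
proof (rule cSup_least)
 show "{sqrt (\<Sum>i<m. (cmod (\<Sum>j<n. \<alpha> i j * v j))\<^sup>2) | v. (\<Sum>j<n. (cmod (v j))\<^sup>2) \<le> 1} \<noteq> {}"
  by (auto intro!: exI[of _ "\<lambda>_. 0"])
 fix r assume "r \<in> {sqrt (\<Sum>i<m. (cmod (\<Sum>j<n. \<alpha> i j * v j))\<^sup>2) | v. (\<Sum>j<n. (cmod (v j))\<^sup>2) \<le> 1}"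
 then obtain v where r: "r = nrm (\<lambda>i. \<Sum>j<n. \<alpha> i j * v j) {..<m}" and v: "nrm v {..<n} \<le> 1"
  by (auto simp: L2_set_def)
 have "r \<le> c * nrm v {..<n}" unfolding r by (rule assms)
 also have "\<dots> \<le> c" using v assms(1) by (rule mult_left_le)
 finally show "r \<le> c" .
qed

text \<open>A matrix and its adjoint have the same norm: test the image \<open>z\<close> of
  \<open>y\<close> under the adjoint against itself. The left factor in \<open>kbd_sandwich\<close>
  needs this.\<close>

lemma cmat_norm_adj: "nrm (\<lambda>j. \<Sum>i<m. cnj (\<alpha> i j) * y i) {..<n} \<le> cmat_norm m n \<alpha> * nrm y {..<m}"
proof -
 define z where "z j = (\<Sum>i<m. cnj (\<alpha> i j) * y i)" for j
 have "complex_of_real ((nrm z {..<n})\<^sup>2) = (\<Sum>j<n. (\<Sum>i<m. cnj (\<alpha> i j) * y i) * cnj (z j))"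
  unfolding nrm_sq by (simp add: z_def)
 also have "\<dots> = (\<Sum>i<m. \<Sum>j<n. cnj (\<alpha> i j) * y i * cnj (z j))"
  unfolding sum_distrib_right by (rule sum.swap)
 also have "\<dots> = (\<Sum>i<m. y i * cnj (\<Sum>j<n. \<alpha> i j * z j))"
  by (simp add: sum_distrib_left mult_ac)
 finally have "cmod (complex_of_real ((nrm z {..<n})\<^sup>2)) = cmod (\<Sum>i<m. y i * cnj (\<Sum>j<n. \<alpha> i j * z j))"
  by (rule arg_cong)
 then have "(nrm z {..<n})\<^sup>2 = cmod (\<Sum>i<m. y i * cnj (\<Sum>j<n. \<alpha> i j * z j))"
  unfolding norm_of_real abs_power2 .
 also have "\<dots> \<le> nrm y {..<m} * nrm (\<lambda>i. \<Sum>j<n. \<alpha> i j * z j) {..<m}"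
  by (rule inner_le_nrm)
 also have "\<dots> \<le> nrm y {..<m} * (cmat_norm m n \<alpha> * nrm z {..<n})"
  by (intro mult_left_mono cmat_norm_apply) auto
 finally have "nrm z {..<n} \<le> cmat_norm m n \<alpha> * nrm y {..<m}"
  by (intro le_of_sq_le[of "nrm z {..<n}"]) (auto simp: cmat_norm_nonneg mult_ac)
 then show ?thesis by (simp add: z_def)
qed

lemma kbd_cmat_norm: "kbd {..<n} \<alpha> (cmat_norm n n \<alpha>)"
proof (rule kbd_finiteI)
 fix x y
 have "cmod (kform {..<n} \<alpha> x y) \<le> nrm (\<lambda>p. \<Sum>q<n. \<alpha> p q * x q) {..<n} * nrm y {..<n}"
  using inner_le_nrm[of "\<lambda>p. \<Sum>q<n. \<alpha> p q * x q" y "{..<n}"] by (simp add: kform_def sum_distrib_right)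
 also have "\<dots> \<le> cmat_norm n n \<alpha> * nrm x {..<n} * nrm y {..<n}"
  by (intro mult_right_mono cmat_norm_apply) auto
 finally show "cmod (kform {..<n} \<alpha> x y) \<le> cmat_norm n n \<alpha> * nrm x {..<n} * nrm y {..<n}" .
qed (auto simp: cmat_norm_nonneg)

lemma cmat_norm_le_iff: "0 \<le> c ==> cmat_norm n n \<alpha> \<le> c \<longleftrightarrow> kbd {..<n} \<alpha> c"
proof
 assume "kbd {..<n} \<alpha> c"
 then show "cmat_norm n n \<alpha> \<le> c"
  using kbd_nonneg by (intro cmat_norm_leI) (auto intro!: kbd_apply)
qed (rule kbd_mono[OF kbd_cmat_norm])

text \<open>A direct sum of two blocks: the form splits into the forms of the blocks, and the norms
  recombine in the plane.\<close>

lemma kbd_union: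
 assumes "kbd S K c" "kbd T K c" "S \<inter> T = {}"
  and "\<And>p q. p \<in> S ==> q \<in> T ==> K p q = 0" "\<And>p q. p \<in> T ==> q \<in> S ==> K p q = 0"
 shows "kbd (S \<union> T) K c"
 unfolding kbd_def
proof (intro conjI allI impI)
 show c: "0 \<le> c" using assms(1) by (rule kbd_nonneg)
 fix F x y assume F: "finite F" "F \<subseteq> S \<union> T"
 define A B where "A = F \<inter> S" and "B = F \<inter> T"
 have AB: "finite A" "finite B" "A \<subseteq> S" "B \<subseteq> T" "A \<inter> B = {}" "F = A \<union> B"
  using F assms(3) by (auto simp: A_def B_def)
 have "(\<Sum>q\<in>B. K p q * x q * cnj (y p)) = 0" if "p \<in> A" for p
  using assms(4)[of p] that AB(3,4) by (intro sum.neutral ballI) (simp add: subset_eq)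
 moreover have "(\<Sum>q\<in>A. K p q * x q * cnj (y p)) = 0" if "p \<in> B" for p
  using assms(5)[of p] that AB(3,4) by (intro sum.neutral ballI) (simp add: subset_eq)
 ultimately have k: "kform F K x y = kform A K x y + kform B K x y"
  using AB by (simp add: kform_def sum.union_disjoint sum.distrib)
 have n: "nrm z F = sqrt ((nrm z A)\<^sup>2 + (nrm z B)\<^sup>2)" for z :: "_ => complex"
  using AB by (simp add: L2_set_def sum.union_disjoint sum_nonneg)
 \<comment> \<open>The two-term Cauchy-Schwarz inequality, read off from Lagrange's
   identity.\<close>
 have cs: "a * b + a' * b' \<le> sqrt (a\<^sup>2 + a'\<^sup>2) * sqrt (b\<^sup>2 + b'\<^sup>2)" for a b a' b' :: real
 proof -
  have "(a * b + a' * b')\<^sup>2 + (a * b' - a' * b)\<^sup>2 = (a\<^sup>2 + a'\<^sup>2) * (b\<^sup>2 + b'\<^sup>2)"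
   by algebra
  then have "(a * b + a' * b')\<^sup>2 \<le> (a\<^sup>2 + a'\<^sup>2) * (b\<^sup>2 + b'\<^sup>2)"
   by (metis le_add_same_cancel1 zero_le_power2)
  then show ?thesis unfolding real_sqrt_mult[symmetric] by (rule real_le_rsqrt)
 qed
 have "cmod (kform F K x y) \<le> c * nrm x A * nrm y A + c * nrm x B * nrm y B"
  unfolding k using kbdD[OF assms(1) AB(1,3)] kbdD[OF assms(2) AB(2,4)]
  by (intro order_trans[OF norm_triangle_ineq] add_mono)
 also have "\<dots> = c * (nrm x A * nrm y A + nrm x B * nrm y B)" by (simp add: algebra_simps)
 also have "\<dots> \<le> c * (nrm x F * nrm y F)" unfolding n by (intro mult_left_mono cs c)
 finally show "cmod (kform F K x y) \<le> c * nrm x F * nrm y F" by (simp add: mult.assoc)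
qed

section \<open>Ruan's axioms for norms given by families of matrices of functionals\<close>

lemma matsI:
 "(\<And>i j. i < n ==> j < n ==> x i j \<in> vecs V) ==> (\<And>i j. \<not> (i < n \<and> j < n) ==> x i j = 0) ==> x \<in> mats V n"
 by (auto simp: mats_def pad_def fun_eq_iff)

lemma mats_in: "x \<in> mats V n ==> i < n ==> j < n ==> x i j \<in> vecs V"
 by (auto simp: mats_def)

lemma mats_out: "x \<in> mats V n ==> \<not> (i < n \<and> j < n) ==> x i j = 0"
 by (auto simp: mats_def pad_def fun_eq_iff) metis+

lemma mats_pad: "(\<And>i j. i < n ==> j < n ==> x i j \<in> vecs V) ==> pad n x \<in> mats V n"
 by (rule matsI) (auto simp: pad_def)

text \<open>Each test \<open>\<theta>\<close> maps the space linearly to complex matrices with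
  finite index set \<open>I \<theta>\<close>, and \<open>mnorm_le_iff\<close> says that the matrix
  norms are the suprema over all tests. Ruan's axioms are then inherited from matrix algebras once
  and for all; completeness is not, and stays a premise of \<open>operator_spaceI\<close>.\<close>

locale represented_space =
 fixes V :: "('v::ab_group_add, 'm) op_space_scheme" and \<Theta> :: "'t set"
  and I :: "'t => 'i set" and ev :: "'t => 'i => 'i => 'v => complex"
 assumes vs: "vector_space (smul V)"
  and sub: "module.subspace (smul V) (vecs V)"
  and fin: "\<theta> \<in> \<Theta> ==> finite (I \<theta>)"
  and ev_add: "\<theta> \<in> \<Theta> ==> x \<in> vecs V ==> y \<in> vecs V ==> ev \<theta> a b (x + y) = ev \<theta> a b x + ev \<theta> a b y"
  and ev_smul: "\<theta> \<in> \<Theta> ==> x \<in> vecs V ==> ev \<theta> a b (smul V c x) = c * ev \<theta> a b x"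
  and mnorm_nonneg: "X \<in> mats V n ==> 0 \<le> mnorm V n X"
  and mnorm_le_iff: "X \<in> mats V n ==> 0 \<le> r ==> mnorm V n X \<le> r \<longleftrightarrow>
   (\<forall>\<theta>\<in>\<Theta>. kbd ({..<n} \<times> I \<theta>) (\<lambda>(i, a) (j, b). ev \<theta> a b (X i j)) r)"
  and separating: "x \<in> vecs V ==> (\<And>\<theta> a b. \<theta> \<in> \<Theta> ==> a \<in> I \<theta> ==> b \<in> I \<theta> ==> ev \<theta> a b x = 0) ==> x = 0"
begin

sublocale vector_space "smul V" by (rule vs)

lemma ev_0: "\<theta> \<in> \<Theta> ==> ev \<theta> a b 0 = 0"
 using ev_add[of \<theta> 0 0] subspace_0[OF sub] by simp

lemma ev_sum:
 assumes "\<theta> \<in> \<Theta>" "\<And>k. k \<in> M ==> f k \<in> vecs V"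
 shows "ev \<theta> a b (\<Sum>k\<in>M. f k) = (\<Sum>k\<in>M. ev \<theta> a b (f k))"
 using assms(2)
proof (induction M rule: infinite_finite_induct)
 case (insert k M)
 then have "(\<Sum>k\<in>M. f k) \<in> vecs V" by (intro subspace_sum sub) auto
 then show ?case using insert by (simp add: ev_add assms(1))
qed (auto simp: ev_0 assms(1))

lemma mnormD: "x \<in> mats V n ==> \<theta> \<in> \<Theta> ==>
  kbd ({..<n} \<times> I \<theta>) (\<lambda>(i, a) (j, b). ev \<theta> a b (x i j)) (mnorm V n x)"
 using mnorm_le_iff[of x n "mnorm V n x"] mnorm_nonneg by auto

lemma mnormI: "x \<in> mats V n ==> 0 \<le> c ==>
  (\<And>\<theta>. \<theta> \<in> \<Theta> ==> kbd ({..<n} \<times> I \<theta>) (\<lambda>(i, a) (j, b). ev \<theta> a b (x i j)) c) ==> mnorm V n x \<le> c"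
 using mnorm_le_iff[of x n c] by auto

lemma mats_add: "x \<in> mats V n ==> y \<in> mats V n ==> x + y \<in> mats V n"
 by (intro matsI) (auto simp: mats_in mats_out subspace_add[OF sub])

lemma mats_smul: "x \<in> mats V n ==> (\<lambda>i j. smul V c (x i j)) \<in> mats V n"
 by (intro matsI) (auto simp: mats_in mats_out subspace_scale[OF sub])

lemma mats_dsum: "x \<in> mats V m ==> y \<in> mats V n ==> dsum m n x y \<in> mats V (m + n)"
 unfolding dsum_def by (intro mats_pad) (auto simp: mats_in subspace_0[OF sub])

lemma mats_sandwich: "x \<in> mats V n ==> sandwich (smul V) m n \<alpha> x \<beta> \<in> mats V m"
 unfolding sandwich_def by (intro mats_pad subspace_sum subspace_scale sub) (auto simp: mats_in)

lemma mnorm_add: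
 assumes "x \<in> mats V n" "y \<in> mats V n"
 shows "mnorm V n (x + y) \<le> mnorm V n x + mnorm V n y"
proof (rule mnormI)
 fix \<theta> assume \<theta>: "\<theta> \<in> \<Theta>"
 show "kbd ({..<n} \<times> I \<theta>) (\<lambda>(i, a) (j, b). ev \<theta> a b ((x + y) i j)) (mnorm V n x + mnorm V n y)"
  by (rule iffD1[OF kbd_cong kbd_add[OF mnormD[OF assms(1) \<theta>] mnormD[OF assms(2) \<theta>]]])
   (auto simp: ev_add[OF \<theta>] mats_in[OF assms(1)] mats_in[OF assms(2)])
qed (use assms in \<open>auto simp: mats_add mnorm_nonneg\<close>)

lemma mnorm_smul_le:
 assumes "x \<in> mats V n"
 shows "mnorm V n (\<lambda>i j. smul V c (x i j)) \<le> cmod c * mnorm V n x"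
proof (rule mnormI)
 fix \<theta> assume \<theta>: "\<theta> \<in> \<Theta>"
 show "kbd ({..<n} \<times> I \<theta>) (\<lambda>(i, a) (j, b). ev \<theta> a b (smul V c (x i j))) (cmod c * mnorm V n x)"
  by (rule iffD1[OF kbd_cong kbd_scale[OF mnormD[OF assms(1) \<theta>]]])
   (auto simp: ev_smul[OF \<theta>] mats_in[OF assms(1)])
qed (use assms in \<open>auto simp: mats_smul mnorm_nonneg\<close>)

lemma mnorm_smul:
 assumes x: "x \<in> mats V n"
 shows "mnorm V n (\<lambda>i j. smul V c (x i j)) = cmod c * mnorm V n x"
proof (rule antisym[OF mnorm_smul_le[OF x]])
 show "cmod c * mnorm V n x \<le> mnorm V n (\<lambda>i j. smul V c (x i j))"
 proof (cases "c = 0")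
  case False
  have "mnorm V n x \<le> cmod (inverse c) * mnorm V n (\<lambda>i j. smul V c (x i j))"
   using mnorm_smul_le[OF mats_smul[OF x, of c], of "inverse c"] False by simp
  then show ?thesis using False by (simp add: norm_divide field_simps)
 qed (use mnorm_nonneg[OF mats_smul[OF x, of 0]] in simp)
qed

lemma mnorm_dsum:
 assumes x: "x \<in> mats V m" and y: "y \<in> mats V n"
 shows "mnorm V (m + n) (dsum m n x y) = max (mnorm V m x) (mnorm V n y)"
proof (rule antisym)
 let ?d = "dsum m n x y"
 note d = mats_dsum[OF x y]
 have d1: "?d i j = x i j" if "i < m" "j < m" for i j using that by (simp add: dsum_def pad_def)
 have d2: "?d (m + i) (m + j) = y i j" if "i < n" "j < n" for i j using that by (simp add: dsum_def pad_def)
 have d3: "?d i j = 0" if "i < m \<longleftrightarrow> m \<le> j" for i j using that by (auto simp: dsum_def pad_def)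
 show "mnorm V (m + n) ?d \<le> max (mnorm V m x) (mnorm V n y)"
 proof (rule mnormI[OF d])
  show "0 \<le> max (mnorm V m x) (mnorm V n y)" using mnorm_nonneg[OF x] by auto
  fix \<theta> assume \<theta>: "\<theta> \<in> \<Theta>"
  let ?K = "\<lambda>(i, a) (j, b). ev \<theta> a b (?d i j)" and ?c = "max (mnorm V m x) (mnorm V n y)"
  have 1: "kbd ({..<m} \<times> I \<theta>) ?K ?c"
   by (rule kbd_mono[OF iffD1[OF kbd_cong mnormD[OF x \<theta>]]]) (auto simp: d1)
  have b: "bij_betw (\<lambda>(i, a). (m + i, a)) ({..<n} \<times> I \<theta>) ({m..<m + n} \<times> I \<theta>)"
   by (rule bij_betwI[where g = "\<lambda>(i, a). (i - m, a)"]) auto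
  have "kbd ({..<n} \<times> I \<theta>) (\<lambda>p q. ?K (case p of (i, a) => (m + i, a)) (case q of (i, a) => (m + i, a))) ?c"
   by (rule kbd_mono[OF iffD1[OF kbd_cong mnormD[OF y \<theta>]]]) (auto simp: d2)
  then have 2: "kbd ({m..<m + n} \<times> I \<theta>) ?K ?c" unfolding kbd_reindex_bij[OF b] .
  have "kbd ({..<m} \<times> I \<theta> \<union> {m..<m + n} \<times> I \<theta>) ?K ?c"
   by (rule kbd_union[OF 1 2]) (auto simp: d3 ev_0[OF \<theta>])
  moreover have "{..<m} \<times> I \<theta> \<union> {m..<m + n} \<times> I \<theta> = {..<m + n} \<times> I \<theta>" by auto
  ultimately show "kbd ({..<m + n} \<times> I \<theta>) ?K ?c" by simp
 qed
 have "mnorm V m x \<le> mnorm V (m + n) ?d"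
 proof (rule mnormI[OF x mnorm_nonneg[OF d]])
  fix \<theta> assume \<theta>: "\<theta> \<in> \<Theta>"
  show "kbd ({..<m} \<times> I \<theta>) (\<lambda>(i, a) (j, b). ev \<theta> a b (x i j)) (mnorm V (m + n) ?d)"
   by (rule iffD1[OF kbd_cong kbd_subset[OF mnormD[OF d \<theta>]]]) (auto simp: d1)
 qed
 moreover have "mnorm V n y \<le> mnorm V (m + n) ?d"
 proof (rule mnormI[OF y mnorm_nonneg[OF d]])
  fix \<theta> assume \<theta>: "\<theta> \<in> \<Theta>"
  show "kbd ({..<n} \<times> I \<theta>) (\<lambda>(i, a) (j, b). ev \<theta> a b (y i j)) (mnorm V (m + n) ?d)"
   by (rule iffD1[OF kbd_cong kbd_reindex[OF mnormD[OF d \<theta>], of "\<lambda>(i, a). (m + i, a)"]])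
    (auto simp: d2 inj_on_def)
 qed
 ultimately show "max (mnorm V m x) (mnorm V n y) \<le> mnorm V (m + n) ?d" by simp
qed

lemma mnorm_sandwich:
 assumes x: "x \<in> mats V n"
 shows "mnorm V m (sandwich (smul V) m n \<alpha> x \<beta>) \<le> cmat_norm m n \<alpha> * mnorm V n x * cmat_norm n m \<beta>"
proof (rule mnormI[OF mats_sandwich[OF x]])
 show "0 \<le> cmat_norm m n \<alpha> * mnorm V n x * cmat_norm n m \<beta>"
  using mnorm_nonneg[OF x] by (simp add: cmat_norm_nonneg)
 fix \<theta> assume \<theta>: "\<theta> \<in> \<Theta>"
 have e: "ev \<theta> a b (sandwich (smul V) m n \<alpha> x \<beta> i j) = (\<Sum>k<n. \<Sum>l<n. \<alpha> i k * ev \<theta> a b (x k l) * \<beta> l j)"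
  if "i < m" "j < m" for i j a b
 proof -
  have "ev \<theta> a b (sandwich (smul V) m n \<alpha> x \<beta> i j) = ev \<theta> a b (\<Sum>k<n. \<Sum>l<n. smul V (\<alpha> i k * \<beta> l j) (x k l))"
   using that by (simp add: sandwich_def pad_def)
  also have "\<dots> = (\<Sum>k<n. ev \<theta> a b (\<Sum>l<n. smul V (\<alpha> i k * \<beta> l j) (x k l)))"
   by (intro ev_sum[OF \<theta>] subspace_sum subspace_scale sub) (auto simp: mats_in[OF x])
  also have "\<dots> = (\<Sum>k<n. \<Sum>l<n. ev \<theta> a b (smul V (\<alpha> i k * \<beta> l j) (x k l)))"
   by (intro sum.cong refl ev_sum[OF \<theta>] subspace_scale sub) (auto simp: mats_in[OF x])
  finally show ?thesis by (simp add: ev_smul[OF \<theta>] mats_in[OF x] mult_ac)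
 qed
 have "kbd ({..<m} \<times> I \<theta>) (\<lambda>(i, p) (j, q). \<Sum>k<n. \<Sum>l<n. \<alpha> i k * (case (k, p) of (i, a) => \<lambda>(j, b). ev \<theta> a b (x i j)) (l, q) * \<beta> l j)
   (cmat_norm m n \<alpha> * mnorm V n x * cmat_norm n m \<beta>)"
  by (rule kbd_sandwich[OF mnormD[OF x \<theta>], where a = "\<lambda>i k p. \<alpha> i k" and b = "\<lambda>l j q. \<beta> l j"])
   (auto simp: fin[OF \<theta>] cmat_norm_nonneg cmat_norm_apply cmat_norm_adj)
 then show "kbd ({..<m} \<times> I \<theta>) (\<lambda>(i, a) (j, b). ev \<theta> a b (sandwich (smul V) m n \<alpha> x \<beta> i j))
   (cmat_norm m n \<alpha> * mnorm V n x * cmat_norm n m \<beta>)"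
  by (rule iffD1[OF kbd_cong, rotated]) (auto simp: e)
qed

lemma mnorm_eq_0:
 assumes x: "x \<in> mats V n"
 shows "mnorm V n x = 0 \<longleftrightarrow> x = 0"
proof
 assume "mnorm V n x = 0"
 then have "ev \<theta> a b (x i j) = 0" if "\<theta> \<in> \<Theta>" "a \<in> I \<theta>" "b \<in> I \<theta>" "i < n" "j < n" for \<theta> a b i j
  using mnormD[OF x that(1)] that kbd_zero_iff[of "{..<n} \<times> I \<theta>" "\<lambda>(i, a) (j, b). ev \<theta> a b (x i j)"] by force
 then have "x i j = 0" for i j
  by (cases "i < n \<and> j < n") (auto simp: mats_out[OF x] intro!: separating mats_in[OF x])
 then show "x = 0" by (simp add: fun_eq_iff)
next
 assume "x = 0"
 then have "mnorm V n x \<le> 0"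
  by (intro mnormI[OF x]) (auto simp: kbd_zero_iff ev_0)
 then show "mnorm V n x = 0" using mnorm_nonneg[OF x] by simp
qed

lemma operator_spaceI:
 assumes "\<And>X. \<lbrakk>\<And>k::nat. X k \<in> vecs V;
     \<And>e. 0 < e ==> \<exists>N. \<forall>k\<ge>N. \<forall>l\<ge>N. vnorm V (X k - X l) < e\<rbrakk>
     \<Longrightarrow> \<exists>x\<in>vecs V. (\<lambda>k. vnorm V (X k - x)) \<longlonglongrightarrow> 0"
 shows "operator_space V"
 by unfold_locales
  (use assms in \<open>auto simp: vs sub mnorm_nonneg mnorm_eq_0 mnorm_add mnorm_smul mnorm_dsum mnorm_sandwich\<close>)

end

section \<open>The group von Neumann algebra of a discrete group\<close>

lemma ell2I:
 assumes "0 \<le> c" "\<And>F. finite F ==> F \<subseteq> S ==> nrm x F \<le> c"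
 shows "(\<lambda>q. (cmod (x q))\<^sup>2) summable_on S" "sqrt (\<Sum>\<^sub>\<infinity>q\<in>S. (cmod (x q))\<^sup>2) \<le> c"
proof -
 have le: "(\<Sum>q\<in>F. (cmod (x q))\<^sup>2) \<le> c\<^sup>2" if "finite F" "F \<subseteq> S" for F
  using assms(2)[OF that] unfolding L2_set_def by (rule sqrt_le_D)
 show s: "(\<lambda>q. (cmod (x q))\<^sup>2) summable_on S"
  by (rule nonneg_bdd_above_summable_on) (auto intro!: bdd_aboveI[of _ "c\<^sup>2"] le)
 have "(\<Sum>\<^sub>\<infinity>q\<in>S. (cmod (x q))\<^sup>2) \<le> c\<^sup>2"
  by (rule infsum_le_finite_sums[OF s]) (rule le)
 then show "sqrt (\<Sum>\<^sub>\<infinity>q\<in>S. (cmod (x q))\<^sup>2) \<le> c" using assms(1) by (auto intro!: real_le_lsqrt)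
qed

lemma ell2D:
 assumes "(\<lambda>q. (cmod (x q))\<^sup>2) summable_on S" "finite F" "F \<subseteq> S"
 shows "nrm x F \<le> sqrt (\<Sum>\<^sub>\<infinity>q\<in>S. (cmod (x q))\<^sup>2)"
 unfolding L2_set_def
 by (intro real_sqrt_le_mono finite_sum_le_infsum assms) auto

lemma ell2_inner_summable:
 assumes "(\<lambda>q. (cmod (x q))\<^sup>2) summable_on S" "(\<lambda>q. (cmod (y q))\<^sup>2) summable_on S"
 shows "(\<lambda>q. x q * y q) summable_on S"
  and "cmod (\<Sum>\<^sub>\<infinity>q\<in>S. x q * y q) \<le> sqrt (\<Sum>\<^sub>\<infinity>q\<in>S. (cmod (x q))\<^sup>2) * sqrt (\<Sum>\<^sub>\<infinity>q\<in>S. (cmod (y q))\<^sup>2)" (is "_ \<le> ?B")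
proof -
 have le: "(\<Sum>q\<in>F. cmod (x q * y q)) \<le> ?B" if F: "finite F" "F \<subseteq> S" for F
 proof -
  have "(\<Sum>q\<in>F. cmod (x q * y q)) \<le> nrm x F * nrm y F"
   using L2_set_mult_ineq[of "\<lambda>q. cmod (x q)" "\<lambda>q. cmod (y q)" F] by (simp add: norm_mult)
  also have "\<dots> \<le> ?B" using F assms by (intro mult_mono ell2D) (auto intro: infsum_nonneg)
  finally show ?thesis .
 qed
 have s: "(\<lambda>q. cmod (x q * y q)) summable_on S"
  by (rule nonneg_bdd_above_summable_on) (auto intro!: bdd_aboveI[of _ ?B] le)
 then show "(\<lambda>q. x q * y q) summable_on S" by (rule abs_summable_summable)
 have "cmod (\<Sum>\<^sub>\<infinity>q\<in>S. x q * y q) \<le> (\<Sum>\<^sub>\<infinity>q\<in>S. cmod (x q * y q))"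
  using s by (rule norm_infsum_bound)
 also have "\<dots> \<le> ?B" by (rule infsum_le_finite_sums[OF s]) (rule le)
 finally show "cmod (\<Sum>\<^sub>\<infinity>q\<in>S. x q * y q) \<le> ?B" .
qed

lemma tendsto_nrm:
 assumes "\<And>p. p \<in> F ==> ((\<lambda>k. f k p) \<longlongrightarrow> g p) \<F>"
 shows "((\<lambda>k. nrm (f k) F) \<longlongrightarrow> nrm g F) \<F>"
 unfolding L2_set_def by (intro tendsto_real_sqrt tendsto_sum tendsto_power tendsto_norm assms)

text \<open>From finite sections to an operator on \<open>l2(S)\<close>: the rows are square
  summable, so the sums converge, and for each finite set of rows the bound passes to the limit over
  finite sets of columns.\<close>

lemma kbd_operator:
 assumes K: "kbd S K c" and x: "(\<lambda>q. (cmod (x q))\<^sup>2) summable_on S"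
 shows "p \<in> S ==> (\<lambda>q. K p q * x q) summable_on S"
  and "(\<lambda>p. (cmod (\<Sum>\<^sub>\<infinity>q\<in>S. K p q * x q))\<^sup>2) summable_on S"
  and "sqrt (\<Sum>\<^sub>\<infinity>p\<in>S. (cmod (\<Sum>\<^sub>\<infinity>q\<in>S. K p q * x q))\<^sup>2) \<le> c * sqrt (\<Sum>\<^sub>\<infinity>q\<in>S. (cmod (x q))\<^sup>2)"
proof -
 let ?X = "sqrt (\<Sum>\<^sub>\<infinity>q\<in>S. (cmod (x q))\<^sup>2)"
 note c = kbd_nonneg[OF K]
 \<comment> \<open>Testing row \<open>p\<close> against its own conjugate bounds its norm by
   \<open>c\<close>.\<close>
 have row: "nrm (K p) F \<le> c" if p: "p \<in> S" and F: "finite F" "F \<subseteq> S" for p F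
 proof -
  have "cmod (\<Sum>p'\<in>{p}. \<Sum>q\<in>F. K p' q * cnj (K p q) * cnj 1) \<le> c * nrm (\<lambda>q. cnj (K p q)) F * nrm (\<lambda>_. 1) {p}"
   by (rule kbd_rect[OF K, where x = "\<lambda>q. cnj (K p q)" and y = "\<lambda>_. 1"]) (use p F in auto)
  then have "cmod (complex_of_real ((nrm (K p) F)\<^sup>2)) \<le> c * nrm (K p) F"
   unfolding nrm_sq by simp
  then have "(nrm (K p) F)\<^sup>2 \<le> c * nrm (K p) F" unfolding norm_of_real abs_power2 .
  then show ?thesis by (rule le_of_sq_le[rotated 2]) (auto simp: c)
 qed
 show s: "(\<lambda>q. K p q * x q) summable_on S" if "p \<in> S" for p
  by (rule ell2_inner_summable(1)[OF ell2I(1)[OF c row[OF that]] x])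
 have "nrm (\<lambda>p. \<Sum>\<^sub>\<infinity>q\<in>S. K p q * x q) F' \<le> c * ?X" if F': "finite F'" "F' \<subseteq> S" for F'
 proof (rule tendsto_upperbound)
  show "((\<lambda>F. nrm (\<lambda>p. \<Sum>q\<in>F. K p q * x q) F') \<longlongrightarrow> nrm (\<lambda>p. \<Sum>\<^sub>\<infinity>q\<in>S. K p q * x q) F') (finite_subsets_at_top S)"
   using F' by (intro tendsto_nrm infsum_tendsto s) auto
  show "\<forall>\<^sub>F F in finite_subsets_at_top S. nrm (\<lambda>p. \<Sum>q\<in>F. K p q * x q) F' \<le> c * ?X"
  proof (rule eventually_finite_subsets_at_top_weakI)
   fix F assume F: "finite F" "F \<subseteq> S"
   have "nrm (\<lambda>p. \<Sum>q\<in>F. K p q * x q) F' \<le> c * nrm x F" by (rule kbd_apply[OF K F(1) F'(1) F(2) F'(2)])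
   also have "\<dots> \<le> c * ?X" by (intro mult_left_mono ell2D x F c)
   finally show "nrm (\<lambda>p. \<Sum>q\<in>F. K p q * x q) F' \<le> c * ?X" .
  qed
 qed simp
 moreover have "0 \<le> c * ?X" using c by (auto intro!: mult_nonneg_nonneg infsum_nonneg)
 ultimately show "(\<lambda>p. (cmod (\<Sum>\<^sub>\<infinity>q\<in>S. K p q * x q))\<^sup>2) summable_on S"
  and "sqrt (\<Sum>\<^sub>\<infinity>p\<in>S. (cmod (\<Sum>\<^sub>\<infinity>q\<in>S. K p q * x q))\<^sup>2) \<le> c * ?X"
  by (auto intro!: ell2I)
qed

subsection \<open>Square summable functions and bounded operators\<close>

definition delta :: "'g => 'g => complex" where
 "delta t = (\<lambda>s. if s = t then 1 else 0)"

definition trunc :: "'g set => ('g => complex) => 'g => complex" where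
 "trunc F \<xi> = (\<lambda>t. if t \<in> F then \<xi> t else 0)"

lemma l2I:
 assumes "0 \<le> c" "\<And>t. t \<notin> carrier G ==> \<xi> t = 0"
  and "\<And>F. finite F ==> F \<subseteq> carrier G ==> nrm \<xi> F \<le> c"
 shows "\<xi> \<in> l2 G" "l2_norm G \<xi> \<le> c"
 using assms ell2I[OF assms(1,3)] by (auto simp: l2_def l2_norm_def)

lemma l2D: "\<xi> \<in> l2 G ==> finite F ==> F \<subseteq> carrier G ==> nrm \<xi> F \<le> l2_norm G \<xi>"
 by (simp add: l2_def l2_norm_def ell2D)

lemma l2_out: "\<xi> \<in> l2 G ==> t \<notin> carrier G ==> \<xi> t = 0"
 by (simp add: l2_def)

lemma l2_norm_nonneg [simp]: "0 \<le> l2_norm G \<xi>"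
 by (auto simp: l2_norm_def intro: infsum_nonneg)

lemma l2_entry:
 assumes "\<xi> \<in> l2 G"
 shows "cmod (\<xi> t) \<le> l2_norm G \<xi>"
proof (cases "t \<in> carrier G")
 case True
 then show ?thesis using l2D[OF assms, of "{t}"] by simp
qed (simp add: l2_out[OF assms])

lemma l2_add:
 assumes "\<xi> \<in> l2 G" "\<eta> \<in> l2 G"
 shows "\<xi> + \<eta> \<in> l2 G" "l2_norm G (\<xi> + \<eta>) \<le> l2_norm G \<xi> + l2_norm G \<eta>"
proof -
 have "nrm (\<xi> + \<eta>) F \<le> l2_norm G \<xi> + l2_norm G \<eta>" if F: "finite F" "F \<subseteq> carrier G" for F
 proof -
  have "nrm (\<xi> + \<eta>) F \<le> L2_set (\<lambda>t. cmod (\<xi> t) + cmod (\<eta> t)) F"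
   by (intro L2_set_mono) (auto intro: norm_triangle_ineq)
  also have "\<dots> \<le> nrm \<xi> F + nrm \<eta> F" by (rule L2_set_triangle_ineq)
  also have "\<dots> \<le> l2_norm G \<xi> + l2_norm G \<eta>" by (intro add_mono l2D assms F)
  finally show ?thesis .
 qed
 note b = this
 have z: "(\<xi> + \<eta>) t = 0" if "t \<notin> carrier G" for t using that by (simp add: l2_out[OF assms(1)] l2_out[OF assms(2)])
 have n: "0 \<le> l2_norm G \<xi> + l2_norm G \<eta>" by simp
 show "\<xi> + \<eta> \<in> l2 G" "l2_norm G (\<xi> + \<eta>) \<le> l2_norm G \<xi> + l2_norm G \<eta>"
  by (rule l2I[OF n z b]; assumption)+
qed

lemma l2_smul:
 assumes "\<xi> \<in> l2 G"
 shows "(\<lambda>t. c * \<xi> t) \<in> l2 G" "l2_norm G (\<lambda>t. c * \<xi> t) \<le> cmod c * l2_norm G \<xi>"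
proof -
 have "nrm (\<lambda>t. c * \<xi> t) F \<le> cmod c * l2_norm G \<xi>" if F: "finite F" "F \<subseteq> carrier G" for F
 proof -
  have "nrm (\<lambda>t. c * \<xi> t) F = cmod c * nrm \<xi> F" by (simp add: norm_mult L2_set_right_distrib)
  then show ?thesis using l2D[OF assms F] by (simp add: mult_left_mono)
 qed
 note b = this
 have z: "c * \<xi> t = 0" if "t \<notin> carrier G" for t using that by (simp add: l2_out[OF assms])
 have n: "0 \<le> cmod c * l2_norm G \<xi>" by simp
 show "(\<lambda>t. c * \<xi> t) \<in> l2 G" "l2_norm G (\<lambda>t. c * \<xi> t) \<le> cmod c * l2_norm G \<xi>"
  by (rule l2I[OF n z b]; assumption)+
qed

lemma l2_0: "0 \<in> l2 G" "l2_norm G 0 = 0"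
 by (auto simp: l2_def l2_norm_def)

lemma l2_diff:
 assumes "\<xi> \<in> l2 G" "\<eta> \<in> l2 G"
 shows "\<xi> - \<eta> \<in> l2 G"
proof -
 have "\<xi> - \<eta> = \<xi> + (\<lambda>t. (-1) * \<eta> t)" by (auto simp: fun_eq_iff)
 then show ?thesis using l2_add(1)[OF assms(1) l2_smul(1)[OF assms(2), of "-1"]] by metis
qed

lemma l2_trunc:
 assumes "finite F" "F \<subseteq> carrier G"
 shows "trunc F \<xi> \<in> l2 G" "l2_norm G (trunc F \<xi>) = nrm \<xi> F"
proof -
 have "nrm (trunc F \<xi>) F' \<le> nrm \<xi> F" if "finite F'" "F' \<subseteq> carrier G" for F'
 proof -
  have "nrm (trunc F \<xi>) F' \<le> nrm (trunc F \<xi>) (F' \<union> F)"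
   unfolding L2_set_def using assms that by (intro real_sqrt_le_mono sum_mono2) auto
  also have "\<dots> = nrm \<xi> F" unfolding trunc_def by (rule nrm_restrict) (use assms that in auto)
  finally show ?thesis .
 qed
 moreover have "trunc F \<xi> t = 0" if "t \<notin> carrier G" for t
  using that assms by (auto simp: trunc_def)
 ultimately have 1: "trunc F \<xi> \<in> l2 G" "l2_norm G (trunc F \<xi>) \<le> nrm \<xi> F"
  using l2I[of "nrm \<xi> F" G "trunc F \<xi>"] by auto
 moreover have "nrm \<xi> F = nrm (trunc F \<xi>) F" by (simp add: trunc_def L2_set_def)
 ultimately show "trunc F \<xi> \<in> l2 G" "l2_norm G (trunc F \<xi>) = nrm \<xi> F"
  using l2D[OF 1(1) assms] by auto
qed

lemma l2_diff_trunc_mono: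
 assumes "\<xi> \<in> l2 G" "finite F" "F \<subseteq> F'" "F' \<subseteq> carrier G" "finite F'"
 shows "l2_norm G (\<xi> - trunc F' \<xi>) \<le> l2_norm G (\<xi> - trunc F \<xi>)"
proof (rule l2I)
 have d: "\<xi> - trunc F \<xi> \<in> l2 G" using assms by (intro l2_diff l2_trunc) auto
 fix E assume E: "finite E" "E \<subseteq> carrier G"
 have "nrm (\<xi> - trunc F' \<xi>) E \<le> nrm (\<xi> - trunc F \<xi>) E"
  using assms by (intro L2_set_mono) (auto simp: trunc_def)
 also have "\<dots> \<le> l2_norm G (\<xi> - trunc F \<xi>)" by (rule l2D[OF d E])
 finally show "nrm (\<xi> - trunc F' \<xi>) E \<le> l2_norm G (\<xi> - trunc F \<xi>)" .
qed (use assms in \<open>auto simp: trunc_def l2_out[OF assms(1)]\<close>)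

lemma l2_trunc_approx:
 assumes \<xi>: "\<xi> \<in> l2 G" and e: "0 < e"
 obtains F where "finite F" "F \<subseteq> carrier G"
  "\<And>F'. finite F' ==> F \<subseteq> F' ==> F' \<subseteq> carrier G ==> l2_norm G (\<xi> - trunc F' \<xi>) < e"
proof -
 define s where "s = (\<Sum>\<^sub>\<infinity>t\<in>carrier G. (cmod (\<xi> t))\<^sup>2)"
 have "((\<lambda>t. (cmod (\<xi> t))\<^sup>2) has_sum s) (carrier G)"
  using \<xi> unfolding s_def l2_def by auto
 then have "\<forall>\<^sub>F F in finite_subsets_at_top (carrier G). dist (\<Sum>t\<in>F. (cmod (\<xi> t))\<^sup>2) s < (e/2)\<^sup>2"
  unfolding has_sum_def using e by (intro tendstoD) auto
 then obtain F where F: "finite F" "F \<subseteq> carrier G" and d: "dist (\<Sum>t\<in>F. (cmod (\<xi> t))\<^sup>2) s < (e/2)\<^sup>2"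
  unfolding eventually_finite_subsets_at_top by blast
 have "l2_norm G (\<xi> - trunc F \<xi>) \<le> e / 2"
 proof (rule l2I)
  fix E assume E: "finite E" "E \<subseteq> carrier G"
  have "(\<Sum>t\<in>E. (cmod ((\<xi> - trunc F \<xi>) t))\<^sup>2) = (\<Sum>t\<in>E - F. (cmod (\<xi> t))\<^sup>2)"
   by (intro sum.mono_neutral_cong_right) (use E in \<open>auto simp: trunc_def\<close>)
  also have "\<dots> = (\<Sum>t\<in>E \<union> F. (cmod (\<xi> t))\<^sup>2) - (\<Sum>t\<in>F. (cmod (\<xi> t))\<^sup>2)"
   using E F by (metis Diff_cancel Un_Diff finite_UnI sum_diff sup_ge2 sup_bot_right)
  also have "(\<Sum>t\<in>E \<union> F. (cmod (\<xi> t))\<^sup>2) \<le> s"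
   unfolding s_def using \<xi> E F by (intro finite_sum_le_infsum) (auto simp: l2_def)
  finally have "(\<Sum>t\<in>E. (cmod ((\<xi> - trunc F \<xi>) t))\<^sup>2) \<le> (e/2)\<^sup>2"
   using d by (simp add: dist_real_def)
  then show "nrm (\<xi> - trunc F \<xi>) E \<le> e / 2"
   unfolding L2_set_def using e by (intro real_le_lsqrt) auto
 qed (use e F in \<open>auto simp: trunc_def l2_out[OF \<xi>]\<close>)
 then have "l2_norm G (\<xi> - trunc F' \<xi>) < e" if "finite F'" "F \<subseteq> F'" "F' \<subseteq> carrier G" for F'
  using l2_diff_trunc_mono[OF \<xi> F(1) that(2,3,1)] e by linarith
 with F that show thesis by blast
qed

lemma l2_delta: "t \<in> carrier G ==> delta t \<in> l2 G" "t \<in> carrier G ==> l2_norm G (delta t) = 1"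
proof -
 have "delta t = trunc {t} (\<lambda>_. 1)" by (auto simp: delta_def trunc_def fun_eq_iff)
 then show "t \<in> carrier G ==> delta t \<in> l2 G" "t \<in> carrier G ==> l2_norm G (delta t) = 1"
  using l2_trunc[of "{t}" G "\<lambda>_. 1"] by auto
qed

lemma l2_inner_bound:
 assumes "\<xi> \<in> l2 G" "\<eta> \<in> l2 G"
 shows "(\<lambda>t. \<xi> t * cnj (\<eta> t)) summable_on carrier G"
  "cmod (l2_inner G \<xi> \<eta>) \<le> l2_norm G \<xi> * l2_norm G \<eta>"
 using ell2_inner_summable[of \<xi> "carrier G" "\<lambda>t. cnj (\<eta> t)"] assms
 by (auto simp: l2_inner_def l2_norm_def l2_def)

lemma l2_inner_add:
 assumes "\<xi> \<in> l2 G" "\<xi>' \<in> l2 G" "\<eta> \<in> l2 G"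
 shows "l2_inner G (\<xi> + \<xi>') \<eta> = l2_inner G \<xi> \<eta> + l2_inner G \<xi>' \<eta>"
  "l2_inner G \<eta> (\<xi> + \<xi>') = l2_inner G \<eta> \<xi> + l2_inner G \<eta> \<xi>'"
 unfolding l2_inner_def
 using infsum_add[OF l2_inner_bound(1)[OF assms(1,3)] l2_inner_bound(1)[OF assms(2,3)]]
  infsum_add[OF l2_inner_bound(1)[OF assms(3,1)] l2_inner_bound(1)[OF assms(3,2)]]
 by (simp_all add: algebra_simps)

lemma l2_inner_smul:
 "l2_inner G (\<lambda>t. c * \<xi> t) \<eta> = c * l2_inner G \<xi> \<eta>"
 "l2_inner G \<xi> (\<lambda>t. c * \<eta> t) = cnj c * l2_inner G \<xi> \<eta>"
 unfolding l2_inner_def by (simp_all add: mult_ac flip: infsum_cmult_right')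

lemma l2_inner_trunc:
 assumes "finite F" "F \<subseteq> carrier G"
 shows "l2_inner G \<xi> (trunc F \<eta>) = (\<Sum>t\<in>F. \<xi> t * cnj (\<eta> t))"
proof -
 have "l2_inner G \<xi> (trunc F \<eta>) = (\<Sum>\<^sub>\<infinity>t\<in>F. \<xi> t * cnj (\<eta> t))"
  unfolding l2_inner_def
  by (rule infsum_cong_neutral) (use assms in \<open>auto simp: trunc_def\<close>)
 then show ?thesis using assms by simp
qed

lemma l2_boundedD:
 assumes "T \<in> l2_bounded G"
 shows "\<xi> \<in> l2 G ==> T \<xi> \<in> l2 G"
  "\<xi> \<in> l2 G ==> \<eta> \<in> l2 G ==> T (\<xi> + \<eta>) = T \<xi> + T \<eta>"
  "\<xi> \<in> l2 G ==> T (\<lambda>t. c * \<xi> t) = (\<lambda>t. c * T \<xi> t)"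
  "\<xi> \<notin> l2 G ==> T \<xi> = 0"
  "T 0 = 0"
proof -
 show "T (\<lambda>t. c * \<xi> t) = (\<lambda>t. c * T \<xi> t)" if "\<xi> \<in> l2 G" for c \<xi>
  using assms that by (auto simp: l2_bounded_def)
 from this[OF l2_0(1), of 0] show "T 0 = 0" by (simp add: zero_fun_def)
qed (use assms in \<open>auto simp: l2_bounded_def\<close>)

lemma l2_bounded_bound:
 assumes "T \<in> l2_bounded G"
 obtains C where "0 \<le> C" "\<And>\<xi>. \<xi> \<in> l2 G ==> l2_norm G (T \<xi>) \<le> C * l2_norm G \<xi>"
proof -
 obtain C where C: "\<And>\<xi>. \<xi> \<in> l2 G ==> l2_norm G (T \<xi>) \<le> C * l2_norm G \<xi>"
  using assms unfolding l2_bounded_def by blast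
 have "l2_norm G (T \<xi>) \<le> \<bar>C\<bar> * l2_norm G \<xi>" if "\<xi> \<in> l2 G" for \<xi>
  using C[OF that] by (rule order_trans) (auto intro: mult_right_mono)
 then show thesis by (intro that[of "\<bar>C\<bar>"]) auto
qed

lemma l2_bounded_trunc:
 assumes T: "T \<in> l2_bounded G" and F: "finite F" "F \<subseteq> carrier G"
 shows "T (trunc F \<xi>) s = (\<Sum>t\<in>F. \<xi> t * T (delta t) s)"
 using F
proof (induction F rule: finite_induct)
 case empty
 have "trunc {} \<xi> = 0" by (simp add: trunc_def fun_eq_iff)
 then have "T (trunc {} \<xi>) = 0" using l2_boundedD(5)[OF T] by metis
 then show ?case by simp
next
 case (insert t F)
 have "trunc (insert t F) \<xi> = (\<lambda>s. \<xi> t * delta t s) + trunc F \<xi>"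
  using insert(2) by (auto simp: trunc_def delta_def fun_eq_iff)
 moreover have "(\<lambda>s. \<xi> t * delta t s) \<in> l2 G" "trunc F \<xi> \<in> l2 G"
  using insert by (auto intro!: l2_smul l2_delta l2_trunc)
 ultimately have "T (trunc (insert t F) \<xi>) = T (\<lambda>s. \<xi> t * delta t s) + T (trunc F \<xi>)"
  by (simp add: l2_boundedD(2)[OF T])
 also have "T (\<lambda>s. \<xi> t * delta t s) = (\<lambda>s. \<xi> t * T (delta t) s)"
  using insert by (intro l2_boundedD(3)[OF T] l2_delta) auto
 finally show ?case using insert by simp
qed

lemma l2_bounded_diff:
 assumes T: "T \<in> l2_bounded G" and "\<xi> \<in> l2 G" "\<eta> \<in> l2 G"
 shows "T (\<xi> - \<eta>) = T \<xi> - T \<eta>"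
proof -
 have "T ((\<xi> - \<eta>) + \<eta>) = T (\<xi> - \<eta>) + T \<eta>"
  using assms by (intro l2_boundedD(2)[OF T] l2_diff)
 then show ?thesis by simp
qed

text \<open>Truncations of \<open>\<xi>\<close> converge in norm, so boundedness of \<open>T\<close>
  gives convergence of the matrix sum in every coordinate. A bounded operator is therefore
  determined by its matrix.\<close>

lemma l2_bounded_has_sum:
 assumes T: "T \<in> l2_bounded G" and \<xi>: "\<xi> \<in> l2 G"
 shows "((\<lambda>t. \<xi> t * T (delta t) s) has_sum T \<xi> s) (carrier G)"
 unfolding has_sum_def
proof (rule tendstoI)
 obtain C where C: "0 \<le> C" "\<And>\<xi>. \<xi> \<in> l2 G ==> l2_norm G (T \<xi>) \<le> C * l2_norm G \<xi>"
  using l2_bounded_bound[OF T] by blast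
 fix e :: real assume e: "0 < e"
 obtain F where F: "finite F" "F \<subseteq> carrier G"
  "\<And>F'. finite F' ==> F \<subseteq> F' ==> F' \<subseteq> carrier G ==> l2_norm G (\<xi> - trunc F' \<xi>) < e / (C + 1)"
  using l2_trunc_approx[OF \<xi>, of "e / (C + 1)"] e C(1) by auto
 show "\<forall>\<^sub>F F in finite_subsets_at_top (carrier G). dist (\<Sum>t\<in>F. \<xi> t * T (delta t) s) (T \<xi> s) < e"
  unfolding eventually_finite_subsets_at_top
 proof (intro exI[of _ F] conjI allI impI)
  fix F' assume F': "finite F' \<and> F \<subseteq> F' \<and> F' \<subseteq> carrier G"
  have t: "trunc F' \<xi> \<in> l2 G" using F' by (intro l2_trunc) auto
  have "dist (\<Sum>t\<in>F'. \<xi> t * T (delta t) s) (T \<xi> s) = cmod (T (\<xi> - trunc F' \<xi>) s)"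
   using F' by (simp add: l2_bounded_trunc[OF T] l2_bounded_diff[OF T \<xi> t] dist_norm norm_minus_commute)
  also have "\<dots> \<le> l2_norm G (T (\<xi> - trunc F' \<xi>))"
   by (intro l2_entry l2_boundedD(1)[OF T] l2_diff \<xi> t)
  also have "\<dots> \<le> C * l2_norm G (\<xi> - trunc F' \<xi>)" by (intro C l2_diff \<xi> t)
  also have "\<dots> \<le> C * (e / (C + 1))" using F(3)[of F'] F' C(1) by (intro mult_left_mono) auto
  also have "\<dots> < e" using e C(1) by (simp add: field_simps)
  finally show "dist (\<Sum>t\<in>F'. \<xi> t * T (delta t) s) (T \<xi> s) < e" .
 qed (use F in auto)
qed

lemma l2_bounded_eqI:
 assumes "T \<in> l2_bounded G" "R \<in> l2_bounded G" "\<And>t. t \<in> carrier G ==> T (delta t) = R (delta t)"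
 shows "T = R"
proof
 fix \<xi> show "T \<xi> = R \<xi>"
 proof (cases "\<xi> \<in> l2 G")
  case True
  show ?thesis
  proof
   fix s
   have "((\<lambda>t. \<xi> t * T (delta t) s) has_sum R \<xi> s) (carrier G)"
    using l2_bounded_has_sum[OF assms(2) True, of s] assms(3) by (simp cong: has_sum_cong)
   with l2_bounded_has_sum[OF assms(1) True] show "T \<xi> s = R \<xi> s" by (rule has_sum_unique)
  qed
 qed (simp add: l2_boundedD(4)[OF assms(1)] l2_boundedD(4)[OF assms(2)])
qed

lemma l2_bounded_comp:
 assumes "T \<in> l2_bounded G" "R \<in> l2_bounded G"
 shows "T \<circ> R \<in> l2_bounded G"
proof -
 obtain C where C: "0 \<le> C" "\<And>\<xi>. \<xi> \<in> l2 G ==> l2_norm G (T \<xi>) \<le> C * l2_norm G \<xi>"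
  using l2_bounded_bound[OF assms(1)] by blast
 obtain C' where C': "0 \<le> C'" "\<And>\<xi>. \<xi> \<in> l2 G ==> l2_norm G (R \<xi>) \<le> C' * l2_norm G \<xi>"
  using l2_bounded_bound[OF assms(2)] by blast
 have "l2_norm G (T (R \<xi>)) \<le> (C * C') * l2_norm G \<xi>" if "\<xi> \<in> l2 G" for \<xi>
 proof -
  have "l2_norm G (T (R \<xi>)) \<le> C * l2_norm G (R \<xi>)" using that by (intro C l2_boundedD[OF assms(2)])
  also have "\<dots> \<le> C * (C' * l2_norm G \<xi>)" by (intro mult_left_mono C C' that)
  finally show ?thesis by (simp add: mult.assoc)
 qed
 then have "\<exists>C. \<forall>\<xi>\<in>l2 G. l2_norm G (T (R \<xi>)) \<le> C * l2_norm G \<xi>" by blast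
 then show ?thesis
  unfolding l2_bounded_def
  using l2_boundedD[OF assms(1)] l2_boundedD[OF assms(2)] by simp
qed

definition perm_op :: "('g, 'm) monoid_scheme => ('g => 'g) => ('g => complex) => 'g => complex" where
 "perm_op G h \<xi> = (\<lambda>t. if \<xi> \<in> l2 G \<and> t \<in> carrier G then \<xi> (h t) else 0)"

lemma perm_op_l2_bounded:
 assumes h: "bij_betw h (carrier G) (carrier G)"
 shows "perm_op G h \<in> l2_bounded G" "\<xi> \<in> l2 G ==> l2_norm G (perm_op G h \<xi>) = l2_norm G \<xi>"
proof -
 have 1: "perm_op G h \<xi> \<in> l2 G" if "\<xi> \<in> l2 G" for \<xi>
  using summable_on_reindex_bij_betw[OF h, of "\<lambda>t. (cmod (\<xi> t))\<^sup>2"] that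
  by (auto simp: l2_def perm_op_def cong: summable_on_cong)
 show 2: "l2_norm G (perm_op G h \<xi>) = l2_norm G \<xi>" if "\<xi> \<in> l2 G" for \<xi>
  using infsum_reindex_bij_betw[OF h, of "\<lambda>t. (cmod (\<xi> t))\<^sup>2"] that
  by (auto simp: l2_norm_def perm_op_def cong: infsum_cong)
 have "\<exists>C. \<forall>\<xi>\<in>l2 G. l2_norm G (perm_op G h \<xi>) \<le> C * l2_norm G \<xi>"
  by (rule exI[of _ 1]) (simp add: 2)
 then show "perm_op G h \<in> l2_bounded G"
  unfolding l2_bounded_def using 1 l2_add(1)[of _ G] l2_smul(1)[of _ G]
  by (auto simp: fun_eq_iff perm_op_def)
qed

section \<open>Symbols of the operators in the group von Neumann algebra\<close>

context group begin

definition coef :: "(('a => complex) => 'a => complex) => 'a => complex" where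
 "coef T = T (delta \<one>)"

definition ker :: "('a => complex) => 'a => 'a => complex" where
 "ker \<alpha> s t = \<alpha> (s \<otimes> inv t)"

definition conv_op :: "('a => complex) => ('a => complex) => 'a => complex" where
 "conv_op \<alpha> \<xi> = (\<lambda>s. if \<xi> \<in> l2 G \<and> s \<in> carrier G then \<Sum>\<^sub>\<infinity>t\<in>carrier G. ker \<alpha> s t * \<xi> t else 0)"

lemma mult_inv_cancel:
 assumes "x \<in> carrier G" "y \<in> carrier G"
 shows "x \<otimes> (inv x \<otimes> y) = y" "inv x \<otimes> (x \<otimes> y) = y"
 using assms by (simp_all flip: m_assoc)

lemma bij_right: "g \<in> carrier G ==> bij_betw (\<lambda>t. t \<otimes> g) (carrier G) (carrier G)"
 by (rule bij_betwI[where g = "\<lambda>t. t \<otimes> inv g"]) (auto simp: m_assoc)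

lemma bij_left: "g \<in> carrier G ==> bij_betw (\<lambda>t. g \<otimes> t) (carrier G) (carrier G)"
 by (rule bij_betwI[where g = "\<lambda>t. inv g \<otimes> t"]) (auto simp flip: m_assoc)

lemma left_regular_perm: "left_regular G s = perm_op G (\<lambda>t. inv s \<otimes> t)"
 by (simp add: left_regular_def perm_op_def fun_eq_iff)

lemma left_regular_bounded: "s \<in> carrier G ==> left_regular G s \<in> l2_bounded G"
 unfolding left_regular_perm by (intro perm_op_l2_bounded(1) bij_left) simp

lemma left_regular_delta:
 assumes "s \<in> carrier G" "t \<in> carrier G"
 shows "left_regular G s (delta t) = delta (s \<otimes> t)"
 using assms l2_delta(1)[OF assms(2)]
 by (auto simp: left_regular_def delta_def fun_eq_iff inv_solve_left' inv_solve_left)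

lemma left_regular_VN:
 assumes "s \<in> carrier G" shows "left_regular G s \<in> vecs (VN G)"
 using assms left_regular_bounded unfolding VN_def commutant_def by auto

lemma VN_bounded: "T \<in> vecs (VN G) ==> T \<in> l2_bounded G"
 by (simp add: VN_def commutant_def)

lemma right_perm_commutant:
 assumes g: "g \<in> carrier G"
 shows "perm_op G (\<lambda>t. t \<otimes> g) \<in> commutant G (left_regular G ` carrier G)"
proof -
 have "perm_op G (\<lambda>t. t \<otimes> g) \<circ> left_regular G s = left_regular G s \<circ> perm_op G (\<lambda>t. t \<otimes> g)"
  if s: "s \<in> carrier G" for s
 proof
  fix \<xi>
  note r = perm_op_l2_bounded(1)[OF bij_right[OF g]]
  show "(perm_op G (\<lambda>t. t \<otimes> g) \<circ> left_regular G s) \<xi> = (left_regular G s \<circ> perm_op G (\<lambda>t. t \<otimes> g)) \<xi>"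
  proof (cases "\<xi> \<in> l2 G")
   case True
   then have "perm_op G (\<lambda>t. t \<otimes> g) \<xi> \<in> l2 G" "left_regular G s \<xi> \<in> l2 G"
    using l2_boundedD(1)[OF r] l2_boundedD(1)[OF left_regular_bounded[OF s]] by auto
   then show ?thesis using True s g
    by (auto simp: fun_eq_iff perm_op_def left_regular_def m_assoc)
  next
   case False
   then have z: "perm_op G (\<lambda>t. t \<otimes> g) \<xi> = 0" "left_regular G s \<xi> = 0"
    using l2_boundedD(4)[OF r] l2_boundedD(4)[OF left_regular_bounded[OF s]] by auto
   show ?thesis by (simp add: z l2_boundedD(5)[OF r] l2_boundedD(5)[OF left_regular_bounded[OF s]])
  qed
 qed
 then show ?thesis unfolding commutant_def using perm_op_l2_bounded(1)[OF bij_right[OF g]] by auto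
qed

text \<open>\<open>T\<close> commutes with the right translations, as these lie in the commutant of
  the left ones. Translating the column \<open>t\<close> to the neutral element turns the entry into
  a value of the symbol.\<close>

lemma VN_entry:
 assumes T: "T \<in> vecs (VN G)" and st: "s \<in> carrier G" "t \<in> carrier G"
 shows "T (delta t) s = ker (coef T) s t"
proof -
 let ?R = "perm_op G (\<lambda>r. r \<otimes> t)"
 have c: "T \<circ> ?R = ?R \<circ> T"
  using T right_perm_commutant[OF st(2)] by (auto simp: VN_def commutant_def)
 have "?R (delta t) = delta \<one>"
  using st l2_delta(1)[OF st(2)] by (auto simp: perm_op_def delta_def fun_eq_iff)
 then have "coef T (s \<otimes> inv t) = ?R (T (delta t)) (s \<otimes> inv t)"
  using fun_cong[OF c, of "delta t"] by (simp add: coef_def)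
 also have "\<dots> = T (delta t) s"
  using st l2_boundedD(1)[OF VN_bounded[OF T] l2_delta(1)[OF st(2)]] by (simp add: perm_op_def m_assoc)
 finally show ?thesis by (simp add: ker_def)
qed

lemma VN_trunc:
 assumes T: "T \<in> vecs (VN G)" and F: "finite F" "F \<subseteq> carrier G" and s: "s \<in> carrier G"
 shows "T (trunc F \<xi>) s = (\<Sum>t\<in>F. ker (coef T) s t * \<xi> t)"
 unfolding l2_bounded_trunc[OF VN_bounded[OF T] F]
 using F s by (intro sum.cong refl) (simp add: VN_entry[OF T s] subset_eq)

lemma VN_has_sum:
 assumes T: "T \<in> vecs (VN G)" and \<xi>: "\<xi> \<in> l2 G" and s: "s \<in> carrier G"
 shows "((\<lambda>t. ker (coef T) s t * \<xi> t) has_sum T \<xi> s) (carrier G)"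
 using l2_bounded_has_sum[OF VN_bounded[OF T] \<xi>, of s]
 by (rule has_sum_cong[THEN iffD1, rotated]) (simp add: VN_entry[OF T s])

lemma VN_eqI:
 assumes "T \<in> vecs (VN G)" "R \<in> vecs (VN G)" "\<And>s. s \<in> carrier G ==> coef T s = coef R s"
 shows "T = R"
proof (rule l2_bounded_eqI[OF VN_bounded VN_bounded, OF assms(1,2)], rule ext)
 fix t s assume t: "t \<in> carrier G"
 show "T (delta t) s = R (delta t) s"
 proof (cases "s \<in> carrier G")
  case True
  then show ?thesis
   using t assms(3)[of "s \<otimes> inv t"] by (simp add: VN_entry[OF assms(1)] VN_entry[OF assms(2)] ker_def)
 next
  case False
  have "T (delta t) \<in> l2 G" "R (delta t) \<in> l2 G"
   by (intro l2_boundedD(1)[OF VN_bounded[OF assms(1)]] l2_boundedD(1)[OF VN_bounded[OF assms(2)]] l2_delta t)+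
  then show ?thesis using False by (metis l2_out)
 qed
qed

lemma VN_kbd:
 assumes T: "T \<in> vecs (VN G)" and C: "0 \<le> C" "\<And>\<xi>. \<xi> \<in> l2 G ==> l2_norm G (T \<xi>) \<le> C * l2_norm G \<xi>"
 shows "kbd (carrier G) (ker (coef T)) C"
proof (rule kbd_applyI[OF C(1)])
 fix F x assume F: "finite F" "F \<subseteq> carrier G"
 have "nrm (\<lambda>p. \<Sum>q\<in>F. ker (coef T) p q * x q) F = nrm (T (trunc F x)) F"
  using F by (intro L2_set_cong refl) (auto simp: VN_trunc[OF T F])
 also have "\<dots> \<le> l2_norm G (T (trunc F x))"
  by (intro l2D F l2_boundedD(1)[OF VN_bounded[OF T]] l2_trunc)
 also have "\<dots> \<le> C * nrm x F"
  using C(2)[OF l2_trunc(1)[OF F]] l2_trunc(2)[OF F, of x] by metis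
 finally show "nrm (\<lambda>p. \<Sum>q\<in>F. ker (coef T) p q * x q) F \<le> C * nrm x F" .
qed

lemma VN_kbd_ex:
 assumes T: "T \<in> vecs (VN G)"
 obtains C where "kbd (carrier G) (ker (coef T)) C"
 using l2_bounded_bound[OF VN_bounded[OF T]] VN_kbd[OF T] by metis

lemma conv_op_bounded:
 assumes K: "kbd (carrier G) (ker \<alpha>) c"
 shows "conv_op \<alpha> \<in> l2_bounded G" "\<xi> \<in> l2 G ==> l2_norm G (conv_op \<alpha> \<xi>) \<le> c * l2_norm G \<xi>"
proof -
 have sq: "(\<lambda>q. (cmod (\<xi> q))\<^sup>2) summable_on carrier G" if "\<xi> \<in> l2 G" for \<xi>
  using that by (simp add: l2_def)
 have 1: "conv_op \<alpha> \<xi> \<in> l2 G" if "\<xi> \<in> l2 G" for \<xi>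
  using kbd_operator(2)[OF K sq[OF that]] that by (auto simp: l2_def conv_op_def cong: summable_on_cong)
 show 2: "l2_norm G (conv_op \<alpha> \<xi>) \<le> c * l2_norm G \<xi>" if "\<xi> \<in> l2 G" for \<xi>
  using kbd_operator(3)[OF K sq[OF that]] that by (auto simp: l2_norm_def conv_op_def cong: infsum_cong)
 note s = kbd_operator(1)[OF K sq]
 have add: "conv_op \<alpha> (\<xi> + \<eta>) = conv_op \<alpha> \<xi> + conv_op \<alpha> \<eta>" if "\<xi> \<in> l2 G" "\<eta> \<in> l2 G" for \<xi> \<eta>
  using that l2_add(1)[OF that] by (auto simp: conv_op_def fun_eq_iff ring_distribs infsum_add s)
 have smul: "conv_op \<alpha> (\<lambda>t. a * \<xi> t) = (\<lambda>t. a * conv_op \<alpha> \<xi> t)" if "\<xi> \<in> l2 G" for a \<xi>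
  using that l2_smul(1)[OF that, of a]
  by (auto simp: conv_op_def fun_eq_iff mult.left_commute infsum_cmult_right')
 have "\<exists>C. \<forall>\<xi>\<in>l2 G. l2_norm G (conv_op \<alpha> \<xi>) \<le> C * l2_norm G \<xi>" using 2 by blast
 then show "conv_op \<alpha> \<in> l2_bounded G"
  unfolding l2_bounded_def using 1 add smul by (auto simp: conv_op_def fun_eq_iff)
qed

lemma infsum_delta:
 fixes f :: "'a => complex"
 assumes "t \<in> S"
 shows "(\<Sum>\<^sub>\<infinity>r\<in>S. f r * delta t r) = f t"
proof -
 have "(\<Sum>\<^sub>\<infinity>r\<in>S. f r * delta t r) = (\<Sum>\<^sub>\<infinity>r\<in>{t}. f r * delta t r)"
  by (rule infsum_cong_neutral) (use assms in \<open>auto simp: delta_def\<close>)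
 then show ?thesis by (simp add: delta_def)
qed

lemma conv_op_delta:
 "t \<in> carrier G ==> s \<in> carrier G ==> conv_op \<alpha> (delta t) s = ker \<alpha> s t"
 by (simp add: conv_op_def l2_delta infsum_delta)

lemma coef_conv_op: "s \<in> carrier G ==> coef (conv_op \<alpha>) s = \<alpha> s"
 by (simp add: coef_def conv_op_delta ker_def)

text \<open>The commutation theorem: an operator commuting with the left translations has matrix entries
 depending on \<open>t\<^sup>-\<^sup>1 s\<close> only, and such matrices commute with those whose entries depend on
 \<open>s t\<^sup>-\<^sup>1\<close>.\<close>

lemma conv_op_VN:
 assumes K: "kbd (carrier G) (ker \<alpha>) c"
 shows "conv_op \<alpha> \<in> vecs (VN G)"
proof -
 note T = conv_op_bounded(1)[OF K]
 have "conv_op \<alpha> \<circ> R = R \<circ> conv_op \<alpha>" if R: "R \<in> commutant G (left_regular G ` carrier G)" for R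
 proof -
  have Rb: "R \<in> l2_bounded G" using R by (simp add: commutant_def)
  define \<beta> where "\<beta> = R (delta \<one>)"
  have Rd: "R (delta t) s = \<beta> (inv t \<otimes> s)" if "t \<in> carrier G" "s \<in> carrier G" for s t
  proof -
   have "R \<circ> left_regular G t = left_regular G t \<circ> R"
    using R that by (auto simp: commutant_def)
   from fun_cong[OF this, of "delta \<one>"] have "R (delta t) = left_regular G t \<beta>"
    using that by (simp add: left_regular_delta \<beta>_def)
   moreover have "\<beta> \<in> l2 G" unfolding \<beta>_def by (intro l2_boundedD(1)[OF Rb] l2_delta) simp
   ultimately show ?thesis using that by (simp add: left_regular_def)
  qed
  show ?thesis
  proof (rule l2_bounded_eqI[OF l2_bounded_comp[OF T Rb] l2_bounded_comp[OF Rb T]], rule ext)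
   fix t s assume t: "t \<in> carrier G"
   have l: "conv_op \<alpha> (delta t) \<in> l2 G" "R (delta t) \<in> l2 G"
    by (intro l2_boundedD(1)[OF T] l2_boundedD(1)[OF Rb] l2_delta t)+
   show "(conv_op \<alpha> \<circ> R) (delta t) s = (R \<circ> conv_op \<alpha>) (delta t) s"
   proof (cases "s \<in> carrier G")
    case s: True
    \<comment> \<open>This substitution carries
      \<open>\<alpha> (r \<otimes> inv t) * \<beta> (inv r \<otimes> s)\<close>, the summand of one
      composition, into \<open>\<alpha> (s \<otimes> inv r) * \<beta> (inv t \<otimes> r)\<close>,
      the summand of the other.\<close>
    have b: "bij_betw (\<lambda>r. s \<otimes> inv r \<otimes> t) (carrier G) (carrier G)"
     by (rule bij_betwI[where g = "\<lambda>p. t \<otimes> inv p \<otimes> s"])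
      (use s t in \<open>auto simp: inv_mult_group m_assoc mult_inv_cancel\<close>)
    have "(conv_op \<alpha> \<circ> R) (delta t) s = (\<Sum>\<^sub>\<infinity>r\<in>carrier G. ker \<alpha> s r * R (delta t) r)"
     using l s by (simp add: conv_op_def)
    also have "\<dots> = (\<Sum>\<^sub>\<infinity>r\<in>carrier G. \<alpha> (s \<otimes> inv r) * \<beta> (inv t \<otimes> r))"
     using t by (intro infsum_cong) (simp add: Rd ker_def)
    also have "\<dots> = (\<Sum>\<^sub>\<infinity>r\<in>carrier G. \<alpha> (s \<otimes> inv (s \<otimes> inv r \<otimes> t)) * \<beta> (inv t \<otimes> (s \<otimes> inv r \<otimes> t)))"
     by (rule infsum_reindex_bij_betw[OF b, symmetric])
    finally have 1: "(conv_op \<alpha> \<circ> R) (delta t) s = (\<Sum>\<^sub>\<infinity>r\<in>carrier G. \<alpha> (s \<otimes> inv r) * \<beta> (inv t \<otimes> r))"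
     using \<open>(conv_op \<alpha> \<circ> R) (delta t) s = (\<Sum>\<^sub>\<infinity>r\<in>carrier G. ker \<alpha> s r * R (delta t) r)\<close>
      \<open>(\<Sum>\<^sub>\<infinity>r\<in>carrier G. ker \<alpha> s r * R (delta t) r) = _\<close> by simp
    have b': "bij_betw (\<lambda>r. s \<otimes> inv r \<otimes> t) (carrier G) (carrier G)" by fact
    have "(\<Sum>\<^sub>\<infinity>r\<in>carrier G. conv_op \<alpha> (delta t) r * R (delta r) s) = (R \<circ> conv_op \<alpha>) (delta t) s"
     using l2_bounded_has_sum[OF Rb l(1), of s] by (simp add: infsumI)
    moreover have "(\<Sum>\<^sub>\<infinity>r\<in>carrier G. conv_op \<alpha> (delta t) r * R (delta r) s) =
      (\<Sum>\<^sub>\<infinity>r\<in>carrier G. \<alpha> (r \<otimes> inv t) * \<beta> (inv r \<otimes> s))"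
     using s t by (intro infsum_cong) (simp add: conv_op_delta Rd ker_def)
    moreover have "\<dots> = (\<Sum>\<^sub>\<infinity>r\<in>carrier G. \<alpha> (s \<otimes> inv r \<otimes> t \<otimes> inv t) * \<beta> (inv (s \<otimes> inv r \<otimes> t) \<otimes> s))"
     by (rule infsum_reindex_bij_betw[OF b', symmetric])
    moreover have "\<dots> = (\<Sum>\<^sub>\<infinity>r\<in>carrier G. \<alpha> (s \<otimes> inv r) * \<beta> (inv t \<otimes> r))"
     using s t by (intro infsum_cong) (simp add: m_assoc inv_mult_group mult_inv_cancel)
    ultimately show ?thesis using 1 by simp
   next
    case False
    have "(conv_op \<alpha> \<circ> R) (delta t) \<in> l2 G" "(R \<circ> conv_op \<alpha>) (delta t) \<in> l2 G"
     by (intro l2_boundedD(1)[OF l2_bounded_comp[OF T Rb]] l2_boundedD(1)[OF l2_bounded_comp[OF Rb T]] l2_delta t)+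
    then show ?thesis using False by (metis l2_out)
   qed
  qed
 qed
 then show ?thesis using T by (auto simp: VN_def commutant_def)
qed

end

lemma sum_fun_apply: "(\<Sum>j\<in>A. f j) s = (\<Sum>j\<in>A. f j s)" for f :: "_ => _ => 'b::comm_monoid_add"
 by (induction A rule: infinite_finite_induct) auto

lemma l2_sum:
 "finite A ==> (\<And>j. j \<in> A ==> f j \<in> l2 G) ==> (\<Sum>j\<in>A. f j) \<in> l2 G"
 by (induction A rule: finite_induct) (auto simp: l2_0 intro: l2_add)

lemma l2_norm_sq: "(l2_norm G \<xi>)\<^sup>2 = (\<Sum>\<^sub>\<infinity>t\<in>carrier G. (cmod (\<xi> t))\<^sup>2)"
 unfolding l2_norm_def by (simp add: infsum_nonneg)

lemma nrm_prod_sq': "(nrm x (J \<times> S))\<^sup>2 = (\<Sum>j\<in>J. (nrm (\<lambda>p. x (j, p)) S)\<^sup>2)"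
 by (simp add: L2_set_def sum_nonneg sum.cartesian_product case_prod_beta)

context group begin

lemma left_regular_norm:
 "s \<in> carrier G ==> \<xi> \<in> l2 G ==> l2_norm G (left_regular G s \<xi>) = l2_norm G \<xi>"
 unfolding left_regular_perm by (intro perm_op_l2_bounded(2) bij_left) auto

lemma coef_left_regular: "s \<in> carrier G ==> coef (left_regular G s) = delta s"
 unfolding coef_def by (simp add: left_regular_delta)

lemma kbd_delta: "s \<in> carrier G ==> kbd (carrier G) (ker (delta s)) 1"
 using VN_kbd[OF left_regular_VN, of s 1] by (simp add: coef_left_regular left_regular_norm)

lemma conv_op_coef:
 assumes T: "T \<in> vecs (VN G)" shows "conv_op (coef T) = T"
proof -
 obtain C where "kbd (carrier G) (ker (coef T)) C" using VN_kbd_ex[OF T] .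
 from conv_op_VN[OF this] show ?thesis
  by (rule VN_eqI[OF _ T]) (rule coef_conv_op)
qed

lemma VN_norm_le:
 assumes T: "T \<in> vecs (VN G)" and K: "kbd (carrier G) (ker (coef T)) c" and \<xi>: "\<xi> \<in> l2 G"
 shows "l2_norm G (T \<xi>) \<le> c * l2_norm G \<xi>"
 using conv_op_bounded(2)[OF K \<xi>] by (simp add: conv_op_coef[OF T])

definition mker :: "(nat => nat => 'a => complex) => nat \<times> 'a => nat \<times> 'a => complex" where
 "mker \<alpha> = (\<lambda>(a, s) (b, t). ker (\<alpha> a b) s t)"

text \<open>The norm bound for the operator matrix with symbols \<open>\<alpha> a b\<close>. Norms
  of operators, of normal functionals and of multipliers are all expressed through it.\<close>

definition mbd :: "nat => (nat => nat => 'a => complex) => real => bool" where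
 "mbd r \<alpha> c \<longleftrightarrow> kbd ({..<r} \<times> carrier G) (mker \<alpha>) c"

lemma mbd_cong:
 assumes "\<And>a b g. a < r ==> b < r ==> g \<in> carrier G ==> \<alpha> a b g = \<beta> a b g"
 shows "mbd r \<alpha> c \<longleftrightarrow> mbd r \<beta> c"
 unfolding mbd_def using assms by (intro kbd_cong) (auto simp: mker_def ker_def)

lemma mbd_entry: "mbd r \<alpha> c ==> a < r ==> b < r ==> g \<in> carrier G ==> cmod (\<alpha> a b g) \<le> c"
 unfolding mbd_def using kbd_entry[of "{..<r} \<times> carrier G" "mker \<alpha>" c "(a, g)" "(b, \<one>)"]
 by (auto simp: mker_def ker_def)

lemma kbd_1_iff_mbd: "kbd (carrier G) (ker \<alpha>) c \<longleftrightarrow> mbd 1 (\<lambda>a b. \<alpha>) c"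
proof -
 have b: "bij_betw (Pair 0) (carrier G) ({..<1::nat} \<times> carrier G)"
  by (rule bij_betwI[where g = snd]) auto
 show ?thesis
  using kbd_reindex_bij[OF b, of "mker (\<lambda>a b. \<alpha>)" c] by (simp add: mbd_def mker_def)
qed

lemma mbd_entry_kbd:
 assumes "mbd r \<alpha> c" "a < r"
 shows "b < r ==> kbd (carrier G) (ker (\<alpha> a b)) c"
 unfolding kbd_def
proof (intro conjI allI impI)
 assume b: "b < r"
 show "0 \<le> c" using assms(1) unfolding mbd_def by (rule kbd_nonneg)
 fix F x y assume F: "finite F" "F \<subseteq> carrier G"
 have "cmod (\<Sum>p\<in>{a} \<times> F. \<Sum>q\<in>{b} \<times> F. mker \<alpha> p q * x (snd q) * cnj (y (snd p)))
   \<le> c * nrm (\<lambda>p. x (snd p)) ({b} \<times> F) * nrm (\<lambda>p. y (snd p)) ({a} \<times> F)"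
  by (rule kbd_rect[OF assms(1)[unfolded mbd_def], where x = "\<lambda>p. x (snd p)" and y = "\<lambda>p. y (snd p)"])
   (use F assms b in auto)
 moreover have "{d} \<times> F = Pair d ` F" for d :: nat by auto
 moreover have "inj_on (Pair d) F" for d :: nat by (simp add: inj_on_def)
 ultimately show "cmod (kform F (ker (\<alpha> a b)) x y) \<le> c * nrm x F * nrm y F"
  by (simp add: sum.reindex kform_def mker_def L2_set_def)
qed

text \<open>Two limits in succession: over finite sets \<open>F\<close> of columns for a fixed
  finite set \<open>F'\<close> of rows, and then over the sets of rows.\<close>

lemma VN_matrix_bound:
 assumes T: "T \<in> mats (VN G) r" and K: "mbd r (\<lambda>a b. coef (T a b)) c"
  and \<xi>: "\<And>j. j < r ==> \<xi> j \<in> l2 G"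
 shows "sqrt (\<Sum>i<r. (l2_norm G (\<Sum>j<r. T i j (\<xi> j)))\<^sup>2) \<le> c * sqrt (\<Sum>j<r. (l2_norm G (\<xi> j))\<^sup>2)"
proof -
 note K' = K[unfolded mbd_def]
 let ?K = "mker (\<lambda>a b. coef (T a b))"
 let ?X = "sqrt (\<Sum>j<r. (l2_norm G (\<xi> j))\<^sup>2)"
 note c = kbd_nonneg[OF K']
 define \<eta> where "\<eta> i = (\<Sum>j<r. T i j (\<xi> j))" for i
 have TV: "T i j \<in> vecs (VN G)" if "i < r" "j < r" for i j using T that by (rule mats_in)
 have \<eta>: "\<eta> i \<in> l2 G" if "i < r" for i
  unfolding \<eta>_def using that \<xi> by (intro l2_sum l2_boundedD(1)[OF VN_bounded[OF TV]]) auto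
 have b: "nrm (\<lambda>(i, s). \<eta> i s) ({..<r} \<times> F') \<le> c * ?X" if F': "finite F'" "F' \<subseteq> carrier G" for F'
 proof (rule tendsto_upperbound)
  let ?f = "\<lambda>F (i, s). \<Sum>j<r. \<Sum>t\<in>F. ker (coef (T i j)) s t * \<xi> j t"
  show "((\<lambda>F. nrm (?f F) ({..<r} \<times> F')) \<longlongrightarrow> nrm (\<lambda>(i, s). \<eta> i s) ({..<r} \<times> F')) (finite_subsets_at_top (carrier G))"
  proof (rule tendsto_nrm)
   fix p assume "p \<in> {..<r} \<times> F'"
   then obtain i s where p: "p = (i, s)" "i < r" "s \<in> carrier G" using F' by auto
   have "((\<lambda>F. \<Sum>j<r. \<Sum>t\<in>F. ker (coef (T i j)) s t * \<xi> j t) \<longlongrightarrow> (\<Sum>j<r. T i j (\<xi> j) s)) (finite_subsets_at_top (carrier G))"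
    using VN_has_sum[OF TV \<xi> p(3)] p(2) by (intro tendsto_sum) (auto simp: has_sum_def)
   then show "((\<lambda>F. ?f F p) \<longlongrightarrow> (case p of (i, s) => \<eta> i s)) (finite_subsets_at_top (carrier G))"
    by (simp add: p \<eta>_def sum_fun_apply)
  qed
  show "\<forall>\<^sub>F F in finite_subsets_at_top (carrier G). nrm (?f F) ({..<r} \<times> F') \<le> c * ?X"
  proof (rule eventually_finite_subsets_at_top_weakI)
   fix F assume F: "finite F" "F \<subseteq> carrier G"
   have "?f F = (\<lambda>p. \<Sum>q\<in>{..<r} \<times> F. ?K p q * (case q of (j, t) => \<xi> j t))"
    by (simp add: fun_eq_iff mker_def sum.cartesian_product case_prod_beta)
   then have "nrm (?f F) ({..<r} \<times> F') \<le> c * nrm (\<lambda>(j, t). \<xi> j t) ({..<r} \<times> F)"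
    using kbd_apply[OF K', of "{..<r} \<times> F" "{..<r} \<times> F'" "\<lambda>(j, t). \<xi> j t"] F F' by auto
   also have "nrm (\<lambda>(j, t). \<xi> j t) ({..<r} \<times> F) \<le> ?X"
   proof (rule real_le_rsqrt)
    show "(nrm (\<lambda>(j, t). \<xi> j t) ({..<r} \<times> F))\<^sup>2 \<le> (\<Sum>j<r. (l2_norm G (\<xi> j))\<^sup>2)"
     unfolding nrm_prod_sq' using l2D[OF \<xi> F] by (auto intro!: sum_mono power_mono)
   qed
   finally show "nrm (?f F) ({..<r} \<times> F') \<le> c * ?X" using c by (auto intro: mult_left_mono)
  qed
 qed simp
 have "(\<Sum>i<r. (l2_norm G (\<eta> i))\<^sup>2) \<le> (c * ?X)\<^sup>2"
 proof (rule tendsto_upperbound)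
  show "((\<lambda>F. \<Sum>i<r. \<Sum>s\<in>F. (cmod (\<eta> i s))\<^sup>2) \<longlongrightarrow> (\<Sum>i<r. (l2_norm G (\<eta> i))\<^sup>2)) (finite_subsets_at_top (carrier G))"
   unfolding l2_norm_sq using \<eta> by (intro tendsto_sum infsum_tendsto) (auto simp: l2_def)
  show "\<forall>\<^sub>F F in finite_subsets_at_top (carrier G). (\<Sum>i<r. \<Sum>s\<in>F. (cmod (\<eta> i s))\<^sup>2) \<le> (c * ?X)\<^sup>2"
  proof (rule eventually_finite_subsets_at_top_weakI)
   fix F assume F: "finite F" "F \<subseteq> carrier G"
   have "(\<Sum>i<r. \<Sum>s\<in>F. (cmod (\<eta> i s))\<^sup>2) = (nrm (\<lambda>(i, s). \<eta> i s) ({..<r} \<times> F))\<^sup>2"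
    unfolding nrm_prod_sq' by (simp add: L2_set_def sum_nonneg)
   also have "\<dots> \<le> (c * ?X)\<^sup>2" by (intro power_mono b F) auto
   finally show "(\<Sum>i<r. \<Sum>s\<in>F. (cmod (\<eta> i s))\<^sup>2) \<le> (c * ?X)\<^sup>2" .
  qed
 qed simp
 moreover have "0 \<le> c * ?X" using c by (auto intro!: mult_nonneg_nonneg sum_nonneg)
 ultimately show ?thesis unfolding \<eta>_def[symmetric] by (intro real_le_lsqrt)
qed

lemma VN_mnorm_def:
 "mnorm (VN G) n T = Sup {sqrt (\<Sum>i<n. (l2_norm G (\<Sum>j<n. T i j (\<xi> j)))\<^sup>2) | \<xi>.
           (\<forall>j<n. \<xi> j \<in> l2 G) \<and> (\<Sum>j<n. (l2_norm G (\<xi> j))\<^sup>2) \<le> 1}"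
 by (simp add: VN_def)

lemma mbd_ex:
 assumes "\<And>a b. a < r ==> b < r ==> \<exists>c. kbd (carrier G) (ker (\<alpha> a b)) c"
 obtains c where "mbd r \<alpha> c"
proof -
 obtain C where C: "\<And>a b. a < r ==> b < r ==> kbd (carrier G) (ker (\<alpha> a b)) (C a b)"
  using assms by metis
 have "kbd ({..<r} \<times> carrier G) (\<lambda>(i, p) (j, q). ker (\<alpha> i j) p q) (\<Sum>i<r. \<Sum>j<r. C i j)"
  by (rule kbd_block) (use C in auto)
 then show thesis using that unfolding mbd_def mker_def by blast
qed

text \<open>\<open>VN_matrix_bound\<close> estimates the supremum from above by any kernel bound;
  conversely a finite section of the kernel is recovered by inserting normalised finitely supported
  vectors.\<close>

lemma VN_mnorm:
 assumes T: "T \<in> mats (VN G) r"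
 shows "0 \<le> mnorm (VN G) r T"
  and "0 \<le> c ==> mnorm (VN G) r T \<le> c \<longleftrightarrow> mbd r (\<lambda>a b. coef (T a b)) c"
proof -
 define Z where "Z = {sqrt (\<Sum>i<r. (l2_norm G (\<Sum>j<r. T i j (\<xi> j)))\<^sup>2) | \<xi>.
           (\<forall>j<r. \<xi> j \<in> l2 G) \<and> (\<Sum>j<r. (l2_norm G (\<xi> j))\<^sup>2) \<le> 1}"
 have m: "mnorm (VN G) r T = Sup Z" by (simp add: VN_mnorm_def Z_def)
 have TV: "T i j \<in> vecs (VN G)" if "i < r" "j < r" for i j using T that by (rule mats_in)
 have le: "z \<le> c" if K: "mbd r (\<lambda>a b. coef (T a b)) c" and z: "z \<in> Z" for z c
 proof -
  obtain \<xi> where \<xi>: "\<And>j. j < r ==> \<xi> j \<in> l2 G" "(\<Sum>j<r. (l2_norm G (\<xi> j))\<^sup>2) \<le> 1"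
   and ze: "z = sqrt (\<Sum>i<r. (l2_norm G (\<Sum>j<r. T i j (\<xi> j)))\<^sup>2)"
   using z by (auto simp: Z_def)
  have "z \<le> c * sqrt (\<Sum>j<r. (l2_norm G (\<xi> j))\<^sup>2)"
   unfolding ze by (rule VN_matrix_bound[OF T K \<xi>(1)])
  also have "\<dots> \<le> c" using \<xi>(2) kbd_nonneg[OF K[unfolded mbd_def]] by (intro mult_left_le) auto
  finally show ?thesis .
 qed
 \<comment> \<open>Some bound exists, so the supremum is taken over a bounded set.\<close>
 obtain c0 where c0: "mbd r (\<lambda>a b. coef (T a b)) c0"
  using mbd_ex[of r "\<lambda>a b. coef (T a b)"] VN_kbd_ex[OF TV] by metis
 have bdd: "bdd_above Z" using le[OF c0] by (intro bdd_aboveI)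
 have z0: "0 \<in> Z"
  unfolding Z_def
 proof (intro CollectI exI[of _ "\<lambda>_. 0"] conjI)
  have "(\<Sum>j<r. T i j 0) = 0" if "i < r" for i
   using that by (intro sum.neutral) (auto simp: l2_boundedD(5)[OF VN_bounded[OF TV]])
  then show "0 = sqrt (\<Sum>i<r. (l2_norm G (\<Sum>j<r. T i j 0))\<^sup>2)" by (simp add: l2_0)
 qed (auto simp: l2_0)
 show "0 \<le> mnorm (VN G) r T" unfolding m by (rule cSup_upper[OF z0 bdd])
 assume c: "0 \<le> c"
 show "mnorm (VN G) r T \<le> c \<longleftrightarrow> mbd r (\<lambda>a b. coef (T a b)) c"
 proof
  assume "mbd r (\<lambda>a b. coef (T a b)) c"
  from le[OF this] show "mnorm (VN G) r T \<le> c" unfolding m using z0 by (intro cSup_least) auto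
 next
  assume mc: "mnorm (VN G) r T \<le> c"
  show "mbd r (\<lambda>a b. coef (T a b)) c"
   unfolding mbd_def
  proof (rule kbd_localI[OF c])
   fix F assume F: "finite F" "F \<subseteq> {..<r} \<times> carrier G"
   define F2 where "F2 = snd ` F"
   have F2: "finite F2" "F2 \<subseteq> carrier G" "F \<subseteq> {..<r} \<times> F2" using F by (force simp: F2_def)+
   have "kbd ({..<r} \<times> F2) (mker (\<lambda>a b. coef (T a b))) c"
   proof (rule kbd_finiteI[OF _ c])
    let ?S = "{..<r} \<times> F2" and ?K = "mker (\<lambda>a b. coef (T a b))"
    fix x y :: "nat \<times> 'a => complex"
    have "nrm (\<lambda>p. \<Sum>q\<in>?S. ?K p q * x q) ?S \<le> c * nrm x ?S"
    proof (cases "nrm x ?S = 0")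
     case True
     then have "x q = 0" if "q \<in> ?S" for q
      using member_le_L2_set[of ?S q "\<lambda>q. cmod (x q)"] that F2 by simp
     then show ?thesis using True by (simp add: L2_set_def)
    next
     case False
     define t where "t = nrm x ?S"
     have t: "0 < t" using False L2_set_nonneg[of "\<lambda>q. cmod (x q)" ?S] unfolding t_def by linarith
     define \<xi> where "\<xi> j = trunc F2 (\<lambda>s. x (j, s) / complex_of_real t)" for j
     have sc: "nrm (\<lambda>i. u i / complex_of_real t) A = nrm u A / t" for u :: "'z => complex" and A
      using t by (simp add: norm_divide divide_inverse norm_mult norm_inverse L2_set_left_distrib)
     have \<xi>: "\<xi> j \<in> l2 G" "l2_norm G (\<xi> j) = nrm (\<lambda>s. x (j, s)) F2 / t" for j
      unfolding \<xi>_def using l2_trunc[OF F2(1,2), of "\<lambda>s. x (j, s) / complex_of_real t"] by (auto simp: sc)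
     have "(\<Sum>j<r. (l2_norm G (\<xi> j))\<^sup>2) = (nrm x ?S)\<^sup>2 / t\<^sup>2"
      by (simp add: \<xi> nrm_prod_sq' power_divide sum_divide_distrib)
     then have 1: "(\<Sum>j<r. (l2_norm G (\<xi> j))\<^sup>2) = 1" using t by (simp add: t_def)
     have "sqrt (\<Sum>i<r. (l2_norm G (\<Sum>j<r. T i j (\<xi> j)))\<^sup>2) \<in> Z"
      unfolding Z_def using \<xi>(1) 1 by auto
     then have 2: "sqrt (\<Sum>i<r. (l2_norm G (\<Sum>j<r. T i j (\<xi> j)))\<^sup>2) \<le> c"
      using mc cSup_upper[OF _ bdd] unfolding m by fastforce
     have e: "(\<Sum>j<r. T i j (\<xi> j)) s = (\<Sum>q\<in>?S. ?K (i, s) q * x q) / complex_of_real t" if "i < r" "s \<in> F2" for i s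
     proof -
      have "(\<Sum>j<r. T i j (\<xi> j)) s = (\<Sum>j<r. \<Sum>q\<in>F2. ker (coef (T i j)) s q * (x (j, q) / complex_of_real t))"
       unfolding sum_fun_apply \<xi>_def using that F2 by (intro sum.cong refl VN_trunc TV) auto
      also have "\<dots> = (\<Sum>j<r. \<Sum>q\<in>F2. ?K (i, s) (j, q) * x (j, q)) / complex_of_real t"
       by (simp add: mker_def sum_divide_distrib)
      finally show ?thesis by (simp add: sum.cartesian_product case_prod_beta)
     qed
     have "(nrm (\<lambda>p. \<Sum>q\<in>?S. ?K p q * x q) ?S / t)\<^sup>2 =
       (\<Sum>i<r. (nrm (\<lambda>s. (\<Sum>q\<in>?S. ?K (i, s) q * x q) / complex_of_real t) F2)\<^sup>2)"
      by (simp only: power_divide nrm_prod_sq' sc sum_divide_distrib[of _ _ "t\<^sup>2"])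
     also have "\<dots> = (\<Sum>i<r. (nrm (\<Sum>j<r. T i j (\<xi> j)) F2)\<^sup>2)"
      by (intro sum.cong refl arg_cong[where f = "\<lambda>x. x\<^sup>2"] L2_set_cong) (auto simp: e)
     also have "\<dots> \<le> (\<Sum>i<r. (l2_norm G (\<Sum>j<r. T i j (\<xi> j)))\<^sup>2)"
      using \<xi>(1) F2 by (intro sum_mono power_mono l2D l2_sum l2_boundedD(1)[OF VN_bounded[OF TV]]) auto
     finally have "nrm (\<lambda>p. \<Sum>q\<in>?S. ?K p q * x q) ?S / t \<le> c"
      using 2 by (meson order_trans real_le_rsqrt)
     then show ?thesis using t by (simp add: field_simps t_def)
    qed
    then have "nrm (\<lambda>p. \<Sum>q\<in>?S. ?K p q * x q) ?S * nrm y ?S \<le> c * nrm x ?S * nrm y ?S"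
     by (intro mult_right_mono) auto
    moreover have "cmod (kform ?S ?K x y) \<le> nrm (\<lambda>p. \<Sum>q\<in>?S. ?K p q * x q) ?S * nrm y ?S"
     using inner_le_nrm[of "\<lambda>p. \<Sum>q\<in>?S. ?K p q * x q" y ?S] by (simp add: kform_def sum_distrib_right)
    ultimately show "cmod (kform ?S ?K x y) \<le> c * nrm x ?S * nrm y ?S" by simp
   qed (use F2 in auto)
   then show "kbd F (mker (\<lambda>a b. coef (T a b))) c" using F2 by (blast intro: kbd_subset)
  qed
 qed
qed

lemma mbd_conv_op:
 assumes K: "mbd r \<alpha> c"
 shows "pad r (\<lambda>a b. conv_op (\<alpha> a b)) \<in> mats (VN G) r"
  "a < r ==> b < r ==> s \<in> carrier G ==> coef (pad r (\<lambda>a b. conv_op (\<alpha> a b)) a b) s = \<alpha> a b s"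
  "mnorm (VN G) r (pad r (\<lambda>a b. conv_op (\<alpha> a b))) \<le> c"
proof -
 show 1: "pad r (\<lambda>a b. conv_op (\<alpha> a b)) \<in> mats (VN G) r"
  using conv_op_VN[OF mbd_entry_kbd[OF K]] by (intro mats_pad) auto
 show 2: "coef (pad r (\<lambda>a b. conv_op (\<alpha> a b)) a b) s = \<alpha> a b s" if "a < r" "b < r" "s \<in> carrier G" for a b s
  using that by (simp add: pad_def coef_conv_op)
 have "mbd r (\<lambda>a b. coef (pad r (\<lambda>a b. conv_op (\<alpha> a b)) a b)) c"
  using mbd_cong[of r "\<lambda>a b. coef (pad r (\<lambda>a b. conv_op (\<alpha> a b)) a b)" \<alpha> c] 2 K by auto
 moreover have "0 \<le> c" using K unfolding mbd_def by (rule kbd_nonneg)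
 ultimately show "mnorm (VN G) r (pad r (\<lambda>a b. conv_op (\<alpha> a b))) \<le> c"
  using VN_mnorm(2)[OF 1] by simp
qed

section \<open>Normal functionals\<close>

definition normal_data :: "(nat => 'a => complex) => (nat => 'a => complex) => bool" where
 "normal_data \<xi> \<eta> \<longleftrightarrow> (\<forall>n. \<xi> n \<in> l2 G \<and> \<eta> n \<in> l2 G) \<and>
   summable (\<lambda>n. (l2_norm G (\<xi> n))\<^sup>2) \<and> summable (\<lambda>n. (l2_norm G (\<eta> n))\<^sup>2)"

lemma normal_data_summable:
 assumes "normal_data \<xi> \<eta>"
 shows "summable (\<lambda>n. l2_norm G (\<xi> n) * l2_norm G (\<eta> n))"
proof (rule summable_comparison_test')
 show "summable (\<lambda>n. (l2_norm G (\<xi> n))\<^sup>2 + (l2_norm G (\<eta> n))\<^sup>2)"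
  using assms by (auto simp: normal_data_def intro: summable_add)
 fix n
 have "x * y \<le> x\<^sup>2 + y\<^sup>2" if "0 \<le> x" "0 \<le> y" for x y :: real
  using sum_squares_bound[of x y] that mult_nonneg_nonneg[OF that] by linarith
 then show "norm (l2_norm G (\<xi> n) * l2_norm G (\<eta> n)) \<le> (l2_norm G (\<xi> n))\<^sup>2 + (l2_norm G (\<eta> n))\<^sup>2"
  by simp
qed

lemma l2_inner_trunc_diff:
 assumes T: "T \<in> vecs (VN G)" and K: "kbd (carrier G) (ker (coef T)) c"
  and l: "\<xi> \<in> l2 G" "\<eta> \<in> l2 G" and F: "finite F" "F \<subseteq> carrier G"
 shows "cmod (l2_inner G (T \<xi>) \<eta> - l2_inner G (T (trunc F \<xi>)) (trunc F \<eta>)) \<le>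
  c * (l2_norm G (\<xi> - trunc F \<xi>) * l2_norm G \<eta> + l2_norm G \<xi> * l2_norm G (\<eta> - trunc F \<eta>))"
proof -
 note Tb = VN_bounded[OF T]
 have t: "trunc F \<xi> \<in> l2 G" "trunc F \<eta> \<in> l2 G" using F by (auto intro: l2_trunc)
 have d: "\<xi> - trunc F \<xi> \<in> l2 G" "\<eta> - trunc F \<eta> \<in> l2 G" by (intro l2_diff l t)+
 note TI = l2_boundedD(1)[OF Tb]
 have "T \<xi> = T (\<xi> - trunc F \<xi>) + T (trunc F \<xi>)"
  using l2_bounded_diff[OF Tb l(1) t(1)] by simp
 then have "l2_inner G (T \<xi>) \<eta> = l2_inner G (T (\<xi> - trunc F \<xi>)) \<eta> + l2_inner G (T (trunc F \<xi>)) \<eta>"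
  using l2_inner_add(1)[OF TI[OF d(1)] TI[OF t(1)] l(2)] by simp
 also have "l2_inner G (T (trunc F \<xi>)) \<eta> =
   l2_inner G (T (trunc F \<xi>)) (\<eta> - trunc F \<eta>) + l2_inner G (T (trunc F \<xi>)) (trunc F \<eta>)"
  using l2_inner_add(2)[OF d(2) t(2) TI[OF t(1)]] by simp
 finally have eq: "l2_inner G (T \<xi>) \<eta> = l2_inner G (T (\<xi> - trunc F \<xi>)) \<eta> +
   (l2_inner G (T (trunc F \<xi>)) (\<eta> - trunc F \<eta>) + l2_inner G (T (trunc F \<xi>)) (trunc F \<eta>))" .
 have 1: "cmod (l2_inner G (T \<xi>) \<eta> - l2_inner G (T (trunc F \<xi>)) (trunc F \<eta>)) \<le>
   cmod (l2_inner G (T (\<xi> - trunc F \<xi>)) \<eta>) + cmod (l2_inner G (T (trunc F \<xi>)) (\<eta> - trunc F \<eta>))"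
 proof -
  have "cmod (x - w) \<le> cmod u + cmod v" if "x = u + (v + w)" for x u v w :: complex
   using that norm_triangle_ineq[of u v] by simp
  from this[OF eq] show ?thesis .
 qed
 have 2: "cmod (l2_inner G (T (\<xi> - trunc F \<xi>)) \<eta>) \<le> (c * l2_norm G (\<xi> - trunc F \<xi>)) * l2_norm G \<eta>"
  by (rule order_trans[OF l2_inner_bound(2)[OF TI[OF d(1)] l(2)]])
   (intro mult_right_mono VN_norm_le[OF T K d(1)], simp)
 have 3: "cmod (l2_inner G (T (trunc F \<xi>)) (\<eta> - trunc F \<eta>)) \<le> (c * l2_norm G \<xi>) * l2_norm G (\<eta> - trunc F \<eta>)"
 proof (rule order_trans[OF l2_inner_bound(2)[OF TI[OF t(1)] d(2)]], rule mult_right_mono)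
  have "l2_norm G (T (trunc F \<xi>)) \<le> c * nrm \<xi> F"
   using VN_norm_le[OF T K t(1)] l2_trunc(2)[OF F, of \<xi>] by simp
  also have "\<dots> \<le> c * l2_norm G \<xi>" by (intro mult_left_mono l2D l F kbd_nonneg[OF K])
  finally show "l2_norm G (T (trunc F \<xi>)) \<le> c * l2_norm G \<xi>" .
 qed simp
 show ?thesis using order_trans[OF 1 add_mono[OF 2 3]] unfolding distrib_left mult.assoc .
qed

lemma l2_inner_trunc_sum:
 assumes F: "finite F" "F \<subseteq> carrier G" and T: "T \<in> vecs (VN G)"
 shows "l2_inner G (T (trunc F \<xi>)) (trunc F \<eta>) =
  (\<Sum>s\<in>(\<lambda>(p, q). p \<otimes> inv q) ` (F \<times> F). coef T s *
   (\<Sum>x\<in>{x \<in> F \<times> F. (case x of (p, q) => p \<otimes> inv q) = s}. \<xi> (snd x) * cnj (\<eta> (fst x))))"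
proof -
 have "l2_inner G (T (trunc F \<xi>)) (trunc F \<eta>) = (\<Sum>p\<in>F. (\<Sum>q\<in>F. ker (coef T) p q * \<xi> q) * cnj (\<eta> p))"
  unfolding l2_inner_trunc[OF F] using F by (intro sum.cong refl) (auto simp: VN_trunc[OF T F])
 also have "\<dots> = (\<Sum>x\<in>F \<times> F. coef T (case x of (p, q) => p \<otimes> inv q) * (\<xi> (snd x) * cnj (\<eta> (fst x))))"
  by (simp add: sum_distrib_right sum.cartesian_product ker_def case_prod_beta mult.assoc)
 also have "\<dots> = (\<Sum>s\<in>(\<lambda>(p, q). p \<otimes> inv q) ` (F \<times> F). \<Sum>x\<in>{x \<in> F \<times> F. (case x of (p, q) => p \<otimes> inv q) = s}.
   coef T (case x of (p, q) => p \<otimes> inv q) * (\<xi> (snd x) * cnj (\<eta> (fst x))))"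
  by (rule sum.image_gen) (use F in auto)
 finally show ?thesis by (simp add: sum_distrib_left)
qed

lemma normal_bound:
 assumes d: "normal_data \<xi> \<eta>" and T: "T \<in> vecs (VN G)" and K: "kbd (carrier G) (ker (coef T)) c"
 shows "cmod (l2_inner G (T (\<xi> n)) (\<eta> n)) \<le> c * (l2_norm G (\<xi> n) * l2_norm G (\<eta> n))"
  and "summable (\<lambda>n. l2_inner G (T (\<xi> n)) (\<eta> n))"
proof -
 have l: "\<xi> n \<in> l2 G" "\<eta> n \<in> l2 G" for n using d by (auto simp: normal_data_def)
 show 1: "cmod (l2_inner G (T (\<xi> n)) (\<eta> n)) \<le> c * (l2_norm G (\<xi> n) * l2_norm G (\<eta> n))" for n
  unfolding mult.assoc[symmetric]
  by (rule order_trans[OF l2_inner_bound(2)[OF l2_boundedD(1)[OF VN_bounded[OF T] l(1)] l(2)]])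
   (intro mult_right_mono VN_norm_le[OF T K l(1)], simp)
 show "summable (\<lambda>n. l2_inner G (T (\<xi> n)) (\<eta> n))"
  by (rule summable_comparison_test'[OF summable_mult[OF normal_data_summable[OF d]], of _ _ c]) (rule 1)
qed

text \<open>Density of the finitely supported functionals in the predual: the error depends on
  \<open>T\<close> only through its bound \<open>c\<close>, so the approximation is uniform on balls
  of \<open>VN G\<close>.\<close>

lemma normal_approx:
 assumes d: "normal_data \<xi> \<eta>" and e: "0 < e"
 obtains S w where "finite S" "S \<subseteq> carrier G"
  "\<And>T c. T \<in> vecs (VN G) ==> kbd (carrier G) (ker (coef T)) c ==>
    cmod ((\<Sum>n. l2_inner G (T (\<xi> n)) (\<eta> n)) - (\<Sum>s\<in>S. coef T s * w s)) \<le> e * c"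
proof -
 have l: "\<xi> n \<in> l2 G" "\<eta> n \<in> l2 G" for n using d by (auto simp: normal_data_def)
 let ?b = "\<lambda>n. l2_norm G (\<xi> n) * l2_norm G (\<eta> n)"
 note sb = normal_data_summable[OF d]
 obtain N where N: "norm (\<Sum>i. ?b (i + N)) < e / 2"
  using suminf_exist_split[OF _ sb, of "e / 2"] e by auto
 \<comment> \<open>The tail beyond \<open>N\<close> costs at most \<open>e / 2\<close>. Each of the
   \<open>N\<close> remaining terms may cost \<open>e / (2 * (real N + 1))\<close>, and truncation
   errors below \<open>h n\<close> ensure this, because the estimate weights them by the norms of
   the two vectors.\<close>
 define h where "h n = e / (2 * (real N + 1)) / (l2_norm G (\<xi> n) + l2_norm G (\<eta> n) + 1)" for n
 have pos: "0 < l2_norm G (\<xi> n) + l2_norm G (\<eta> n) + 1" for n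
  by (intro add_nonneg_pos add_nonneg_nonneg) auto
 have h: "0 < h n" for n unfolding h_def using e pos[of n] by auto
 have "\<exists>F. finite F \<and> F \<subseteq> carrier G \<and> (\<forall>F'. finite F' \<longrightarrow> F \<subseteq> F' \<longrightarrow> F' \<subseteq> carrier G \<longrightarrow>
   l2_norm G (z - trunc F' z) < h n)" if "z \<in> l2 G" for z n
  using l2_trunc_approx[OF that h[of n]] by metis
 note ex = this
 define P where "P z n F \<longleftrightarrow> finite F \<and> F \<subseteq> carrier G \<and> (\<forall>F'. finite F' \<longrightarrow> F \<subseteq> F' \<longrightarrow> F' \<subseteq> carrier G \<longrightarrow>
   l2_norm G (z - trunc F' z) < h n)" for z n F
 have "\<forall>n. \<exists>F. P (\<xi> n) n F" "\<forall>n. \<exists>F. P (\<eta> n) n F"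
  unfolding P_def by (intro allI ex l)+
 then obtain F1 F2 where P12: "\<forall>n. P (\<xi> n) n (F1 n)" "\<forall>n. P (\<eta> n) n (F2 n)"
  using choice[of "\<lambda>n. P (\<xi> n) n"] choice[of "\<lambda>n. P (\<eta> n) n"] by auto
 have F1: "finite (F1 n)" "F1 n \<subseteq> carrier G" and F2: "finite (F2 n)" "F2 n \<subseteq> carrier G" for n
  using P12 by (auto simp: P_def)
 have F1b: "l2_norm G (\<xi> n - trunc F' (\<xi> n)) < h n" if "finite F'" "F1 n \<subseteq> F'" "F' \<subseteq> carrier G" for n F'
  using spec[OF P12(1), of n] that unfolding P_def by (elim conjE allE impE) assumption+
 have F2b: "l2_norm G (\<eta> n - trunc F' (\<eta> n)) < h n" if "finite F'" "F2 n \<subseteq> F'" "F' \<subseteq> carrier G" for n F'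
  using spec[OF P12(2), of n] that unfolding P_def by (elim conjE allE impE) assumption+
 define F where "F = (\<Union>n<N. F1 n \<union> F2 n)"
 have F: "finite F" "F \<subseteq> carrier G"
  unfolding F_def using F1(2) F2(2) by (simp_all add: F1(1) F2(1) UN_subset_iff)
 have small: "l2_norm G (\<xi> n - trunc F (\<xi> n)) * l2_norm G (\<eta> n) + l2_norm G (\<xi> n) * l2_norm G (\<eta> n - trunc F (\<eta> n))
   \<le> e / (2 * (real N + 1))" if n: "n < N" for n
 proof -
  have "l2_norm G (\<xi> n - trunc F (\<xi> n)) \<le> h n" "l2_norm G (\<eta> n - trunc F (\<eta> n)) \<le> h n"
  proof -
   have "F1 n \<subseteq> F" "F2 n \<subseteq> F" using n by (auto simp: F_def)
   then show "l2_norm G (\<xi> n - trunc F (\<xi> n)) \<le> h n" "l2_norm G (\<eta> n - trunc F (\<eta> n)) \<le> h n"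
    using F1b[OF F(1) _ F(2)] F2b[OF F(1) _ F(2)] less_imp_le by blast+
  qed
  then have "l2_norm G (\<xi> n - trunc F (\<xi> n)) * l2_norm G (\<eta> n) + l2_norm G (\<xi> n) * l2_norm G (\<eta> n - trunc F (\<eta> n))
    \<le> h n * l2_norm G (\<eta> n) + l2_norm G (\<xi> n) * h n"
   by (intro add_mono mult_right_mono mult_left_mono) auto
  also have "\<dots> \<le> h n * (l2_norm G (\<xi> n) + l2_norm G (\<eta> n) + 1)"
   using h[of n] by (simp add: algebra_simps)
  also have "\<dots> = e / (2 * (real N + 1))"
   unfolding h_def using pos[of n] by simp
  finally show ?thesis .
 qed
 define S where "S = (\<lambda>(p, q). p \<otimes> inv q) ` (F \<times> F)"
 define v where "v n s = (\<Sum>x\<in>{x \<in> F \<times> F. (case x of (p, q) => p \<otimes> inv q) = s}. \<xi> n (snd x) * cnj (\<eta> n (fst x)))" for n s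
 show thesis
 proof (rule that[of S "\<lambda>s. \<Sum>n<N. v n s"])
  show "finite S" "S \<subseteq> carrier G" using F by (auto simp: S_def)
  fix T c assume T: "T \<in> vecs (VN G)" and K: "kbd (carrier G) (ker (coef T)) c"
  note c = kbd_nonneg[OF K]
  let ?f = "\<lambda>n. l2_inner G (T (\<xi> n)) (\<eta> n)"
  note fb = normal_bound[OF d T K]
  have e1: "(\<Sum>n. ?f n) = (\<Sum>i. ?f (i + N)) + (\<Sum>n<N. ?f n)"
   by (rule suminf_split_initial_segment[OF fb(2)])
  have e2: "(\<Sum>s\<in>S. coef T s * (\<Sum>n<N. v n s)) = (\<Sum>n<N. l2_inner G (T (trunc F (\<xi> n))) (trunc F (\<eta> n)))"
   unfolding l2_inner_trunc_sum[OF F T] v_def[symmetric] S_def[symmetric] sum_distrib_left by (rule sum.swap)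
  have e3: "(\<Sum>n<N. ?f n) - (\<Sum>n<N. l2_inner G (T (trunc F (\<xi> n))) (trunc F (\<eta> n))) =
    (\<Sum>n<N. ?f n - l2_inner G (T (trunc F (\<xi> n))) (trunc F (\<eta> n)))" (is "_ = ?D")
   by (rule sum_subtractf[symmetric])
  have e4: "(\<Sum>n. ?f n) - (\<Sum>s\<in>S. coef T s * (\<Sum>n<N. v n s)) = (\<Sum>i. ?f (i + N)) + ?D"
   unfolding e1 e2 e3[symmetric] by (rule add_diff_eq[symmetric])
  have 1: "cmod ((\<Sum>n. ?f n) - (\<Sum>s\<in>S. coef T s * (\<Sum>n<N. v n s))) \<le> cmod (\<Sum>i. ?f (i + N)) + cmod ?D"
   unfolding e4 by (rule norm_triangle_ineq)
  have "cmod ?D \<le> (\<Sum>n<N. c * (e / (2 * (real N + 1))))"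
  proof (rule order_trans[OF norm_sum], rule sum_mono)
   fix n assume "n \<in> {..<N}"
   then have n: "n < N" by simp
   show "cmod (?f n - l2_inner G (T (trunc F (\<xi> n))) (trunc F (\<eta> n))) \<le> c * (e / (2 * (real N + 1)))"
    by (rule order_trans[OF l2_inner_trunc_diff[OF T K l F] mult_left_mono[OF small[OF n] c]])
  qed
  also have "\<dots> = c * (real N * (e / (2 * (real N + 1))))" by simp
  also have "\<dots> \<le> c * (e / 2)"
  proof (rule mult_left_mono[OF _ c])
   show "real N * (e / (2 * (real N + 1))) \<le> e / 2" using e by (simp add: field_simps)
  qed
  finally have 2: "cmod ?D \<le> c * (e / 2)" .
  have "cmod (\<Sum>i. ?f (i + N)) \<le> (\<Sum>i. c * ?b (i + N))"
   by (rule norm_suminf_le[OF fb(1) summable_mult[OF summable_ignore_initial_segment[OF sb]]])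
  also have "\<dots> = c * (\<Sum>i. ?b (i + N))" by (intro suminf_mult summable_ignore_initial_segment sb)
  also have "\<dots> \<le> c * (e / 2)" by (rule mult_left_mono[OF _ c]) (use N in auto)
  finally have "cmod (\<Sum>i. ?f (i + N)) \<le> c * (e / 2)" .
  with 1 2 have "cmod ((\<Sum>n. ?f n) - (\<Sum>s\<in>S. coef T s * (\<Sum>n<N. v n s))) \<le> c * (e / 2) + c * (e / 2)" by linarith
  also have "c * (e / 2) + c * (e / 2) = e * c" by simp
  finally show "cmod ((\<Sum>n. ?f n) - (\<Sum>s\<in>S. coef T s * (\<Sum>n<N. v n s))) \<le> e * c" .
 qed
qed

text \<open>The operator is not expanded into translations. Both sides are compared with the
  approximant of \<open>normal_approx\<close>, which uses finitely many coefficients, and the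
  tolerance is arbitrary.\<close>

lemma normal_finite:
 assumes d: "normal_data \<xi> \<eta>" and E: "finite E" "E \<subseteq> carrier G" "\<And>s. s \<notin> E ==> \<beta> s = 0"
  and K: "kbd (carrier G) (ker \<beta>) c"
 shows "(\<Sum>n. l2_inner G (conv_op \<beta> (\<xi> n)) (\<eta> n)) =
  (\<Sum>s\<in>E. \<beta> s * (\<Sum>n. l2_inner G (left_regular G s (\<xi> n)) (\<eta> n)))" (is "?l = ?r")
proof -
 \<comment> \<open>The errors are weighted by \<open>c\<close> for the operator itself and by
   \<open>cmod (\<beta> s)\<close> for each translation, whose own bound is 1.\<close>
 define C where "C = c + (\<Sum>s\<in>E. cmod (\<beta> s))"
 have C: "0 \<le> C" unfolding C_def using kbd_nonneg[OF K] by (simp add: sum_nonneg)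
 have "cmod (?l - ?r) \<le> e" if e: "0 < e" for e
 proof -
  define e' where "e' = e / (C + 1)"
  have e': "0 < e'" using e C by (simp add: e'_def)
  from normal_approx[OF d e'] obtain S w where S: "finite S" "S \<subseteq> carrier G"
   and w: "\<And>T c. T \<in> vecs (VN G) ==> kbd (carrier G) (ker (coef T)) c ==>
     cmod ((\<Sum>n. l2_inner G (T (\<xi> n)) (\<eta> n)) - (\<Sum>s\<in>S. coef T s * w s)) \<le> e' * c"
   by blast
  have "kbd (carrier G) (ker (coef (conv_op \<beta>))) c"
   using K kbd_cong[of "carrier G" "ker (coef (conv_op \<beta>))" "ker \<beta>" c] by (simp add: ker_def coef_conv_op)
  then have 1: "cmod (?l - (\<Sum>s\<in>S. coef (conv_op \<beta>) s * w s)) \<le> e' * c"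
   by (rule w[OF conv_op_VN[OF K]])
  have 2: "(\<Sum>s\<in>S. coef (conv_op \<beta>) s * w s) = (\<Sum>s\<in>E. \<beta> s * (if s \<in> S then w s else 0))"
  proof -
   have "(\<Sum>s\<in>S. coef (conv_op \<beta>) s * w s) = (\<Sum>s\<in>S. \<beta> s * w s)"
    using S by (intro sum.cong refl) (auto simp: coef_conv_op)
   also have "\<dots> = (\<Sum>s\<in>S \<inter> E. \<beta> s * w s)"
    using S E(3) by (intro sum.mono_neutral_right) auto
   also have "\<dots> = (\<Sum>s\<in>E. \<beta> s * (if s \<in> S then w s else 0))"
    using E by (intro sum.mono_neutral_cong_left) auto
   finally show ?thesis .
  qed
  \<comment> \<open>The symbol of the translation by \<open>s\<close> is a point mass, so the
    approximation compares the single weight \<open>w s\<close> with the value of the functional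
    there.\<close>
  have 3: "cmod ((if s \<in> S then w s else 0) - (\<Sum>n. l2_inner G (left_regular G s (\<xi> n)) (\<eta> n))) \<le> e'" if s: "s \<in> carrier G" for s
  proof -
   have "(\<Sum>g\<in>S. coef (left_regular G s) g * w g) = (if s \<in> S then w s else 0)"
    using S by (simp add: coef_left_regular[OF s] delta_def if_distrib[of "\<lambda>z. z * _"] cong: if_cong)
   then show ?thesis
    using w[OF left_regular_VN[OF s], of 1] kbd_delta[OF s] by (simp add: coef_left_regular[OF s] norm_minus_commute)
  qed
  have "cmod ((\<Sum>s\<in>E. \<beta> s * (if s \<in> S then w s else 0)) - ?r) \<le> (\<Sum>s\<in>E. cmod (\<beta> s) * e')"
   unfolding sum_subtractf[symmetric] right_diff_distrib[symmetric]
  proof (rule order_trans[OF norm_sum], rule sum_mono)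
   fix s assume "s \<in> E"
   then have "s \<in> carrier G" using E(2) by blast
   from 3[OF this] show "cmod (\<beta> s * ((if s \<in> S then w s else 0) - (\<Sum>n. l2_inner G (left_regular G s (\<xi> n)) (\<eta> n))))
    \<le> cmod (\<beta> s) * e'"
    unfolding norm_mult by (rule mult_left_mono) simp
  qed
  with 1 2 have "cmod (?l - ?r) \<le> e' * c + (\<Sum>s\<in>E. cmod (\<beta> s) * e')"
   using norm_triangle_ineq[of "?l - (\<Sum>s\<in>S. coef (conv_op \<beta>) s * w s)" "(\<Sum>s\<in>S. coef (conv_op \<beta>) s * w s) - ?r"]
   by simp
  also have "\<dots> = e' * C" unfolding C_def distrib_left sum_distrib_right[symmetric] by (simp only: mult.commute)
  also have "\<dots> \<le> e' * (C + 1)" using e' by simp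
  also have "\<dots> = e" using C by (simp add: e'_def)
  finally show ?thesis .
 qed
 then have "cmod (?l - ?r) \<le> 0" by (rule field_le_epsilon) simp
 then show ?thesis by simp
qed

text \<open>Slicing an operator matrix by scalar vectors: a section of the slice at
  \<open>X\<close>, \<open>Y\<close> is the section of the matrix at product vectors. Matrix bounds
  for scalar functionals reduce to plain bounds in this way.\<close>

lemma mbd_contract:
 assumes K: "mbd r \<alpha> c"
 shows "kbd (carrier G) (ker (\<lambda>s. \<Sum>a<r. \<Sum>b<r. \<alpha> a b s * x b * cnj (y a))) (c * nrm x {..<r} * nrm y {..<r})"
 unfolding kbd_def
proof (intro conjI allI impI)
 note K' = K[unfolded mbd_def]
 show "0 \<le> c * nrm x {..<r} * nrm y {..<r}" using kbd_nonneg[OF K'] by simp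
 fix F X Y assume F: "finite F" "F \<subseteq> carrier G"
 have n: "nrm (\<lambda>(a, p). z a * Z p) ({..<r} \<times> F) = nrm z {..<r} * nrm Z F" for z :: "nat => complex" and Z :: "'a => complex"
 proof -
  have "(nrm (\<lambda>(a, p). z a * Z p) ({..<r} \<times> F))\<^sup>2 = (nrm z {..<r} * nrm Z F)\<^sup>2"
   unfolding nrm_prod_sq' power_mult_distrib
   by (simp add: norm_mult L2_set_def sum_nonneg power_mult_distrib sum_product)
  then show ?thesis by simp
 qed
 have "kform F (ker (\<lambda>s. \<Sum>a<r. \<Sum>b<r. \<alpha> a b s * x b * cnj (y a))) X Y =
   (\<Sum>p\<in>F. \<Sum>q\<in>F. \<Sum>a<r. \<Sum>b<r. ker (\<alpha> a b) p q * (x b * X q) * cnj (y a * Y p))"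
  unfolding kform_def ker_def by (simp add: sum_distrib_right sum_distrib_left mult_ac)
 also have "\<dots> = (\<Sum>p\<in>F. \<Sum>a<r. \<Sum>b<r. \<Sum>q\<in>F. ker (\<alpha> a b) p q * (x b * X q) * cnj (y a * Y p))"
  by (rule sum.cong[OF refl], subst sum.swap, rule sum.cong[OF refl], rule sum.swap)
 also have "\<dots> = kform ({..<r} \<times> F) (mker \<alpha>) (\<lambda>(b, q). x b * X q) (\<lambda>(a, p). y a * Y p)"
  unfolding kform_prod by (subst sum.swap) (simp add: mker_def)
 also have "cmod \<dots> \<le> c * nrm (\<lambda>(b, q). x b * X q) ({..<r} \<times> F) * nrm (\<lambda>(a, p). y a * Y p) ({..<r} \<times> F)"
  using F by (intro kbdD[OF K']) auto
 finally show "cmod (kform F (ker (\<lambda>s. \<Sum>a<r. \<Sum>b<r. \<alpha> a b s * x b * cnj (y a))) X Y)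
   \<le> c * nrm x {..<r} * nrm y {..<r} * nrm X F * nrm Y F"
  unfolding n by (simp add: mult_ac)
qed

end

section \<open>Sublinear functionals\<close>

definition sublinear_on :: "('g => complex) set => (('g => complex) => real) => bool" where
 "sublinear_on W q \<longleftrightarrow> (\<forall>x\<in>W. \<forall>y\<in>W. q (x + y) \<le> q x + q y) \<and>
   (\<forall>x\<in>W. \<forall>t\<ge>0. q (\<lambda>s. complex_of_real t * x s) \<le> t * q x)"

locale complex_function_space =
 fixes W :: "('g => complex) set"
 assumes W_add: "x \<in> W ==> y \<in> W ==> x + y \<in> W"
  and W_scale: "x \<in> W ==> (\<lambda>s. c * x s) \<in> W"
  and W_nonempty: "W \<noteq> {}"
begin

lemma W_0: "0 \<in> W"
 using W_nonempty W_scale[of _ 0] by (auto simp: zero_fun_def)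

lemma sublinear_0:
 assumes "sublinear_on W q" shows "q 0 = 0"
proof -
 have "q (\<lambda>s. complex_of_real 0 * (0 :: 'g => complex) s) \<le> 0 * q 0"
  using assms W_0 unfolding sublinear_on_def by blast
 moreover have "q (0 + 0) \<le> q 0 + q 0"
  using assms W_0 unfolding sublinear_on_def by blast
 ultimately show ?thesis by (simp flip: zero_fun_def)
qed

lemma sublinear_scale:
 assumes q: "sublinear_on W q" and x: "x \<in> W" and t: "0 \<le> t"
 shows "q (\<lambda>s. complex_of_real t * x s) = t * q x"
proof (cases "t = 0")
 case True
 then show ?thesis using sublinear_0[OF q] by (simp add: zero_fun_def)
next
 case False
 let ?y = "\<lambda>s. complex_of_real t * x s"
 have "?y \<in> W" using x by (rule W_scale)
 then have "q (\<lambda>s. complex_of_real (inverse t) * ?y s) \<le> inverse t * q ?y"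
  using q t unfolding sublinear_on_def by (meson inverse_nonnegative_iff_nonnegative)
 moreover have "(\<lambda>s. complex_of_real (inverse t) * ?y s) = x"
  using False by (simp add: fun_eq_iff)
 ultimately have "t * q x \<le> q ?y" using False t by (simp add: field_simps)
 moreover have "q ?y \<le> t * q x" using q x t unfolding sublinear_on_def by blast
 ultimately show ?thesis by simp
qed

text \<open>A minimal \<open>q\<close> satisfies \<open>tilt q y = q\<close> on \<open>W\<close>,
  and the term \<open>t = 1\<close> of the infimum then gives
  \<open>q x + q y \<le> q (x + y)\<close>. The value 0 outside \<open>W\<close> allows functionals
  on \<open>W\<close> to be compared as total functions.\<close>

definition tilt :: "(('g => complex) => real) => ('g => complex) => ('g => complex) => real" where
 "tilt q y x = (if x \<in> W then (INF t\<in>{0..}. q (x + (\<lambda>s. complex_of_real t * y s)) - t * q y) else 0)"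

lemma tilt_bdd:
 assumes q: "sublinear_on W q" and x: "x \<in> W" and y: "y \<in> W"
 shows "bdd_below ((\<lambda>t. q (x + (\<lambda>s. complex_of_real t * y s)) - t * q y) ` {0..})"
proof (rule bdd_belowI2)
 fix t :: real assume "t \<in> {0..}"
 then have t: "0 \<le> t" by simp
 let ?ty = "\<lambda>s. complex_of_real t * y s"
 have m: "(\<lambda>s. - 1 * x s) \<in> W" "x + ?ty \<in> W" by (intro W_scale W_add x y)+
 have "q ((x + ?ty) + (\<lambda>s. - 1 * x s)) \<le> q (x + ?ty) + q (\<lambda>s. - 1 * x s)"
  using q m unfolding sublinear_on_def by blast
 moreover have "q ((x + ?ty) + (\<lambda>s. - 1 * x s)) = t * q y"
 proof -
  have "(x + ?ty) + (\<lambda>s. - 1 * x s) = ?ty" by (auto simp: fun_eq_iff)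
  then show ?thesis using sublinear_scale[OF q y t] by metis
 qed
 ultimately show "- q (\<lambda>s. - 1 * x s) \<le> q (x + ?ty) - t * q y"
  by linarith
qed

lemma tilt_le:
 assumes "sublinear_on W q" "x \<in> W" "y \<in> W" "0 \<le> t"
 shows "tilt q y x \<le> q (x + (\<lambda>s. complex_of_real t * y s)) - t * q y"
 unfolding tilt_def using assms by (simp add: cINF_lower[OF tilt_bdd[OF assms(1-3)]])

lemma tilt_le_self:
 assumes "sublinear_on W q" "x \<in> W" "y \<in> W"
 shows "tilt q y x \<le> q x"
proof -
 have "x + (\<lambda>s. complex_of_real 0 * y s) = x" by (auto simp: fun_eq_iff)
 then show ?thesis using tilt_le[OF assms, of 0] by simp
qed

lemma tilt_greatest:
 assumes "x \<in> W" "\<And>t. 0 \<le> t ==> m \<le> q (x + (\<lambda>s. complex_of_real t * y s)) - t * q y"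
 shows "m \<le> tilt q y x"
 unfolding tilt_def using assms by (auto intro: cINF_greatest)

lemma tilt_sublinear:
 assumes q: "sublinear_on W q" and y: "y \<in> W"
 shows "sublinear_on W (tilt q y)"
 unfolding sublinear_on_def
proof (intro conjI ballI allI impI)
 fix x x' assume x: "x \<in> W" "x' \<in> W"
 have "tilt q y (x + x') - tilt q y x' \<le> tilt q y x"
 proof (rule tilt_greatest[OF x(1)])
  fix t :: real assume t: "0 \<le> t"
  have "tilt q y (x + x') - (q (x + (\<lambda>s. complex_of_real t * y s)) - t * q y) \<le> tilt q y x'"
  proof (rule tilt_greatest[OF x(2)])
   fix t' :: real assume t': "0 \<le> t'"
   have "tilt q y (x + x') \<le> q ((x + x') + (\<lambda>s. complex_of_real (t + t') * y s)) - (t + t') * q y"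
    using t t' x y by (intro tilt_le q W_add) auto
   also have "(x + x') + (\<lambda>s. complex_of_real (t + t') * y s) =
     (x + (\<lambda>s. complex_of_real t * y s)) + (x' + (\<lambda>s. complex_of_real t' * y s))"
    by (auto simp: fun_eq_iff algebra_simps)
   also have "q \<dots> \<le> q (x + (\<lambda>s. complex_of_real t * y s)) + q (x' + (\<lambda>s. complex_of_real t' * y s))"
    using q x y unfolding sublinear_on_def by (blast intro: W_add W_scale)
   finally show "tilt q y (x + x') - (q (x + (\<lambda>s. complex_of_real t * y s)) - t * q y)
     \<le> q (x' + (\<lambda>s. complex_of_real t' * y s)) - t' * q y"
    unfolding ring_distribs(2) by linarith
  qed
  then show "tilt q y (x + x') - tilt q y x' \<le> q (x + (\<lambda>s. complex_of_real t * y s)) - t * q y"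
   by simp
 qed
 then show "tilt q y (x + x') \<le> tilt q y x + tilt q y x'" by simp
next
 fix x and c :: real assume x: "x \<in> W" and c: "0 \<le> c"
 let ?cx = "\<lambda>s. complex_of_real c * x s"
 have cx: "?cx \<in> W" using x by (rule W_scale)
 show "tilt q y ?cx \<le> c * tilt q y x"
 proof (cases "c = 0")
  case True
  then have "?cx = 0" by (auto simp: fun_eq_iff)
  then show ?thesis using tilt_le_self[OF q W_0 y] True sublinear_0[OF q] by simp
 next
  case False
  with c have c: "0 < c" by simp
  have "tilt q y ?cx / c \<le> tilt q y x"
  proof (rule tilt_greatest[OF x])
   fix t :: real assume t: "0 \<le> t"
   have "tilt q y ?cx \<le> q (?cx + (\<lambda>s. complex_of_real (c * t) * y s)) - (c * t) * q y"
    using c t by (intro tilt_le q cx y) auto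
   also have "?cx + (\<lambda>s. complex_of_real (c * t) * y s) =
     (\<lambda>s. complex_of_real c * (x + (\<lambda>s. complex_of_real t * y s)) s)"
    by (auto simp: fun_eq_iff algebra_simps)
   also have "q \<dots> = c * q (x + (\<lambda>s. complex_of_real t * y s))"
    using c by (intro sublinear_scale q W_add W_scale x y) auto
   finally show "tilt q y ?cx / c \<le> q (x + (\<lambda>s. complex_of_real t * y s)) - t * q y"
    using c by (simp add: field_simps)
  qed
  then show ?thesis using c by (simp add: field_simps)
 qed
qed

text \<open>Of two members of a chain one lies below both on \<open>W\<close>; this common lower
  member carries the subadditivity over to the infimum.\<close>

lemma sublinear_chain_Inf:
 assumes C: "C \<noteq> {}" "\<And>q. q \<in> C ==> sublinear_on W q"
  and chain: "\<And>q r. q \<in> C ==> r \<in> C ==> (\<forall>x\<in>W. q x \<le> r x) \<or> (\<forall>x\<in>W. r x \<le> q x)"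
  and bdd: "\<And>x. x \<in> W ==> bdd_below ((\<lambda>q. q x) ` C)"
 shows "sublinear_on W (\<lambda>x. INF q\<in>C. q x)"
 unfolding sublinear_on_def
proof (intro conjI ballI allI impI)
 fix x y assume xy: "x \<in> W" "y \<in> W"
 have "(INF q\<in>C. q (x + y)) - (INF q\<in>C. q y) \<le> (INF q\<in>C. q x)"
 proof (rule cINF_greatest[OF C(1)])
  fix q assume q: "q \<in> C"
  have "(INF q\<in>C. q (x + y)) - q x \<le> (INF q\<in>C. q y)"
  proof (rule cINF_greatest[OF C(1)])
   fix r assume r: "r \<in> C"
   have "\<exists>z\<in>C. z x \<le> q x \<and> z y \<le> r y" using chain[OF q r] q r xy by blast
   then obtain z where z: "z \<in> C" "z x \<le> q x" "z y \<le> r y" by blast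
   have "(INF q\<in>C. q (x + y)) \<le> z (x + y)" by (rule cINF_lower[OF bdd[OF W_add[OF xy]] z(1)])
   also have "\<dots> \<le> z x + z y" using C(2)[OF z(1)] xy by (auto simp: sublinear_on_def)
   finally show "(INF q\<in>C. q (x + y)) - q x \<le> r y" using z by simp
  qed
  then show "(INF q\<in>C. q (x + y)) - (INF q\<in>C. q y) \<le> q x" by simp
 qed
 then show "(INF q\<in>C. q (x + y)) \<le> (INF q\<in>C. q x) + (INF q\<in>C. q y)" by simp
next
 fix x and t :: real assume x: "x \<in> W" and t: "0 \<le> t"
 let ?tx = "\<lambda>s. complex_of_real t * x s"
 have le: "(INF q\<in>C. q ?tx) \<le> t * q x" if q: "q \<in> C" for q
  using cINF_lower[OF bdd[OF W_scale[OF x, of "complex_of_real t"]] q] sublinear_scale[OF C(2)[OF q] x t] by simp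
 show "(INF q\<in>C. q ?tx) \<le> t * (INF q\<in>C. q x)"
 proof (cases "t = 0")
  case True
  then show ?thesis using le C(1) by auto
 next
  case False
  have "(INF q\<in>C. q ?tx) / t \<le> (INF q\<in>C. q x)"
   using le False t by (intro cINF_greatest[OF C(1)]) (simp add: field_simps)
  then show ?thesis using False t by (simp add: field_simps)
 qed
qed

text \<open>A minimal sublinear functional is additive, because \<open>tilt q y\<close> lies below \<open>q\<close>.\<close>

lemma Hahn_Banach:
 assumes p: "sublinear_on W p" and w: "w \<in> W"
 obtains f where "\<And>x. x \<in> W ==> f x \<le> p x" "\<And>x y. x \<in> W ==> y \<in> W ==> f (x + y) = f x + f y"
  "\<And>x t. x \<in> W ==> 0 \<le> t ==> f (\<lambda>s. complex_of_real t * x s) = t * f x" "f w = p w"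
proof -
 \<comment> \<open>The competitors lie below \<open>tilt p w\<close> and not merely below
   \<open>p\<close>: at the negative of \<open>w\<close> this gives the value at most
   \<open>- p w\<close>, and hence \<open>f w = p w\<close>. Fixing the value 0 outside
   \<open>W\<close> makes the order antisymmetric.\<close>
 define Q where "Q = {q. sublinear_on W q \<and> (\<forall>x\<in>W. q x \<le> tilt p w x) \<and> (\<forall>x. x \<notin> W \<longrightarrow> q x = 0)}"
 \<comment> \<open>The order is reversed, so that the maximal element supplied by Zorn's lemma is a
   minimal functional.\<close>
 define P where "P q r \<longleftrightarrow> (\<forall>x\<in>W. r x \<le> q x)" for q r :: "('g => complex) => real"
 have t: "tilt p w \<in> Q" unfolding Q_def using tilt_sublinear[OF p w] by (auto simp: tilt_def)
 \<comment> \<open>All members of \<open>Q\<close> lie above one fixed function, so infima of chains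
   are finite.\<close>
 have lb: "- tilt p w (\<lambda>s. - 1 * x s) \<le> q x" if "q \<in> Q" "x \<in> W" for q x
 proof -
  have m: "(\<lambda>s. - 1 * x s) \<in> W" using that by (intro W_scale)
  have "q (x + (\<lambda>s. - 1 * x s)) \<le> q x + q (\<lambda>s. - 1 * x s)"
   using that m unfolding Q_def sublinear_on_def by blast
  moreover have "x + (\<lambda>s. - 1 * x s) = 0" by (auto simp: fun_eq_iff)
  moreover have "q 0 = 0" using that by (auto simp: Q_def intro: sublinear_0)
  moreover have "q (\<lambda>s. - 1 * x s) \<le> tilt p w (\<lambda>s. - 1 * x s)" using that m unfolding Q_def by blast
  ultimately show ?thesis by simp
 qed
 have "\<exists>m\<in>Q. \<forall>a\<in>Q. P m a \<longrightarrow> a = m"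
 proof (rule predicate_Zorn)
  show "partial_order_on Q (relation_of P Q)"
   unfolding partial_order_on_def preorder_on_def
  proof (intro conjI)
   show "refl_on Q (relation_of P Q)" by (auto simp: refl_on_def relation_of_def P_def)
   show "trans (relation_of P Q)" by (force simp: trans_def relation_of_def P_def)
   show "antisym (relation_of P Q)"
   proof (rule antisymI, rule ext)
    fix q r x assume "(q, r) \<in> relation_of P Q" "(r, q) \<in> relation_of P Q"
    then show "q x = r x" by (cases "x \<in> W") (auto simp: relation_of_def P_def Q_def intro: antisym)
   qed
  qed (auto simp: relation_of_def)
 next
  fix C assume "C \<in> Chains (relation_of P Q)"
  then have CQ: "C \<subseteq> Q" and ch: "\<And>q r. q \<in> C ==> r \<in> C ==> P q r \<or> P r q"
   by (auto simp: Chains_def relation_of_def)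
  show "\<exists>u\<in>Q. \<forall>a\<in>C. P a u"
  proof (cases "C = {}")
   case True
   then show ?thesis using t by auto
  next
   case False
   define u where "u x = (if x \<in> W then INF q\<in>C. q x else 0)" for x
   have bdd: "bdd_below ((\<lambda>q. q x) ` C)" if "x \<in> W" for x
    by (rule bdd_belowI2) (rule lb[OF _ that], use CQ in auto)
   have "sublinear_on W (\<lambda>x. INF q\<in>C. q x)"
    using False CQ ch bdd by (intro sublinear_chain_Inf) (auto simp: Q_def P_def)
   then have "sublinear_on W u" unfolding sublinear_on_def u_def by (simp add: W_add W_scale)
   moreover have le: "u x \<le> q x" if "q \<in> C" "x \<in> W" for q x
    unfolding u_def using that bdd by (auto intro: cINF_lower)
   moreover have "u x \<le> tilt p w x" if "x \<in> W" for x
    using False CQ le[OF _ that] that unfolding Q_def by force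
   ultimately have "u \<in> Q" by (auto simp: Q_def u_def)
   with le show ?thesis by (auto simp: P_def)
  qed
 qed
 then obtain f where f: "f \<in> Q" and min: "\<And>a. a \<in> Q ==> P f a ==> a = f" by blast
 have sf: "sublinear_on W f" using f by (simp add: Q_def)
 have tf: "tilt f y = f" if y: "y \<in> W" for y
 proof (rule min)
  show "tilt f y \<in> Q"
   unfolding Q_def using tilt_sublinear[OF sf y] tilt_le_self[OF sf _ y] f
   by (auto simp: tilt_def Q_def intro: order_trans)
  show "P f (tilt f y)" using tilt_le_self[OF sf _ y] by (auto simp: P_def)
 qed
 have add: "f (x + y) = f x + f y" if xy: "x \<in> W" "y \<in> W" for x y
 proof (rule antisym)
  show "f (x + y) \<le> f x + f y" using sf xy by (simp add: sublinear_on_def)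
  have "f x \<le> f (x + (\<lambda>s. complex_of_real 1 * y s)) - 1 * f y"
   using tilt_le[OF sf xy, of 1] tf[OF xy(2)] by simp
  then show "f x + f y \<le> f (x + y)" by (simp add: plus_fun_def)
 qed
 have fp: "f x \<le> p x" if "x \<in> W" for x
  using f that tilt_le_self[OF p that w] unfolding Q_def by force
 have m: "(\<lambda>s. - 1 * w s) \<in> W" using w by (rule W_scale)
 have "f (\<lambda>s. - 1 * w s) \<le> tilt p w (\<lambda>s. - 1 * w s)" using f m unfolding Q_def by blast
 also have "\<dots> \<le> p ((\<lambda>s. - 1 * w s) + (\<lambda>s. complex_of_real 1 * w s)) - 1 * p w"
  by (rule tilt_le[OF p m w]) simp
 also have "(\<lambda>s. - 1 * w s) + (\<lambda>s. complex_of_real 1 * w s) = 0" by (auto simp: fun_eq_iff)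
 finally have "f (\<lambda>s. - 1 * w s) \<le> - p w" unfolding sublinear_0[OF p] by linarith
 moreover have "f (w + (\<lambda>s. - 1 * w s)) = f w + f (\<lambda>s. - 1 * w s)" by (rule add[OF w m])
 moreover have "w + (\<lambda>s. - 1 * w s) = 0" by (auto simp: fun_eq_iff)
 ultimately have "f w = p w" using fp[OF w] sublinear_0[OF sf] by simp
 with fp add sublinear_scale[OF sf] that show thesis by blast
qed

end

section \<open>The Fourier algebra as a completion of the finitely supported functions\<close>

definition finsupp :: "('g, 'm) monoid_scheme => ('g => complex) => bool" where
 "finsupp G w \<longleftrightarrow> finite {s. w s \<noteq> 0} \<and> {s. w s \<noteq> 0} \<subseteq> carrier G"

text \<open>Weak amenability of a discrete group: finitely supported functions tending to 1 that are
  uniformly bounded as Herz-Schur multipliers. \<open>e_bound\<close> covers all matrix sizes with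
  one constant, so it bounds the completely bounded norm.\<close>

locale approx_group = group G for G (structure) +
 fixes e :: "nat => 'a => complex" and B :: real
 assumes e_finsupp: "finsupp G (e k)"
  and e_tendsto: "s \<in> carrier G ==> (\<lambda>k. e k s) \<longlonglongrightarrow> 1"
  and e_bound: "mbd r \<alpha> c ==> mbd r (\<lambda>a b s. e k s * \<alpha> a b s) (B * c)"
begin

definition psum :: "nat => ('a => complex) => ('a => complex) => complex" where
 "psum k u \<alpha> = (\<Sum>s | e k s \<noteq> 0. e k s * \<alpha> s * u s)"

definition pair :: "('a => complex) => ('a => complex) => complex" where
 "pair u \<alpha> = lim (\<lambda>k. psum k u \<alpha>)"

text \<open>Intrinsic form of membership in \<open>A(G)\<close>: the finitely supported functionals
  given by the products of \<open>e k\<close> with \<open>u\<close> are Cauchy, uniformly on the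
  unit ball of \<open>VN G\<close>. Their limit, the normal functional on symbols, is
  \<open>pair u\<close>; it is meaningful for regular \<open>u\<close> and symbols with bounded
  kernel.\<close>

definition regular :: "('a => complex) => bool" where
 "regular u \<longleftrightarrow> (\<forall>s. s \<notin> carrier G \<longrightarrow> u s = 0) \<and>
   (\<forall>\<epsilon>>0. \<exists>N. \<forall>k\<ge>N. \<forall>l\<ge>N. \<forall>\<alpha>. kbd (carrier G) (ker \<alpha>) 1 \<longrightarrow> cmod (psum k u \<alpha> - psum l u \<alpha>) \<le> \<epsilon>)"

lemma e_carrier: "e k s \<noteq> 0 ==> s \<in> carrier G"
 using e_finsupp[of k] by (auto simp: finsupp_def)

lemma e_finite: "finite {s. e k s \<noteq> 0}"
 using e_finsupp[of k] by (simp add: finsupp_def)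

lemma kbd_e: "kbd (carrier G) (ker \<alpha>) c ==> kbd (carrier G) (ker (\<lambda>s. e k s * \<alpha> s)) (B * c)"
 unfolding kbd_1_iff_mbd by (rule e_bound)

lemma B_nonneg: "0 \<le> B"
 using kbd_nonneg[OF kbd_e[OF kbd_delta[of \<one>], of 0]] by simp

lemma psum_cong:
 assumes "\<And>s. s \<in> carrier G ==> \<alpha> s = \<beta> s" shows "psum k u \<alpha> = psum k u \<beta>"
 unfolding psum_def by (intro sum.cong refl) (auto simp: assms dest: e_carrier)

text \<open>A normal functional is the uniform limit of its truncations by \<open>e k\<close>: a
  finite approximant does not notice the truncation for large \<open>k\<close>, and the truncated
  operator is bounded by \<open>B * c\<close>.\<close>

lemma normal_uniform:
 assumes d: "normal_data \<xi> \<eta>"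
  and u: "\<And>s. s \<in> carrier G ==> u s = (\<Sum>n. l2_inner G (left_regular G s (\<xi> n)) (\<eta> n))"
  and \<epsilon>: "0 < \<epsilon>"
 obtains N where "\<And>k T c. N \<le> k ==> T \<in> vecs (VN G) ==> kbd (carrier G) (ker (coef T)) c ==>
  cmod ((\<Sum>n. l2_inner G (T (\<xi> n)) (\<eta> n)) - psum k u (coef T)) \<le> \<epsilon> * c"
proof -
 \<comment> \<open>Three errors are added: \<open>\<delta> * c\<close> at \<open>T\<close>,
   \<open>\<delta> * (B * c)\<close> at the truncated operator, and \<open>c * \<delta>\<close>
   between the two finite sums.\<close>
 define \<delta> where "\<delta> = \<epsilon> / (B + 2)"
 have \<delta>: "0 < \<delta>" unfolding \<delta>_def using \<epsilon> B_nonneg by simp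
 obtain S w where S: "finite S" "S \<subseteq> carrier G"
  and w: "\<And>T c. T \<in> vecs (VN G) ==> kbd (carrier G) (ker (coef T)) c ==>
     cmod ((\<Sum>n. l2_inner G (T (\<xi> n)) (\<eta> n)) - (\<Sum>s\<in>S. coef T s * w s)) \<le> \<delta> * c"
  using normal_approx[OF d \<delta>] by blast
 have "(\<lambda>k. \<Sum>s\<in>S. cmod (1 - e k s) * cmod (w s)) \<longlonglongrightarrow> (\<Sum>s\<in>S. cmod (1 - 1) * cmod (w s))"
  using S by (intro tendsto_sum tendsto_mult tendsto_norm tendsto_diff tendsto_const e_tendsto) auto
 then have "\<forall>\<^sub>F k in sequentially. (\<Sum>s\<in>S. cmod (1 - e k s) * cmod (w s)) < \<delta>"
  by (rule order_tendstoD) (simp add: \<delta>)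
 then obtain N where N: "\<And>k. N \<le> k ==> (\<Sum>s\<in>S. cmod (1 - e k s) * cmod (w s)) < \<delta>"
  unfolding eventually_sequentially by blast
 show thesis
 proof (rule that[of N])
  fix k T c assume k: "N \<le> k" and T: "T \<in> vecs (VN G)" and K: "kbd (carrier G) (ker (coef T)) c"
  let ?\<beta> = "\<lambda>s. e k s * coef T s"
  let ?\<phi> = "\<lambda>T. \<Sum>n. l2_inner G (T (\<xi> n)) (\<eta> n)"
  note K\<beta> = kbd_e[OF K, of k]
  note c = kbd_nonneg[OF K]
  have "?\<phi> (conv_op ?\<beta>) = (\<Sum>s\<in>{s. e k s \<noteq> 0}. ?\<beta> s * (\<Sum>n. l2_inner G (left_regular G s (\<xi> n)) (\<eta> n)))"
   by (rule normal_finite[OF d e_finite _ _ K\<beta>]) (auto dest: e_carrier)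
  also have "\<dots> = psum k u (coef T)"
   unfolding psum_def by (intro sum.cong refl) (auto simp: u dest: e_carrier)
  finally have 1: "?\<phi> (conv_op ?\<beta>) = psum k u (coef T)" .
  have "kbd (carrier G) (ker (coef (conv_op ?\<beta>))) (B * c)"
   using K\<beta> kbd_cong[of "carrier G" "ker (coef (conv_op ?\<beta>))" "ker ?\<beta>" "B * c"] by (simp add: ker_def coef_conv_op)
  from w[OF conv_op_VN[OF K\<beta>] this]
  have "cmod (psum k u (coef T) - (\<Sum>s\<in>S. coef (conv_op ?\<beta>) s * w s)) \<le> \<delta> * (B * c)"
   unfolding 1 .
  moreover have "(\<Sum>s\<in>S. coef (conv_op ?\<beta>) s * w s) = (\<Sum>s\<in>S. ?\<beta> s * w s)"
   using S by (intro sum.cong refl) (auto simp: coef_conv_op)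
  ultimately have 2: "cmod (psum k u (coef T) - (\<Sum>s\<in>S. ?\<beta> s * w s)) \<le> \<delta> * (B * c)" by simp
  have "cmod ((\<Sum>s\<in>S. coef T s * w s) - (\<Sum>s\<in>S. ?\<beta> s * w s)) \<le> (\<Sum>s\<in>S. c * (cmod (1 - e k s) * cmod (w s)))"
   unfolding sum_subtractf[symmetric]
  proof (rule order_trans[OF norm_sum], rule sum_mono)
   fix s assume "s \<in> S"
   then have s: "s \<in> carrier G" using S by blast
   have "cmod (coef T s) \<le> c" using kbd_entry[OF K s one_closed] s by (simp add: ker_def)
   moreover have "coef T s * w s - ?\<beta> s * w s = coef T s * ((1 - e k s) * w s)" by (simp add: algebra_simps)
   ultimately show "cmod (coef T s * w s - ?\<beta> s * w s) \<le> c * (cmod (1 - e k s) * cmod (w s))"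
    by (simp add: norm_mult mult_right_mono)
  qed
  also have "\<dots> = c * (\<Sum>s\<in>S. cmod (1 - e k s) * cmod (w s))" by (simp add: sum_distrib_left)
  also have "\<dots> \<le> c * \<delta>" using N[OF k] by (intro mult_left_mono[OF _ c]) simp
  finally have 3: "cmod ((\<Sum>s\<in>S. coef T s * w s) - (\<Sum>s\<in>S. ?\<beta> s * w s)) \<le> c * \<delta>" .
  have tri: "cmod (x - z) \<le> cmod (x - y) + cmod (y - v) + cmod (z - v)" for x y z v :: complex
  proof -
   have "x - z = (x - y) + (y - v) - (z - v)" by simp
   then show ?thesis
    by (metis norm_triangle_ineq norm_triangle_ineq4 order_trans add_right_mono)
  qed
  have "cmod (?\<phi> T - psum k u (coef T)) \<le> \<delta> * c + c * \<delta> + \<delta> * (B * c)"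
   using tri[of "?\<phi> T" "psum k u (coef T)" "\<Sum>s\<in>S. coef T s * w s" "\<Sum>s\<in>S. ?\<beta> s * w s"] w[OF T K] 2 3 by linarith
  also have "\<dots> = \<delta> * (B + 2) * c" by (simp add: algebra_simps)
  also have "\<delta> * (B + 2) = \<epsilon>" unfolding \<delta>_def using B_nonneg by simp
  finally show "cmod (?\<phi> T - psum k u (coef T)) \<le> \<epsilon> * c" .
 qed
qed

lemma regular_of_normal:
 assumes d: "normal_data \<xi> \<eta>"
  and u: "\<And>s. s \<in> carrier G ==> u s = (\<Sum>n. l2_inner G (left_regular G s (\<xi> n)) (\<eta> n))"
  and u0: "\<And>s. s \<notin> carrier G ==> u s = 0"
 shows "regular u"
 unfolding regular_def
proof (intro conjI allI impI u0)
 fix \<epsilon> :: real assume "0 < \<epsilon>"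
 then have \<epsilon>: "0 < \<epsilon> / 2" by simp
 obtain N where N: "\<And>k T c. N \<le> k ==> T \<in> vecs (VN G) ==> kbd (carrier G) (ker (coef T)) c ==>
  cmod ((\<Sum>n. l2_inner G (T (\<xi> n)) (\<eta> n)) - psum k u (coef T)) \<le> \<epsilon> / 2 * c"
  using normal_uniform[OF d u \<epsilon>] by blast
 show "\<exists>N. \<forall>k\<ge>N. \<forall>l\<ge>N. \<forall>\<alpha>. kbd (carrier G) (ker \<alpha>) 1 \<longrightarrow> cmod (psum k u \<alpha> - psum l u \<alpha>) \<le> \<epsilon>"
 proof (intro exI[of _ N] allI impI)
  fix k l \<alpha> assume kl: "N \<le> k" "N \<le> l" and K: "kbd (carrier G) (ker \<alpha>) 1"
  let ?T = "conv_op \<alpha>"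
  have K': "kbd (carrier G) (ker (coef ?T)) 1"
   using K kbd_cong[of "carrier G" "ker (coef ?T)" "ker \<alpha>" 1] by (simp add: ker_def coef_conv_op)
  have e: "psum k u (coef ?T) = psum k u \<alpha>" for k by (rule psum_cong) (rule coef_conv_op)
  show "cmod (psum k u \<alpha> - psum l u \<alpha>) \<le> \<epsilon>"
   using N[OF kl(1) conv_op_VN[OF K] K'] N[OF kl(2) conv_op_VN[OF K] K'] unfolding e
   using norm_triangle_ineq4[of "(\<Sum>n. l2_inner G (?T (\<xi> n)) (\<eta> n)) - psum l u \<alpha>"
     "(\<Sum>n. l2_inner G (?T (\<xi> n)) (\<eta> n)) - psum k u \<alpha>"]
   by simp
 qed
qed

lemma psum_scale: "psum k u (\<lambda>s. a * \<alpha> s) = a * psum k u \<alpha>"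
 unfolding psum_def by (simp add: sum_distrib_left mult_ac)

lemma psum_add_left: "psum k (\<lambda>s. u s + v s) \<alpha> = psum k u \<alpha> + psum k v \<alpha>"
 unfolding psum_def by (simp add: sum.distrib[symmetric] algebra_simps)

lemma psum_scale_left: "psum k (\<lambda>s. a * u s) \<alpha> = a * psum k u \<alpha>"
 unfolding psum_def by (simp add: sum_distrib_left mult_ac)

lemma psum_mult: "psum k (\<lambda>s. f s * u s) \<alpha> = psum k u (\<lambda>s. f s * \<alpha> s)"
 unfolding psum_def by (simp add: mult_ac)

lemma kbd_normalize:
 assumes "kbd S K c" "0 < c"
 shows "kbd S (\<lambda>p q. complex_of_real (inverse c) * K p q) 1"
 using kbd_scale[OF assms(1), of "complex_of_real (inverse c)"] assms(2) by (simp add: norm_inverse norm_divide)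

lemma ker_scale: "ker (\<lambda>s. a * \<alpha> s) = (\<lambda>s t. a * ker \<alpha> s t)"
 by (simp add: ker_def fun_eq_iff)

lemma kbd_ker_zero:
 assumes "kbd (carrier G) (ker \<alpha>) 0" "s \<in> carrier G" shows "\<alpha> s = 0"
 using kbd_entry[OF assms one_closed] assms(2) by (simp add: ker_def)

lemma regular_Cauchy:
 assumes u: "regular u" and \<epsilon>: "0 < \<epsilon>"
 obtains N where "\<And>k l \<alpha> c. N \<le> k ==> N \<le> l ==> kbd (carrier G) (ker \<alpha>) c ==>
  cmod (psum k u \<alpha> - psum l u \<alpha>) \<le> \<epsilon> * c"
proof -
 obtain N where N: "\<And>k l \<alpha>. N \<le> k ==> N \<le> l ==> kbd (carrier G) (ker \<alpha>) 1 ==>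
  cmod (psum k u \<alpha> - psum l u \<alpha>) \<le> \<epsilon>"
  using u \<epsilon> unfolding regular_def by blast
 show thesis
 proof (rule that[of N])
  fix k l \<alpha> c assume kl: "N \<le> k" "N \<le> l" and K: "kbd (carrier G) (ker \<alpha>) c"
  show "cmod (psum k u \<alpha> - psum l u \<alpha>) \<le> \<epsilon> * c"
  proof (cases "c = 0")
   case True
   have "psum k u \<alpha> = 0" for k
    unfolding psum_def using kbd_ker_zero[OF K[unfolded True]] by (intro sum.neutral) (auto dest: e_carrier)
   then show ?thesis using True by simp
  next
   case False
   then have c: "0 < c" using kbd_nonneg[OF K] by simp
   have "cmod (psum k u (\<lambda>s. complex_of_real (inverse c) * \<alpha> s) - psum l u (\<lambda>s. complex_of_real (inverse c) * \<alpha> s)) \<le> \<epsilon>"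
    by (rule N[OF kl]) (simp only: ker_scale kbd_normalize[OF K c])
   then have "inverse c * cmod (psum k u \<alpha> - psum l u \<alpha>) \<le> \<epsilon>"
    unfolding psum_scale right_diff_distrib[symmetric] norm_mult using c by (simp add: norm_inverse)
   then show ?thesis using c by (simp add: field_simps)
  qed
 qed
qed

lemma pair_tendsto:
 assumes u: "regular u" and K: "kbd (carrier G) (ker \<alpha>) c"
 shows "(\<lambda>k. psum k u \<alpha>) \<longlonglongrightarrow> pair u \<alpha>"
proof -
 have "Cauchy (\<lambda>k. psum k u \<alpha>)"
 proof (rule metric_CauchyI)
  fix \<epsilon> :: real assume \<epsilon>: "0 < \<epsilon>"
  then have "0 < \<epsilon> / (c + 1)" using kbd_nonneg[OF K] by simp
  from regular_Cauchy[OF u this] obtain N where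
   N: "\<And>k l \<alpha> c'. N \<le> k ==> N \<le> l ==> kbd (carrier G) (ker \<alpha>) c' ==>
     cmod (psum k u \<alpha> - psum l u \<alpha>) \<le> \<epsilon> / (c + 1) * c'" by blast
  have "\<epsilon> / (c + 1) * c < \<epsilon>" using \<epsilon> kbd_nonneg[OF K] by (simp add: field_simps)
  then have "dist (psum k u \<alpha>) (psum l u \<alpha>) < \<epsilon>" if "N \<le> k" "N \<le> l" for k l
   using N[OF that K] by (simp add: dist_norm)
  then show "\<exists>M. \<forall>m\<ge>M. \<forall>n\<ge>M. dist (psum m u \<alpha>) (psum n u \<alpha>) < \<epsilon>" by blast
 qed
 then have "convergent (\<lambda>k. psum k u \<alpha>)" by (simp add: Cauchy_convergent_iff)
 then show ?thesis unfolding pair_def convergent_LIMSEQ_iff .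
qed

lemma pair_uniform:
 assumes u: "regular u" and \<epsilon>: "0 < \<epsilon>"
 obtains N where "\<And>k \<alpha> c. N \<le> k ==> kbd (carrier G) (ker \<alpha>) c ==>
  cmod (pair u \<alpha> - psum k u \<alpha>) \<le> \<epsilon> * c"
proof -
 obtain N where N: "\<And>k l \<alpha> c. N \<le> k ==> N \<le> l ==> kbd (carrier G) (ker \<alpha>) c ==>
  cmod (psum k u \<alpha> - psum l u \<alpha>) \<le> \<epsilon> * c"
  using regular_Cauchy[OF u \<epsilon>] by blast
 show thesis
 proof (rule that[of N])
  fix k \<alpha> c assume k: "N \<le> k" and K: "kbd (carrier G) (ker \<alpha>) c"
  have "(\<lambda>l. cmod (psum l u \<alpha> - psum k u \<alpha>)) \<longlonglongrightarrow> cmod (pair u \<alpha> - psum k u \<alpha>)"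
   by (intro tendsto_norm tendsto_diff pair_tendsto[OF u K] tendsto_const)
  then show "cmod (pair u \<alpha> - psum k u \<alpha>) \<le> \<epsilon> * c"
  proof (rule tendsto_upperbound)
   show "\<forall>\<^sub>F l in sequentially. cmod (psum l u \<alpha> - psum k u \<alpha>) \<le> \<epsilon> * c"
    unfolding eventually_sequentially using N[OF _ k K] by blast
  qed simp
 qed
qed

lemma pair_normal:
 assumes d: "normal_data \<xi> \<eta>"
  and u: "\<And>s. s \<in> carrier G ==> u s = (\<Sum>n. l2_inner G (left_regular G s (\<xi> n)) (\<eta> n))"
  and T: "T \<in> vecs (VN G)"
 shows "(\<Sum>n. l2_inner G (T (\<xi> n)) (\<eta> n)) = pair u (coef T)"
proof -
 obtain c where K: "kbd (carrier G) (ker (coef T)) c" using VN_kbd_ex[OF T] .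
 have "(\<lambda>k. psum k u (coef T)) \<longlonglongrightarrow> (\<Sum>n. l2_inner G (T (\<xi> n)) (\<eta> n))"
 proof (rule metric_LIMSEQ_I)
  fix \<epsilon> :: real assume \<epsilon>: "0 < \<epsilon>"
  then have p: "0 < \<epsilon> / (c + 1)" using kbd_nonneg[OF K] by simp
  obtain N where N: "\<And>k T c'. N \<le> k ==> T \<in> vecs (VN G) ==> kbd (carrier G) (ker (coef T)) c' ==>
   cmod ((\<Sum>n. l2_inner G (T (\<xi> n)) (\<eta> n)) - psum k u (coef T)) \<le> \<epsilon> / (c + 1) * c'"
   using normal_uniform[OF d u p] by blast
  have "\<epsilon> / (c + 1) * c < \<epsilon>" using \<epsilon> kbd_nonneg[OF K] by (simp add: field_simps)
  then have "dist (psum k u (coef T)) (\<Sum>n. l2_inner G (T (\<xi> n)) (\<eta> n)) < \<epsilon>" if "N \<le> k" for k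
   using N[OF that T K] by (simp add: dist_norm norm_minus_commute)
  then show "\<exists>no. \<forall>n\<ge>no. dist (psum n u (coef T)) (\<Sum>n. l2_inner G (T (\<xi> n)) (\<eta> n)) < \<epsilon>" by blast
 qed
 then show ?thesis unfolding pair_def by (simp add: limI)
qed

lemma pair_eqI: "(\<lambda>k. psum k u \<alpha>) \<longlonglongrightarrow> z ==> pair u \<alpha> = z"
 unfolding pair_def by (rule limI)

lemma pair_cong: "(\<And>s. s \<in> carrier G ==> \<alpha> s = \<beta> s) ==> pair u \<alpha> = pair u \<beta>"
 unfolding pair_def by (simp add: psum_cong[of \<alpha> \<beta>])

lemma pair_add_left:
 assumes "regular u" "regular v" "kbd (carrier G) (ker \<alpha>) c"
 shows "pair (\<lambda>s. u s + v s) \<alpha> = pair u \<alpha> + pair v \<alpha>"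
 by (rule pair_eqI, unfold psum_add_left) (intro tendsto_add pair_tendsto[OF _ assms(3)] assms(1,2))

lemma pair_scale_left:
 assumes "regular u" "kbd (carrier G) (ker \<alpha>) c"
 shows "pair (\<lambda>s. a * u s) \<alpha> = a * pair u \<alpha>"
 by (rule pair_eqI, unfold psum_scale_left) (intro tendsto_mult tendsto_const pair_tendsto[OF assms])

lemma pair_scale:
 assumes "regular u" "kbd (carrier G) (ker \<alpha>) c"
 shows "pair u (\<lambda>s. a * \<alpha> s) = a * pair u \<alpha>"
 by (rule pair_eqI, unfold psum_scale) (intro tendsto_mult tendsto_const pair_tendsto[OF assms])

lemma pair_mult: "pair (\<lambda>s. f s * u s) \<alpha> = pair u (\<lambda>s. f s * \<alpha> s)"
 unfolding pair_def psum_mult ..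

lemma regular_out: "regular u ==> s \<notin> carrier G ==> u s = 0"
 by (simp add: regular_def)

lemma regular_add:
 assumes "regular u" "regular v" shows "regular (\<lambda>s. u s + v s)"
 unfolding regular_def
proof (intro conjI allI impI)
 fix \<epsilon> :: real assume "0 < \<epsilon>"
 then have \<epsilon>: "0 < \<epsilon> / 2" by simp
 obtain N where N: "\<And>k l \<alpha> c. N \<le> k ==> N \<le> l ==> kbd (carrier G) (ker \<alpha>) c ==>
  cmod (psum k u \<alpha> - psum l u \<alpha>) \<le> \<epsilon> / 2 * c" using regular_Cauchy[OF assms(1) \<epsilon>] by blast
 obtain M where M: "\<And>k l \<alpha> c. M \<le> k ==> M \<le> l ==> kbd (carrier G) (ker \<alpha>) c ==>
  cmod (psum k v \<alpha> - psum l v \<alpha>) \<le> \<epsilon> / 2 * c" using regular_Cauchy[OF assms(2) \<epsilon>] by blast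
 show "\<exists>N. \<forall>k\<ge>N. \<forall>l\<ge>N. \<forall>\<alpha>. kbd (carrier G) (ker \<alpha>) 1 \<longrightarrow>
   cmod (psum k (\<lambda>s. u s + v s) \<alpha> - psum l (\<lambda>s. u s + v s) \<alpha>) \<le> \<epsilon>"
 proof (intro exI[of _ "max N M"] allI impI)
  fix k l \<alpha> assume "max N M \<le> k" "max N M \<le> l" and K: "kbd (carrier G) (ker \<alpha>) 1"
  then have "cmod (psum k u \<alpha> - psum l u \<alpha>) \<le> \<epsilon> / 2" "cmod (psum k v \<alpha> - psum l v \<alpha>) \<le> \<epsilon> / 2"
   using N[OF _ _ K] M[OF _ _ K] by auto
  then show "cmod (psum k (\<lambda>s. u s + v s) \<alpha> - psum l (\<lambda>s. u s + v s) \<alpha>) \<le> \<epsilon>"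
   unfolding psum_add_left add_diff_add
   using norm_triangle_ineq[of "psum k u \<alpha> - psum l u \<alpha>" "psum k v \<alpha> - psum l v \<alpha>"] by linarith
 qed
qed (simp add: regular_out assms)

lemma regular_scale:
 assumes "regular u" shows "regular (\<lambda>s. a * u s)"
 unfolding regular_def
proof (intro conjI allI impI)
 fix \<epsilon> :: real assume "0 < \<epsilon>"
 then have \<epsilon>: "0 < \<epsilon> / (cmod a + 1)" by (simp add: add_nonneg_pos)
 obtain N where N: "\<And>k l \<alpha> c. N \<le> k ==> N \<le> l ==> kbd (carrier G) (ker \<alpha>) c ==>
  cmod (psum k u \<alpha> - psum l u \<alpha>) \<le> \<epsilon> / (cmod a + 1) * c" using regular_Cauchy[OF assms(1) \<epsilon>] by blast
 show "\<exists>N. \<forall>k\<ge>N. \<forall>l\<ge>N. \<forall>\<alpha>. kbd (carrier G) (ker \<alpha>) 1 \<longrightarrow>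
   cmod (psum k (\<lambda>s. a * u s) \<alpha> - psum l (\<lambda>s. a * u s) \<alpha>) \<le> \<epsilon>"
 proof (intro exI[of _ N] allI impI)
  fix k l \<alpha> assume kl: "N \<le> k" "N \<le> l" and K: "kbd (carrier G) (ker \<alpha>) 1"
  have "cmod (psum k (\<lambda>s. a * u s) \<alpha> - psum l (\<lambda>s. a * u s) \<alpha>) = cmod a * cmod (psum k u \<alpha> - psum l u \<alpha>)"
   unfolding psum_scale_left right_diff_distrib[symmetric] norm_mult ..
  also have "\<dots> \<le> (cmod a + 1) * (\<epsilon> / (cmod a + 1))" using N[OF kl K] by (intro mult_mono) auto
  also have "\<dots> = \<epsilon>"
   using norm_ge_zero[of a] by (simp add: add_nonneg_eq_0_iff del: norm_ge_zero)
  finally show "cmod (psum k (\<lambda>s. a * u s) \<alpha> - psum l (\<lambda>s. a * u s) \<alpha>) \<le> \<epsilon>" .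
 qed
qed (simp add: regular_out assms)

text \<open>From some \<open>N\<close> on the functional differs from \<open>psum N u\<close> by at
  most \<open>c\<close>, and in that finite sum each value of the symbol is at most
  \<open>c\<close>.\<close>

lemma regular_bounded:
 assumes "regular u"
 obtains C where "0 \<le> C" "\<And>\<alpha> c. kbd (carrier G) (ker \<alpha>) c ==> cmod (pair u \<alpha>) \<le> C * c"
proof -
 obtain N where N: "\<And>k \<alpha> c. N \<le> k ==> kbd (carrier G) (ker \<alpha>) c ==>
  cmod (pair u \<alpha> - psum k u \<alpha>) \<le> 1 * c" using pair_uniform[OF assms, of 1] by auto
 define C where "C = (\<Sum>s | e N s \<noteq> 0. cmod (e N s) * cmod (u s))"
 show thesis
 proof (rule that[of "1 + C"])
  show "0 \<le> 1 + C" unfolding C_def by (intro add_nonneg_nonneg sum_nonneg) auto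
  fix \<alpha> c assume K: "kbd (carrier G) (ker \<alpha>) c"
  have "cmod (psum N u \<alpha>) \<le> (\<Sum>s | e N s \<noteq> 0. cmod (e N s) * cmod (u s) * c)"
   unfolding psum_def
  proof (rule order_trans[OF norm_sum], rule sum_mono)
   fix s assume "s \<in> {s. e N s \<noteq> 0}"
   then have s: "s \<in> carrier G" by (auto dest: e_carrier)
   have "cmod (\<alpha> s) \<le> c" using kbd_entry[OF K s one_closed] s by (simp add: ker_def)
   then have "cmod (e N s) * cmod (u s) * cmod (\<alpha> s) \<le> cmod (e N s) * cmod (u s) * c"
    by (rule mult_left_mono) simp
   then show "cmod (e N s * \<alpha> s * u s) \<le> cmod (e N s) * cmod (u s) * c"
    by (simp add: norm_mult mult_ac)
  qed
  also have "\<dots> = C * c" by (simp add: C_def sum_distrib_right)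
  finally have "cmod (psum N u \<alpha>) \<le> C * c" .
  moreover have "cmod (pair u \<alpha> - psum N u \<alpha>) \<le> c" using N[OF order_refl K] by simp
  moreover have "cmod (pair u \<alpha>) \<le> cmod (pair u \<alpha> - psum N u \<alpha>) + cmod (psum N u \<alpha>)"
   using norm_triangle_ineq[of "pair u \<alpha> - psum N u \<alpha>" "psum N u \<alpha>"] by simp
  ultimately show "cmod (pair u \<alpha>) \<le> (1 + C) * c" unfolding distrib_right by linarith
 qed
qed

text \<open>A functional is completely bounded with its own constant: \<open>mbd_contract\<close>
  turns the scalar form of the matrix into a single value of the functional.\<close>

lemma pair_matrix_bound:
 assumes u: "regular u" and C: "\<And>\<alpha> c. kbd (carrier G) (ker \<alpha>) c ==> cmod (pair u \<alpha>) \<le> C * c" "0 \<le> C"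
  and K: "mbd r \<alpha> c"
 shows "kbd {..<r} (\<lambda>a b. pair u (\<alpha> a b)) (C * c)"
proof (rule kbd_finiteI)
 show "0 \<le> C * c" using C(2) kbd_nonneg[OF K[unfolded mbd_def]] by simp
 fix x y :: "nat => complex"
 let ?\<beta> = "\<lambda>s. \<Sum>a<r. \<Sum>b<r. \<alpha> a b s * x b * cnj (y a)"
 note K\<beta> = mbd_contract[OF K, of x y]
 have "psum k u ?\<beta> = (\<Sum>a<r. \<Sum>b<r. psum k u (\<alpha> a b) * x b * cnj (y a))" for k
 proof -
  have "psum k u ?\<beta> = (\<Sum>s | e k s \<noteq> 0. \<Sum>a<r. \<Sum>b<r. e k s * \<alpha> a b s * u s * x b * cnj (y a))"
   unfolding psum_def by (simp add: sum_distrib_left sum_distrib_right mult_ac)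
  also have "\<dots> = (\<Sum>a<r. \<Sum>b<r. \<Sum>s | e k s \<noteq> 0. e k s * \<alpha> a b s * u s * x b * cnj (y a))"
   by (subst sum.swap, rule sum.cong[OF refl], rule sum.swap)
  finally show ?thesis unfolding psum_def by (simp add: sum_distrib_right)
 qed
 moreover have "(\<lambda>k. \<Sum>a<r. \<Sum>b<r. psum k u (\<alpha> a b) * x b * cnj (y a)) \<longlonglongrightarrow>
   (\<Sum>a<r. \<Sum>b<r. pair u (\<alpha> a b) * x b * cnj (y a))"
  by (intro tendsto_sum tendsto_mult tendsto_const pair_tendsto[OF u mbd_entry_kbd[OF K]]) auto
 ultimately have "pair u ?\<beta> = kform {..<r} (\<lambda>a b. pair u (\<alpha> a b)) x y"
  unfolding kform_def by (intro pair_eqI) simp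
 then show "cmod (kform {..<r} (\<lambda>a b. pair u (\<alpha> a b)) x y) \<le> C * c * nrm x {..<r} * nrm y {..<r}"
  using C(1)[OF K\<beta>] by (simp add: mult.assoc)
qed simp

lemma regular_finsupp:
 assumes w: "finsupp G w"
 shows "regular w" and "pair w \<alpha> = (\<Sum>s | w s \<noteq> 0. \<alpha> s * w s)"
proof -
 let ?S = "{s. w s \<noteq> 0}"
 have S: "finite ?S" "?S \<subseteq> carrier G" using w by (auto simp: finsupp_def)
 have ps: "psum k w \<alpha> = (\<Sum>s\<in>?S. e k s * \<alpha> s * w s)" for k \<alpha>
 proof -
  have "psum k w \<alpha> = (\<Sum>s\<in>{s. e k s \<noteq> 0} \<inter> ?S. e k s * \<alpha> s * w s)"
   unfolding psum_def by (rule sum.mono_neutral_right[OF e_finite]) auto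
  also have "\<dots> = (\<Sum>s\<in>?S. e k s * \<alpha> s * w s)"
   by (rule sum.mono_neutral_left[OF S(1)]) auto
  finally show ?thesis .
 qed
 have lim: "(\<lambda>k. \<Sum>s\<in>?S. cmod (e k s - 1) * cmod (w s)) \<longlonglongrightarrow> (\<Sum>s\<in>?S. cmod (1 - 1) * cmod (w s))"
  using S by (intro tendsto_sum tendsto_mult tendsto_norm tendsto_diff tendsto_const e_tendsto) auto
 have est: "cmod (psum k w \<alpha> - (\<Sum>s\<in>?S. \<alpha> s * w s)) \<le> (\<Sum>s\<in>?S. cmod (e k s - 1) * cmod (w s)) * c"
  if K: "kbd (carrier G) (ker \<alpha>) c" for k \<alpha> c
  unfolding ps sum_subtractf[symmetric] sum_distrib_right
 proof (rule order_trans[OF norm_sum], rule sum_mono)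
  fix s assume "s \<in> ?S"
  then have s: "s \<in> carrier G" using S by blast
  have "cmod (\<alpha> s) \<le> c" using kbd_entry[OF K s one_closed] s by (simp add: ker_def)
  then have "cmod (e k s - 1) * cmod (w s) * cmod (\<alpha> s) \<le> cmod (e k s - 1) * cmod (w s) * c"
   by (rule mult_left_mono) simp
  moreover have "e k s * \<alpha> s * w s - \<alpha> s * w s = (e k s - 1) * w s * \<alpha> s" by (simp add: algebra_simps)
  ultimately show "cmod (e k s * \<alpha> s * w s - \<alpha> s * w s) \<le> cmod (e k s - 1) * cmod (w s) * c"
   by (simp add: norm_mult)
 qed
 show "regular w"
  unfolding regular_def
 proof (intro conjI allI impI)
  show "w s = 0" if "s \<notin> carrier G" for s using S that by blast
  fix \<epsilon> :: real assume "0 < \<epsilon>"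
  then have "\<forall>\<^sub>F k in sequentially. (\<Sum>s\<in>?S. cmod (e k s - 1) * cmod (w s)) < \<epsilon> / 2"
   by (intro order_tendstoD(2)[OF lim]) simp
  then obtain N where N: "\<And>k. N \<le> k ==> (\<Sum>s\<in>?S. cmod (e k s - 1) * cmod (w s)) < \<epsilon> / 2"
   unfolding eventually_sequentially by blast
  show "\<exists>N. \<forall>k\<ge>N. \<forall>l\<ge>N. \<forall>\<alpha>. kbd (carrier G) (ker \<alpha>) 1 \<longrightarrow> cmod (psum k w \<alpha> - psum l w \<alpha>) \<le> \<epsilon>"
  proof (intro exI[of _ N] allI impI)
   fix k l \<alpha> assume kl: "N \<le> k" "N \<le> l" and K: "kbd (carrier G) (ker \<alpha>) 1"
   show "cmod (psum k w \<alpha> - psum l w \<alpha>) \<le> \<epsilon>"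
    using est[OF K, of k] est[OF K, of l] N[OF kl(1)] N[OF kl(2)]
     norm_triangle_ineq4[of "psum k w \<alpha> - (\<Sum>s\<in>?S. \<alpha> s * w s)" "psum l w \<alpha> - (\<Sum>s\<in>?S. \<alpha> s * w s)"]
    by simp
  qed
 qed
 show "pair w \<alpha> = (\<Sum>s\<in>?S. \<alpha> s * w s)"
 proof (rule pair_eqI)
  have "(\<lambda>k. \<Sum>s\<in>?S. e k s * \<alpha> s * w s) \<longlonglongrightarrow> (\<Sum>s\<in>?S. 1 * \<alpha> s * w s)"
   using S by (intro tendsto_sum tendsto_mult tendsto_const e_tendsto) auto
  then show "(\<lambda>k. psum k w \<alpha>) \<longlonglongrightarrow> (\<Sum>s\<in>?S. \<alpha> s * w s)" unfolding ps by simp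
 qed
qed

end

section \<open>Coefficient functions of the regular representation and the projective norm\<close>

lemma l2_inner_delta: "s \<in> carrier G ==> l2_inner G \<xi> (delta s) = \<xi> s"
proof -
 assume s: "s \<in> carrier G"
 have "delta s = trunc {s} (\<lambda>_. 1)" by (auto simp: delta_def trunc_def fun_eq_iff)
 then show ?thesis using l2_inner_trunc[of "{s}" G \<xi> "\<lambda>_. 1"] s by simp
qed

lemma l2_norm_zeroD:
 assumes "\<xi> \<in> l2 G" "l2_norm G \<xi> = 0" shows "\<xi> = 0"
proof
 fix t show "\<xi> t = 0 t" using l2_entry[OF assms(1), of t] assms(2) by simp
qed

lemma sum_list_prod_decode_summable:
 fixes g :: "nat => nat => real"
 assumes g: "\<And>j n. 0 \<le> g j n" "\<And>j n. len j \<le> n ==> g j n = 0"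
  and C: "\<And>j. (\<Sum>n<len j. g j n) \<le> C j" "summable C"
 shows "(\<lambda>(j, n). g j n) summable_on UNIV"
proof (rule nonneg_bdd_above_summable_on)
 have C0: "0 \<le> C j" for j using sum_nonneg[of "{..<len j}" "g j"] g(1) C(1)[of j] by (meson order_trans)
 show "bdd_above (sum (\<lambda>(j, n). g j n) ` {F. F \<subseteq> UNIV \<and> finite F})"
 proof (rule bdd_aboveI2)
  fix F :: "(nat \<times> nat) set" assume "F \<in> {F. F \<subseteq> UNIV \<and> finite F}"
  then have F: "finite F" by simp
  define J where "J = fst ` F"
  define N where "N = snd ` F"
  have JN: "finite J" "finite N" "F \<subseteq> J \<times> N" using F by (force simp: J_def N_def)+
  have "(\<Sum>(j, n)\<in>F. g j n) \<le> (\<Sum>(j, n)\<in>J \<times> N. g j n)"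
   using JN g(1) by (intro sum_mono2) auto
  also have "\<dots> = (\<Sum>j\<in>J. \<Sum>n\<in>N. g j n)" by (simp add: sum.cartesian_product)
  also have "\<dots> \<le> (\<Sum>j\<in>J. C j)"
  proof (rule sum_mono)
   fix j
   have "(\<Sum>n\<in>N. g j n) = (\<Sum>n\<in>N \<inter> {..<len j}. g j n)"
    using JN g(2) by (intro sum.mono_neutral_right) (auto simp: not_less)
   also have "\<dots> \<le> (\<Sum>n<len j. g j n)" using g(1) by (intro sum_mono2) auto
   finally show "(\<Sum>n\<in>N. g j n) \<le> C j" using C(1)[of j] by simp
  qed
  also have "\<dots> \<le> suminf C" by (rule sum_le_suminf[OF C(2) JN(1)]) (use C0 in auto)
  finally show "(\<Sum>(j, n)\<in>F. g j n) \<le> suminf C" .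
 qed
qed (use g in auto)

lemma summable_on_prod_decode:
 fixes g :: "nat \<times> nat => 'b::{topological_comm_monoid_add,t2_space}"
 shows "(g has_sum x) UNIV ==> ((\<lambda>m. g (prod_decode m)) has_sum x) UNIV"
 using has_sum_reindex_bij_betw[OF bij_prod_decode, of g x] by simp

context group begin

definition om :: "('a => complex) => ('a => complex) => 'a => complex" where
 "om \<xi> \<eta> = (\<lambda>s. if s \<in> carrier G then l2_inner G (left_regular G s \<xi>) \<eta> else 0)"

definition om_sum :: "(('a => complex) \<times> ('a => complex)) list => 'a => complex" where
 "om_sum L = (\<lambda>s. \<Sum>(\<xi>, \<eta>)\<leftarrow>L. om \<xi> \<eta> s)"

definition cost :: "(('a => complex) \<times> ('a => complex)) list => real" where
 "cost L = (\<Sum>(\<xi>, \<eta>)\<leftarrow>L. l2_norm G \<xi> * l2_norm G \<eta>)"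

definition reps :: "('a => complex) => (('a => complex) \<times> ('a => complex)) list set" where
 "reps w = {L. set L \<subseteq> l2 G \<times> l2 G \<and> w = om_sum L}"

text \<open>The norm of \<open>A(G)\<close> as a quotient of a projective tensor product of two
  copies of \<open>l2 G\<close>, restricted to finite sums of coefficient functions.
  \<open>small_representation\<close> bounds it by the dual norm.\<close>

definition proj_norm :: "('a => complex) => real" where
 "proj_norm w = (INF L\<in>reps w. cost L)"

lemma cost_nonneg: "0 \<le> cost L"
 unfolding cost_def by (intro sum_list_nonneg) auto

lemma left_regular_l2: "s \<in> carrier G ==> \<xi> \<in> l2 G ==> left_regular G s \<xi> \<in> l2 G"
 by (rule l2_boundedD(1)[OF left_regular_bounded])

lemma om_scale:
 assumes "\<xi> \<in> l2 G"
 shows "om (\<lambda>t. c * \<xi> t) \<eta> = (\<lambda>s. c * om \<xi> \<eta> s)"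
proof
 fix s show "om (\<lambda>t. c * \<xi> t) \<eta> s = c * om \<xi> \<eta> s"
 proof (cases "s \<in> carrier G")
  case True
  then show ?thesis
   by (simp add: om_def l2_boundedD(3)[OF left_regular_bounded[OF True] assms] l2_inner_smul)
 qed (simp add: om_def)
qed

lemma om_scale2: "om \<xi> (\<lambda>t. c * \<eta> t) = (\<lambda>s. cnj c * om \<xi> \<eta> s)"
 unfolding om_def by (auto simp: fun_eq_iff l2_inner_smul)

lemma reps_append: "L \<in> reps w ==> L' \<in> reps w' ==> L @ L' \<in> reps (w + w')"
 by (auto simp: reps_def om_sum_def fun_eq_iff)

lemma cost_append: "cost (L @ L') = cost L + cost L'"
 by (simp add: cost_def)

lemma reps_scale:
 assumes L: "L \<in> reps w"
 shows "map (\<lambda>(\<xi>, \<eta>). ((\<lambda>t. c * \<xi> t), \<eta>)) L \<in> reps (\<lambda>s. c * w s)" (is "?M L \<in> _")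
  "cost (map (\<lambda>(\<xi>, \<eta>). ((\<lambda>t. c * \<xi> t), \<eta>)) L) \<le> cmod c * cost L"
proof -
 have sub: "set L \<subseteq> l2 G \<times> l2 G" and w: "w = om_sum L" using L by (auto simp: reps_def)
 have "om_sum (?M L) = (\<lambda>s. c * om_sum L s)"
  using sub unfolding om_sum_def by (induction L) (auto simp: fun_eq_iff om_scale algebra_simps)
 moreover have "set (?M L) \<subseteq> l2 G \<times> l2 G" using sub by (auto intro: l2_smul)
 ultimately show "?M L \<in> reps (\<lambda>s. c * w s)" by (simp add: reps_def w)
 show "cost (?M L) \<le> cmod c * cost L"
  using sub unfolding cost_def
 proof (induction L)
  case (Cons p L)
  obtain \<xi> \<eta> where p: "p = (\<xi>, \<eta>)" by fastforce
  have "l2_norm G (\<lambda>t. c * \<xi> t) * l2_norm G \<eta> \<le> cmod c * l2_norm G \<xi> * l2_norm G \<eta>"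
   using Cons(2) p by (intro mult_right_mono l2_smul) auto
  then show ?case using Cons p by (simp add: algebra_simps)
 qed simp
qed

definition W :: "('a => complex) set" where "W = {w. reps w \<noteq> {}}"

lemma om_W: "\<xi> \<in> l2 G ==> \<eta> \<in> l2 G ==> [(\<xi>, \<eta>)] \<in> reps (om \<xi> \<eta>)"
 by (simp add: reps_def om_sum_def fun_eq_iff)

lemma complex_function_space_W: "complex_function_space W"
proof
 show "x + y \<in> W" if "x \<in> W" "y \<in> W" for x y using that reps_append unfolding W_def by blast
 show "(\<lambda>s. c * x s) \<in> W" if "x \<in> W" for x c using that reps_scale(1) unfolding W_def by blast
 show "W \<noteq> {}" using om_W[OF l2_0(1) l2_0(1)] unfolding W_def by blast
qed

lemma proj_norm_le: "L \<in> reps w ==> proj_norm w \<le> cost L"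
 unfolding proj_norm_def by (rule cINF_lower) (auto intro: bdd_belowI2[of _ 0] cost_nonneg)

lemma proj_norm_greatest: "w \<in> W ==> (\<And>L. L \<in> reps w ==> m \<le> cost L) ==> m \<le> proj_norm w"
 unfolding proj_norm_def W_def by (rule cINF_greatest) auto

lemma proj_norm_sublinear: "sublinear_on W proj_norm"
 unfolding sublinear_on_def
proof (intro conjI ballI allI impI)
 fix x y assume xy: "x \<in> W" "y \<in> W"
 have "proj_norm (x + y) - proj_norm y \<le> proj_norm x"
 proof (rule proj_norm_greatest[OF xy(1)])
  fix L assume L: "L \<in> reps x"
  have "proj_norm (x + y) - cost L \<le> proj_norm y"
  proof (rule proj_norm_greatest[OF xy(2)])
   fix L' assume "L' \<in> reps y"
   from proj_norm_le[OF reps_append[OF L this]] show "proj_norm (x + y) - cost L \<le> cost L'"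
    unfolding cost_append by simp
  qed
  then show "proj_norm (x + y) - proj_norm y \<le> cost L" by simp
 qed
 then show "proj_norm (x + y) \<le> proj_norm x + proj_norm y" by simp
next
 fix x and t :: real assume x: "x \<in> W" and t: "0 \<le> t"
 let ?tx = "\<lambda>s. complex_of_real t * x s"
 have le: "proj_norm ?tx \<le> t * cost L" if "L \<in> reps x" for L
  using proj_norm_le[OF reps_scale(1)[OF that, of "complex_of_real t"]] reps_scale(2)[OF that, of "complex_of_real t"] t by simp
 show "proj_norm ?tx \<le> t * proj_norm x"
 proof (cases "t = 0")
  case True
  have "?tx = om_sum []" using True by (simp add: om_sum_def)
  then have "[] \<in> reps ?tx" by (simp add: reps_def)
  from proj_norm_le[OF this] show ?thesis using True by (simp add: cost_def)
 next
  case False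
  have "proj_norm ?tx / t \<le> proj_norm x"
   using le False t by (intro proj_norm_greatest[OF x]) (simp add: field_simps)
  then show ?thesis using False t by (simp add: field_simps)
 qed
qed

lemma om_delta: "s \<in> carrier G ==> om (delta \<one>) (delta s) = delta s"
 by (auto simp: om_def fun_eq_iff l2_inner_delta left_regular_delta) (auto simp: delta_def)

lemma delta_W: "s \<in> carrier G ==> delta s \<in> W"
 using om_W[of "delta \<one>" "delta s"] om_delta[of s] l2_delta(1)[of _ G] by (auto simp: W_def)

text \<open>For finitely supported vectors the pair \<open>(p, q)\<close> contributes a point mass
  at \<open>p \<otimes> inv q\<close>. A linear functional on \<open>W\<close> therefore becomes the
  form of a kernel \<open>ker \<alpha>\<close>.\<close>

lemma om_trunc:
 assumes F: "finite F" "F \<subseteq> carrier G"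
 shows "om (trunc F x) (trunc F y) = (\<Sum>p\<in>F. \<Sum>q\<in>F. (\<lambda>s. (x q * cnj (y p)) * delta (p \<otimes> inv q) s))"
proof
 fix s
 show "om (trunc F x) (trunc F y) s = (\<Sum>p\<in>F. \<Sum>q\<in>F. (\<lambda>s. (x q * cnj (y p)) * delta (p \<otimes> inv q) s)) s"
 proof (cases "s \<in> carrier G")
  case True
  have l: "trunc F x \<in> l2 G" by (rule l2_trunc[OF F])
  have "left_regular G s (trunc F x) p = (\<Sum>q\<in>F. x q * delta (p \<otimes> inv q) s)" if p: "p \<in> F" for p
  proof -
   have pc: "p \<in> carrier G" using p F by blast
   have d: "delta (p \<otimes> inv q) s = (if q = inv s \<otimes> p then 1 else 0)" if "q \<in> F" for q
   proof -
    have qc: "q \<in> carrier G" using that F by blast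
    have "s = p \<otimes> inv q \<longleftrightarrow> q = inv s \<otimes> p"
     using True pc qc by (metis inv_closed inv_solve_left inv_solve_right m_closed)
    then show ?thesis by (simp add: delta_def)
   qed
   have "(\<Sum>q\<in>F. x q * delta (p \<otimes> inv q) s) = (\<Sum>q\<in>F. if q = inv s \<otimes> p then x q else 0)"
    by (intro sum.cong refl) (simp add: d)
   also have "\<dots> = trunc F x (inv s \<otimes> p)" using F by (simp add: trunc_def)
   finally show ?thesis using l pc True by (simp add: left_regular_def)
  qed
  then show ?thesis
   using True by (simp add: om_def l2_inner_trunc[OF F] sum_fun_apply sum_distrib_left sum_distrib_right mult_ac)
 next
  case False
  have z: "(x q * cnj (y p)) * delta (p \<otimes> inv q) s = 0" if "p \<in> F" "q \<in> F" for p q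
  proof -
   have "p \<otimes> inv q \<in> carrier G" using that F by blast
   then show ?thesis using False by (auto simp: delta_def)
  qed
  have "(\<Sum>p\<in>F. \<Sum>q\<in>F. (\<lambda>s. (x q * cnj (y p)) * delta (p \<otimes> inv q) s)) s = 0"
   unfolding sum_fun_apply by (intro sum.neutral ballI) (rule z)
  then show ?thesis using False by (simp add: om_def)
 qed
qed

lemma finsupp_W:
 assumes "finsupp G w"
 shows "w = (\<Sum>s | w s \<noteq> 0. (\<lambda>t. w s * delta s t))" "w \<in> W"
proof -
 interpret complex_function_space W by (rule complex_function_space_W)
 have S: "finite {s. w s \<noteq> 0}" "{s. w s \<noteq> 0} \<subseteq> carrier G" using assms by (auto simp: finsupp_def)
 show e: "w = (\<Sum>s | w s \<noteq> 0. (\<lambda>t. w s * delta s t))"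
 proof
  fix t
  have "(\<Sum>s | w s \<noteq> 0. (\<lambda>t. w s * delta s t)) t = (\<Sum>s | w s \<noteq> 0. if s = t then w s else 0)"
   unfolding sum_fun_apply by (intro sum.cong refl) (auto simp: delta_def)
  then show "w t = (\<Sum>s | w s \<noteq> 0. (\<lambda>t. w s * delta s t)) t" using S by simp
 qed
 have "(\<Sum>s\<in>A. (\<lambda>t. w s * delta s t)) \<in> W" if "finite A" "A \<subseteq> carrier G" for A
  using that by (induction A rule: finite_induct) (auto intro: W_0 W_add W_scale delta_W)
 from this[OF S] e show "w \<in> W" by simp
qed

text \<open>Duality: a finitely supported function that is small as a functional on the group von Neumann
 algebra has a representation by vectors of small norm. The operator that witnesses this comes from
 a Hahn-Banach functional.\<close>

lemma small_representation:
 assumes w: "finsupp G w" and c: "\<And>\<alpha>. kbd (carrier G) (ker \<alpha>) 1 ==> cmod (\<Sum>s | w s \<noteq> 0. \<alpha> s * w s) \<le> c"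
  and \<epsilon>: "0 < \<epsilon>"
 obtains L where "L \<in> reps w" "cost L < c + \<epsilon>"
proof -
 interpret complex_function_space W by (rule complex_function_space_W)
 note wW = finsupp_W(2)[OF w]
 obtain f where f: "\<And>x. x \<in> W ==> f x \<le> proj_norm x" "\<And>x y. x \<in> W ==> y \<in> W ==> f (x + y) = f x + f y"
  "\<And>x t. x \<in> W ==> 0 \<le> t ==> f (\<lambda>s. complex_of_real t * x s) = t * f x" "f w = proj_norm w"
  using Hahn_Banach[OF proj_norm_sublinear wW] by blast
 have f0: "f 0 = 0" using f(2)[OF W_0 W_0] by simp
 have fr: "f (\<lambda>s. complex_of_real t * x s) = t * f x" if x: "x \<in> W" for t x
 proof (cases "0 \<le> t")
  case False
  have "f ((\<lambda>s. complex_of_real t * x s) + (\<lambda>s. complex_of_real (- t) * x s)) =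
    f (\<lambda>s. complex_of_real t * x s) + f (\<lambda>s. complex_of_real (- t) * x s)"
   by (rule f(2)[OF W_scale[OF x] W_scale[OF x]])
  moreover have "(\<lambda>s. complex_of_real t * x s) + (\<lambda>s. complex_of_real (- t) * x s) = 0" by (auto simp: fun_eq_iff)
  moreover have "f (\<lambda>s. complex_of_real (- t) * x s) = - t * f x" using False by (intro f(3) x) auto
  ultimately show ?thesis using f0 by simp
 qed (rule f(3)[OF x])
 \<comment> \<open>The complex-linear functional with real part \<open>f\<close>.\<close>
 define \<Lambda> where "\<Lambda> x = Complex (f x) (- f (\<lambda>s. \<i> * x s))" for x
 have \<Lambda>_add: "\<Lambda> (x + y) = \<Lambda> x + \<Lambda> y" if "x \<in> W" "y \<in> W" for x y
 proof -
  have "(\<lambda>s. \<i> * (x + y) s) = (\<lambda>s. \<i> * x s) + (\<lambda>s. \<i> * y s)" by (auto simp: fun_eq_iff algebra_simps)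
  then show ?thesis using f(2)[OF that] f(2)[OF W_scale W_scale, OF that, of \<i> \<i>] by (simp add: \<Lambda>_def complex_eq_iff)
 qed
 have \<Lambda>_r: "\<Lambda> (\<lambda>s. complex_of_real t * x s) = complex_of_real t * \<Lambda> x" if x: "x \<in> W" for t x
 proof -
  have "(\<lambda>s. \<i> * (complex_of_real t * x s)) = (\<lambda>s. complex_of_real t * (\<i> * x s))" by (auto simp: fun_eq_iff)
  then show ?thesis using fr[OF x] fr[OF W_scale[OF x, of \<i>]] by (simp add: \<Lambda>_def complex_eq_iff)
 qed
 have \<Lambda>_i: "\<Lambda> (\<lambda>s. \<i> * x s) = \<i> * \<Lambda> x" if x: "x \<in> W" for x
 proof -
  have "(\<lambda>s. \<i> * (\<i> * x s)) = (\<lambda>s. complex_of_real (-1) * x s)" by (auto simp: fun_eq_iff)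
  then show ?thesis using fr[OF x, of "-1"] by (simp add: \<Lambda>_def complex_eq_iff)
 qed
 have \<Lambda>_scale: "\<Lambda> (\<lambda>s. a * x s) = a * \<Lambda> x" if x: "x \<in> W" for a x
 proof -
  have ix: "(\<lambda>s. \<i> * x s) \<in> W" by (rule W_scale[OF x])
  have "(\<lambda>s. a * x s) = (\<lambda>s. complex_of_real (Re a) * x s) + (\<lambda>s. complex_of_real (Im a) * (\<i> * x s))"
   by (auto simp: fun_eq_iff complex_eq_iff)
  then have "\<Lambda> (\<lambda>s. a * x s) = complex_of_real (Re a) * \<Lambda> x + complex_of_real (Im a) * (\<i> * \<Lambda> x)"
   using \<Lambda>_add[OF W_scale[OF x] W_scale[OF ix], of "complex_of_real (Re a)" "complex_of_real (Im a)"]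
    \<Lambda>_r[OF x, of "Re a"] \<Lambda>_r[OF ix, of "Im a"] \<Lambda>_i[OF x] by simp
  also have "\<dots> = a * \<Lambda> x" by (simp add: complex_eq_iff)
  finally show ?thesis .
 qed
 have \<Lambda>_sum: "\<Lambda> (\<Sum>k\<in>A. h k) = (\<Sum>k\<in>A. \<Lambda> (h k)) \<and> (\<Sum>k\<in>A. h k) \<in> W" if "finite A" "\<And>k. k \<in> A ==> h k \<in> W" for A :: "'a set" and h
  using that
 proof (induction A rule: finite_induct)
  case empty
  have "\<Lambda> 0 = 0" using \<Lambda>_add[OF W_0 W_0] by simp
  then show ?case unfolding sum.empty using W_0 by blast
 next
  case (insert k A)
  then have ih: "\<Lambda> (sum h A) = (\<Sum>k\<in>A. \<Lambda> (h k))" "sum h A \<in> W" and hk: "h k \<in> W" by auto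
  show ?case
   unfolding sum.insert[OF insert(1,2)] \<Lambda>_add[OF hk ih(2)] ih(1) using W_add[OF hk ih(2)] by blast
 qed
 have \<Lambda>_om: "cmod (\<Lambda> (om \<xi> \<eta>)) \<le> l2_norm G \<xi> * l2_norm G \<eta>" if l: "\<xi> \<in> l2 G" "\<eta> \<in> l2 G" for \<xi> \<eta>
 proof (cases "\<Lambda> (om \<xi> \<eta>) = 0")
  case False
  \<comment> \<open>A rotation that makes the value real and positive, so that the bound on
    \<open>f\<close> bounds the modulus.\<close>
  define a where "a = cnj (\<Lambda> (om \<xi> \<eta>)) / cmod (\<Lambda> (om \<xi> \<eta>))"
  have a1: "cmod a = 1" using False by (simp add: a_def norm_divide)
  have oW: "om \<xi> \<eta> \<in> W" using om_W[OF l] by (auto simp: W_def)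
  have al: "(\<lambda>t. a * \<xi> t) \<in> l2 G" by (rule l2_smul(1)[OF l(1)])
  have "\<Lambda> (om (\<lambda>t. a * \<xi> t) \<eta>) = a * \<Lambda> (om \<xi> \<eta>)" unfolding om_scale[OF l(1)] by (rule \<Lambda>_scale[OF oW])
  also have "\<dots> = complex_of_real (cmod (\<Lambda> (om \<xi> \<eta>)))"
   using False by (simp add: a_def complex_norm_square[symmetric] power2_eq_square mult.commute)
  finally have "cmod (\<Lambda> (om \<xi> \<eta>)) = f (om (\<lambda>t. a * \<xi> t) \<eta>)" by (simp add: \<Lambda>_def complex_eq_iff)
  also have "\<dots> \<le> proj_norm (om (\<lambda>t. a * \<xi> t) \<eta>)" using om_W[OF al l(2)] by (intro f(1)) (auto simp: W_def)
  also have "\<dots> \<le> cost [(\<lambda>t. a * \<xi> t, \<eta>)]" by (rule proj_norm_le[OF om_W[OF al l(2)]])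
  also have "\<dots> \<le> l2_norm G \<xi> * l2_norm G \<eta>"
   using l2_smul(2)[OF l(1), of a] a1 by (simp add: cost_def mult_right_mono)
  finally show ?thesis .
 qed simp
 \<comment> \<open>The symbol of the operator that represents \<open>\<Lambda>\<close>. Its kernel
   bound 1 is the bound of \<open>\<Lambda>\<close> on coefficient functions of finitely supported
   vectors.\<close>
 define \<alpha> where "\<alpha> s = \<Lambda> (delta s)" for s
 have "kbd (carrier G) (ker \<alpha>) 1"
  unfolding kbd_def
 proof (intro conjI allI impI)
  fix F x y assume F: "finite F" "F \<subseteq> carrier G"
  let ?h = "\<lambda>p q. (\<lambda>s. (x q * cnj (y p)) * delta (p \<otimes> inv q) s)"
  have hW: "?h p q \<in> W" if "p \<in> F" "q \<in> F" for p q
   using that F by (intro W_scale delta_W) auto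
  have 1: "\<Lambda> (\<Sum>q\<in>F. ?h p q) = (\<Sum>q\<in>F. \<Lambda> (?h p q)) \<and> (\<Sum>q\<in>F. ?h p q) \<in> W" if "p \<in> F" for p
   by (rule \<Lambda>_sum[OF F(1)]) (rule hW[OF that])
  have 2: "\<Lambda> (\<Sum>p\<in>F. \<Sum>q\<in>F. ?h p q) = (\<Sum>p\<in>F. \<Lambda> (\<Sum>q\<in>F. ?h p q))"
   using \<Lambda>_sum[OF F(1), of "\<lambda>p. \<Sum>q\<in>F. ?h p q"] 1 by blast
  have "\<Lambda> (om (trunc F x) (trunc F y)) = (\<Sum>p\<in>F. \<Sum>q\<in>F. \<Lambda> (?h p q))"
   unfolding om_trunc[OF F] 2 using 1 by (intro sum.cong refl) blast
  also have "\<dots> = kform F (ker \<alpha>) x y"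
   unfolding kform_def
  proof (intro sum.cong refl)
   fix p q assume "p \<in> F" "q \<in> F"
   then have "p \<otimes> inv q \<in> carrier G" using F by blast
   from \<Lambda>_scale[OF delta_W[OF this], of "x q * cnj (y p)"]
   show "\<Lambda> (?h p q) = ker \<alpha> p q * x q * cnj (y p)" by (simp add: ker_def \<alpha>_def mult_ac)
  qed
  finally have "cmod (kform F (ker \<alpha>) x y) \<le> l2_norm G (trunc F x) * l2_norm G (trunc F y)"
   using \<Lambda>_om[OF l2_trunc(1)[OF F] l2_trunc(1)[OF F]] by metis
  then show "cmod (kform F (ker \<alpha>) x y) \<le> 1 * nrm x F * nrm y F" by (simp add: l2_trunc(2)[OF F])
 qed simp
 from c[OF this] have "cmod (\<Sum>s | w s \<noteq> 0. \<alpha> s * w s) \<le> c" .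
 moreover have "\<Lambda> w = (\<Sum>s | w s \<noteq> 0. \<alpha> s * w s)"
 proof -
  have S: "finite {s. w s \<noteq> 0}" "{s. w s \<noteq> 0} \<subseteq> carrier G" using w by (auto simp: finsupp_def)
  have "\<Lambda> w = \<Lambda> (\<Sum>s | w s \<noteq> 0. (\<lambda>t. w s * delta s t))" using finsupp_W(1)[OF w] by simp
  also have "\<dots> = (\<Sum>s | w s \<noteq> 0. \<Lambda> (\<lambda>t. w s * delta s t))"
   using \<Lambda>_sum[OF S(1), of "\<lambda>s t. w s * delta s t"] S(2) by (auto intro: W_scale delta_W)
  also have "\<dots> = (\<Sum>s | w s \<noteq> 0. w s * \<alpha> s)"
   unfolding \<alpha>_def using S(2) by (intro sum.cong refl \<Lambda>_scale delta_W) auto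
  finally show ?thesis by (simp add: mult.commute)
 qed
 moreover have "f w \<le> cmod (\<Lambda> w)" using complex_Re_le_cmod[of "\<Lambda> w"] by (simp add: \<Lambda>_def)
 ultimately have "proj_norm w \<le> c" using f(4) by simp
 then have "\<exists>L\<in>reps w. cost L < c + \<epsilon>"
  using \<epsilon> proj_norm_greatest[OF wW, of "c + \<epsilon>"] by force
 then show thesis using that by blast
qed

lemma om_0: "om 0 \<eta> = 0"
 using om_scale[OF l2_0(1), of 0 \<eta>] by (simp add: zero_fun_def)

text \<open>Scaling one vector by \<open>t\<close> and the other by its inverse leaves the
  coefficient function unchanged and equalises the norms. Products of norms thus become the squares
  that \<open>normal_data\<close> asks to be summable. If one vector vanishes, so does the
  coefficient function.\<close>

lemma balanced:
 assumes l: "\<xi> \<in> l2 G" "\<eta> \<in> l2 G"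
 obtains \<xi>' \<eta>' where "\<xi>' \<in> l2 G" "\<eta>' \<in> l2 G" "om \<xi>' \<eta>' = om \<xi> \<eta>"
  "(l2_norm G \<xi>')\<^sup>2 \<le> l2_norm G \<xi> * l2_norm G \<eta>" "(l2_norm G \<eta>')\<^sup>2 \<le> l2_norm G \<xi> * l2_norm G \<eta>"
proof (cases "l2_norm G \<xi> = 0 \<or> l2_norm G \<eta> = 0")
 case True
 have "om \<xi> \<eta> = 0"
 proof (cases "l2_norm G \<xi> = 0")
  case True
  then show ?thesis using l2_norm_zeroD[OF l(1)] om_0 by simp
 next
  case False
  then have "\<eta> = 0" using True l2_norm_zeroD[OF l(2)] by simp
  then show ?thesis using om_scale2[of \<xi> 0 0] by (simp add: zero_fun_def)
 qed
 then show thesis using that[OF l2_0(1) l2_0(1)] om_0 True by (auto simp: l2_0)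
next
 case False
 define a where "a = l2_norm G \<xi>"
 define b where "b = l2_norm G \<eta>"
 have ab: "0 < a" "0 < b" using False unfolding a_def b_def by (metis l2_norm_nonneg less_eq_real_def)+
 define t where "t = sqrt (b / a)"
 have t: "0 < t" "t\<^sup>2 = b / a" using ab by (auto simp: t_def)
 let ?\<xi> = "\<lambda>s. complex_of_real t * \<xi> s" and ?\<eta> = "\<lambda>s. complex_of_real (inverse t) * \<eta> s"
 have "om ?\<xi> ?\<eta> = om \<xi> \<eta>" unfolding om_scale2 om_scale[OF l(1)] using t by (simp add: fun_eq_iff)
 moreover have "(l2_norm G ?\<xi>)\<^sup>2 \<le> (t * a)\<^sup>2"
  using l2_smul(2)[OF l(1), of "complex_of_real t"] t by (intro power_mono) (auto simp: a_def)
 moreover have "(t * a)\<^sup>2 = a * b" using ab t(2) by (simp add: power_mult_distrib power2_eq_square field_simps)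
 moreover have "(l2_norm G ?\<eta>)\<^sup>2 \<le> (inverse t * b)\<^sup>2"
  using l2_smul(2)[OF l(2), of "complex_of_real (inverse t)"] t
  by (intro power_mono) (auto simp: b_def norm_inverse)
 moreover have "(inverse t * b)\<^sup>2 = a * b" unfolding power_mult_distrib power_inverse t(2)
  using ab by (simp add: power2_eq_square field_simps)
 ultimately show thesis using that[OF l2_smul(1)[OF l(1)] l2_smul(1)[OF l(2)]] unfolding a_def b_def by metis
qed

lemma balanced_list:
 assumes L: "L \<in> reps w"
 obtains L' where "L' \<in> reps w" "(\<Sum>n<length L'. (l2_norm G (fst (L' ! n)))\<^sup>2) \<le> cost L"
  "(\<Sum>n<length L'. (l2_norm G (snd (L' ! n)))\<^sup>2) \<le> cost L"
proof -
 have "set L \<subseteq> l2 G \<times> l2 G" using L by (auto simp: reps_def)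
 then have "\<exists>L'. set L' \<subseteq> l2 G \<times> l2 G \<and> om_sum L' = om_sum L \<and>
   (\<Sum>p\<leftarrow>L'. (l2_norm G (fst p))\<^sup>2) \<le> cost L \<and> (\<Sum>p\<leftarrow>L'. (l2_norm G (snd p))\<^sup>2) \<le> cost L"
 proof (induction L)
  case Nil
  then show ?case by (intro exI[of _ "[]"]) (simp add: cost_def)
 next
  case (Cons p L)
  then obtain L' where L': "set L' \<subseteq> l2 G \<times> l2 G" "om_sum L' = om_sum L"
   "(\<Sum>p\<leftarrow>L'. (l2_norm G (fst p))\<^sup>2) \<le> cost L" "(\<Sum>p\<leftarrow>L'. (l2_norm G (snd p))\<^sup>2) \<le> cost L" by auto
  obtain \<xi> \<eta> where p: "p = (\<xi>, \<eta>)" "\<xi> \<in> l2 G" "\<eta> \<in> l2 G" using Cons(2) by (cases p) auto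
  obtain \<xi>' \<eta>' where b: "\<xi>' \<in> l2 G" "\<eta>' \<in> l2 G" "om \<xi>' \<eta>' = om \<xi> \<eta>"
   "(l2_norm G \<xi>')\<^sup>2 \<le> l2_norm G \<xi> * l2_norm G \<eta>" "(l2_norm G \<eta>')\<^sup>2 \<le> l2_norm G \<xi> * l2_norm G \<eta>"
   using balanced[OF p(2,3)] by blast
  have "om_sum ((\<xi>', \<eta>') # L') = om_sum (p # L)"
   using L'(2) b(3) by (simp add: om_sum_def p fun_eq_iff)
  then show ?case using b L' p by (intro exI[of _ "(\<xi>', \<eta>') # L'"]) (simp add: cost_def)
 qed
 then obtain L' where L': "set L' \<subseteq> l2 G \<times> l2 G" "om_sum L' = om_sum L"
  "(\<Sum>p\<leftarrow>L'. (l2_norm G (fst p))\<^sup>2) \<le> cost L" "(\<Sum>p\<leftarrow>L'. (l2_norm G (snd p))\<^sup>2) \<le> cost L" by blast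
 show thesis
  by (rule that[of L']) (use L L' in \<open>simp_all add: reps_def sum_list_sum_nth atLeast0LessThan\<close>)
qed

text \<open>The balanced lists, continued by zero vectors, form a double sequence that is enumerated
  by \<open>prod_decode\<close>. Summable cost makes both families of vectors square summable and
  the double series absolutely convergent, so it may be summed row by row.\<close>

lemma normal_data_of_reps:
 assumes L: "\<And>j. L j \<in> reps (w j)" and C: "summable (\<lambda>j. cost (L j))"
  and u: "\<And>s. s \<in> carrier G ==> (\<lambda>j. w j s) sums u s"
 obtains \<xi> \<eta> where "normal_data \<xi> \<eta>"
  "\<And>s. s \<in> carrier G ==> u s = (\<Sum>n. l2_inner G (left_regular G s (\<xi> n)) (\<eta> n))"
proof -
 have "\<forall>j. \<exists>L'. L' \<in> reps (w j) \<and> (\<Sum>n<length L'. (l2_norm G (fst (L' ! n)))\<^sup>2) \<le> cost (L j) \<and>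
  (\<Sum>n<length L'. (l2_norm G (snd (L' ! n)))\<^sup>2) \<le> cost (L j)"
 proof
  fix j
  obtain L' where "L' \<in> reps (w j)" "(\<Sum>n<length L'. (l2_norm G (fst (L' ! n)))\<^sup>2) \<le> cost (L j)"
   "(\<Sum>n<length L'. (l2_norm G (snd (L' ! n)))\<^sup>2) \<le> cost (L j)"
   using balanced_list[OF L] by blast
  then show "\<exists>L'. L' \<in> reps (w j) \<and> (\<Sum>n<length L'. (l2_norm G (fst (L' ! n)))\<^sup>2) \<le> cost (L j) \<and>
   (\<Sum>n<length L'. (l2_norm G (snd (L' ! n)))\<^sup>2) \<le> cost (L j)" by blast
 qed
 from choice[OF this] obtain M where M: "\<And>j. M j \<in> reps (w j)"
  "\<And>j. (\<Sum>n<length (M j). (l2_norm G (fst (M j ! n)))\<^sup>2) \<le> cost (L j)"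
  "\<And>j. (\<Sum>n<length (M j). (l2_norm G (snd (M j ! n)))\<^sup>2) \<le> cost (L j)" by blast
 define x where "x j n = (if n < length (M j) then fst (M j ! n) else 0)" for j n
 define y where "y j n = (if n < length (M j) then snd (M j ! n) else 0)" for j n
 have Mn: "M j ! n \<in> l2 G \<times> l2 G" if "n < length (M j)" for j n
  using M(1)[of j] nth_mem[OF that] unfolding reps_def by blast
 have xy: "x j n \<in> l2 G" "y j n \<in> l2 G" for j n
  using Mn[of n j] by (auto simp: x_def y_def l2_0 mem_Times_iff)
 have sx: "(\<lambda>(j, n). (l2_norm G (x j n))\<^sup>2) summable_on UNIV"
  by (rule sum_list_prod_decode_summable[where len = "\<lambda>j. length (M j)", OF _ _ _ C]) (use M(2) in \<open>auto simp: x_def l2_0\<close>)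
 have sy: "(\<lambda>(j, n). (l2_norm G (y j n))\<^sup>2) summable_on UNIV"
  by (rule sum_list_prod_decode_summable[where len = "\<lambda>j. length (M j)", OF _ _ _ C]) (use M(3) in \<open>auto simp: y_def l2_0\<close>)
 define \<xi> where "\<xi> m = (case prod_decode m of (j, n) => x j n)" for m
 define \<eta> where "\<eta> m = (case prod_decode m of (j, n) => y j n)" for m
 have dec: "f summable_on UNIV ==> summable (\<lambda>m. f (prod_decode m))" for f :: "nat \<times> nat => real"
  using summable_on_reindex_bij_betw[OF bij_prod_decode, of f] summable_on_imp_summable by blast
 have s2: "summable (\<lambda>m. (l2_norm G (\<xi> m))\<^sup>2)" "summable (\<lambda>m. (l2_norm G (\<eta> m))\<^sup>2)"
  using dec[OF sx] dec[OF sy] by (simp_all add: \<xi>_def \<eta>_def case_prod_beta)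
 have nd: "normal_data \<xi> \<eta>"
  unfolding normal_data_def using s2 xy by (auto simp: \<xi>_def \<eta>_def split: prod.split)
 have "u s = (\<Sum>m. l2_inner G (left_regular G s (\<xi> m)) (\<eta> m))" if s: "s \<in> carrier G" for s
 proof -
  define h where "h = (\<lambda>(j, n). l2_inner G (left_regular G s (x j n)) (y j n))"
  have hb: "cmod (h p) \<le> (\<lambda>(j, n). (l2_norm G (x j n))\<^sup>2) p + (\<lambda>(j, n). (l2_norm G (y j n))\<^sup>2) p" for p
  proof -
   obtain j n where p: "p = (j, n)" by fastforce
   have "cmod (h p) \<le> l2_norm G (x j n) * l2_norm G (y j n)"
    using l2_inner_bound(2)[OF left_regular_l2[OF s xy(1)[of j n]] xy(2)[of j n]] left_regular_norm[OF s xy(1)[of j n]]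
    by (simp add: h_def p)
   also have "a * b \<le> a\<^sup>2 + b\<^sup>2" if "0 \<le> a" "0 \<le> b" for a b :: real
    using sum_squares_bound[of a b] that mult_nonneg_nonneg[OF that] by linarith
   from this[OF l2_norm_nonneg[of G "x j n"] l2_norm_nonneg[of G "y j n"]]
   have "l2_norm G (x j n) * l2_norm G (y j n) \<le> (l2_norm G (x j n))\<^sup>2 + (l2_norm G (y j n))\<^sup>2" .
   finally show ?thesis by (simp add: p)
  qed
  have "h summable_on UNIV"
   by (rule abs_summable_summable, rule summable_on_comparison_test[OF summable_on_add[OF sx sy]]) (use hb in auto)
  then have hs: "(h has_sum infsum h UNIV) UNIV" by simp
  have "(\<lambda>m. h (prod_decode m)) sums infsum h UNIV"
   using summable_on_prod_decode[OF hs] by (rule has_sum_imp_sums)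
  then have 1: "infsum h UNIV = (\<Sum>m. l2_inner G (left_regular G s (\<xi> m)) (\<eta> m))"
   by (simp add: sums_iff h_def \<xi>_def \<eta>_def case_prod_beta)
  have row: "((\<lambda>n. h (j, n)) has_sum w j s) UNIV" for j
  proof -
   have "w j s = (\<Sum>n<length (M j). om (fst (M j ! n)) (snd (M j ! n)) s)"
    using M(1)[of j] by (simp add: reps_def om_sum_def sum_list_sum_nth atLeast0LessThan case_prod_beta)
   also have "\<dots> = (\<Sum>n<length (M j). h (j, n))" using s by (simp add: h_def x_def y_def om_def)
   finally have e: "w j s = (\<Sum>n<length (M j). h (j, n))" .
   have "((\<lambda>n. h (j, n)) has_sum w j s) {..<length (M j)}" unfolding e by (rule has_sum_finite) simp
   moreover have "h (j, n) = 0" if "\<not> n < length (M j)" for n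
    using that l2_boundedD(5)[OF left_regular_bounded[OF s]] by (simp add: h_def x_def l2_inner_def)
   ultimately show ?thesis
    by (subst has_sum_cong_neutral[where g = "\<lambda>n. h (j, n)" and T = "{..<length (M j)}"]) auto
  qed
  have "((\<lambda>j. w j s) has_sum infsum h UNIV) UNIV"
  proof (rule has_sum_SigmaD[where B = "\<lambda>_. UNIV" and f = h])
   show "(h has_sum infsum h UNIV) (SIGMA _:UNIV. UNIV)" using hs by simp
  qed (rule row)
  then have "(\<lambda>j. w j s) sums infsum h UNIV" by (rule has_sum_imp_sums)
  with u[OF s] have "u s = infsum h UNIV" by (rule sums_unique2)
  with 1 show ?thesis by simp
 qed
 with nd that show thesis by blast
qed

end

context approx_group begin

text \<open>The converse of \<open>regular_of_normal\<close>. Along a fast subsequence the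
  differences of consecutive truncations are finitely supported and geometrically small as
  functionals, so \<open>small_representation\<close> gives vectors of summable cost for the
  telescoping series.\<close>

lemma normal_of_regular:
 assumes u: "regular u"
 obtains \<xi> \<eta> where "normal_data \<xi> \<eta>"
  "\<And>s. s \<in> carrier G ==> u s = (\<Sum>n. l2_inner G (left_regular G s (\<xi> n)) (\<eta> n))"
proof -
 have "\<forall>j. \<exists>N. \<forall>k\<ge>N. \<forall>l\<ge>N. \<forall>\<alpha>. kbd (carrier G) (ker \<alpha>) 1 \<longrightarrow> cmod (psum k u \<alpha> - psum l u \<alpha>) \<le> (1/2)^j"
  using u unfolding regular_def by simp
 from choice[OF this] obtain N0 where N0: "\<And>j k l \<alpha>. N0 j \<le> k ==> N0 j \<le> l ==> kbd (carrier G) (ker \<alpha>) 1 ==>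
  cmod (psum k u \<alpha> - psum l u \<alpha>) \<le> (1/2)^j" by blast
 \<comment> \<open>\<open>K\<close> dominates \<open>N0\<close> both at its own index and at the
   preceding one, so that consecutive truncations can be compared; the summand \<open>j\<close>
   drives it to infinity.\<close>
 define K where "K j = (\<Sum>i\<le>j. N0 i) + j" for j
 have K1: "N0 j \<le> K j" for j
  unfolding K_def using member_le_sum[of j "{..j}" N0] by simp
 have K2: "N0 j \<le> K (Suc j)" for j
  unfolding K_def using member_le_sum[of j "{..Suc j}" N0] by simp
 have Kj: "j \<le> K j" for j by (simp add: K_def)
 define v where "v j = (\<lambda>s. e (K j) s * u s)" for j
 \<comment> \<open>The partial sums telescope to the truncations \<open>v\<close>. No bound on the
   cost of \<open>w 0\<close> is needed for summability.\<close>
 define w where "w j = (case j of 0 => v 0 | Suc i => (\<lambda>s. v (Suc i) s - v i s))" for j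
 have vf: "finite {s. v j s \<noteq> 0}" "{s. v j s \<noteq> 0} \<subseteq> carrier G" for j
  by (rule finite_subset[OF _ e_finite[of "K j"]]) (auto simp: v_def dest: e_carrier)
 have wf: "finsupp G (w j)" for j
 proof (cases j)
  case 0
  then show ?thesis using vf[of 0] by (simp add: w_def finsupp_def)
 next
  case (Suc i)
  have "{s. w j s \<noteq> 0} \<subseteq> {s. v (Suc i) s \<noteq> 0} \<union> {s. v i s \<noteq> 0}" by (auto simp: w_def Suc)
  then show ?thesis
   unfolding finsupp_def using vf[of "Suc i"] vf[of i] by (meson Un_least finite_UnI finite_subset order_trans)
 qed
 have pv: "(\<Sum>s\<in>A. \<alpha> s * v j s) = psum (K j) u \<alpha>" if "finite A" "{s. v j s \<noteq> 0} \<subseteq> A" for A j \<alpha>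
 proof -
  have "(\<Sum>s\<in>A. \<alpha> s * v j s) = (\<Sum>s | v j s \<noteq> 0. \<alpha> s * v j s)"
   using that by (intro sum.mono_neutral_right) auto
  also have "\<dots> = (\<Sum>s | e (K j) s \<noteq> 0. \<alpha> s * v j s)"
   by (rule sum.mono_neutral_left[OF e_finite]) (auto simp: v_def)
  finally show ?thesis by (simp add: psum_def v_def mult_ac)
 qed
 have small: "cmod (\<Sum>s | w (Suc i) s \<noteq> 0. \<alpha> s * w (Suc i) s) \<le> (1/2)^i" if Ka: "kbd (carrier G) (ker \<alpha>) 1" for i \<alpha>
 proof -
  define A where "A = {s. v (Suc i) s \<noteq> 0} \<union> {s. v i s \<noteq> 0}"
  have A: "finite A" using vf by (simp add: A_def)
  have "(\<Sum>s | w (Suc i) s \<noteq> 0. \<alpha> s * w (Suc i) s) = (\<Sum>s\<in>A. \<alpha> s * w (Suc i) s)"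
   by (rule sum.mono_neutral_left[OF A]) (auto simp: w_def A_def)
  also have "\<dots> = (\<Sum>s\<in>A. \<alpha> s * v (Suc i) s) - (\<Sum>s\<in>A. \<alpha> s * v i s)"
   by (simp add: w_def right_diff_distrib sum_subtractf)
  also have "\<dots> = psum (K (Suc i)) u \<alpha> - psum (K i) u \<alpha>"
   by (subst (1 2) pv[OF A]) (auto simp: A_def)
  finally show ?thesis using N0[OF K2 K1 Ka] by simp
 qed
 have "\<exists>L. L \<in> reps (w j) \<and> (\<forall>i. j = Suc i \<longrightarrow> cost L \<le> 2 * (1/2)^i)" for j
 proof (cases j)
  case 0
  then show ?thesis using finsupp_W(2)[OF wf[of j]] unfolding W_def by auto
 next
  case (Suc i)
  obtain L where "L \<in> reps (w (Suc i))" "cost L < (1/2)^i + (1/2)^i"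
   by (rule small_representation[OF wf small, of "(1/2)^i" i]) simp_all
  then show ?thesis using Suc by (intro exI[of _ L]) simp
 qed
 then have "\<forall>j. \<exists>L. L \<in> reps (w j) \<and> (\<forall>i. j = Suc i \<longrightarrow> cost L \<le> 2 * (1/2)^i)" by blast
 from choice[OF this] obtain L where L: "\<And>j. L j \<in> reps (w j)" "\<And>i. cost (L (Suc i)) \<le> 2 * (1/2)^i" by blast
 have "summable (\<lambda>i. cost (L (Suc i)))"
 proof (rule summable_comparison_test')
  show "summable (\<lambda>i. 2 * (1/2::real)^i)" by (intro summable_mult summable_geometric) simp
  show "norm (cost (L (Suc i))) \<le> 2 * (1/2)^i" for i using L(2)[of i] cost_nonneg by simp
 qed
 then have C: "summable (\<lambda>j. cost (L j))" using summable_Suc_iff[of "\<lambda>j. cost (L j)"] by blast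
 have sums: "(\<lambda>j. w j s) sums u s" if s: "s \<in> carrier G" for s
 proof -
  have ps: "(\<Sum>j<Suc n. w j s) = v n s" for n by (induction n) (simp_all add: w_def)
  have "filterlim K at_top sequentially"
   by (rule filterlim_at_top_mono[OF filterlim_ident]) (simp add: Kj)
  then have "(\<lambda>n. e (K n) s) \<longlonglongrightarrow> 1" by (rule filterlim_compose[OF e_tendsto[OF s]])
  then have "(\<lambda>n. v n s) \<longlonglongrightarrow> 1 * u s" unfolding v_def by (intro tendsto_mult tendsto_const)
  then have "(\<lambda>n. \<Sum>j<Suc n. w j s) \<longlonglongrightarrow> u s" unfolding ps by simp
  then show ?thesis unfolding sums_def by (rule LIMSEQ_imp_Suc)
 qed
 show thesis by (rule normal_data_of_reps[OF L(1) C sums]) (use that in blast)+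
qed

end

section \<open>Completely bounded multipliers\<close>

text \<open>Passes from the index coding used by \<open>amplify\<close> to pairs of indices.\<close>

lemma kbd_divmod:
 fixes n r :: nat
 shows "kbd {..<n * r} (\<lambda>p q. K (p div r, p mod r) (q div r, q mod r)) c \<longleftrightarrow> kbd ({..<n} \<times> {..<r}) K c"
proof -
 have b: "bij_betw (\<lambda>p. (p div r, p mod r)) {..<n * r} ({..<n} \<times> {..<r})"
 proof (rule bij_betwI[where g = "\<lambda>(i, a). i * r + a"])
  show "(\<lambda>p. (p div r, p mod r)) \<in> {..<n * r} \<rightarrow> {..<n} \<times> {..<r}"
  proof (rule funcsetI)
   fix p assume "p \<in> {..<n * r}"
   then have p: "p < n * r" by simp
   then have "0 < r" by (cases r) auto
   then show "(p div r, p mod r) \<in> {..<n} \<times> {..<r}" using p by (simp add: less_mult_imp_div_less)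
  qed
  show "(\<lambda>(i, a). i * r + a) \<in> {..<n} \<times> {..<r} \<rightarrow> {..<n * r}"
  proof (rule funcsetI)
   fix x assume "x \<in> {..<n} \<times> {..<r}"
   then obtain i a where x: "x = (i, a)" "i < n" "a < r" by auto
   have "i * r + a < i * r + r" using x by simp
   also have "\<dots> \<le> n * r" using x(2) by (metis Suc_leI add.commute mult_Suc mult_le_mono1)
   finally show "(case x of (i, a) => i * r + a) \<in> {..<n * r}" by (simp add: x)
  qed
 qed auto
 show ?thesis by (rule kbd_reindex_bij[OF b, of K c])
qed

context approx_group begin

definition nfun :: "(nat => 'a => complex) => (nat => 'a => complex) => (('a => complex) => 'a => complex) => complex" where
 "nfun \<xi> \<eta> = (\<lambda>T. if T \<in> vecs (VN G) then (\<Sum>n. l2_inner G (T (\<xi> n)) (\<eta> n)) else 0)"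

lemma predual_vecs: "vecs (VN_predual G) = {nfun \<xi> \<eta> | \<xi> \<eta>. normal_data \<xi> \<eta>}"
 by (simp add: VN_predual_def nfun_def normal_data_def)

lemma fourier_nfun:
 "s \<in> carrier G ==> fourier_fun G (nfun \<xi> \<eta>) s = (\<Sum>n. l2_inner G (left_regular G s (\<xi> n)) (\<eta> n))"
 by (simp add: fourier_fun_def nfun_def left_regular_VN)

lemma predual_pair:
 assumes \<phi>: "\<phi> \<in> vecs (VN_predual G)"
 shows "regular (fourier_fun G \<phi>)"
  and "\<phi> = (\<lambda>T. if T \<in> vecs (VN G) then pair (fourier_fun G \<phi>) (coef T) else 0)"
proof -
 obtain \<xi> \<eta> where n: "\<phi> = nfun \<xi> \<eta>" and d: "normal_data \<xi> \<eta>" using \<phi> unfolding predual_vecs by blast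
 show "regular (fourier_fun G \<phi>)"
  by (rule regular_of_normal[OF d]) (auto simp: n fourier_nfun, simp add: fourier_fun_def)
 show "\<phi> = (\<lambda>T. if T \<in> vecs (VN G) then pair (fourier_fun G \<phi>) (coef T) else 0)"
 proof
  fix T show "\<phi> T = (if T \<in> vecs (VN G) then pair (fourier_fun G \<phi>) (coef T) else 0)"
   using pair_normal[OF d, of "fourier_fun G \<phi>" T] by (simp add: n fourier_nfun) (simp add: nfun_def)
 qed
qed

lemma fourier_fun_inj: "inj_on (fourier_fun G) (vecs (VN_predual G))"
proof (rule inj_onI)
 fix \<phi> \<psi> assume p: "\<phi> \<in> vecs (VN_predual G)" "\<psi> \<in> vecs (VN_predual G)" and e: "fourier_fun G \<phi> = fourier_fun G \<psi>"
 show "\<phi> = \<psi>"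
  using predual_pair(2)[OF p(1)] predual_pair(2)[OF p(2), symmetric] unfolding e by (rule trans)
qed

lemma regular_fourier:
 assumes u: "regular u" obtains \<phi> where "\<phi> \<in> vecs (VN_predual G)" "u = fourier_fun G \<phi>"
proof -
 obtain \<xi> \<eta> where d: "normal_data \<xi> \<eta>"
  and ue: "\<And>s. s \<in> carrier G ==> u s = (\<Sum>n. l2_inner G (left_regular G s (\<xi> n)) (\<eta> n))"
  using normal_of_regular[OF u] by blast
 have "u = fourier_fun G (nfun \<xi> \<eta>)"
 proof
  fix s show "u s = fourier_fun G (nfun \<xi> \<eta>) s"
   by (cases "s \<in> carrier G") (simp_all add: ue fourier_nfun regular_out[OF u], simp add: fourier_fun_def)
 qed
 with d show thesis using that unfolding predual_vecs by blast
qed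

text \<open>Normal functionals are uniform limits of their truncations, and conversely such limits
  are normal. From here on \<open>regular\<close> stands for membership in the Fourier
  algebra.\<close>

lemma A_vecs: "u \<in> vecs (fourier_algebra G) \<longleftrightarrow> regular u"
 unfolding fourier_algebra_def using predual_pair(1) regular_fourier[of u] by auto

lemma A_smul: "smul (fourier_algebra G) = (\<lambda>c u t. c * u t)"
 by (simp add: fourier_algebra_def)

lemma the_inv_fourier:
 assumes "regular u"
 shows "the_inv_into (vecs (VN_predual G)) (fourier_fun G) u =
  (\<lambda>T. if T \<in> vecs (VN G) then pair u (coef T) else 0)"
proof -
 obtain \<phi> where \<phi>: "\<phi> \<in> vecs (VN_predual G)" "u = fourier_fun G \<phi>" using regular_fourier[OF assms] .
 show ?thesis
  using the_inv_into_f_f[OF fourier_fun_inj \<phi>(1)] predual_pair(2)[OF \<phi>(1)] unfolding \<phi>(2) by (rule trans)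
qed

lemma A_mats: "u \<in> mats (fourier_algebra G) n ==> i < n ==> j < n ==> regular (u i j)"
 using mats_in[of u "fourier_algebra G" n i j] by (simp add: A_vecs)

lemma A_mats_all:
 assumes "u \<in> mats (fourier_algebra G) n" shows "regular (u i j)"
proof (cases "i < n \<and> j < n")
 case False
 have "regular (\<lambda>s. 0)" using regular_finsupp(1)[of "\<lambda>_. 0"] by (simp add: finsupp_def)
 then show ?thesis using mats_out[OF assms False] by (simp add: zero_fun_def)
qed (use A_mats[OF assms] in auto)

text \<open>The matrix norm of the predual is tested on the unit balls of matrices over
  \<open>VN G\<close>. Since \<open>conv_op\<close> realises every bounded symbol by an operator,
  the tests can be run over symbols alone.\<close>

lemma A_mnorm:
 assumes u: "u \<in> mats (fourier_algebra G) n"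
 shows "0 \<le> mnorm (fourier_algebra G) n u"
  and "0 \<le> c ==> mnorm (fourier_algebra G) n u \<le> c \<longleftrightarrow>
   (\<forall>r \<alpha>. mbd r \<alpha> 1 \<longrightarrow> kbd ({..<n} \<times> {..<r}) (\<lambda>(i, a) (j, b). pair (u i j) (\<alpha> a b)) c)"
proof -
 let ?\<phi> = "\<lambda>i j. the_inv_into (vecs (VN_predual G)) (fourier_fun G) (u i j)"
 define Z where "Z = {cmat_norm (n * r) (n * r) (amplify n r ?\<phi> T) | r T. T \<in> mats (VN G) r \<and> mnorm (VN G) r T \<le> 1}"
 have m: "mnorm (fourier_algebra G) n u = Sup Z"
  by (simp add: fourier_algebra_def VN_predual_def os_dual_def cb_mnorm_def complex_os_def Z_def)
 have iff: "cmat_norm (n * r) (n * r) (amplify n r ?\<phi> T) \<le> c \<longleftrightarrow>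
   kbd ({..<n} \<times> {..<r}) (\<lambda>(i, a) (j, b). pair (u i j) (coef (T a b))) c"
  if T: "T \<in> mats (VN G) r" and c: "0 \<le> c" for r T c
 proof -
  let ?K = "\<lambda>(i, a) (j, b). pair (u i j) (coef (T a b))"
  have e: "amplify n r ?\<phi> T p q = ?K (p div r, p mod r) (q div r, q mod r)" if "p < n * r" "q < n * r" for p q
  proof -
   have r: "0 < r" using that by (cases r) auto
   have "p div r < n" "q div r < n" using that by (auto simp: less_mult_imp_div_less)
   moreover have "T (p mod r) (q mod r) \<in> vecs (VN G)" using mats_in[OF T] r by simp
   ultimately show ?thesis
    using that by (simp add: amplify_def pad_def the_inv_fourier[OF A_mats[OF u]])
  qed
  have "cmat_norm (n * r) (n * r) (amplify n r ?\<phi> T) \<le> c \<longleftrightarrow> kbd {..<n * r} (amplify n r ?\<phi> T) c"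
   by (rule cmat_norm_le_iff[OF c])
  also have "\<dots> \<longleftrightarrow> kbd {..<n * r} (\<lambda>p q. ?K (p div r, p mod r) (q div r, q mod r)) c"
   by (rule kbd_cong) (use e in auto)
  also have "\<dots> \<longleftrightarrow> kbd ({..<n} \<times> {..<r}) ?K c" by (rule kbd_divmod)
  finally show ?thesis .
 qed
 have iff2: "(\<forall>z\<in>Z. z \<le> c) \<longleftrightarrow>
   (\<forall>r \<alpha>. mbd r \<alpha> 1 \<longrightarrow> kbd ({..<n} \<times> {..<r}) (\<lambda>(i, a) (j, b). pair (u i j) (\<alpha> a b)) c)" if c: "0 \<le> c" for c
 proof (intro iffI allI impI)
  fix r \<alpha> assume le: "\<forall>z\<in>Z. z \<le> c" and \<alpha>: "mbd r \<alpha> 1"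
  let ?T = "pad r (\<lambda>a b. conv_op (\<alpha> a b))"
  note T = mbd_conv_op[OF \<alpha>]
  have "cmat_norm (n * r) (n * r) (amplify n r ?\<phi> ?T) \<in> Z" unfolding Z_def using T by blast
  then have "kbd ({..<n} \<times> {..<r}) (\<lambda>(i, a) (j, b). pair (u i j) (coef (?T a b))) c"
   using le iff[OF T(1) c] by blast
  then show "kbd ({..<n} \<times> {..<r}) (\<lambda>(i, a) (j, b). pair (u i j) (\<alpha> a b)) c"
  proof (rule iffD1[OF kbd_cong, rotated])
   fix p q assume "p \<in> {..<n} \<times> {..<r}" "q \<in> {..<n} \<times> {..<r}"
   then show "(case p of (i, a) => \<lambda>(j, b). pair (u i j) (coef (?T a b))) q = (case p of (i, a) => \<lambda>(j, b). pair (u i j) (\<alpha> a b)) q"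
    using T(2) by (auto intro: pair_cong)
  qed
 next
  assume *: "\<forall>r \<alpha>. mbd r \<alpha> 1 \<longrightarrow> kbd ({..<n} \<times> {..<r}) (\<lambda>(i, a) (j, b). pair (u i j) (\<alpha> a b)) c"
  show "\<forall>z\<in>Z. z \<le> c"
  proof
   fix z assume "z \<in> Z"
   then obtain r T where z: "z = cmat_norm (n * r) (n * r) (amplify n r ?\<phi> T)" and T: "T \<in> mats (VN G) r" "mnorm (VN G) r T \<le> 1"
    unfolding Z_def by blast
   have "mbd r (\<lambda>a b. coef (T a b)) 1" using VN_mnorm(2)[OF T(1), of 1] T(2) by simp
   then show "z \<le> c" unfolding z iff[OF T(1) c] using * by blast
  qed
 qed
 \<comment> \<open>A crude bound makes the set \<open>Z\<close> bounded; otherwise its supremum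
   would carry no information.\<close>
 have "\<exists>C. 0 \<le> C \<and> (\<forall>\<alpha> c. kbd (carrier G) (ker \<alpha>) c \<longrightarrow> cmod (pair (u i j) \<alpha>) \<le> C * c)" for i j
  using regular_bounded[OF A_mats_all[OF u]] by metis
 then obtain C where C: "\<And>i j. 0 \<le> C i j" "\<And>i j \<alpha> c. kbd (carrier G) (ker \<alpha>) c ==> cmod (pair (u i j) \<alpha>) \<le> C i j * c"
  by metis
 have C0: "0 \<le> (\<Sum>i<n. \<Sum>j<n. C i j)" using C(1) by (intro sum_nonneg)
 have "\<forall>z\<in>Z. z \<le> (\<Sum>i<n. \<Sum>j<n. C i j)"
  unfolding iff2[OF C0]
 proof (intro allI impI)
  fix r \<alpha> assume \<alpha>: "mbd r \<alpha> 1"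
  show "kbd ({..<n} \<times> {..<r}) (\<lambda>(i, a) (j, b). pair (u i j) (\<alpha> a b)) (\<Sum>i<n. \<Sum>j<n. C i j)"
   by (rule kbd_block) (use pair_matrix_bound[OF A_mats[OF u] C(2) C(1) \<alpha>] in auto)
 qed
 then have bdd: "bdd_above Z" by (intro bdd_aboveI) auto
 \<comment> \<open>The matrix of size 0 supplies an element of \<open>Z\<close>.\<close>
 have z: "(0 :: nat => nat => ('a => complex) => 'a => complex) \<in> mats (VN G) 0" by (rule matsI) auto
 have "mnorm (VN G) 0 0 \<le> 1" using VN_mnorm(2)[OF z, of 1] by (simp add: mbd_def kbd_def kform_def)
 with z have mem: "cmat_norm (n * 0) (n * 0) (amplify n 0 ?\<phi> 0) \<in> Z" unfolding Z_def by blast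
 show "0 \<le> mnorm (fourier_algebra G) n u" unfolding m
  using cSup_upper[OF mem bdd] cmat_norm_nonneg by (meson order_trans)
 assume c: "0 \<le> c"
 have "Sup Z \<le> c \<longleftrightarrow> (\<forall>z\<in>Z. z \<le> c)"
  by (rule cSup_le_iff[OF _ bdd]) (use mem in auto)
 then show "mnorm (fourier_algebra G) n u \<le> c \<longleftrightarrow>
   (\<forall>r \<alpha>. mbd r \<alpha> 1 \<longrightarrow> kbd ({..<n} \<times> {..<r}) (\<lambda>(i, a) (j, b). pair (u i j) (\<alpha> a b)) c)"
  unfolding m iff2[OF c] .
qed

lemma mbd_scale: "mbd r \<alpha> c ==> mbd r (\<lambda>a b s. x * \<alpha> a b s) (cmod x * c)"
proof -
 assume "mbd r \<alpha> c"
 from kbd_scale[OF this[unfolded mbd_def], of x] have "kbd ({..<r} \<times> carrier G) (\<lambda>p q. x * mker \<alpha> p q) (cmod x * c)" .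
 moreover have "(\<lambda>p q. x * mker \<alpha> p q) = mker (\<lambda>a b s. x * \<alpha> a b s)" by (auto simp: mker_def ker_def fun_eq_iff)
 ultimately show ?thesis by (simp add: mbd_def)
qed

lemma mbd_nonneg: "mbd r \<alpha> c ==> 0 \<le> c"
 unfolding mbd_def by (rule kbd_nonneg)

text \<open>Homogeneity in \<open>\<alpha>\<close>. For \<open>c = 0\<close> no rescaling is
  possible, but then the symbols vanish on the group and so do all pairings.\<close>

lemma A_mnormD:
 assumes u: "u \<in> mats (fourier_algebra G) n" and \<alpha>: "mbd r \<alpha> c"
 shows "kbd ({..<n} \<times> {..<r}) (\<lambda>(i, a) (j, b). pair (u i j) (\<alpha> a b)) (mnorm (fourier_algebra G) n u * c)"
proof (cases "c = 0")
 case True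
 have "pair (u i j) (\<alpha> a b) = 0" if "a < r" "b < r" for i j a b
 proof -
  have z: "\<alpha> a b s = 0" if "s \<in> carrier G" for s
   using mbd_entry[OF \<alpha> \<open>a < r\<close> \<open>b < r\<close> that] True by simp
  have "psum k (u i j) (\<alpha> a b) = 0" for k
   unfolding psum_def by (intro sum.neutral) (auto dest: e_carrier simp: z)
  then show ?thesis by (intro pair_eqI) simp
 qed
 then show ?thesis using True by (auto simp: kbd_zero_iff)
next
 case False
 then have c: "0 < c" using mbd_nonneg[OF \<alpha>] by simp
 let ?x = "complex_of_real (inverse c)"
 have "mbd r (\<lambda>a b s. ?x * \<alpha> a b s) (cmod ?x * c)" by (rule mbd_scale[OF \<alpha>])
 moreover have "cmod ?x * c = 1" using c by (simp add: norm_inverse norm_divide)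
 ultimately have m: "mbd r (\<lambda>a b s. ?x * \<alpha> a b s) 1" by simp
 have "kbd ({..<n} \<times> {..<r}) (\<lambda>(i, a) (j, b). pair (u i j) (\<lambda>s. ?x * \<alpha> a b s)) (mnorm (fourier_algebra G) n u)"
  using A_mnorm[OF u] m by blast
 from kbd_scale[OF this, of "complex_of_real c"]
 have "kbd ({..<n} \<times> {..<r}) (\<lambda>p q. complex_of_real c * (case p of (i, a) => \<lambda>(j, b). pair (u i j) (\<lambda>s. ?x * \<alpha> a b s)) q)
   (c * mnorm (fourier_algebra G) n u)" using c by simp
 then have "kbd ({..<n} \<times> {..<r}) (\<lambda>(i, a) (j, b). pair (u i j) (\<alpha> a b)) (c * mnorm (fourier_algebra G) n u)"
 proof (rule iffD1[OF kbd_cong, rotated])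
  fix p q assume pq: "p \<in> {..<n} \<times> {..<r}" "q \<in> {..<n} \<times> {..<r}"
  obtain i a j b where "p = (i, a)" "q = (j, b)" by fastforce
  then show "complex_of_real c * (case p of (i, a) => \<lambda>(j, b). pair (u i j) (\<lambda>s. ?x * \<alpha> a b s)) q =
    (case p of (i, a) => \<lambda>(j, b). pair (u i j) (\<alpha> a b)) q"
   using pq c by (simp add: pair_scale[OF A_mats_all[OF u] mbd_entry_kbd[OF \<alpha>]])
 qed
 then show ?thesis by (simp add: mult.commute)
qed

text \<open>The Herz-Schur bound: \<open>f\<close> acts on symbols, hence on \<open>VN G\<close>, as
  the adjoint of multiplication on \<open>A(G)\<close>. One constant for all matrix sizes expresses
  complete boundedness.\<close>

definition HS :: "('a => complex) => real => bool" where
 "HS f c \<longleftrightarrow> 0 \<le> c \<and> (\<forall>r \<alpha> d. mbd r \<alpha> d \<longrightarrow> mbd r (\<lambda>a b s. f s * \<alpha> a b s) (c * d))"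

lemma HS_kbd: "HS f c ==> kbd (carrier G) (ker \<alpha>) d ==> kbd (carrier G) (ker (\<lambda>s. f s * \<alpha> s)) (c * d)"
 unfolding kbd_1_iff_mbd HS_def by blast

lemma HS_e: "HS (e k) B"
 unfolding HS_def using B_nonneg e_bound by blast

lemma HS_mult_regular:
 assumes f: "HS f c" and u: "regular u" shows "regular (\<lambda>s. f s * u s)"
 unfolding regular_def
proof (intro conjI allI impI)
 have c: "0 \<le> c" using f by (simp add: HS_def)
 fix \<epsilon> :: real assume \<epsilon>: "0 < \<epsilon>"
 then have "0 < \<epsilon> / (c + 1)" using c by simp
 from regular_Cauchy[OF u this] obtain N where N: "\<And>k l \<alpha> d. N \<le> k ==> N \<le> l ==> kbd (carrier G) (ker \<alpha>) d ==>
   cmod (psum k u \<alpha> - psum l u \<alpha>) \<le> \<epsilon> / (c + 1) * d" by blast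
 have "\<epsilon> / (c + 1) * (c * 1) \<le> \<epsilon>" using \<epsilon> c by (simp add: field_simps)
 then show "\<exists>N. \<forall>k\<ge>N. \<forall>l\<ge>N. \<forall>\<alpha>. kbd (carrier G) (ker \<alpha>) 1 \<longrightarrow>
   cmod (psum k (\<lambda>s. f s * u s) \<alpha> - psum l (\<lambda>s. f s * u s) \<alpha>) \<le> \<epsilon>"
  unfolding psum_mult using N HS_kbd[OF f] by (meson order_trans)
qed (simp add: regular_out[OF u])

lemma multiplierD:
 assumes "multiplier G f" "regular u" shows "regular (\<lambda>s. f s * u s)"
proof -
 have "mult_op G f u \<in> vecs (fourier_algebra G)"
  using assms by (auto simp: multiplier_def A_vecs)
 then show ?thesis using assms(2) by (simp add: A_vecs mult_op_def)
qed

lemma lin_on_mult_op: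
 assumes "multiplier G f"
 shows "lin_on (fourier_algebra G) (fourier_algebra G) (mult_op G f)"
 unfolding lin_on_def
proof (intro conjI ballI allI)
 fix x assume x: "x \<in> vecs (fourier_algebra G)"
 show "mult_op G f x \<in> vecs (fourier_algebra G)" using assms x by (auto simp: multiplier_def)
 show "mult_op G f (smul (fourier_algebra G) c x) = smul (fourier_algebra G) c (mult_op G f x)" for c
  using x regular_scale[of x c] by (simp add: mult_op_def A_vecs A_smul mult.left_commute)
 fix y assume y: "y \<in> vecs (fourier_algebra G)"
 have "x + y \<in> vecs (fourier_algebra G)" using regular_add[of x y] x y by (simp add: A_vecs plus_fun_def)
 then show "mult_op G f (x + y) = mult_op G f x + mult_op G f y"
  using x y by (simp add: mult_op_def fun_eq_iff algebra_simps)
qed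

lemma M_vecs:
 "f \<in> vecs (M_cb G) \<longleftrightarrow> multiplier G f \<and>
  (\<exists>C\<ge>0. \<forall>n. \<forall>u\<in>mats (fourier_algebra G) n. mnorm (fourier_algebra G) n (\<lambda>i j s. f s * u i j s) \<le> C * mnorm (fourier_algebra G) n u)"
proof -
 have e: "(\<lambda>i j. mult_op G f (u i j)) = (\<lambda>i j s. f s * u i j s)" if "u \<in> mats (fourier_algebra G) n" for n u
  using A_mats_all[OF that] by (simp add: mult_op_def A_vecs)
 have "(\<exists>C. \<forall>n. \<forall>x\<in>mats (fourier_algebra G) n. mnorm (fourier_algebra G) n (\<lambda>i j. mult_op G f (x i j)) \<le> C * mnorm (fourier_algebra G) n x)
  \<longleftrightarrow> (\<exists>C\<ge>0. \<forall>n. \<forall>u\<in>mats (fourier_algebra G) n. mnorm (fourier_algebra G) n (\<lambda>i j s. f s * u i j s) \<le> C * mnorm (fourier_algebra G) n u)"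
 proof
  assume "\<exists>C. \<forall>n. \<forall>x\<in>mats (fourier_algebra G) n. mnorm (fourier_algebra G) n (\<lambda>i j. mult_op G f (x i j)) \<le> C * mnorm (fourier_algebra G) n x"
  then obtain C where C: "\<And>n x. x \<in> mats (fourier_algebra G) n ==>
   mnorm (fourier_algebra G) n (\<lambda>i j. mult_op G f (x i j)) \<le> C * mnorm (fourier_algebra G) n x" by blast
  have "mnorm (fourier_algebra G) n (\<lambda>i j s. f s * u i j s) \<le> \<bar>C\<bar> * mnorm (fourier_algebra G) n u"
   if u: "u \<in> mats (fourier_algebra G) n" for n u
  proof -
   have "mnorm (fourier_algebra G) n (\<lambda>i j s. f s * u i j s) \<le> C * mnorm (fourier_algebra G) n u"
    using C[OF u] unfolding e[OF u] .
   also have "\<dots> \<le> \<bar>C\<bar> * mnorm (fourier_algebra G) n u" by (rule mult_right_mono[OF _ A_mnorm(1)[OF u]]) simp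
   finally show ?thesis .
  qed
  then show "\<exists>C\<ge>0. \<forall>n. \<forall>u\<in>mats (fourier_algebra G) n. mnorm (fourier_algebra G) n (\<lambda>i j s. f s * u i j s) \<le> C * mnorm (fourier_algebra G) n u"
   by (intro exI[of _ "\<bar>C\<bar>"]) auto
 next
  assume "\<exists>C\<ge>0. \<forall>n. \<forall>u\<in>mats (fourier_algebra G) n. mnorm (fourier_algebra G) n (\<lambda>i j s. f s * u i j s) \<le> C * mnorm (fourier_algebra G) n u"
  then obtain C where C: "\<And>n u. u \<in> mats (fourier_algebra G) n ==>
   mnorm (fourier_algebra G) n (\<lambda>i j s. f s * u i j s) \<le> C * mnorm (fourier_algebra G) n u" by blast
  show "\<exists>C. \<forall>n. \<forall>x\<in>mats (fourier_algebra G) n. mnorm (fourier_algebra G) n (\<lambda>i j. mult_op G f (x i j)) \<le> C * mnorm (fourier_algebra G) n x"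
  proof (intro exI allI ballI)
   fix n x assume x: "x \<in> mats (fourier_algebra G) n"
   show "mnorm (fourier_algebra G) n (\<lambda>i j. mult_op G f (x i j)) \<le> C * mnorm (fourier_algebra G) n x"
    unfolding e[OF x] by (rule C[OF x])
  qed
 qed
 then show ?thesis unfolding M_cb_def cb_on_def using lin_on_mult_op[of f] by auto
qed

lemma M_multiplier: "f \<in> vecs (M_cb G) ==> multiplier G f"
 by (simp add: M_vecs)

lemma M_regular: "f \<in> vecs (M_cb G) ==> regular u ==> regular (\<lambda>s. f s * u s)"
 using M_multiplier multiplierD by blast

lemma M_out: "f \<in> vecs (M_cb G) ==> s \<notin> carrier G ==> f s = 0"
 by (simp add: M_vecs multiplier_def)

lemma mult_mats:
 assumes "f \<in> vecs (M_cb G)" "u \<in> mats (fourier_algebra G) n"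
 shows "(\<lambda>i j s. f s * u i j s) \<in> mats (fourier_algebra G) n"
 using A_mats_all[OF assms(2)] mats_out[OF assms(2)] M_regular[OF assms(1)]
 by (intro matsI) (auto simp: A_vecs fun_eq_iff)

text \<open>By \<open>pair_mult\<close> the multiplier can be moved from the function to the symbol,
  so a bound for matrices over \<open>VN G\<close> is a bound on the predual.\<close>

lemma HS_M:
 assumes f: "HS f c" and f0: "\<And>s. s \<notin> carrier G ==> f s = 0"
 shows "f \<in> vecs (M_cb G)"
proof -
 have c: "0 \<le> c" using f by (simp add: HS_def)
 have mult: "multiplier G f"
  unfolding multiplier_def using HS_mult_regular[OF f] f0 by (auto simp: A_vecs mult_op_def)
 have "mnorm (fourier_algebra G) n (\<lambda>i j s. f s * u i j s) \<le> c * mnorm (fourier_algebra G) n u"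
  if u: "u \<in> mats (fourier_algebra G) n" for n u
 proof -
  have m: "(\<lambda>i j s. f s * u i j s) \<in> mats (fourier_algebra G) n"
   using A_mats_all[OF u] mats_out[OF u] multiplierD[OF mult]
   by (intro matsI) (auto simp: A_vecs fun_eq_iff)
  have n0: "0 \<le> c * mnorm (fourier_algebra G) n u" using c A_mnorm(1)[OF u] by simp
  show ?thesis
   unfolding A_mnorm(2)[OF m n0]
  proof (intro allI impI)
   fix r \<alpha> assume "mbd r \<alpha> 1"
   then have "mbd r (\<lambda>a b s. f s * \<alpha> a b s) (c * 1)" using f unfolding HS_def by blast
   from A_mnormD[OF u this]
   show "kbd ({..<n} \<times> {..<r}) (\<lambda>(i, a) (j, b). pair (\<lambda>s. f s * u i j s) (\<alpha> a b)) (c * mnorm (fourier_algebra G) n u)"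
    by (simp add: pair_mult mult.commute)
  qed
 qed
 then show ?thesis unfolding M_vecs using mult c by blast
qed

lemma kbd_assoc:
 fixes n m r :: nat
 shows "kbd ({..<n * m} \<times> {..<r}) (\<lambda>(p, a) (q, b). K (p div m, p mod m, a) (q div m, q mod m, b)) c \<longleftrightarrow>
  kbd ({..<n} \<times> {..<m} \<times> {..<r}) K c"
proof -
 have b: "bij_betw (\<lambda>(p, a). (p div m, p mod m, a)) ({..<n * m} \<times> {..<r}) ({..<n} \<times> {..<m} \<times> {..<r})"
 proof (rule bij_betwI[where g = "\<lambda>(i, k, a). (i * m + k, a)"])
  show "(\<lambda>(p, a). (p div m, p mod m, a)) \<in> {..<n * m} \<times> {..<r} \<rightarrow> {..<n} \<times> {..<m} \<times> {..<r}"
  proof (rule funcsetI)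
   fix x assume "x \<in> {..<n * m} \<times> {..<r}"
   then obtain p a where x: "x = (p, a)" "p < n * m" "a < r" by auto
   then have "0 < m" by (cases m) auto
   then show "(case x of (p, a) => (p div m, p mod m, a)) \<in> {..<n} \<times> {..<m} \<times> {..<r}"
    using x by (simp add: less_mult_imp_div_less)
  qed
  show "(\<lambda>(i, k, a). (i * m + k, a)) \<in> {..<n} \<times> {..<m} \<times> {..<r} \<rightarrow> {..<n * m} \<times> {..<r}"
  proof (rule funcsetI)
   fix x assume "x \<in> {..<n} \<times> {..<m} \<times> {..<r}"
   then obtain i k a where x: "x = (i, k, a)" "i < n" "k < m" "a < r" by auto
   have "i * m + k < i * m + m" using x by simp
   also have "\<dots> \<le> n * m" using x(2) by (metis Suc_leI add.commute mult_Suc mult_le_mono1)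
   finally show "(case x of (i, k, a) => (i * m + k, a)) \<in> {..<n * m} \<times> {..<r}" by (simp add: x)
  qed
 qed auto
 have "(\<lambda>(p, a) (q, b). K (p div m, p mod m, a) (q div m, q mod m, b)) =
   (\<lambda>p q. K (case p of (p, a) => (p div m, p mod m, a)) (case q of (p, a) => (p div m, p mod m, a)))"
  by (auto simp: fun_eq_iff)
 then show ?thesis using kbd_reindex_bij[OF b, of K c] by simp
qed

text \<open>The three index slots belong to the matrix of multipliers, the matrix over the Fourier
  algebra and the matrix of symbols that tests the result.\<close>

definition act :: "(nat => nat => 'a => complex) => (nat => nat => 'a => complex) => (nat => nat => 'a => complex) =>
  nat \<times> nat \<times> nat => nat \<times> nat \<times> nat => complex" where
 "act f u \<alpha> = (\<lambda>(i, k, a) (j, l, b). pair (\<lambda>s. f i j s * u k l s) (\<alpha> a b))"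

lemma amplify_mult:
 assumes f: "f \<in> mats (M_cb G) n" and u: "u \<in> mats (fourier_algebra G) m"
 shows "amplify n m (\<lambda>i j. mult_op G (f i j)) u = pad (n * m) (\<lambda>p q s. f (p div m) (q div m) s * u (p mod m) (q mod m) s)"
  and "amplify n m (\<lambda>i j. mult_op G (f i j)) u \<in> mats (fourier_algebra G) (n * m)"
proof -
 show e: "amplify n m (\<lambda>i j. mult_op G (f i j)) u = pad (n * m) (\<lambda>p q s. f (p div m) (q div m) s * u (p mod m) (q mod m) s)"
  unfolding amplify_def using A_mats_all[OF u] by (simp add: mult_op_def A_vecs)
 show "amplify n m (\<lambda>i j. mult_op G (f i j)) u \<in> mats (fourier_algebra G) (n * m)"
  unfolding e
 proof (rule mats_pad)
  fix p q assume pq: "p < n * m" "q < n * m"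
  have "f (p div m) (q div m) \<in> vecs (M_cb G)"
   using pq by (intro mats_in[OF f]) (auto simp: less_mult_imp_div_less)
  then show "(\<lambda>s. f (p div m) (q div m) s * u (p mod m) (q mod m) s) \<in> vecs (fourier_algebra G)"
   using M_regular A_mats_all[OF u] by (simp add: A_vecs)
 qed
qed

lemma amplify_norm_iff:
 assumes f: "f \<in> mats (M_cb G) n" and u: "u \<in> mats (fourier_algebra G) m" and c: "0 \<le> c"
 shows "mnorm (fourier_algebra G) (n * m) (amplify n m (\<lambda>i j. mult_op G (f i j)) u) \<le> c \<longleftrightarrow>
  (\<forall>r \<alpha>. mbd r \<alpha> 1 \<longrightarrow> kbd ({..<n} \<times> {..<m} \<times> {..<r}) (act f u \<alpha>) c)"
proof -
 let ?U = "amplify n m (\<lambda>i j. mult_op G (f i j)) u"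
 have "kbd ({..<n * m} \<times> {..<r}) (\<lambda>(p, a) (q, b). pair (?U p q) (\<alpha> a b)) c \<longleftrightarrow>
  kbd ({..<n} \<times> {..<m} \<times> {..<r}) (act f u \<alpha>) c" for r \<alpha>
 proof -
  have "kbd ({..<n * m} \<times> {..<r}) (\<lambda>(p, a) (q, b). pair (?U p q) (\<alpha> a b)) c \<longleftrightarrow>
   kbd ({..<n * m} \<times> {..<r}) (\<lambda>(p, a) (q, b). act f u \<alpha> (p div m, p mod m, a) (q div m, q mod m, b)) c"
   by (rule kbd_cong) (auto simp: amplify_mult(1)[OF f u] pad_def act_def)
  also have "\<dots> \<longleftrightarrow> kbd ({..<n} \<times> {..<m} \<times> {..<r}) (act f u \<alpha>) c" by (rule kbd_assoc)
  finally show ?thesis .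
 qed
 note e = this
 show ?thesis unfolding A_mnorm(2)[OF amplify_mult(2)[OF f u] c] by (simp only: e)
qed

text \<open>The norm of \<open>CB\<close> is a supremum over matrices \<open>u\<close>, and the norm
  of each amplification is in turn tested by symbols. A crude bound built from the entries shows
  that the outer supremum is finite.\<close>

lemma M_mnorm:
 assumes f: "f \<in> mats (M_cb G) n"
 shows "0 \<le> mnorm (M_cb G) n f"
  and "0 \<le> c ==> mnorm (M_cb G) n f \<le> c \<longleftrightarrow>
   (\<forall>m u r \<alpha>. u \<in> mats (fourier_algebra G) m \<longrightarrow> mnorm (fourier_algebra G) m u \<le> 1 \<longrightarrow> mbd r \<alpha> 1 \<longrightarrow>
     kbd ({..<n} \<times> {..<m} \<times> {..<r}) (act f u \<alpha>) c)"
proof -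
 define Z where "Z = {mnorm (fourier_algebra G) (n * m) (amplify n m (\<lambda>i j. mult_op G (f i j)) u) | m u.
  u \<in> mats (fourier_algebra G) m \<and> mnorm (fourier_algebra G) m u \<le> 1}"
 have m: "mnorm (M_cb G) n f = Sup Z" by (simp add: M_cb_def CB_def cb_mnorm_def Z_def)
 have iff: "(\<forall>z\<in>Z. z \<le> c) \<longleftrightarrow>
   (\<forall>m u r \<alpha>. u \<in> mats (fourier_algebra G) m \<longrightarrow> mnorm (fourier_algebra G) m u \<le> 1 \<longrightarrow> mbd r \<alpha> 1 \<longrightarrow>
     kbd ({..<n} \<times> {..<m} \<times> {..<r}) (act f u \<alpha>) c)" if c: "0 \<le> c" for c
  unfolding Z_def using amplify_norm_iff[OF f _ c] by blast
 define P where "P i j C \<longleftrightarrow> 0 \<le> C \<and> (\<forall>m. \<forall>u\<in>mats (fourier_algebra G) m.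
   mnorm (fourier_algebra G) m (\<lambda>k l s. f i j s * u k l s) \<le> C * mnorm (fourier_algebra G) m u)" for i j C
 define C where "C i j = (SOME C. P i j C)" for i j
 have "P i j (C i j)" if "i < n" "j < n" for i j
  unfolding C_def
 proof (rule someI_ex)
  show "\<exists>C. P i j C" using mats_in[OF f that] unfolding M_vecs P_def by blast
 qed
 then have C: "\<And>i j. i < n ==> j < n ==> 0 \<le> C i j"
  "\<And>i j m u. i < n ==> j < n ==> u \<in> mats (fourier_algebra G) m ==>
    mnorm (fourier_algebra G) m (\<lambda>k l s. f i j s * u k l s) \<le> C i j * mnorm (fourier_algebra G) m u"
  unfolding P_def by blast+
 have C0: "0 \<le> (\<Sum>i<n. \<Sum>j<n. C i j)" using C(1) by (intro sum_nonneg) auto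
 have "\<forall>z\<in>Z. z \<le> (\<Sum>i<n. \<Sum>j<n. C i j)"
  unfolding iff[OF C0]
 proof (intro allI impI)
  fix m u r \<alpha> assume u: "u \<in> mats (fourier_algebra G) m" "mnorm (fourier_algebra G) m u \<le> 1" and \<alpha>: "mbd r \<alpha> 1"
  have "kbd ({..<n} \<times> ({..<m} \<times> {..<r})) (\<lambda>(i, p) (j, q). (\<lambda>(k, a) (l, b). pair (\<lambda>s. f i j s * u k l s) (\<alpha> a b)) p q) (\<Sum>i<n. \<Sum>j<n. C i j)"
  proof (rule kbd_block)
   fix i j assume "i \<in> {..<n}" "j \<in> {..<n}"
   then have ij: "i < n" "j < n" by auto
   have "mnorm (fourier_algebra G) m (\<lambda>k l s. f i j s * u k l s) \<le> C i j * mnorm (fourier_algebra G) m u"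
    by (rule C(2)[OF ij u(1)])
   also have "\<dots> \<le> C i j" using u(2) C(1)[OF ij] by (rule mult_left_le)
   finally show "kbd ({..<m} \<times> {..<r}) (\<lambda>(k, a) (l, b). pair (\<lambda>s. f i j s * u k l s) (\<alpha> a b)) (C i j)"
    using A_mnorm(2)[OF mult_mats[OF mats_in[OF f ij] u(1)] C(1)[OF ij]] \<alpha> by blast
  qed simp
  then show "kbd ({..<n} \<times> {..<m} \<times> {..<r}) (act f u \<alpha>) (\<Sum>i<n. \<Sum>j<n. C i j)"
   by (rule iffD1[OF kbd_cong, rotated]) (auto simp: act_def)
 qed
 then have bdd: "bdd_above Z" by (intro bdd_aboveI) auto
 have z0: "(0 :: nat => nat => 'a => complex) \<in> mats (fourier_algebra G) 0" by (intro matsI) auto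
 have "mnorm (fourier_algebra G) 0 0 \<le> 1"
  using A_mnorm(2)[OF z0, of 1] by (simp add: kbd_def kform_def)
 then have mem: "mnorm (fourier_algebra G) (n * 0) (amplify n 0 (\<lambda>i j. mult_op G (f i j)) 0) \<in> Z"
  unfolding Z_def using z0 by blast
 show "0 \<le> mnorm (M_cb G) n f" unfolding m
  using cSup_upper[OF mem bdd] A_mnorm(1)[OF amplify_mult(2)[OF f z0]] by linarith
 assume c: "0 \<le> c"
 have "Sup Z \<le> c \<longleftrightarrow> (\<forall>z\<in>Z. z \<le> c)"
  by (rule cSup_le_iff[OF _ bdd]) (use mem in auto)
 then show "mnorm (M_cb G) n f \<le> c \<longleftrightarrow>
   (\<forall>m u r \<alpha>. u \<in> mats (fourier_algebra G) m \<longrightarrow> mnorm (fourier_algebra G) m u \<le> 1 \<longrightarrow> mbd r \<alpha> 1 \<longrightarrow>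
     kbd ({..<n} \<times> {..<m} \<times> {..<r}) (act f u \<alpha>) c)"
  unfolding m iff[OF c] .
qed

end

text \<open>A limit of bounds is a bound; this removes the \<open>\<epsilon>\<close> left by
  approximations.\<close>

lemma kbd_closed:
 assumes "(g \<longlongrightarrow> c) (at_right 0)" "\<And>\<epsilon>::real. 0 < \<epsilon> ==> kbd S K (g \<epsilon>)"
 shows "kbd S K c"
 unfolding kbd_def
proof (intro conjI allI impI)
 have ev: "\<forall>\<^sub>F \<epsilon> in at_right 0. P (g \<epsilon>)" if "\<And>\<epsilon>::real. 0 < \<epsilon> ==> P (g \<epsilon>)" for P
  using that by (auto simp: eventually_at_right_field intro: exI[of _ 1])
 show "0 \<le> c" by (rule tendsto_lowerbound[OF assms(1) ev]) (use assms(2) kbd_nonneg in auto)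
 fix F x y assume F: "finite F" "F \<subseteq> S"
 have "((\<lambda>\<epsilon>. g \<epsilon> * nrm x F * nrm y F) \<longlongrightarrow> c * nrm x F * nrm y F) (at_right 0)"
  by (intro tendsto_mult assms(1) tendsto_const)
 then show "cmod (kform F K x y) \<le> c * nrm x F * nrm y F"
  by (rule tendsto_lowerbound[OF _ ev[of "\<lambda>z. cmod (kform F K x y) \<le> z * nrm x F * nrm y F"]])
   (use kbdD[OF assms(2) F] in auto)
qed

section \<open>Matrices of Herz-Schur multipliers and the inclusion of the Fourier algebra\<close>

context approx_group begin

text \<open>Matrix form of the Herz-Schur condition: at each point of the kernel the entries of
  multiplier and operator matrix are multiplied, while their matrix indices form a tensor
  product.\<close>

definition HSm :: "nat => (nat => nat => 'a => complex) => real => bool" where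
 "HSm q f c \<longleftrightarrow> 0 \<le> c \<and> (\<forall>r \<alpha> d. mbd r \<alpha> d \<longrightarrow>
   kbd ({..<q} \<times> {..<r} \<times> carrier G) (\<lambda>(i, a, s) (j, b, t). ker (f i j) s t * ker (\<alpha> a b) s t) (c * d))"

lemma HSm_unitI:
 assumes c: "0 \<le> c" and h: "\<And>r \<alpha>. mbd r \<alpha> 1 ==>
  kbd ({..<q} \<times> {..<r} \<times> carrier G) (\<lambda>(i, a, s) (j, b, t). ker (f i j) s t * ker (\<alpha> a b) s t) c"
 shows "HSm q f c"
 unfolding HSm_def
proof (intro conjI allI impI c)
 fix r \<alpha> d assume \<alpha>: "mbd r \<alpha> d"
 show "kbd ({..<q} \<times> {..<r} \<times> carrier G) (\<lambda>(i, a, s) (j, b, t). ker (f i j) s t * ker (\<alpha> a b) s t) (c * d)"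
 \<comment> \<open>\<open>d + \<epsilon>\<close> in place of \<open>d\<close> keeps the rescaling
   possible when \<open>d = 0\<close>.\<close>
 proof (rule kbd_closed[where g = "\<lambda>\<epsilon>. c * (d + \<epsilon>)"])
  show "((\<lambda>\<epsilon>. c * (d + \<epsilon>)) \<longlongrightarrow> c * d) (at_right 0)" by (auto intro!: tendsto_eq_intros)
  fix \<epsilon> :: real assume \<epsilon>: "0 < \<epsilon>"
  then have p: "0 < d + \<epsilon>" using mbd_nonneg[OF \<alpha>] by simp
  define x where "x = complex_of_real (inverse (d + \<epsilon>))"
  have x: "cmod x = inverse (d + \<epsilon>)" unfolding x_def norm_of_real using p by simp
  have x1: "complex_of_real (d + \<epsilon>) * x = 1" unfolding x_def of_real_mult[symmetric] using p by simp
  have "cmod x * d \<le> 1" unfolding x using p \<epsilon> by (simp add: field_simps)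
  with mbd_scale[OF \<alpha>, of x] have "mbd r (\<lambda>a b s. x * \<alpha> a b s) 1" unfolding mbd_def by (rule kbd_mono)
  from kbd_scale[OF h[OF this], of "complex_of_real (d + \<epsilon>)"]
  have "kbd ({..<q} \<times> {..<r} \<times> carrier G) (\<lambda>P Q. complex_of_real (d + \<epsilon>) * (\<lambda>(i, a, s) (j, b, t). ker (f i j) s t * ker (\<lambda>s. x * \<alpha> a b s) s t) P Q) ((d + \<epsilon>) * c)"
   unfolding norm_of_real using p by simp
  also have "(\<lambda>P Q. complex_of_real (d + \<epsilon>) * (\<lambda>(i, a, s) (j, b, t). ker (f i j) s t * ker (\<lambda>s. x * \<alpha> a b s) s t) P Q) =
    (\<lambda>(i, a, s) (j, b, t). (complex_of_real (d + \<epsilon>) * x) * (ker (f i j) s t * ker (\<alpha> a b) s t))"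
   by (auto simp: fun_eq_iff ker_def)
  finally show "kbd ({..<q} \<times> {..<r} \<times> carrier G) (\<lambda>(i, a, s) (j, b, t). ker (f i j) s t * ker (\<alpha> a b) s t) (c * (d + \<epsilon>))"
   unfolding x1 by (simp add: mult.commute)
 qed
qed

lemma delta_finsupp: "s \<in> carrier G ==> finsupp G (\<lambda>t. c * delta s t)"
 by (auto simp: finsupp_def delta_def)

lemma pair_mult_delta:
 assumes "g \<in> carrier G" shows "pair (\<lambda>s. f s * delta g s) \<beta> = f g * \<beta> g"
proof -
 have "(\<lambda>s. f s * delta g s) = (\<lambda>s. f g * delta g s)" by (auto simp: delta_def)
 then have "pair (\<lambda>s. f s * delta g s) \<beta> = (\<Sum>t | f g * delta g t \<noteq> 0. \<beta> t * (f g * delta g t))"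
  using regular_finsupp(2)[OF delta_finsupp[OF assms, of "f g"]] by simp
 also have "\<dots> = (\<Sum>t\<in>{g}. \<beta> t * (f g * delta g t))" by (rule sum.mono_neutral_left) (auto simp: delta_def)
 finally show ?thesis by (simp add: delta_def)
qed

text \<open>Apply the multiplier to the matrix \<open>[\<delta>(h k h l\<inverse>)]\<close>, which lies in the unit ball.\<close>

lemma mnorm_HSm:
 assumes f: "f \<in> mats (M_cb G) q" and c: "mnorm (M_cb G) q f \<le> c"
 shows "HSm q f c"
proof (rule HSm_unitI)
 show c0: "0 \<le> c" using M_mnorm(1)[OF f] c by linarith
 fix r \<alpha> assume \<alpha>: "mbd r \<alpha> 1"
 show "kbd ({..<q} \<times> {..<r} \<times> carrier G) (\<lambda>(i, a, s) (j, b, t). ker (f i j) s t * ker (\<alpha> a b) s t) c"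
 proof (rule kbd_localI[OF c0])
  fix F assume F: "finite F" "F \<subseteq> {..<q} \<times> {..<r} \<times> carrier G"
  define T where "T = (\<lambda>(i, a, s). s) ` F"
  have T: "finite T" "T \<subseteq> carrier G" using F by (auto simp: T_def)
  define m where "m = card T"
  obtain h where h: "bij_betw h {..<m} T" using ex_bij_betw_nat_finite[OF T(1)] by (auto simp: m_def atLeast0LessThan)
  have hG: "h k \<in> carrier G" if "k < m" for k using bij_betwE[OF h] T(2) that by blast
  define u where "u = pad m (\<lambda>k l. delta (h k \<otimes> inv (h l)))"
  have um: "u \<in> mats (fourier_algebra G) m"
   unfolding u_def
  proof (rule mats_pad)
   fix k l assume kl: "k < m" "l < m"
   have "finsupp G (delta (h k \<otimes> inv (h l)))" using delta_finsupp[of "h k \<otimes> inv (h l)" 1] hG kl by simp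
   then show "delta (h k \<otimes> inv (h l)) \<in> vecs (fourier_algebra G)" unfolding A_vecs by (rule regular_finsupp(1))
  qed
  have pu: "pair (\<lambda>s. g s * u k l s) \<beta> = g (h k \<otimes> inv (h l)) * \<beta> (h k \<otimes> inv (h l))" if "k < m" "l < m" for g k l \<beta>
   using that hG by (simp add: u_def pad_def pair_mult_delta)
  \<comment> \<open>Pairing \<open>u\<close> with a symbol matrix reproduces a finite section of the
    kernel of that matrix, over the elements of \<open>T\<close>.\<close>
  have "mnorm (fourier_algebra G) m u \<le> 1"
   unfolding A_mnorm(2)[OF um zero_le_one]
  proof (intro allI impI)
   fix r \<alpha> assume "mbd r \<alpha> 1"
   then have "kbd ({..<m} \<times> {..<r}) (\<lambda>P Q. mker \<alpha> ((\<lambda>(k, a). (a, h k)) P) ((\<lambda>(k, a). (a, h k)) Q)) 1"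
    unfolding mbd_def by (rule kbd_reindex) (use h hG in \<open>auto simp: inj_on_def bij_betw_def\<close>)
   then show "kbd ({..<m} \<times> {..<r}) (\<lambda>(i, a) (j, b). pair (u i j) (\<alpha> a b)) 1"
    by (rule iffD1[OF kbd_cong, rotated]) (use pu[of _ _ "\<lambda>_. 1"] in \<open>auto simp: mker_def ker_def\<close>)
  qed
  then have "kbd ({..<q} \<times> {..<m} \<times> {..<r}) (act f u \<alpha>) c" using M_mnorm(2)[OF f c0] c um \<alpha> by blast
  moreover define h' where "h' = inv_into {..<m} h"
  have h': "h' s < m" "h (h' s) = s" if "s \<in> T" for s
   using bij_betwE[OF bij_betw_inv_into[OF h]] bij_betw_inv_into_right[OF h] that by (auto simp: h'_def)
  have FT: "s \<in> T" if "(i, a, s) \<in> F" for i a s using that by (force simp: T_def)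
  \<comment> \<open>Keeping only those triples whose middle index is the number \<open>h' s\<close>
    of the group element compresses \<open>act f u \<alpha>\<close> to the kernel sought.\<close>
  ultimately have "kbd F (\<lambda>P Q. act f u \<alpha> ((\<lambda>(i, a, s). (i, h' s, a)) P) ((\<lambda>(i, a, s). (i, h' s, a)) Q)) c"
  proof (elim kbd_reindex)
   show "inj_on (\<lambda>(i, a, s). (i, h' s, a)) F"
    by (rule inj_on_inverseI[where g = "\<lambda>(i, k, a). (i, a, h k)"]) (use h'(2) FT in auto)
   show "(\<lambda>(i, a, s). (i, h' s, a)) ` F \<subseteq> {..<q} \<times> {..<m} \<times> {..<r}" using h'(1) FT F(2) by force
  qed
  then show "kbd F (\<lambda>(i, a, s) (j, b, t). ker (f i j) s t * ker (\<alpha> a b) s t) c"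
   by (rule iffD1[OF kbd_cong, rotated]) (auto simp: act_def pu h' FT ker_def)
 qed
qed

text \<open>The products of entries of \<open>f\<close> and \<open>\<alpha>\<close> form a symbol
  matrix \<open>\<gamma>\<close> of size \<open>q * r\<close> with bound \<open>c\<close>. Pairing
  it with \<open>u\<close> and moving the multiplier back to the side of \<open>u\<close> gives
  \<open>act f u \<alpha>\<close>.\<close>

lemma HSm_mnorm:
 assumes f: "f \<in> mats (M_cb G) q" and h: "HSm q f c"
 shows "mnorm (M_cb G) q f \<le> c"
proof -
 have c: "0 \<le> c" using h by (simp add: HSm_def)
 show ?thesis
  unfolding M_mnorm(2)[OF f c]
 proof (intro allI impI)
  fix m u r \<alpha> assume u: "u \<in> mats (fourier_algebra G) m" "mnorm (fourier_algebra G) m u \<le> 1" and \<alpha>: "mbd r \<alpha> 1"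
  define \<gamma> where "\<gamma> p p' = (\<lambda>s. f (p div r) (p' div r) s * \<alpha> (p mod r) (p' mod r) s)" for p p'
  have "kbd ({..<q} \<times> {..<r} \<times> carrier G) (\<lambda>(i, a, s) (j, b, t). ker (f i j) s t * ker (\<alpha> a b) s t) (c * 1)"
   using h \<alpha> unfolding HSm_def by blast
  then have "kbd ({..<q * r} \<times> carrier G)
    (\<lambda>P Q. (\<lambda>(i, a, s) (j, b, t). ker (f i j) s t * ker (\<alpha> a b) s t)
     ((\<lambda>(p, s). (p div r, p mod r, s)) P) ((\<lambda>(p, s). (p div r, p mod r, s)) Q)) (c * 1)"
  proof (rule kbd_reindex)
   show "inj_on (\<lambda>(p, s). (p div r, p mod r, s)) ({..<q * r} \<times> carrier G)"
    by (auto simp: inj_on_def) (metis div_mult_mod_eq)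
   show "(\<lambda>(p, s). (p div r, p mod r, s)) ` ({..<q * r} \<times> carrier G) \<subseteq> {..<q} \<times> {..<r} \<times> carrier G"
   proof (rule image_subsetI)
    fix P assume "P \<in> {..<q * r} \<times> carrier G"
    then obtain p s where P: "P = (p, s)" "p < q * r" "s \<in> carrier G" by auto
    then have "0 < r" by (cases r) auto
    then show "(case P of (p, s) => (p div r, p mod r, s)) \<in> {..<q} \<times> {..<r} \<times> carrier G"
     using P by (simp add: less_mult_imp_div_less)
   qed
  qed
  then have "mbd (q * r) \<gamma> (c * 1)"
   unfolding mbd_def by (rule iffD1[OF kbd_cong, rotated]) (auto simp: mker_def ker_def \<gamma>_def)
  then have m: "mbd (q * r) \<gamma> c" by simp
  have "kbd ({..<m} \<times> {..<q * r}) (\<lambda>(i, a) (j, b). pair (u i j) (\<gamma> a b)) (mnorm (fourier_algebra G) m u * c)"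
   by (rule A_mnormD[OF u(1) m])
  then have "kbd ({..<m} \<times> {..<q * r}) (\<lambda>(i, a) (j, b). pair (u i j) (\<gamma> a b)) c"
   by (rule kbd_mono) (use u(2) c in \<open>simp add: mult_left_le_one_le A_mnorm(1)[OF u(1)]\<close>)
  then have "kbd ({..<q} \<times> {..<m} \<times> {..<r}) (\<lambda>P Q. (\<lambda>(i, a) (j, b). pair (u i j) (\<gamma> a b))
    ((\<lambda>(i, k, a). (k, i * r + a)) P) ((\<lambda>(i, k, a). (k, i * r + a)) Q)) c"
  proof (rule kbd_reindex)
   show "inj_on (\<lambda>(i, k, a). (k, i * r + a)) ({..<q} \<times> {..<m} \<times> {..<r})"
   proof (rule inj_onI)
    fix P Q assume PQ: "P \<in> {..<q} \<times> {..<m} \<times> {..<r}" "Q \<in> {..<q} \<times> {..<m} \<times> {..<r}"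
     and e: "(\<lambda>(i, k, a). (k, i * r + a)) P = (\<lambda>(i, k, a). (k, i * r + a)) Q"
    obtain i k a where P: "P = (i, k, a)" "a < r" using PQ by auto
    obtain j l b where Q: "Q = (j, l, b)" "b < r" using PQ by auto
    have x: "k = l" "i * r + a = j * r + b" using e by (auto simp: P Q)
    have "i = (i * r + a) div r" "a = (i * r + a) mod r" using P by auto
    moreover have "j = (j * r + b) div r" "b = (j * r + b) mod r" using Q by auto
    ultimately show "P = Q" using x P Q by simp
   qed
   show "(\<lambda>(i, k, a). (k, i * r + a)) ` ({..<q} \<times> {..<m} \<times> {..<r}) \<subseteq> {..<m} \<times> {..<q * r}"
   proof (rule image_subsetI)
    fix P assume "P \<in> {..<q} \<times> {..<m} \<times> {..<r}"
    then obtain i k a where P: "P = (i, k, a)" "i < q" "k < m" "a < r" by auto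
    have "i * r + a < i * r + r" using P by simp
    also have "\<dots> \<le> q * r" using P by (metis Suc_leI add.commute mult_Suc mult_le_mono1)
    finally show "(case P of (i, k, a) => (k, i * r + a)) \<in> {..<m} \<times> {..<q * r}" using P by simp
   qed
  qed
  then show "kbd ({..<q} \<times> {..<m} \<times> {..<r}) (act f u \<alpha>) c"
  proof (rule iffD1[OF kbd_cong, rotated])
   fix P Q assume PQ: "P \<in> {..<q} \<times> {..<m} \<times> {..<r}" "Q \<in> {..<q} \<times> {..<m} \<times> {..<r}"
   obtain i k a where P: "P = (i, k, a)" "a < r" using PQ by auto
   obtain j l b where Q: "Q = (j, l, b)" "b < r" using PQ by auto
   show "(\<lambda>(i, a) (j, b). pair (u i j) (\<gamma> a b)) ((\<lambda>(i, k, a). (k, i * r + a)) P) ((\<lambda>(i, k, a). (k, i * r + a)) Q) = act f u \<alpha> P Q"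
    using P Q by (simp add: act_def \<gamma>_def pair_mult)
  qed
 qed
qed

lemma HS_HSm: "HS f c ==> HSm 1 (pad 1 (\<lambda>i j. f)) c"
 unfolding HSm_def
proof (intro conjI allI impI)
 assume f: "HS f c"
 then show "0 \<le> c" by (simp add: HS_def)
 fix r \<alpha> d assume "mbd r \<alpha> d"
 then have "kbd ({..<r} \<times> carrier G) (mker (\<lambda>a b s. f s * \<alpha> a b s)) (c * d)"
  using f unfolding HS_def mbd_def by blast
 then have "kbd ({..<1::nat} \<times> {..<r} \<times> carrier G) (\<lambda>p q. mker (\<lambda>a b s. f s * \<alpha> a b s) (snd p) (snd q)) (c * d)"
  by (rule kbd_reindex) (auto simp: inj_on_def)
 then show "kbd ({..<1} \<times> {..<r} \<times> carrier G) (\<lambda>(i, a, s) (j, b, t). ker (pad 1 (\<lambda>i j. f) i j) s t * ker (\<alpha> a b) s t) (c * d)"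
  by (rule iffD1[OF kbd_cong, rotated]) (auto simp: mker_def ker_def pad_def)
qed

lemma pad1_mats: "f \<in> vecs V ==> pad 1 (\<lambda>i j. f) \<in> mats V 1"
 by (rule mats_pad)

lemma HS_vnorm:
 assumes f: "HS f c" and f0: "\<And>s. s \<notin> carrier G ==> f s = 0"
 shows "vnorm (M_cb G) f \<le> c"
 unfolding vnorm_def by (rule HSm_mnorm[OF pad1_mats[OF HS_M[OF f f0]] HS_HSm[OF f]])

lemma M_HS:
 assumes f: "f \<in> vecs (M_cb G)" shows "HS f (vnorm (M_cb G) f)"
 unfolding HS_def
proof (intro conjI allI impI)
 have h: "HSm 1 (pad 1 (\<lambda>i j. f)) (vnorm (M_cb G) f)"
  unfolding vnorm_def by (rule mnorm_HSm[OF pad1_mats[OF f] order_refl])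
 then show "0 \<le> vnorm (M_cb G) f" by (simp add: HSm_def)
 fix r \<alpha> d assume "mbd r \<alpha> d"
 then have "kbd ({..<1} \<times> {..<r} \<times> carrier G) (\<lambda>(i, a, s) (j, b, t). ker (pad 1 (\<lambda>i j. f) i j) s t * ker (\<alpha> a b) s t) (vnorm (M_cb G) f * d)"
  using h by (simp add: HSm_def)
 from kbd_reindex[OF this, of "\<lambda>p. (0, p)" "{..<r} \<times> carrier G"]
 have "kbd ({..<r} \<times> carrier G) (\<lambda>p q. (\<lambda>(i, a, s) (j, b, t). ker (pad 1 (\<lambda>i j. f) i j) s t * ker (\<alpha> a b) s t) (0, p) (0, q)) (vnorm (M_cb G) f * d)"
  by (auto simp: inj_on_def)
 then show "mbd r (\<lambda>a b s. f s * \<alpha> a b s) (vnorm (M_cb G) f * d)"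
  unfolding mbd_def by (rule iffD1[OF kbd_cong, rotated]) (auto simp: pad_def mker_def ker_def)
qed

lemma HS_scale: "HS f c ==> HS (\<lambda>s. x * f s) (cmod x * c)"
 unfolding HS_def
proof (intro conjI allI impI; elim conjE)
 fix r \<alpha> d assume "\<forall>r \<alpha> d. mbd r \<alpha> d \<longrightarrow> mbd r (\<lambda>a b s. f s * \<alpha> a b s) (c * d)" "mbd r \<alpha> d"
 then have "mbd r (\<lambda>a b s. f s * \<alpha> a b s) (c * d)" by blast
 from mbd_scale[OF this, of x] show "mbd r (\<lambda>a b s. x * f s * \<alpha> a b s) (cmod x * c * d)" by (simp add: mult.assoc)
qed simp

lemma HS_times: "HS f c ==> HS g d ==> HS (\<lambda>s. f s * g s) (c * d)"
 unfolding HS_def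
proof (intro conjI allI impI; elim conjE)
 fix r \<alpha> d' assume f: "\<forall>r \<alpha> d. mbd r \<alpha> d \<longrightarrow> mbd r (\<lambda>a b s. f s * \<alpha> a b s) (c * d)"
  and g: "\<forall>r \<alpha> d'. mbd r \<alpha> d' \<longrightarrow> mbd r (\<lambda>a b s. g s * \<alpha> a b s) (d * d')" and \<alpha>: "mbd r \<alpha> d'"
 have "mbd r (\<lambda>a b s. g s * \<alpha> a b s) (d * d')" using g \<alpha> by blast
 then have "mbd r (\<lambda>a b s. f s * (g s * \<alpha> a b s)) (c * (d * d'))" by (rule f[rule_format])
 then show "mbd r (\<lambda>a b s. f s * g s * \<alpha> a b s) (c * d * d')" by (simp add: mult.assoc)
qed simp

lemma HS_lim:
 assumes "\<And>s. s \<in> carrier G ==> (\<lambda>k. f k s) \<longlonglongrightarrow> g s" and f: "\<And>k. HS (f k) c"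
 shows "HS g c"
 unfolding HS_def
proof (intro conjI allI impI)
 show "0 \<le> c" using f[of 0] by (simp add: HS_def)
 fix r \<alpha> d assume \<alpha>: "mbd r \<alpha> d"
 show "mbd r (\<lambda>a b s. g s * \<alpha> a b s) (c * d)"
  unfolding mbd_def
 proof (rule kbd_lim[where K = "\<lambda>k. mker (\<lambda>a b s. f k s * \<alpha> a b s)"])
  show "\<forall>\<^sub>F k in sequentially. kbd ({..<r} \<times> carrier G) (mker (\<lambda>a b s. f k s * \<alpha> a b s)) (c * d)"
   using f \<alpha> unfolding HS_def mbd_def by (intro always_eventually) blast
  fix p q assume "p \<in> {..<r} \<times> carrier G" "q \<in> {..<r} \<times> carrier G"
  then show "(\<lambda>k. mker (\<lambda>a b s. f k s * \<alpha> a b s) p q) \<longlonglongrightarrow> mker (\<lambda>a b s. g s * \<alpha> a b s) p q"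
   by (auto simp: mker_def ker_def intro!: tendsto_mult assms(1))
 qed simp
qed

lemma HS_mono: "HS f c ==> c \<le> d ==> HS f d"
 unfolding HS_def mbd_def
proof (intro conjI allI impI)
 assume f: "0 \<le> c \<and> (\<forall>r \<alpha> d. kbd ({..<r} \<times> carrier G) (mker \<alpha>) d \<longrightarrow> kbd ({..<r} \<times> carrier G) (mker (\<lambda>a b s. f s * \<alpha> a b s)) (c * d))"
  and cd: "c \<le> d"
 then show "0 \<le> d" by simp
 fix r \<alpha> d' assume K: "kbd ({..<r} \<times> carrier G) (mker \<alpha>) d'"
 show "kbd ({..<r} \<times> carrier G) (mker (\<lambda>a b s. f s * \<alpha> a b s)) (d * d')"
  by (rule kbd_mono[where c = "c * d'"]) (use f K kbd_nonneg[OF K] cd in \<open>auto intro: mult_right_mono\<close>)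
qed

lemma HS_add: "HS f c ==> HS g d ==> HS (\<lambda>s. f s + g s) (c + d)"
 unfolding HS_def
proof (intro conjI allI impI)
 assume f: "0 \<le> c \<and> (\<forall>r \<alpha> d. mbd r \<alpha> d \<longrightarrow> mbd r (\<lambda>a b s. f s * \<alpha> a b s) (c * d))"
  and g: "0 \<le> d \<and> (\<forall>r \<alpha> d'. mbd r \<alpha> d' \<longrightarrow> mbd r (\<lambda>a b s. g s * \<alpha> a b s) (d * d'))"
 then show "0 \<le> c + d" by simp
 fix r \<alpha> d' assume \<alpha>: "mbd r \<alpha> d'"
 have "kbd ({..<r} \<times> carrier G) (\<lambda>p q. mker (\<lambda>a b s. f s * \<alpha> a b s) p q + mker (\<lambda>a b s. g s * \<alpha> a b s) p q) (c * d' + d * d')"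
  using f g \<alpha> unfolding mbd_def by (intro kbd_add) auto
 then show "mbd r (\<lambda>a b s. (f s + g s) * \<alpha> a b s) ((c + d) * d')"
  unfolding mbd_def distrib_right by (rule iffD1[OF kbd_cong, rotated]) (auto simp: mker_def ker_def algebra_simps)
qed

text \<open>Writing \<open>om \<xi> \<eta> (s t\<^sup>-\<^sup>1)\<close> as the inner product of \<open>\<lambda>(t\<^sup>-\<^sup>1) \<xi>\<close> and \<open>\<lambda>(s\<^sup>-\<^sup>1) \<eta>\<close> makes the Schur test applicable.\<close>

lemma HS_om:
 assumes l: "\<xi> \<in> l2 G" "\<eta> \<in> l2 G"
 shows "HS (om \<xi> \<eta>) (l2_norm G \<xi> * l2_norm G \<eta>)"
 unfolding HS_def
proof (intro conjI allI impI)
 show "0 \<le> l2_norm G \<xi> * l2_norm G \<eta>" by simp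
 fix r \<alpha> d assume \<alpha>: "mbd r \<alpha> d"
 let ?S = "{..<r} \<times> carrier G"
 let ?L = "\<lambda>t \<zeta>. left_regular G (inv t) \<zeta>"
 define Q where "Q M p q = (\<Sum>g\<in>M. cnj (?L (snd p) \<eta> g) * ?L (snd q) \<xi> g) * mker \<alpha> p q" for M and p q :: "nat \<times> 'a"
 have inner: "((\<lambda>g. cnj (?L s \<eta> g) * ?L t \<xi> g) has_sum om \<xi> \<eta> (s \<otimes> inv t)) (carrier G)"
  if s: "s \<in> carrier G" and t: "t \<in> carrier G" for s t
 proof -
  have st: "s \<otimes> inv t \<in> carrier G" using s t by simp
  note b = bij_left[of "inv s"]
  have "((\<lambda>p. left_regular G (s \<otimes> inv t) \<xi> p * cnj (\<eta> p)) has_sum om \<xi> \<eta> (s \<otimes> inv t)) (carrier G)"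
   using l2_inner_bound(1)[OF left_regular_l2[OF st l(1)] l(2)] st by (simp add: om_def l2_inner_def)
  then have "((\<lambda>g. left_regular G (s \<otimes> inv t) \<xi> (s \<otimes> g) * cnj (\<eta> (s \<otimes> g))) has_sum om \<xi> \<eta> (s \<otimes> inv t)) (carrier G)"
   using has_sum_reindex_bij_betw[OF bij_left[OF s], of "\<lambda>p. left_regular G (s \<otimes> inv t) \<xi> p * cnj (\<eta> p)"] by simp
  then show ?thesis
   by (rule has_sum_cong[THEN iffD1, rotated])
    (use s t l in \<open>simp add: left_regular_def inv_mult_group m_assoc mult_inv_cancel mult.commute\<close>)
 qed
 show "mbd r (\<lambda>a b s. om \<xi> \<eta> s * \<alpha> a b s) (l2_norm G \<xi> * l2_norm G \<eta> * d)"
  unfolding mbd_def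
 \<comment> \<open>The inner product is an infinite sum over the group. Its partial sums over finite
   \<open>M\<close> are Schur multipliers with one common bound, and the limit runs over these
   sets.\<close>
 proof (rule kbd_lim[where K = Q])
  fix p q assume "p \<in> ?S" "q \<in> ?S"
  then obtain a s b t where pq: "p = (a, s)" "q = (b, t)" "s \<in> carrier G" "t \<in> carrier G" by auto
  have "((\<lambda>M. (\<Sum>g\<in>M. cnj (?L s \<eta> g) * ?L t \<xi> g) * mker \<alpha> p q) \<longlongrightarrow> om \<xi> \<eta> (s \<otimes> inv t) * mker \<alpha> p q) (finite_subsets_at_top (carrier G))"
   using inner[OF pq(3,4)] unfolding has_sum_def by (intro tendsto_mult tendsto_const)
  then show "((\<lambda>M. Q M p q) \<longlongrightarrow> mker (\<lambda>a b s. om \<xi> \<eta> s * \<alpha> a b s) p q) (finite_subsets_at_top (carrier G))"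
   by (simp add: Q_def pq mker_def ker_def)
 next
  show "\<forall>\<^sub>F M in finite_subsets_at_top (carrier G). kbd ?S (Q M) (l2_norm G \<xi> * l2_norm G \<eta> * d)"
  proof (rule eventually_finite_subsets_at_top_weakI)
   fix M assume M: "finite M" "M \<subseteq> carrier G"
   have n0: "0 \<le> l2_norm G \<xi> * l2_norm G \<eta> * d" using mbd_nonneg[OF \<alpha>] by simp
   show "kbd ?S (Q M) (l2_norm G \<xi> * l2_norm G \<eta> * d)"
   proof (rule kbd_localI[OF n0])
    fix F assume F: "finite F" "F \<subseteq> ?S"
    have row: "nrm (\<lambda>g. \<Sum>j\<in>{()}. ?L (snd q) \<zeta> g * x j) M \<le> l2_norm G \<zeta> * nrm x {()}"
     if q: "q \<in> F" and z: "\<zeta> \<in> l2 G" for q x \<zeta>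
    proof -
     have c: "inv (snd q) \<in> carrier G" using q F by auto
     have "nrm (\<lambda>g. \<Sum>j\<in>{()}. ?L (snd q) \<zeta> g * x j) M = nrm (?L (snd q) \<zeta>) M * cmod (x ())"
      by (simp add: norm_mult L2_set_left_distrib)
     also have "\<dots> \<le> l2_norm G \<zeta> * cmod (x ())"
      using l2D[OF left_regular_l2[OF c z] M] left_regular_norm[OF c z] by (simp add: mult_right_mono)
     finally show ?thesis by simp
    qed
    have "kbd ({()} \<times> F) (\<lambda>(i, p) (j, q). (\<Sum>g\<in>M. cnj (?L (snd p) \<eta> g) * ?L (snd q) \<xi> g) * mker \<alpha> p q)
      (l2_norm G \<xi> * l2_norm G \<eta> * d)"
     by (rule kbd_schur[OF kbd_subset[OF \<alpha>[unfolded mbd_def] F(2)] F(1) _ M(1),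
        where a = "\<lambda>j g q. ?L (snd q) \<xi> g" and b = "\<lambda>j g p. ?L (snd p) \<eta> g"])
      (use row l in auto)
    then have "kbd F (\<lambda>p q. (\<lambda>(i, p) (j, q). (\<Sum>g\<in>M. cnj (?L (snd p) \<eta> g) * ?L (snd q) \<xi> g) * mker \<alpha> p q) ((), p) ((), q))
      (l2_norm G \<xi> * l2_norm G \<eta> * d)"
     by (rule kbd_reindex) (auto simp: inj_on_def)
    then show "kbd F (Q M) (l2_norm G \<xi> * l2_norm G \<eta> * d)" by (simp add: Q_def[abs_def])
   qed
  qed
 qed simp
qed

lemma HS_zero: "HS (\<lambda>s. 0) 0"
 unfolding HS_def mbd_def by (auto simp: mker_def ker_def intro!: iffD2[OF kbd_zero_iff])

lemma HS_om_sum: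
 assumes "set L \<subseteq> l2 G \<times> l2 G" shows "HS (om_sum L) (cost L)"
 using assms
proof (induction L)
 case (Cons p L)
 obtain \<xi> \<eta> where p: "p = (\<xi>, \<eta>)" by fastforce
 have "HS (\<lambda>s. om \<xi> \<eta> s + om_sum L s) (l2_norm G \<xi> * l2_norm G \<eta> + cost L)"
  using Cons p by (intro HS_add HS_om) auto
 then show ?case by (simp add: om_sum_def cost_def p)
qed (simp add: om_sum_def cost_def HS_zero)

lemma psum_pair:
 shows "finsupp G (\<lambda>s. e k s * u s)" "pair (\<lambda>s. e k s * u s) \<alpha> = psum k u \<alpha>"
proof -
 show f: "finsupp G (\<lambda>s. e k s * u s)"
  unfolding finsupp_def using finite_subset[OF _ e_finite[of k], of "{s. e k s * u s \<noteq> 0}"] by (auto dest: e_carrier)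
 have "(\<Sum>s | e k s * u s \<noteq> 0. \<alpha> s * (e k s * u s)) = (\<Sum>s | e k s \<noteq> 0. \<alpha> s * (e k s * u s))"
  by (rule sum.mono_neutral_left[OF e_finite]) auto
 then show "pair (\<lambda>s. e k s * u s) \<alpha> = psum k u \<alpha>"
  unfolding regular_finsupp(2)[OF f] psum_def by (simp only: mult_ac)
qed

text \<open>The norm of \<open>A(G)\<close> dominates the multiplier norm: a representation of cost
  below \<open>C + \<epsilon>\<close> is a Herz-Schur multiplier with that bound by
  \<open>HS_om_sum\<close>.\<close>

lemma HS_finsupp:
 assumes w: "finsupp G w" and C: "\<And>\<alpha>. kbd (carrier G) (ker \<alpha>) 1 ==> cmod (pair w \<alpha>) \<le> C" and \<epsilon>: "0 < \<epsilon>"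
 shows "HS w (C + \<epsilon>)"
proof -
 obtain L where L: "L \<in> reps w" "cost L < C + \<epsilon>"
  using small_representation[OF w _ \<epsilon>, of C] C unfolding regular_finsupp(2)[OF w] by blast
 have "HS (om_sum L) (cost L)" using L by (intro HS_om_sum) (simp add: reps_def)
 then show ?thesis using L HS_mono[of w "cost L" "C + \<epsilon>"] by (auto simp: reps_def)
qed

text \<open>For large index the truncations of \<open>u\<close> have functionals of norm at most
  \<open>C + \<epsilon> / 2\<close>, so \<open>HS_finsupp\<close> applies to them. The Herz-Schur
  bound survives the pointwise limit, and then \<open>\<epsilon>\<close> tends to 0.\<close>

lemma regular_HS:
 assumes u: "regular u" and C: "\<And>\<alpha>. kbd (carrier G) (ker \<alpha>) 1 ==> cmod (pair u \<alpha>) \<le> C"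
 shows "HS u C"
proof -
 have step: "HS u (C + \<epsilon>)" if \<epsilon>: "0 < \<epsilon>" for \<epsilon>
 proof -
  obtain N where N: "\<And>k \<alpha> c. N \<le> k ==> kbd (carrier G) (ker \<alpha>) c ==> cmod (pair u \<alpha> - psum k u \<alpha>) \<le> \<epsilon> / 2 * c"
   using pair_uniform[OF u, of "\<epsilon> / 2"] \<epsilon> by auto
  show ?thesis
  proof (rule HS_lim)
   fix s assume s: "s \<in> carrier G"
   have "(\<lambda>k. e (N + k) s * u s) \<longlonglongrightarrow> 1 * u s"
    using LIMSEQ_ignore_initial_segment[OF e_tendsto[OF s], of N]
    by (intro tendsto_mult tendsto_const) (simp add: add.commute)
   then show "(\<lambda>k. e (N + k) s * u s) \<longlonglongrightarrow> u s" by simp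
  next
   fix k
   have "HS (\<lambda>s. e (N + k) s * u s) ((C + \<epsilon> / 2) + \<epsilon> / 2)"
   proof (rule HS_finsupp[OF psum_pair(1)])
    fix \<alpha> assume K: "kbd (carrier G) (ker \<alpha>) 1"
    have "cmod (psum (N + k) u \<alpha>) \<le> cmod (pair u \<alpha>) + cmod (pair u \<alpha> - psum (N + k) u \<alpha>)"
     using norm_triangle_ineq4[of "pair u \<alpha>" "pair u \<alpha> - psum (N + k) u \<alpha>"] by simp
    then show "cmod (pair (\<lambda>s. e (N + k) s * u s) \<alpha>) \<le> C + \<epsilon> / 2"
     unfolding psum_pair(2) using C[OF K] N[OF _ K, of "N + k"] by simp
   qed (use \<epsilon> in simp)
   then show "HS (\<lambda>s. e (N + k) s * u s) (C + \<epsilon>)" by (rule HS_mono) simp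
  qed
 qed
 show ?thesis
  unfolding HS_def mbd_def
 proof (intro conjI allI impI)
  have "ker (\<lambda>_. 0) = (\<lambda>p q. 0)" by (simp add: ker_def fun_eq_iff)
  then have "kbd (carrier G) (ker (\<lambda>_. 0)) 1" using kbd_zero[of 1 "carrier G"] by simp
  from order_trans[OF norm_ge_zero C[OF this]] show "0 \<le> C" .
  fix r \<alpha> d assume K: "kbd ({..<r} \<times> carrier G) (mker \<alpha>) d"
  show "kbd ({..<r} \<times> carrier G) (mker (\<lambda>a b s. u s * \<alpha> a b s)) (C * d)"
  proof (rule kbd_closed)
   show "((\<lambda>\<epsilon>. (C + \<epsilon>) * d) \<longlongrightarrow> C * d) (at_right 0)" by (auto intro!: tendsto_eq_intros)
   show "kbd ({..<r} \<times> carrier G) (mker (\<lambda>a b s. u s * \<alpha> a b s)) ((C + \<epsilon>) * d)" if "0 < \<epsilon>" for \<epsilon>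
    using step[OF that] K unfolding HS_def mbd_def by blast
  qed
 qed
qed

lemma regular_M:
 assumes u: "regular u" shows "u \<in> vecs (M_cb G)"
proof -
 obtain C where "0 \<le> C" "\<And>\<alpha> c. kbd (carrier G) (ker \<alpha>) c ==> cmod (pair u \<alpha>) \<le> C * c"
  using regular_bounded[OF u] by blast
 then have "HS u C" by (intro regular_HS[OF u]) fastforce
 then show ?thesis by (rule HS_M) (rule regular_out[OF u])
qed

text \<open>Regularity says that the truncations tend to \<open>u\<close> in the norm of
  \<open>A(G)\<close>; by \<open>regular_HS\<close> they tend to it in the multiplier norm.\<close>

lemma e_approx:
 assumes u: "regular u" and \<epsilon>: "0 < \<epsilon>"
 obtains N where "\<And>k. N \<le> k ==> HS (\<lambda>s. u s - e k s * u s) \<epsilon>"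
proof -
 obtain N where N: "\<And>k \<alpha> c. N \<le> k ==> kbd (carrier G) (ker \<alpha>) c ==> cmod (pair u \<alpha> - psum k u \<alpha>) \<le> \<epsilon> * c"
  using pair_uniform[OF u \<epsilon>] by blast
 show thesis
 proof (rule that)
  fix k assume k: "N \<le> k"
  have r: "regular (\<lambda>s. u s + (-1) * (e k s * u s))"
   by (intro regular_add u regular_scale regular_finsupp(1) psum_pair(1))
  have "HS (\<lambda>s. u s + (-1) * (e k s * u s)) \<epsilon>"
  proof (rule regular_HS[OF r])
   fix \<alpha> assume K: "kbd (carrier G) (ker \<alpha>) 1"
   note rk = regular_finsupp(1)[OF psum_pair(1)[of k u]]
   have "pair (\<lambda>s. u s + (-1) * (e k s * u s)) \<alpha> = pair u \<alpha> - psum k u \<alpha>"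
    unfolding pair_add_left[OF u regular_scale[OF rk] K] pair_scale_left[OF rk K] psum_pair(2) by simp
   then show "cmod (pair (\<lambda>s. u s + (-1) * (e k s * u s)) \<alpha>) \<le> \<epsilon>" using N[OF k K] by simp
  qed
  then show "HS (\<lambda>s. u s - e k s * u s) \<epsilon>" by simp
 qed
qed

end

context represented_space begin

lemma pad1: "x \<in> vecs V ==> pad 1 (\<lambda>i j. x) \<in> mats V 1"
 by (rule mats_pad)

lemma vnorm_nonneg: "x \<in> vecs V ==> 0 \<le> vnorm V x"
 unfolding vnorm_def by (rule mnorm_nonneg[OF pad1])

lemma vnorm_0: "vnorm V 0 = 0"
proof -
 have "pad 1 (\<lambda>i j. 0) = (0 :: nat => nat => 'v)" by (auto simp: pad_def fun_eq_iff)
 then show ?thesis unfolding vnorm_def using mnorm_eq_0[OF pad1[OF subspace_0[OF sub]]] by simp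
qed

lemma vnorm_add:
 assumes "x \<in> vecs V" "y \<in> vecs V"
 shows "vnorm V (x + y) \<le> vnorm V x + vnorm V y"
proof -
 have "pad 1 (\<lambda>i j. x + y) = pad 1 (\<lambda>i j. x) + pad 1 (\<lambda>i j. y)" by (auto simp: pad_def fun_eq_iff)
 then show ?thesis unfolding vnorm_def using mnorm_add[OF pad1[OF assms(1)] pad1[OF assms(2)]] by metis
qed

lemma vnorm_smul:
 assumes "x \<in> vecs V" shows "vnorm V (smul V c x) = cmod c * vnorm V x"
proof -
 have "pad 1 (\<lambda>i j. smul V c x) = (\<lambda>i j. smul V c (pad 1 (\<lambda>i j. x) i j))" by (auto simp: pad_def fun_eq_iff)
 then show ?thesis unfolding vnorm_def using mnorm_smul[OF pad1[OF assms]] by metis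
qed

lemma vnorm_minus_commute:
 assumes "x \<in> vecs V" "y \<in> vecs V" shows "vnorm V (x - y) = vnorm V (y - x)"
 using vnorm_smul[OF subspace_diff[OF sub assms(2,1)], of "-1"] by simp

lemma vnorm_triangle:
 assumes "x \<in> vecs V" "y \<in> vecs V" "z \<in> vecs V"
 shows "vnorm V (x - z) \<le> vnorm V (x - y) + vnorm V (y - z)"
 using vnorm_add[OF subspace_diff[OF sub assms(1,2)] subspace_diff[OF sub assms(2,3)]] by simp

end

section \<open>The operator space structure of the multiplier algebra\<close>

context approx_group begin

text \<open>The Herz-Schur condition cut down to finite sets of group elements, because
  \<open>represented_space\<close> requires finite index sets.\<close>

definition test_set :: "(nat \<times> (nat => nat => 'a => complex) \<times> 'a set) set" where
 "test_set = {(r, \<alpha>, F). mbd r \<alpha> 1 \<and> finite F \<and> F \<subseteq> carrier G}"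

definition test_index :: "nat \<times> (nat => nat => 'a => complex) \<times> 'a set => (nat \<times> 'a) set" where
 "test_index = (\<lambda>(r, \<alpha>, F). if finite F then {..<r} \<times> F else {})"

definition test_val :: "nat \<times> (nat => nat => 'a => complex) \<times> 'a set => nat \<times> 'a => nat \<times> 'a => ('a => complex) => complex" where
 "test_val = (\<lambda>(r, \<alpha>, F) (a, s) (b, t) f. ker f s t * ker (\<alpha> a b) s t)"

lemma vs_fun: "vector_space (\<lambda>c (f :: 'a => complex) t. c * f t)"
 by (rule vector_space_pointwise)

lemma subspace_funI:
 assumes "(\<lambda>s. 0) \<in> S" "\<And>f g. f \<in> S ==> g \<in> S ==> (\<lambda>s. f s + g s) \<in> S" "\<And>c f. f \<in> S ==> (\<lambda>s. c * f s) \<in> S"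
 shows "module.subspace (\<lambda>c (f :: 'a => complex) t. c * f t) S"
proof -
 interpret vector_space "\<lambda>c (f :: 'a => complex) t. c * f t" by (rule vs_fun)
 show ?thesis using assms by (auto simp: subspace_def zero_fun_def plus_fun_def)
qed

lemma M_subspace: "module.subspace (\<lambda>c (f :: 'a => complex) t. c * f t) (vecs (M_cb G))"
proof (rule subspace_funI)
 show "(\<lambda>s. 0) \<in> vecs (M_cb G)" by (rule HS_M[OF HS_zero]) simp
 show "(\<lambda>s. f s + g s) \<in> vecs (M_cb G)" if "f \<in> vecs (M_cb G)" "g \<in> vecs (M_cb G)" for f g
  by (rule HS_M[OF HS_add[OF M_HS[OF that(1)] M_HS[OF that(2)]]]) (simp add: M_out[OF that(1)] M_out[OF that(2)])
 show "(\<lambda>s. c * f s) \<in> vecs (M_cb G)" if "f \<in> vecs (M_cb G)" for c f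
  by (rule HS_M[OF HS_scale[OF M_HS[OF that]]]) (simp add: M_out[OF that])
qed

text \<open>Stated for any subspace carrying the structure of \<open>M_cb G\<close>, so that one
  proof serves both \<open>M_cb G\<close> and \<open>A_cb G\<close>.\<close>

lemma M_represented:
 fixes V :: "('a => complex, 'z) op_space_scheme"
 assumes sub: "vecs V \<subseteq> vecs (M_cb G)" "module.subspace (\<lambda>c (f :: 'a => complex) t. c * f t) (vecs V)"
  and sm: "smul V = (\<lambda>c f t. c * f t)" and mn: "mnorm V = mnorm (M_cb G)"
 shows "represented_space V test_set test_index test_val"
proof (rule represented_space.intro)
 show "vector_space (smul V)" "module.subspace (smul V) (vecs V)" unfolding sm by (rule vs_fun, rule sub(2))
 show "finite (test_index \<theta>)" for \<theta> by (auto simp: test_index_def split: prod.split)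
 show "test_val \<theta> a b (x + y) = test_val \<theta> a b x + test_val \<theta> a b y" for \<theta> a b x y
  by (cases \<theta>; cases a; cases b) (simp add: test_val_def ker_def distrib_right)
 show "test_val \<theta> a b (smul V c x) = c * test_val \<theta> a b x" for \<theta> a b c x
  by (cases \<theta>; cases a; cases b) (simp add: test_val_def ker_def sm)
next
 fix X n assume "X \<in> mats V n"
 then have X: "X \<in> mats (M_cb G) n" using sub(1) by (auto simp: mats_def)
 show "0 \<le> mnorm V n X" unfolding mn by (rule M_mnorm(1)[OF X])
 fix c :: real assume c: "0 \<le> c"
 let ?K = "\<lambda>\<alpha>. \<lambda>(i, a, s) (j, b, t). ker (X i j) s t * ker (\<alpha> a b) s t"
 have e: "kbd ({..<n} \<times> test_index (r, \<alpha>, F)) (\<lambda>(i, a) (j, b). test_val (r, \<alpha>, F) a b (X i j)) c \<longleftrightarrow>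
   kbd ({..<n} \<times> {..<r} \<times> F) (?K \<alpha>) c" if "finite F" for r \<alpha> F
  using that unfolding test_index_def prod.case if_P[OF that] by (intro kbd_cong) (auto simp: test_val_def)
 have "mnorm V n X \<le> c \<longleftrightarrow> (\<forall>r \<alpha>. mbd r \<alpha> 1 \<longrightarrow> kbd ({..<n} \<times> {..<r} \<times> carrier G) (?K \<alpha>) c)"
 proof
  assume "mnorm V n X \<le> c"
  then have h: "HSm n X c" unfolding mn by (rule mnorm_HSm[OF X])
  show "\<forall>r \<alpha>. mbd r \<alpha> 1 \<longrightarrow> kbd ({..<n} \<times> {..<r} \<times> carrier G) (?K \<alpha>) c"
  proof (intro allI impI)
   fix r \<alpha> assume "mbd r \<alpha> 1"
   then have "kbd ({..<n} \<times> {..<r} \<times> carrier G) (?K \<alpha>) (c * 1)" using h unfolding HSm_def by blast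
   then show "kbd ({..<n} \<times> {..<r} \<times> carrier G) (?K \<alpha>) c" by simp
  qed
 next
  assume h: "\<forall>r \<alpha>. mbd r \<alpha> 1 \<longrightarrow> kbd ({..<n} \<times> {..<r} \<times> carrier G) (?K \<alpha>) c"
  show "mnorm V n X \<le> c" unfolding mn by (rule HSm_mnorm[OF X HSm_unitI[OF c]]) (rule h[rule_format])
 qed
 also have "\<dots> \<longleftrightarrow> (\<forall>r \<alpha> F. mbd r \<alpha> 1 \<longrightarrow> finite F \<longrightarrow> F \<subseteq> carrier G \<longrightarrow> kbd ({..<n} \<times> {..<r} \<times> F) (?K \<alpha>) c)"
 proof (intro iffI allI impI)
  fix r \<alpha> F assume h: "\<forall>r \<alpha>. mbd r \<alpha> 1 \<longrightarrow> kbd ({..<n} \<times> {..<r} \<times> carrier G) (?K \<alpha>) c" and \<alpha>: "mbd r \<alpha> 1" and F: "F \<subseteq> carrier G"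
  show "kbd ({..<n} \<times> {..<r} \<times> F) (?K \<alpha>) c" by (rule kbd_subset[OF h[rule_format, OF \<alpha>]]) (use F in auto)
 next
  fix r \<alpha> assume h: "\<forall>r \<alpha> F. mbd r \<alpha> 1 \<longrightarrow> finite F \<longrightarrow> F \<subseteq> carrier G \<longrightarrow> kbd ({..<n} \<times> {..<r} \<times> F) (?K \<alpha>) c"
   and \<alpha>: "mbd r \<alpha> 1"
  show "kbd ({..<n} \<times> {..<r} \<times> carrier G) (?K \<alpha>) c"
  proof (rule kbd_localI[OF c])
   fix F assume F: "finite F" "F \<subseteq> {..<n} \<times> {..<r} \<times> carrier G"
   define T where "T = (\<lambda>(i, a, s). s) ` F"
   have T: "finite T" "T \<subseteq> carrier G" "F \<subseteq> {..<n} \<times> {..<r} \<times> T" using F by (force simp: T_def)+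
   show "kbd F (?K \<alpha>) c" by (rule kbd_subset[OF h[rule_format, OF \<alpha> T(1,2)] T(3)])
  qed
 qed
 also have "\<dots> \<longleftrightarrow> (\<forall>\<theta>\<in>test_set. kbd ({..<n} \<times> test_index \<theta>) (\<lambda>(i, a) (j, b). test_val \<theta> a b (X i j)) c)"
  unfolding test_set_def using e by auto
 finally show "mnorm V n X \<le> c \<longleftrightarrow> (\<forall>\<theta>\<in>test_set. kbd ({..<n} \<times> test_index \<theta>) (\<lambda>(i, a) (j, b). test_val \<theta> a b (X i j)) c)" .
next
 fix x assume x: "x \<in> vecs V" and z: "\<And>\<theta> a b. \<theta> \<in> test_set ==> a \<in> test_index \<theta> ==> b \<in> test_index \<theta> ==> test_val \<theta> a b x = 0"
 have xm: "x \<in> vecs (M_cb G)" using x sub(1) by auto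
 have "x s = 0" for s
 proof (cases "s \<in> carrier G")
  case True
  \<comment> \<open>The 1 by 1 test given by the translation by \<open>s\<close> reads off the value
    \<open>x s\<close> in row \<open>s\<close> and neutral column.\<close>
  let ?\<theta> = "(1 :: nat, \<lambda>a b :: nat. delta s, {s, \<one>})"
  have "?\<theta> \<in> test_set" unfolding test_set_def using kbd_delta[OF True] True by (simp add: kbd_1_iff_mbd)
  then have "test_val ?\<theta> (0, s) (0, \<one>) x = 0" by (rule z) (auto simp: test_index_def)
  then show ?thesis using True by (simp add: test_val_def ker_def delta_def)
 qed (rule M_out[OF xm])
 then show "x = 0" by (simp add: fun_eq_iff)
qed

lemma M_smul: "smul (M_cb G) = (\<lambda>c f t. c * f t)"
 by (simp add: M_cb_def)

sublocale M: represented_space "M_cb G" test_set test_index test_val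
 by (rule M_represented) (auto simp: M_subspace M_smul)

text \<open>Multiplying the symbol of the translation by \<open>s\<close> leaves only the value
  \<open>f s\<close>, and that translation has norm 1.\<close>

lemma M_entry:
 assumes f: "f \<in> vecs (M_cb G)" shows "cmod (f s) \<le> vnorm (M_cb G) f"
proof (cases "s \<in> carrier G")
 case True
 from kbd_entry[OF HS_kbd[OF M_HS[OF f] kbd_delta[OF True]] True one_closed]
 show ?thesis using True by (simp add: ker_def delta_def)
qed (use M_out[OF f] M.vnorm_nonneg[OF f] in simp)

lemma M_mult:
 assumes f: "f \<in> vecs (M_cb G)" and g: "g \<in> vecs (M_cb G)"
 shows "(\<lambda>s. f s * g s) \<in> vecs (M_cb G)"
  and vnorm_mult: "vnorm (M_cb G) (\<lambda>s. f s * g s) \<le> vnorm (M_cb G) f * vnorm (M_cb G) g"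
 using HS_times[OF M_HS[OF f] M_HS[OF g]] M_out[OF f] by (auto intro!: HS_M HS_vnorm)

definition mprod :: "nat => nat => (nat => nat => 'a => complex) => (nat => nat => 'a => complex) => nat => nat => 'a => complex" where
 "mprod p q v w = pad (p * q) (\<lambda>i j s. v (i div q) (j div q) s * w (i mod q) (j mod q) s)"

lemma mprod_mats:
 assumes v: "v \<in> mats (M_cb G) p" and w: "w \<in> mats (M_cb G) q"
 shows "mprod p q v w \<in> mats (M_cb G) (p * q)"
 unfolding mprod_def
proof (rule mats_pad)
 fix i j assume ij: "i < p * q" "j < p * q"
 then have "0 < q" by (cases q) auto
 then show "(\<lambda>s. v (i div q) (j div q) s * w (i mod q) (j mod q) s) \<in> vecs (M_cb G)"
  using ij by (intro M_mult mats_in[OF v] mats_in[OF w]) (auto simp: less_mult_imp_div_less)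
qed

text \<open>A tensor product of multiplier matrices acts as a composition: \<open>w\<close> turns
  \<open>\<alpha>\<close> into the symbol matrix \<open>\<gamma>\<close> of size
  \<open>q * r\<close>, and \<open>v\<close> acts on that.\<close>

lemma HSm_mprod:
 assumes v: "HSm p v c" and w: "HSm q w d"
 shows "HSm (p * q) (mprod p q v w) (c * d)"
 unfolding HSm_def
proof (intro conjI allI impI)
 show "0 \<le> c * d" using v w by (simp add: HSm_def)
 fix r \<alpha> d' assume \<alpha>: "mbd r \<alpha> d'"
 define \<gamma> where "\<gamma> P Q = (\<lambda>s. w (P div r) (Q div r) s * \<alpha> (P mod r) (Q mod r) s)" for P Q
 have lt: "0 < y" if "x < n * y" for x n y :: nat using that by (cases y) auto
 have "kbd ({..<q} \<times> {..<r} \<times> carrier G) (\<lambda>(i, a, s) (j, b, t). ker (w i j) s t * ker (\<alpha> a b) s t) (d * d')"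
  using w \<alpha> unfolding HSm_def by blast
 then have "kbd ({..<q * r} \<times> carrier G) (\<lambda>P Q. (\<lambda>(i, a, s) (j, b, t). ker (w i j) s t * ker (\<alpha> a b) s t)
   ((\<lambda>(P, s). (P div r, P mod r, s)) P) ((\<lambda>(P, s). (P div r, P mod r, s)) Q)) (d * d')"
 proof (rule kbd_reindex)
  show "inj_on (\<lambda>(P, s). (P div r, P mod r, s)) ({..<q * r} \<times> carrier G)"
   by (rule inj_on_inverseI[where g = "\<lambda>(k, a, s). (k * r + a, s)"]) auto
  show "(\<lambda>(P, s). (P div r, P mod r, s)) ` ({..<q * r} \<times> carrier G) \<subseteq> {..<q} \<times> {..<r} \<times> carrier G"
   by (auto simp: less_mult_imp_div_less dest: lt)
 qed
 then have "mbd (q * r) \<gamma> (d * d')"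
  unfolding mbd_def by (rule iffD1[OF kbd_cong, rotated]) (auto simp: mker_def ker_def \<gamma>_def)
 then have "kbd ({..<p} \<times> {..<q * r} \<times> carrier G) (\<lambda>(i, a, s) (j, b, t). ker (v i j) s t * ker (\<gamma> a b) s t) (c * (d * d'))"
  using v unfolding HSm_def by blast
 then have "kbd ({..<p * q} \<times> {..<r} \<times> carrier G) (\<lambda>P Q. (\<lambda>(i, a, s) (j, b, t). ker (v i j) s t * ker (\<gamma> a b) s t)
   ((\<lambda>(i, a, s). (i div q, (i mod q) * r + a, s)) P) ((\<lambda>(i, a, s). (i div q, (i mod q) * r + a, s)) Q)) (c * (d * d'))"
 proof (rule kbd_reindex)
  show "inj_on (\<lambda>(i, a, s). (i div q, (i mod q) * r + a, s)) ({..<p * q} \<times> {..<r} \<times> carrier G)"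
   by (rule inj_on_inverseI[where g = "\<lambda>(i, k, s). (i * q + k div r, k mod r, s)"]) auto
  have "(i mod q) * r + a < q * r" if "0 < q" "a < r" for i a
  proof -
   have "Suc (i mod q) * r \<le> q * r" using that by (intro mult_le_mono1) (simp add: Suc_le_eq)
   then show ?thesis using that by simp
  qed
  then show "(\<lambda>(i, a, s). (i div q, (i mod q) * r + a, s)) ` ({..<p * q} \<times> {..<r} \<times> carrier G) \<subseteq> {..<p} \<times> {..<q * r} \<times> carrier G"
   by (auto simp: less_mult_imp_div_less dest: lt)
 qed
 then show "kbd ({..<p * q} \<times> {..<r} \<times> carrier G) (\<lambda>(i, a, s) (j, b, t). ker (mprod p q v w i j) s t * ker (\<alpha> a b) s t) (c * d * d')"
  unfolding mult.assoc[of c]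
  by (rule iffD1[OF kbd_cong, rotated]) (auto simp: ker_def \<gamma>_def mprod_def pad_def)
qed

lemma mprod_norm:
 assumes v: "v \<in> mats (M_cb G) p" and w: "w \<in> mats (M_cb G) q"
 shows "mnorm (M_cb G) (p * q) (mprod p q v w) \<le> mnorm (M_cb G) p v * mnorm (M_cb G) q w"
 by (rule HSm_mnorm[OF mprod_mats[OF v w] HSm_mprod[OF mnorm_HSm[OF v order_refl] mnorm_HSm[OF w order_refl]]])

section \<open>The algebra \<open>A_cb\<close>\<close>

lemma Acb_vecs: "f \<in> vecs (A_cb G) \<longleftrightarrow> f \<in> vecs (M_cb G) \<and> (\<forall>\<epsilon>>0. \<exists>u. regular u \<and> vnorm (M_cb G) (f - u) < \<epsilon>)"
 by (simp add: A_cb_def A_vecs Bex_def)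

lemma Acb_M: "f \<in> vecs (A_cb G) ==> f \<in> vecs (M_cb G)"
 by (simp add: Acb_vecs)

lemma Acb_simps: "smul (A_cb G) = (\<lambda>c f t. c * f t)" "mnorm (A_cb G) = mnorm (M_cb G)" "amult (A_cb G) = (\<lambda>f g t. f t * g t)"
 "vnorm (A_cb G) = vnorm (M_cb G)"
 by (simp_all add: A_cb_def M_cb_def vnorm_def fun_eq_iff)

lemma regular_Acb: "regular u ==> u \<in> vecs (A_cb G)"
 unfolding Acb_vecs using regular_M M.vnorm_0 by (auto intro!: exI[of _ u] simp del: fun_diff_def simp: diff_self[of u])

lemma Acb_approx:
 assumes f: "f \<in> vecs (A_cb G)" and \<epsilon>: "0 < \<epsilon>"
 obtains u where "regular u" "vnorm (M_cb G) (f - u) < \<epsilon>"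
 using f \<epsilon> unfolding Acb_vecs by blast

lemma Acb_subspace: "module.subspace (\<lambda>c (f :: 'a => complex) t. c * f t) (vecs (A_cb G))"
proof (rule subspace_funI)
 show "(\<lambda>s. 0) \<in> vecs (A_cb G)" by (rule regular_Acb[OF regular_finsupp(1)]) (simp add: finsupp_def)
next
 fix f g assume f: "f \<in> vecs (A_cb G)" and g: "g \<in> vecs (A_cb G)"
 have fgM: "f + g \<in> vecs (M_cb G)" by (intro M.subspace_add M.sub Acb_M f g)
 have "f + g \<in> vecs (A_cb G)"
  unfolding Acb_vecs
 proof (intro conjI fgM allI impI)
  fix \<epsilon> :: real assume "0 < \<epsilon>"
  then have \<epsilon>: "0 < \<epsilon> / 2" by simp
  obtain u where u: "regular u" "vnorm (M_cb G) (f - u) < \<epsilon> / 2" using Acb_approx[OF f \<epsilon>] .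
  obtain v where v: "regular v" "vnorm (M_cb G) (g - v) < \<epsilon> / 2" using Acb_approx[OF g \<epsilon>] .
  have "regular (u + v)" using regular_add[OF u(1) v(1)] by (simp add: plus_fun_def)
  moreover have "vnorm (M_cb G) ((f - u) + (g - v)) \<le> vnorm (M_cb G) (f - u) + vnorm (M_cb G) (g - v)"
   by (intro M.vnorm_add M.subspace_diff M.sub Acb_M f g regular_M u(1) v(1))
  moreover have "(f + g) - (u + v) = (f - u) + (g - v)" by (rule add_diff_add)
  ultimately have "vnorm (M_cb G) ((f + g) - (u + v)) < \<epsilon>" using u(2) v(2) by (simp only:)
  with \<open>regular (u + v)\<close> show "\<exists>u. regular u \<and> vnorm (M_cb G) (f + g - u) < \<epsilon>" by blast
 qed
 then show "(\<lambda>s. f s + g s) \<in> vecs (A_cb G)" by (simp add: plus_fun_def)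
next
 fix c f assume f: "f \<in> vecs (A_cb G)"
 have cfM: "(\<lambda>s. c * f s) \<in> vecs (M_cb G)" using M.subspace_scale[OF M.sub Acb_M[OF f], of c] by (simp add: M_smul)
 show "(\<lambda>s. c * f s) \<in> vecs (A_cb G)"
  unfolding Acb_vecs
 proof (intro conjI cfM allI impI)
  fix \<epsilon> :: real assume \<epsilon>: "0 < \<epsilon>"
  then have "0 < \<epsilon> / (cmod c + 1)" by (simp add: add_nonneg_pos)
  from Acb_approx[OF f this] obtain u where u: "regular u" "vnorm (M_cb G) (f - u) < \<epsilon> / (cmod c + 1)" .
  have d: "f - u \<in> vecs (M_cb G)" by (intro M.subspace_diff M.sub Acb_M f regular_M u(1))
  have "vnorm (M_cb G) (\<lambda>s. c * (f - u) s) = cmod c * vnorm (M_cb G) (f - u)"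
   using M.vnorm_smul[OF d, of c] unfolding M_smul .
  moreover have "(\<lambda>s. c * (f - u) s) = (\<lambda>s. c * f s) - (\<lambda>s. c * u s)" by (auto simp: fun_eq_iff algebra_simps)
  ultimately have "vnorm (M_cb G) ((\<lambda>s. c * f s) - (\<lambda>s. c * u s)) = cmod c * vnorm (M_cb G) (f - u)" by metis
  also have "\<dots> \<le> (cmod c + 1) * vnorm (M_cb G) (f - u)" using M.vnorm_nonneg[OF d] by (intro mult_right_mono) auto
  also have "\<dots> < \<epsilon>" using u(2) by (simp add: add_nonneg_pos pos_less_divide_eq mult.commute)
  finally show "\<exists>u. regular u \<and> vnorm (M_cb G) ((\<lambda>s. c * f s) - u) < \<epsilon>" using regular_scale[OF u(1)] by blast
 qed
qed

sublocale A: represented_space "A_cb G" test_set test_index test_val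
 by (rule M_represented) (auto simp: Acb_subspace Acb_simps Acb_M)

lemma Acb_mult:
 assumes f: "f \<in> vecs (A_cb G)" and g: "g \<in> vecs (A_cb G)"
 shows "(\<lambda>s. f s * g s) \<in> vecs (A_cb G)"
 unfolding Acb_vecs
proof (intro conjI allI impI)
 note fM = Acb_M[OF f] and gM = Acb_M[OF g]
 show fgM: "(\<lambda>s. f s * g s) \<in> vecs (M_cb G)" by (rule M_mult(1)[OF fM gM])
 fix \<epsilon> :: real assume \<epsilon>: "0 < \<epsilon>"
 have nf: "0 \<le> vnorm (M_cb G) f" by (rule M.vnorm_nonneg[OF fM])
 \<comment> \<open>The approximant \<open>v\<close> of \<open>g\<close> is chosen before
   \<open>u\<close>: in the splitting \<open>f (g - v) + (f - u) v\<close> the second error is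
   weighted by the norm of \<open>v\<close>.\<close>
 have "0 < \<epsilon> / 2 / (vnorm (M_cb G) f + 1)" using \<epsilon> nf by simp
 from Acb_approx[OF g this] obtain v where v: "regular v" "vnorm (M_cb G) (g - v) < \<epsilon> / 2 / (vnorm (M_cb G) f + 1)" .
 note vM = regular_M[OF v(1)]
 have nv: "0 \<le> vnorm (M_cb G) v" by (rule M.vnorm_nonneg[OF vM])
 have "0 < \<epsilon> / 2 / (vnorm (M_cb G) v + 1)" using \<epsilon> nv by simp
 from Acb_approx[OF f this] obtain u where u: "regular u" "vnorm (M_cb G) (f - u) < \<epsilon> / 2 / (vnorm (M_cb G) v + 1)" .
 have gd: "g - v \<in> vecs (M_cb G)" and fd: "f - u \<in> vecs (M_cb G)"
  by (intro M.subspace_diff M.sub fM gM vM regular_M[OF u(1)])+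
 have small: "x * y < e" if "0 \<le> x" "y < e / (x + 1)" "0 < e" "0 \<le> y" for x y e :: real
 proof -
  have "x * y \<le> (x + 1) * y" using that by (intro mult_right_mono) auto
  also have "\<dots> < e" using that by (simp add: pos_less_divide_eq mult.commute)
  finally show ?thesis .
 qed
 have e: "(\<lambda>s. f s * g s) - (\<lambda>s. u s * v s) = (\<lambda>s. f s * (g - v) s) + (\<lambda>s. (f - u) s * v s)"
  by (auto simp: fun_eq_iff algebra_simps)
 have "vnorm (M_cb G) ((\<lambda>s. f s * g s) - (\<lambda>s. u s * v s)) \<le> vnorm (M_cb G) (\<lambda>s. f s * (g - v) s) + vnorm (M_cb G) (\<lambda>s. (f - u) s * v s)"
  unfolding e by (intro M.vnorm_add M_mult fM vM gd fd)
 also have "vnorm (M_cb G) (\<lambda>s. f s * (g - v) s) \<le> vnorm (M_cb G) f * vnorm (M_cb G) (g - v)"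
  by (rule vnorm_mult[OF fM gd])
 also have "vnorm (M_cb G) (\<lambda>s. (f - u) s * v s) \<le> vnorm (M_cb G) v * vnorm (M_cb G) (f - u)"
  using vnorm_mult[OF fd vM] by (simp only: mult.commute)
 also have "vnorm (M_cb G) f * vnorm (M_cb G) (g - v) < \<epsilon> / 2"
  by (rule small[OF nf v(2) _ M.vnorm_nonneg[OF gd]]) (use \<epsilon> in simp)
 also have "vnorm (M_cb G) v * vnorm (M_cb G) (f - u) < \<epsilon> / 2"
  by (rule small[OF nv u(2) _ M.vnorm_nonneg[OF fd]]) (use \<epsilon> in simp)
 finally have "vnorm (M_cb G) ((\<lambda>s. f s * g s) - (\<lambda>s. u s * v s)) < \<epsilon>" by simp
 then show "\<exists>u. regular u \<and> vnorm (M_cb G) ((\<lambda>s. f s * g s) - u) < \<epsilon>"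
  using M_regular[OF regular_M[OF u(1)] v(1)] by blast
qed

end

section \<open>Completeness of the multiplier algebras\<close>

context approx_group begin

text \<open>The multiplier norm dominates point values, so a Cauchy sequence has a pointwise limit;
  \<open>HS_lim\<close> transfers the Cauchy estimates to the differences from that limit.\<close>

lemma M_complete:
 assumes X: "\<And>k::nat. X k \<in> vecs (M_cb G)"
  and cauchy: "\<And>\<epsilon>. 0 < \<epsilon> ==> \<exists>N. \<forall>k\<ge>N. \<forall>l\<ge>N. vnorm (M_cb G) (X k - X l) < \<epsilon>"
 obtains f where "f \<in> vecs (M_cb G)" "(\<lambda>k. vnorm (M_cb G) (X k - f)) \<longlonglongrightarrow> 0"
proof -
 have XX: "X k - X l \<in> vecs (M_cb G)" for k l by (intro M.subspace_diff M.sub X)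
 have "\<exists>z. (\<lambda>k. X k s) \<longlonglongrightarrow> z" for s
 proof -
  have "Cauchy (\<lambda>k. X k s)"
  proof (rule metric_CauchyI)
   fix \<epsilon> :: real assume "0 < \<epsilon>"
   from cauchy[OF this] obtain N where N: "\<forall>k\<ge>N. \<forall>l\<ge>N. vnorm (M_cb G) (X k - X l) < \<epsilon>" by blast
   have "dist (X k s) (X l s) < \<epsilon>" if "N \<le> k" "N \<le> l" for k l
    using M_entry[OF XX[of k l], of s] N that by (force simp: dist_norm)
   then show "\<exists>M. \<forall>m\<ge>M. \<forall>n\<ge>M. dist (X m s) (X n s) < \<epsilon>" by blast
  qed
  then show ?thesis using Cauchy_convergent_iff convergent_def by blast
 qed
 then have "\<forall>s. \<exists>z. (\<lambda>k. X k s) \<longlonglongrightarrow> z" by blast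
 from choice[OF this] obtain f where f: "\<And>s. (\<lambda>k. X k s) \<longlonglongrightarrow> f s" by blast
 have f0: "f s = 0" if "s \<notin> carrier G" for s
  using f[of s] M_out[OF X that] by (simp add: LIMSEQ_const_iff)
 have HSd: "HS (\<lambda>s. X k s - f s) \<epsilon>" if N: "\<forall>k\<ge>N. \<forall>l\<ge>N. vnorm (M_cb G) (X k - X l) < \<epsilon>" and k: "N \<le> k" for N k \<epsilon>
 proof (rule HS_lim)
  show "(\<lambda>l. X k s - X (l + N) s) \<longlonglongrightarrow> X k s - f s" for s
   by (intro tendsto_diff tendsto_const LIMSEQ_ignore_initial_segment f)
  fix l
  have "vnorm (M_cb G) (X k - X (l + N)) \<le> \<epsilon>" using N k by (simp add: less_imp_le)
  from HS_mono[OF M_HS[OF XX] this] show "HS (\<lambda>s. X k s - X (l + N) s) \<epsilon>" by (simp add: fun_diff_def)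
 qed
 have fM: "f \<in> vecs (M_cb G)"
 proof -
  obtain N where N: "\<forall>k\<ge>N. \<forall>l\<ge>N. vnorm (M_cb G) (X k - X l) < 1" using cauchy[of 1] by auto
  from HS_M[OF HS_add[OF M_HS[OF X[of N]] HS_scale[OF HSd[OF N order_refl], of "-1"]]]
  show ?thesis using f0 M_out[OF X] by simp
 qed
 have "(\<lambda>k. vnorm (M_cb G) (X k - f)) \<longlonglongrightarrow> 0"
 proof (rule metric_LIMSEQ_I)
  fix \<epsilon> :: real assume "0 < \<epsilon>"
  then have \<epsilon>: "0 < \<epsilon> / 2" by simp
  obtain N where N: "\<forall>k\<ge>N. \<forall>l\<ge>N. vnorm (M_cb G) (X k - X l) < \<epsilon> / 2" using cauchy[OF \<epsilon>] by blast
  have "vnorm (M_cb G) (X k - f) \<le> \<epsilon> / 2" if "N \<le> k" for k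
   using HSd[OF N that] by (intro HS_vnorm) (simp_all add: fun_diff_def f0 M_out[OF X])
  then show "\<exists>no. \<forall>n\<ge>no. dist (vnorm (M_cb G) (X n - f)) 0 < \<epsilon>"
   using \<epsilon> M.vnorm_nonneg[OF M.subspace_diff[OF M.sub X fM]] by (intro exI[of _ N]) (force simp: dist_real_def)
 qed
 with fM that show thesis by blast
qed

lemma operator_space_Acb: "operator_space (A_cb G)"
proof (rule A.operator_spaceI)
 fix X assume X: "\<And>k::nat. X k \<in> vecs (A_cb G)"
  and cauchy: "\<And>\<epsilon>. 0 < \<epsilon> ==> \<exists>N. \<forall>k\<ge>N. \<forall>l\<ge>N. vnorm (A_cb G) (X k - X l) < \<epsilon>"
 note XM = Acb_M[OF X]
 obtain f where f: "f \<in> vecs (M_cb G)" "(\<lambda>k. vnorm (M_cb G) (X k - f)) \<longlonglongrightarrow> 0"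
  using M_complete[of X, OF XM cauchy[unfolded Acb_simps]] by blast
 have "f \<in> vecs (A_cb G)"
  unfolding Acb_vecs
 proof (intro conjI f allI impI)
  fix \<epsilon> :: real assume "0 < \<epsilon>"
  then have \<epsilon>: "0 < \<epsilon> / 2" by simp
  from order_tendstoD(2)[OF f(2) this] obtain k where k: "vnorm (M_cb G) (X k - f) < \<epsilon> / 2"
   by (auto simp: eventually_sequentially)
  obtain u where u: "regular u" "vnorm (M_cb G) (X k - u) < \<epsilon> / 2" using Acb_approx[OF X \<epsilon>] .
  have "vnorm (M_cb G) (f - u) \<le> vnorm (M_cb G) (f - X k) + vnorm (M_cb G) (X k - u)"
   by (rule M.vnorm_triangle[OF f(1) XM regular_M[OF u(1)]])
  also have "vnorm (M_cb G) (f - X k) = vnorm (M_cb G) (X k - f)" by (rule M.vnorm_minus_commute[OF f(1) XM])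
  finally show "\<exists>u. regular u \<and> vnorm (M_cb G) (f - u) < \<epsilon>" using k u by (intro exI[of _ u]) linarith
 qed
 then show "\<exists>x\<in>vecs (A_cb G). (\<lambda>k. vnorm (A_cb G) (X k - x)) \<longlonglongrightarrow> 0"
  using f(2) unfolding Acb_simps by blast
qed

end

section \<open>The projective tensor product\<close>

lemma bij_divmod:
 fixes n r :: nat
 shows "bij_betw (\<lambda>p. (p div r, p mod r)) {..<n * r} ({..<n} \<times> {..<r})"
proof (rule bij_betwI[where g = "\<lambda>(i, a). i * r + a"])
 show "(\<lambda>p. (p div r, p mod r)) \<in> {..<n * r} \<rightarrow> {..<n} \<times> {..<r}"
 proof (rule funcsetI)
  fix p assume "p \<in> {..<n * r}"
  then have p: "p < n * r" by simp
  then have "0 < r" by (cases r) auto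
  then show "(p div r, p mod r) \<in> {..<n} \<times> {..<r}" using p by (simp add: less_mult_imp_div_less)
 qed
 show "(\<lambda>(i, a). i * r + a) \<in> {..<n} \<times> {..<r} \<rightarrow> {..<n * r}"
 proof (rule funcsetI)
  fix x assume "x \<in> {..<n} \<times> {..<r}"
  then obtain i a where x: "x = (i, a)" "i < n" "a < r" by auto
  have "i * r + a < i * r + r" using x by simp
  also have "\<dots> \<le> n * r" using x(2) by (metis Suc_leI add.commute mult_Suc mult_le_mono1)
  finally show "(case x of (i, a) => i * r + a) \<in> {..<n * r}" by (simp add: x)
 qed
qed auto

lemma sum_divmod:
 fixes n r :: nat and g :: "nat => nat => 'b::comm_monoid_add"
 shows "(\<Sum>p<n * r. g (p div r) (p mod r)) = (\<Sum>i<n. \<Sum>a<r. g i a)"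
 using sum.reindex_bij_betw[OF bij_divmod[of r n], of "\<lambda>(i, a). g i a"] by (simp add: sum.cartesian_product)

lemma sum_divmod2:
 fixes n r :: nat and H :: "nat => nat => nat => nat => 'b::comm_monoid_add"
 shows "(\<Sum>K<n * r. \<Sum>M<n * r. H (K div r) (K mod r) (M div r) (M mod r)) = (\<Sum>i<n. \<Sum>a<r. \<Sum>j<n. \<Sum>b<r. H i a j b)"
 using sum_divmod[of "\<lambda>i a. \<Sum>M<n * r. H i a (M div r) (M mod r)" r n] by (simp add: sum_divmod[of "H i a" for i a])

context
 fixes V :: "('v::ab_group_add, 'm) op_space_scheme" and W :: "('w::ab_group_add, 'n) op_space_scheme"
 assumes V: "operator_space V" and W: "operator_space W"
begin

interpretation V: operator_space V by (rule V)
interpretation W: operator_space W by (rule W)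
interpretation VS: vector_space "smul V" by (rule V.ambient)
interpretation WS: vector_space "smul W" by (rule W.ambient)
interpretation T: vector_space "\<lambda>c (f :: ('v => 'w => complex) => complex) t. c * f t" by (rule vector_space_pointwise)

lemma tensor_smul:
 assumes "x \<in> vecs V" "y \<in> vecs W"
 shows "tensor V W (smul V c x) y = (\<lambda>B. c * tensor V W x y B)"
 using assms unfolding tensor_def bilin_on_def lin_on_def complex_os_def by (auto simp: fun_eq_iff)

lemma tensor_zero:
 assumes "x \<in> vecs V" shows "tensor V W x 0 = (\<lambda>B. 0)"
proof
 fix B
 have z: "0 \<in> vecs W" by (rule WS.subspace_0[OF W.subspace])
 have "B x (smul W 0 0) = 0 * B x 0" if "bilin_on V W complex_os B"
 proof -
  have "\<forall>c. \<forall>y\<in>vecs W. B x (smul W c y) = c * B x y"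
   using that assms unfolding bilin_on_def lin_on_def complex_os_def by simp
  then show ?thesis using z by blast
 qed
 then show "tensor V W x 0 B = 0" by (simp add: tensor_def)
qed

lemma span_tensor_list:
 assumes "t \<in> vecs (proj_tensor V W)"
 obtains L where "set L \<subseteq> vecs V \<times> vecs W" "t = (\<lambda>B. \<Sum>(x, y)\<leftarrow>L. tensor V W x y B)"
proof -
 have "t \<in> T.span {tensor V W x y | x y. x \<in> vecs V \<and> y \<in> vecs W}"
  using assms by (simp add: proj_tensor_def)
 then have "\<exists>L. set L \<subseteq> vecs V \<times> vecs W \<and> t = (\<lambda>B. \<Sum>(x, y)\<leftarrow>L. tensor V W x y B)"
 proof (induction rule: T.span_induct_alt)
  case base
  show ?case by (rule exI[of _ "[]"]) (simp add: fun_eq_iff)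
 next
  case (step c x t)
  then obtain a b where ab: "x = tensor V W a b" "a \<in> vecs V" "b \<in> vecs W" by blast
  from step obtain L where L: "set L \<subseteq> vecs V \<times> vecs W" "t = (\<lambda>B. \<Sum>(x, y)\<leftarrow>L. tensor V W x y B)" by blast
  show ?case
   by (rule exI[of _ "(smul V c a, b) # L"])
    (use ab L in \<open>auto simp: fun_eq_iff tensor_smul VS.subspace_scale[OF V.subspace]\<close>)
 qed
 then show thesis using that by blast
qed

lemma tensor_matrix_list:
 assumes u: "u \<in> mats (proj_tensor V W) n"
 obtains L :: "(nat \<times> nat \<times> 'v \<times> 'w) list" where "\<And>i j x y. (i, j, x, y) \<in> set L ==> x \<in> vecs V \<and> y \<in> vecs W"
  "\<And>i j B. i < n ==> j < n ==> u i j B = (\<Sum>(i', j', x, y)\<leftarrow>L. if i' = i \<and> j' = j then tensor V W x y B else 0)"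
proof -
 have "\<exists>L. (\<forall>(i, j, x, y)\<in>set L. x \<in> vecs V \<and> y \<in> vecs W) \<and>
  (\<forall>i j B. (\<Sum>(i', j', x, y)\<leftarrow>L. if i' = i \<and> j' = j then tensor V W x y B else 0) = (if (i, j) \<in> E then u i j B else 0))"
  if "finite E" "E \<subseteq> {..<n} \<times> {..<n}" for E
  using that
 proof (induction E rule: finite_induct)
  case empty
  show ?case by (rule exI[of _ "[]"]) simp
 next
  case (insert p E)
  obtain i0 j0 where p: "p = (i0, j0)" "i0 < n" "j0 < n" using insert(4) by auto
  have "E \<subseteq> {..<n} \<times> {..<n}" using insert(4) by blast
  from insert(3)[OF this] obtain L where L: "\<forall>(i, j, x, y)\<in>set L. x \<in> vecs V \<and> y \<in> vecs W"
   "\<forall>i j B. (\<Sum>(i', j', x, y)\<leftarrow>L. if i' = i \<and> j' = j then tensor V W x y B else 0) = (if (i, j) \<in> E then u i j B else 0)"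
   by blast
  obtain M where M: "set M \<subseteq> vecs V \<times> vecs W" "u i0 j0 = (\<lambda>B. \<Sum>(x, y)\<leftarrow>M. tensor V W x y B)"
   using span_tensor_list[OF mats_in[OF u p(2,3)]] by blast
  define M' where "M' = map (\<lambda>(x, y). (i0, j0, x, y)) M"
  have "(\<Sum>(i', j', x, y)\<leftarrow>M'. if i' = i \<and> j' = j then tensor V W x y B else 0) = (if (i, j) = (i0, j0) then u i0 j0 B else 0)" for i j B
   unfolding M'_def M(2) by (induction M) auto
  then have s: "(\<Sum>(i', j', x, y)\<leftarrow>M' @ L. if i' = i \<and> j' = j then tensor V W x y B else 0) = (if (i, j) \<in> insert p E then u i j B else 0)" for i j B
   using spec[OF spec[OF spec[OF L(2), of i], of j], of B] insert(2) p by (cases "(i, j) = (i0, j0)") auto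
  have "\<forall>(i, j, x, y)\<in>set (M' @ L). x \<in> vecs V \<and> y \<in> vecs W"
   using L(1) M(1) by (auto simp: M'_def)
  with s show ?case by blast
 qed
 note this[of "{..<n} \<times> {..<n}"]
 then have "\<exists>L. (\<forall>(i, j, x, y)\<in>set L. x \<in> vecs V \<and> y \<in> vecs W) \<and>
  (\<forall>i j B. (\<Sum>(i', j', x, y)\<leftarrow>L. if i' = i \<and> j' = j then tensor V W x y B else 0) = (if (i, j) \<in> {..<n} \<times> {..<n} then u i j B else 0))"
  by simp
 then obtain L where L: "\<forall>(i, j, x, y)\<in>set L. x \<in> vecs V \<and> y \<in> vecs W"
  "\<forall>i j B. (\<Sum>(i', j', x, y)\<leftarrow>L. if i' = i \<and> j' = j then tensor V W x y B else 0) = (if (i, j) \<in> {..<n} \<times> {..<n} then u i j B else 0)"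
  by blast
 show thesis by (rule that[of L]) (use L in auto)
qed

text \<open>The norm of \<open>proj_tensor\<close> is an infimum over factorisations, which is
  meaningful only if there is one. The entries of \<open>u\<close> are listed as elementary tensors
  with their positions; \<open>v\<close> and \<open>w\<close> are the diagonal matrices of the two
  factors, and scalar matrices collect the tensors at their positions.\<close>

lemma proj_tensor_nonempty:
 assumes u: "u \<in> mats (proj_tensor V W) n"
 obtains p q \<alpha> v w \<beta> where "v \<in> mats V p" "w \<in> mats W q"
  "u = sandwich (\<lambda>c t B. c * t B) n (p * q) \<alpha> (mat_tensor V W p q v w) \<beta>"
proof -
 obtain L :: "(nat \<times> nat \<times> 'v \<times> 'w) list" where L: "\<And>i j x y. (i, j, x, y) \<in> set L ==> x \<in> vecs V \<and> y \<in> vecs W"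
  "\<And>i j B. i < n ==> j < n ==> u i j B = (\<Sum>(i', j', x, y)\<leftarrow>L. if i' = i \<and> j' = j then tensor V W x y B else 0)"
  using tensor_matrix_list[OF u] by blast
 define N where "N = length L"
 define row col X Y where "row \<rho> = fst (L ! \<rho>)" and "col \<rho> = fst (snd (L ! \<rho>))"
  and "X \<rho> = fst (snd (snd (L ! \<rho>)))" and "Y \<rho> = snd (snd (snd (L ! \<rho>)))" for \<rho>
 have XY: "X \<rho> \<in> vecs V" "Y \<rho> \<in> vecs W" if "\<rho> < N" for \<rho>
 proof -
  have "L ! \<rho> = (row \<rho>, col \<rho>, X \<rho>, Y \<rho>)" by (simp add: row_def col_def X_def Y_def)
  then have "(row \<rho>, col \<rho>, X \<rho>, Y \<rho>) \<in> set L" using that nth_mem[of \<rho> L] by (simp add: N_def)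
  then show "X \<rho> \<in> vecs V" "Y \<rho> \<in> vecs W" using L(1) by blast+
 qed
 have uL: "u i j B = (\<Sum>\<rho><N. if row \<rho> = i \<and> col \<rho> = j then tensor V W (X \<rho>) (Y \<rho>) B else 0)" if "i < n" "j < n" for i j B
  unfolding L(2)[OF that] row_def col_def X_def Y_def N_def by (simp add: sum_list_sum_nth atLeast0LessThan case_prod_beta)
 define v where "v = pad N (\<lambda>\<rho> \<sigma>. if \<rho> = \<sigma> then X \<rho> else 0)"
 define w where "w = pad N (\<lambda>\<rho> \<sigma>. if \<rho> = \<sigma> then Y \<rho> else 0)"
 \<comment> \<open>\<open>K\<close> codes a pair of list positions. Only equal pairs are selected,
   and each is sent to the row of the list entry; \<open>\<beta>\<close> does the same for
   columns.\<close>
 define \<alpha> :: "nat => nat => complex" where "\<alpha> i K = (if K div N = K mod N \<and> row (K div N) = i then 1 else 0)" for i K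
 define \<beta> :: "nat => nat => complex" where "\<beta> K j = (if K div N = K mod N \<and> col (K div N) = j then 1 else 0)" for K j
 have vm: "v \<in> mats V N" unfolding v_def by (rule mats_pad) (auto simp: XY VS.subspace_0[OF V.subspace])
 have wm: "w \<in> mats W N" unfolding w_def by (rule mats_pad) (auto simp: XY WS.subspace_0[OF W.subspace])
 have tt: "tensor V W (v \<rho> \<sigma>) (w \<rho> \<sigma>) B = (if \<rho> = \<sigma> then tensor V W (X \<rho>) (Y \<rho>) B else 0)" if "\<rho> < N" "\<sigma> < N" for \<rho> \<sigma> B
  using that by (simp add: v_def w_def pad_def tensor_zero[OF VS.subspace_0[OF V.subspace]])
 let ?S = "sandwich (\<lambda>c t B. c * t B) n (N * N) \<alpha> (mat_tensor V W N N v w) \<beta>"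
 have "u i j = ?S i j" for i j
 proof (cases "i < n \<and> j < n")
  case True
  show ?thesis
  proof
   fix B
   define H where "H \<rho> \<rho>' \<sigma> \<sigma>' = (if \<rho> = \<rho>' \<and> row \<rho> = i then 1 else 0) * (if \<sigma> = \<sigma>' \<and> col \<sigma> = j then 1 else 0) *
     tensor V W (v \<rho> \<sigma>) (w \<rho>' \<sigma>') B" for \<rho> \<rho>' \<sigma> \<sigma>'
   have "?S i j B = (\<Sum>K<N * N. \<Sum>M<N * N. \<alpha> i K * \<beta> M j * tensor V W (v (K div N) (M div N)) (w (K mod N) (M mod N)) B)"
    using True by (simp add: sandwich_def pad_def sum_fun_apply mat_tensor_def)
   also have "\<dots> = (\<Sum>K<N * N. \<Sum>M<N * N. H (K div N) (K mod N) (M div N) (M mod N))"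
    by (simp add: \<alpha>_def \<beta>_def H_def)
   also have "\<dots> = (\<Sum>\<rho><N. \<Sum>\<rho>'<N. \<Sum>\<sigma><N. \<Sum>\<sigma>'<N. H \<rho> \<rho>' \<sigma> \<sigma>')"
    by (rule sum_divmod2)
   also have "\<dots> = (\<Sum>\<rho><N. \<Sum>\<rho>'<N. \<Sum>\<sigma><N. \<Sum>\<sigma>'<N. (if \<rho> = \<rho>' \<and> row \<rho> = i then 1 else 0) * (if \<sigma> = \<sigma>' \<and> col \<sigma> = j then 1 else 0) *
     tensor V W (v \<rho> \<sigma>) (w \<rho>' \<sigma>') B)"
    unfolding H_def ..
   also have "\<dots> = (\<Sum>\<rho><N. \<Sum>\<sigma><N. (if row \<rho> = i then 1 else 0) * (if col \<sigma> = j then 1 else 0) * tensor V W (v \<rho> \<sigma>) (w \<rho> \<sigma>) B)"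
   proof (rule sum.cong[OF refl])
    fix \<rho> assume \<rho>: "\<rho> \<in> {..<N}"
    have "(\<Sum>\<sigma><N. \<Sum>\<sigma>'<N. (if \<rho> = \<rho>' \<and> row \<rho> = i then 1 else 0) * (if \<sigma> = \<sigma>' \<and> col \<sigma> = j then 1 else 0) * tensor V W (v \<rho> \<sigma>) (w \<rho>' \<sigma>') B)
      = (if \<rho> = \<rho>' then \<Sum>\<sigma><N. (if row \<rho> = i then 1 else 0) * (if col \<sigma> = j then 1 else 0) * tensor V W (v \<rho> \<sigma>) (w \<rho> \<sigma>) B else 0)" for \<rho>'
    proof (cases "\<rho> = \<rho>'")
     case True
     have "(\<Sum>\<sigma>'<N. (if \<rho> = \<rho>' \<and> row \<rho> = i then 1 else 0) * (if \<sigma> = \<sigma>' \<and> col \<sigma> = j then 1 else 0) * tensor V W (v \<rho> \<sigma>) (w \<rho>' \<sigma>') B)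
      = (if row \<rho> = i then 1 else 0) * (if col \<sigma> = j then 1 else 0) * tensor V W (v \<rho> \<sigma>) (w \<rho> \<sigma>) B" if "\<sigma> < N" for \<sigma>
     proof -
      have "(\<Sum>\<sigma>'<N. (if \<rho> = \<rho>' \<and> row \<rho> = i then 1 else 0) * (if \<sigma> = \<sigma>' \<and> col \<sigma> = j then 1 else 0) * tensor V W (v \<rho> \<sigma>) (w \<rho>' \<sigma>') B)
       = (\<Sum>\<sigma>'<N. if \<sigma> = \<sigma>' then (if row \<rho> = i then 1 else 0) * (if col \<sigma> = j then 1 else 0) * tensor V W (v \<rho> \<sigma>) (w \<rho> \<sigma>) B else 0)"
       using True by (intro sum.cong refl) auto
      then show ?thesis using that by simp
     qed
     then show ?thesis using True by simp
    qed simp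
    then show "(\<Sum>\<rho>'<N. \<Sum>\<sigma><N. \<Sum>\<sigma>'<N. (if \<rho> = \<rho>' \<and> row \<rho> = i then 1 else 0) * (if \<sigma> = \<sigma>' \<and> col \<sigma> = j then 1 else 0) * tensor V W (v \<rho> \<sigma>) (w \<rho>' \<sigma>') B)
     = (\<Sum>\<sigma><N. (if row \<rho> = i then 1 else 0) * (if col \<sigma> = j then 1 else 0) * tensor V W (v \<rho> \<sigma>) (w \<rho> \<sigma>) B)"
     using \<rho> by simp
   qed
   also have "\<dots> = (\<Sum>\<rho><N. if row \<rho> = i \<and> col \<rho> = j then tensor V W (X \<rho>) (Y \<rho>) B else 0)"
   proof (rule sum.cong[OF refl])
    fix \<rho> assume \<rho>: "\<rho> \<in> {..<N}"
    have "(\<Sum>\<sigma><N. (if row \<rho> = i then 1 else 0) * (if col \<sigma> = j then 1 else 0) * tensor V W (v \<rho> \<sigma>) (w \<rho> \<sigma>) B) =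
     (\<Sum>\<sigma><N. if \<rho> = \<sigma> then (if row \<rho> = i \<and> col \<rho> = j then tensor V W (X \<rho>) (Y \<rho>) B else 0) else 0)"
     using \<rho> by (intro sum.cong refl) (auto simp: tt)
    then show "(\<Sum>\<sigma><N. (if row \<rho> = i then 1 else 0) * (if col \<sigma> = j then 1 else 0) * tensor V W (v \<rho> \<sigma>) (w \<rho> \<sigma>) B) =
     (if row \<rho> = i \<and> col \<rho> = j then tensor V W (X \<rho>) (Y \<rho>) B else 0)" using \<rho> by simp
   qed
   also have "\<dots> = u i j B" using True by (simp add: uL)
   finally show "u i j B = ?S i j B" by simp
  qed
 next
  case False
  then show ?thesis using mats_out[OF u False] by (auto simp: sandwich_def pad_def)
 qed
 then have "u = ?S" by (intro ext[of u] ext[of "u i" for i])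
 with vm wm show thesis by (rule that)
qed

end

context approx_group begin

text \<open>The linearisation evaluates a tensor at the bilinear forms \<open>ev s\<close>. It
  carries a factorisation through \<open>v\<close> and \<open>w\<close> to one through
  \<open>mprod p q v w\<close>, whose norm is at most the product of the norms, so multiplication is
  completely contractive.\<close>

lemma cb_mult_Acb: "cb_bilin (A_cb G) (A_cb G) (A_cb G) (amult (A_cb G))"
 unfolding cb_bilin_def
proof (intro conjI)
 let ?A = "A_cb G"
 interpret T: vector_space "\<lambda>c (f :: (('a => complex) => ('a => complex) => complex) => complex) t. c * f t" by (rule vector_space_pointwise)
 have add: "x + y \<in> vecs ?A" if "x \<in> vecs ?A" "y \<in> vecs ?A" for x y by (rule A.subspace_add[OF A.sub that])
 have scl: "(\<lambda>t. c * x t) \<in> vecs ?A" if "x \<in> vecs ?A" for x c using A.subspace_scale[OF A.sub that, of c] by (simp add: Acb_simps)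
 show "bilin_on ?A ?A ?A (amult ?A)"
  unfolding bilin_on_def lin_on_def Acb_simps using Acb_mult by (auto simp: fun_eq_iff algebra_simps)
 define ev where "ev s = (\<lambda>x y :: 'a => complex. x s * y s)" for s :: 'a
 define L where "L t = (\<lambda>s. t (ev s))" for t :: "(('a => complex) => ('a => complex) => complex) => complex"
 have evb: "bilin_on ?A ?A complex_os (ev s)" for s
  unfolding bilin_on_def lin_on_def Acb_simps complex_os_def ev_def by (auto simp: algebra_simps)
 have Lt: "L (tensor ?A ?A x y) = (\<lambda>t. x t * y t)" for x y
  using evb by (simp add: L_def tensor_def ev_def)
 have Lvec: "L t \<in> vecs ?A" if "t \<in> vecs (proj_tensor ?A ?A)" for t
 proof -
  have "T.span {tensor ?A ?A x y | x y. x \<in> vecs ?A \<and> y \<in> vecs ?A} \<subseteq> {t. L t \<in> vecs ?A}"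
  proof (rule T.span_minimal)
   show "{tensor ?A ?A x y | x y. x \<in> vecs ?A \<and> y \<in> vecs ?A} \<subseteq> {t. L t \<in> vecs ?A}"
    by (auto simp: Lt Acb_mult)
   have "(\<lambda>s. 0) \<in> vecs ?A" using A.subspace_0[OF A.sub] by (simp add: zero_fun_def)
   moreover have "(\<lambda>s. L t s + L t' s) \<in> vecs ?A" if "L t \<in> vecs ?A" "L t' \<in> vecs ?A" for t t'
    using add[OF that] by (simp add: plus_fun_def)
   ultimately show "T.subspace {t. L t \<in> vecs ?A}"
    unfolding T.subspace_def using scl by (auto simp: L_def)
  qed
  then show ?thesis using that by (auto simp: proj_tensor_def)
 qed
 have "cb_on (proj_tensor ?A ?A) ?A L"
  unfolding cb_on_def
 proof (intro conjI exI[of _ 1] allI ballI)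
  show "lin_on (proj_tensor ?A ?A) ?A L"
   unfolding lin_on_def
  proof (intro conjI ballI allI)
   show "L x \<in> vecs ?A" if "x \<in> vecs (proj_tensor ?A ?A)" for x using Lvec[OF that] .
   show "L (x + y) = L x + L y" for x y unfolding L_def by (simp add: fun_eq_iff)
   show "L (smul (proj_tensor ?A ?A) c x) = smul ?A c (L x)" for c x unfolding L_def by (simp add: Acb_simps proj_tensor_def)
  qed
  fix n u assume u: "u \<in> mats (proj_tensor ?A ?A) n"
  define Z where "Z = {cmat_norm n (p * q) \<alpha> * mnorm ?A p v * mnorm ?A q w * cmat_norm (p * q) n \<beta>
    | p q \<alpha> v w \<beta>. v \<in> mats ?A p \<and> w \<in> mats ?A q \<and>
      u = sandwich (\<lambda>c t B. c * t B) n (p * q) \<alpha> (mat_tensor ?A ?A p q v w) \<beta>}"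
  have "mnorm ?A n (\<lambda>i j. L (u i j)) \<le> Inf Z"
  proof (rule cInf_greatest)
   obtain p q \<alpha> v w \<beta> where "v \<in> mats ?A p" "w \<in> mats ?A q"
    "u = sandwich (\<lambda>c t B. c * t B) n (p * q) \<alpha> (mat_tensor ?A ?A p q v w) \<beta>"
    using proj_tensor_nonempty[OF operator_space_Acb operator_space_Acb u] .
   then show "Z \<noteq> {}" unfolding Z_def by blast
   fix z assume "z \<in> Z"
   then obtain p q \<alpha> v w \<beta> where z: "z = cmat_norm n (p * q) \<alpha> * mnorm ?A p v * mnorm ?A q w * cmat_norm (p * q) n \<beta>"
    and v: "v \<in> mats ?A p" and w: "w \<in> mats ?A q"
    and ue: "u = sandwich (\<lambda>c t B. c * t B) n (p * q) \<alpha> (mat_tensor ?A ?A p q v w) \<beta>"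
    unfolding Z_def by blast
   have vM: "v \<in> mats (M_cb G) p" and wM: "w \<in> mats (M_cb G) q"
    using v w Acb_M by (auto simp: mats_def)
   have P: "mprod p q v w \<in> mats ?A (p * q)"
    unfolding mprod_def
   proof (rule mats_pad)
    fix i j assume ij: "i < p * q" "j < p * q"
    then have "0 < q" by (cases q) auto
    then show "(\<lambda>s. v (i div q) (j div q) s * w (i mod q) (j mod q) s) \<in> vecs ?A"
     using ij by (intro Acb_mult mats_in[OF v] mats_in[OF w]) (auto simp: less_mult_imp_div_less)
   qed
   have "(\<lambda>i j. L (u i j)) = sandwich (smul ?A) n (p * q) \<alpha> (mprod p q v w) \<beta>"
   proof (intro ext)
    fix i j s
    show "L (u i j) s = sandwich (smul ?A) n (p * q) \<alpha> (mprod p q v w) \<beta> i j s"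
    proof (cases "i < n \<and> j < n")
     case True
     have m: "mat_tensor ?A ?A p q v w k l (ev s) = mprod p q v w k l s" if "k < p * q" "l < p * q" for k l
      using that evb by (simp add: mat_tensor_def mprod_def pad_def tensor_def ev_def)
     show ?thesis
      using True by (simp add: ue L_def sandwich_def pad_def sum_fun_apply Acb_simps m)
    qed (auto simp: ue L_def sandwich_def pad_def)
   qed
   then have "mnorm ?A n (\<lambda>i j. L (u i j)) \<le> cmat_norm n (p * q) \<alpha> * mnorm ?A (p * q) (mprod p q v w) * cmat_norm (p * q) n \<beta>"
    using A.mnorm_sandwich[OF P, of n \<alpha> \<beta>] by simp
   also have "\<dots> \<le> cmat_norm n (p * q) \<alpha> * (mnorm ?A p v * mnorm ?A q w) * cmat_norm (p * q) n \<beta>"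
    using mprod_norm[OF vM wM] unfolding Acb_simps by (intro mult_right_mono mult_left_mono cmat_norm_nonneg)
   finally show "mnorm ?A n (\<lambda>i j. L (u i j)) \<le> z" by (simp add: z mult.assoc)
  qed
  then show "mnorm ?A n (\<lambda>i j. L (u i j)) \<le> 1 * mnorm (proj_tensor ?A ?A) n u"
   by (simp add: proj_tensor_def Z_def)
 qed
 moreover have "\<forall>x\<in>vecs ?A. \<forall>y\<in>vecs ?A. L (tensor ?A ?A x y) = amult ?A x y" by (simp add: Lt Acb_simps)
 ultimately show "\<exists>L. cb_on (proj_tensor ?A ?A) ?A L \<and> (\<forall>x\<in>vecs ?A. \<forall>y\<in>vecs ?A. L (tensor ?A ?A x y) = amult ?A x y)"
  by blast
qed

lemma quantized_banach_algebra_Acb: "quantized_banach_algebra (A_cb G)"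
proof (rule quantized_banach_algebra.intro[OF operator_space_Acb])
 show "quantized_banach_algebra_axioms (A_cb G)"
  by (rule quantized_banach_algebra_axioms.intro[OF cb_mult_Acb]) (simp add: Acb_simps mult.assoc)
qed

end

section \<open>Approximate units and finite quotients of the free group\<close>

text \<open>Inner products of vectors of norm at most 1 form a Schur multiplier of norm at most 1:
  this is \<open>kbd_schur\<close> with a one-point index set.\<close>

lemma kbd_feature:
 fixes \<xi> \<eta> :: "'q => 'v => complex"
 assumes K: "kbd S K c" and V: "\<And>q. q \<in> S ==> finite (V q)" "\<And>q v. q \<in> S ==> v \<notin> V q ==> \<xi> q v = 0"
  and n: "\<And>q M. q \<in> S ==> finite M ==> nrm (\<xi> q) M \<le> 1" "\<And>q M. q \<in> S ==> finite M ==> nrm (\<eta> q) M \<le> 1"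
 shows "kbd S (\<lambda>p q. (\<Sum>v\<in>V q. cnj (\<eta> p v) * \<xi> q v) * K p q) c"
proof (rule kbd_localI[OF kbd_nonneg[OF K]])
 fix F assume F: "finite F" "F \<subseteq> S"
 define M where "M = (\<Union>q\<in>F. V q)"
 have M: "finite M" unfolding M_def using F V(1) by blast
 have nn: "nrm (\<lambda>k. \<Sum>j\<in>{0::nat}. z k * x j) M \<le> 1 * nrm x {0}" if "nrm z M \<le> 1" for z x
 proof -
  have "nrm (\<lambda>k. z k * x 0) M = nrm z M * cmod (x 0)"
   by (simp add: norm_mult L2_set_left_distrib)
  also have "\<dots> \<le> 1 * cmod (x 0)" using that by (intro mult_right_mono) auto
  finally show ?thesis by (simp add: L2_set_def)
 qed
 have "kbd ({0::nat} \<times> F) (\<lambda>(i, p) (j, q). (\<Sum>k\<in>M. cnj (\<eta> p k) * \<xi> q k) * K p q) (1 * 1 * c)"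
  by (rule kbd_schur[where a = "\<lambda>j k q. \<xi> q k" and b = "\<lambda>i k p. \<eta> p k"])
   (use kbd_subset[OF K F(2)] F M in \<open>auto intro!: nn[simplified] n\<close>)
 from kbd_reindex[OF this, of "\<lambda>q. (0, q)" F]
 have "kbd F (\<lambda>p q. (\<Sum>k\<in>M. cnj (\<eta> p k) * \<xi> q k) * K p q) c" by (auto simp: inj_on_def)
 moreover have "(\<Sum>k\<in>M. cnj (\<eta> p k) * \<xi> q k) = (\<Sum>v\<in>V q. cnj (\<eta> p v) * \<xi> q v)" if "q \<in> F" for p q
  by (rule sum.mono_neutral_right) (use that M V(2) F(2) in \<open>auto simp: M_def\<close>)
 ultimately show "kbd F (\<lambda>p q. (\<Sum>v\<in>V q. cnj (\<eta> p v) * \<xi> q v) * K p q) c"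
  by (subst (asm) kbd_cong) auto
qed

text \<open>The \<open>k\<close>-th vertex on the geodesic ray of the Cayley tree that runs from \<open>t\<close> to the neutral
 element and then along an added half-line.\<close>

definition vertex :: "'x list => nat => 'x list \<times> nat" where
 "vertex t k = (drop k t, k - length t)"

lemma vertex_inj: "vertex t k = vertex t k' \<longleftrightarrow> k = k'"
proof
 assume "vertex t k = vertex t k'"
 then have "length (drop k t) = length (drop k' t)" "k - length t = k' - length t" by (auto simp: vertex_def)
 then show "k = k'" by simp
qed simp

text \<open>The vector belonging to a word puts weight \<open>x k\<close> on the \<open>k\<close>-th
  vertex of its ray. The vertices of one ray are distinct, so this vector has the norm of
  \<open>x\<close>; an inner product counts the coincidences of two rays.\<close>

lemma kbd_tree:
 fixes x y :: "nat => real"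
 assumes K: "kbd S K c" and I: "finite I" "(\<Sum>k\<in>I. (x k)\<^sup>2) \<le> 1" and J: "finite J" "(\<Sum>l\<in>J. (y l)\<^sup>2) \<le> 1"
 shows "kbd S (\<lambda>p q. (\<Sum>k\<in>I. \<Sum>l\<in>J. of_real (x k * y l) * (if vertex (w q) k = vertex (w p) l then 1 else 0)) * K p q) c"
proof -
 define f where "f I x t v = (\<Sum>k\<in>I. complex_of_real (x k) * (if v = vertex t k then 1 else 0))"
  for I x and t :: "'b list" and v
 have fv: "f I x t (vertex t k) = complex_of_real (x k)" if "finite I" "k \<in> I" for I k x t
 proof -
  have "f I x t (vertex t k) = (\<Sum>k'\<in>I. if k = k' then complex_of_real (x k') else 0)"
   unfolding f_def vertex_inj by (intro sum.cong refl) auto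
  then show ?thesis using that by simp
 qed
 have f0: "f I x t v = 0" if "v \<notin> vertex t ` I" for I x t v
  unfolding f_def using that by (intro sum.neutral) auto
 have inj: "inj_on (vertex t) I" for t :: "'b list" and I by (auto simp: inj_on_def vertex_inj)
 have fn: "nrm (f I x t) M \<le> 1" if I: "finite I" "(\<Sum>k\<in>I. (x k)\<^sup>2) \<le> 1" and M: "finite M" for I x t M
 proof -
  have "(\<Sum>v\<in>M. (cmod (f I x t v))\<^sup>2) \<le> (\<Sum>v\<in>M \<union> vertex t ` I. (cmod (f I x t v))\<^sup>2)"
   by (rule sum_mono2) (use I M in auto)
  also have "\<dots> = (\<Sum>v\<in>vertex t ` I. (cmod (f I x t v))\<^sup>2)"
   by (rule sum.mono_neutral_right) (use I M f0 in auto)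
  also have "\<dots> = (\<Sum>k\<in>I. (x k)\<^sup>2)"
   unfolding sum.reindex[OF inj] by (rule sum.cong[OF refl]) (simp add: fv I(1))
  finally show ?thesis using I(2) by (simp add: L2_set_def)
 qed
 have "kbd S (\<lambda>p q. (\<Sum>v\<in>vertex (w q) ` I. cnj (f J y (w p) v) * f I x (w q) v) * K p q) c"
  by (rule kbd_feature[OF K]) (use I J f0 fn in auto)
 moreover have "(\<Sum>v\<in>vertex (w q) ` I. cnj (f J y (w p) v) * f I x (w q) v) =
   (\<Sum>k\<in>I. \<Sum>l\<in>J. of_real (x k * y l) * (if vertex (w q) k = vertex (w p) l then 1 else 0))" for p q
 proof -
  have "(\<Sum>v\<in>vertex (w q) ` I. cnj (f J y (w p) v) * f I x (w q) v) = (\<Sum>k\<in>I. cnj (f J y (w p) (vertex (w q) k)) * of_real (x k))"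
   unfolding sum.reindex[OF inj] by (rule sum.cong[OF refl]) (simp add: fv I(1))
  also have "\<dots> = (\<Sum>k\<in>I. \<Sum>l\<in>J. of_real (x k * y l) * (if vertex (w q) k = vertex (w p) l then 1 else 0))"
   unfolding f_def by (intro sum.cong refl) (auto simp: sum_distrib_right intro!: sum.cong)
  finally show ?thesis .
 qed
 ultimately show ?thesis by simp
qed

section \<open>Geodesics and truncated Haagerup functions on the free group\<close>

lemma reduced_append: "reduced (u @ v) \<longleftrightarrow> reduced u \<and> reduced v \<and> (u \<noteq> [] \<longrightarrow> v \<noteq> [] \<longrightarrow> hd v \<noteq> inv_letter (last u))"
 by (auto simp: reduced_def successively_append_iff)

lemma foldr_push_append: "reduced (u @ v) ==> foldr push u v = u @ v"
 using foldr_push_Nil[of "u @ v"] foldr_push_Nil[of v] by (simp add: reduced_append)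

interpretation F2: group F2 by (rule group_F2)

lemma F2_simps: "carrier F2 = {w. reduced w}" "x \<otimes>\<^bsub>F2\<^esub> y = foldr push x y" "\<one>\<^bsub>F2\<^esub> = []"
 by (simp_all add: F2_def)

text \<open>With \<open>c\<close> the longest common suffix of \<open>s = s' @ c\<close> and
  \<open>t = t' @ c\<close>, the two rays are disjoint before \<open>c\<close> and coincide from
  there on, and no cancellation occurs in \<open>s t^-1\<close>. Suffixes matter because the kernel
  depends on \<open>s t^-1\<close> and \<open>vertex\<close> drops letters from the front.\<close>

lemma geodesics_merge:
 assumes s: "reduced s" and t: "reduced t"
 obtains a b where "length (s \<otimes>\<^bsub>F2\<^esub> inv\<^bsub>F2\<^esub> t) = a + b"
  "\<And>k l. vertex t k = vertex s l \<longleftrightarrow> (\<exists>j. k = b + j \<and> l = a + j)"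
proof -
 obtain c s' t' where st: "s = s' @ c" "t = t' @ c" and d: "s' = [] \<or> t' = [] \<or> last s' \<noteq> last t'"
  using longest_common_suffix[of s t] by blast
 define r where "r = s' @ rev (map inv_letter t')"
 have red: "reduced s'" "reduced c" "reduced t'" using s t by (simp_all add: st reduced_append)
 have "hd (rev (map inv_letter t')) = inv_letter (last t')" if "t' \<noteq> []"
  using that by (simp add: hd_rev last_map)
 moreover have "inv_letter x = inv_letter y \<longleftrightarrow> x = y" for x y by (metis inv_letter_invol)
 ultimately have r: "reduced r" using red d reduced_inverse[OF red(3)] by (auto simp: r_def reduced_append)
 have "foldr push r t = foldr push s' (foldr push (rev (map inv_letter t')) (foldr push t' c))"
  using foldr_push_append[of t' c] t by (simp add: r_def st)
 also have "\<dots> = s" using foldr_push_inverse[OF red(2)] foldr_push_append[of s' c] s by (simp add: st)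
 finally have "r \<otimes>\<^bsub>F2\<^esub> t = s" by (simp add: F2_simps)
 then have req: "r = s \<otimes>\<^bsub>F2\<^esub> inv\<^bsub>F2\<^esub> t"
  using r s t F2.inv_solve_right[of r s t] by (simp add: F2_simps(1))
 have len: "length (s \<otimes>\<^bsub>F2\<^esub> inv\<^bsub>F2\<^esub> t) = length s' + length t'"
  by (subst req[symmetric]) (simp add: r_def)
 have v: "vertex t k = vertex s l \<longleftrightarrow> (\<exists>j. k = length t' + j \<and> l = length s' + j)" for k l
 proof
  assume "\<exists>j. k = length t' + j \<and> l = length s' + j"
  then show "vertex t k = vertex s l" by (auto simp: vertex_def st)
 next
  assume e: "vertex t k = vertex s l"
  then have "length (drop k t) = length (drop l s)" "k - length t = l - length s" "drop k t = drop l s"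
   by (auto simp: vertex_def)
  then have kl: "k + length s' = l + length t'" by (simp add: st)
  show "\<exists>j. k = length t' + j \<and> l = length s' + j"
  proof (cases "length t' \<le> k")
   case True
   then show ?thesis using kl by (intro exI[of _ "k - length t'"]) simp
  next
   case False
   \<comment> \<open>An earlier meeting would make the last letters of \<open>s'\<close> and
     \<open>t'\<close> agree.\<close>
   then have "k < length t'" "l < length s'" using kl by auto
   moreover from this have "drop k t' = drop l s'" using e by (simp add: vertex_def st)
   ultimately have "last t' = last s'" "t' \<noteq> []" "s' \<noteq> []" by (auto dest: arg_cong[of _ _ last])
   then show ?thesis using d by simp
  qed
 qed
 show thesis by (rule that[OF len v])
qed

text \<open>A partial sum of \<open>r^d = \<Sum>j. (1 - r^2) r^(d + 2 j)\<close>, Haagerup's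
  positive definite function of the word length \<open>d\<close>. The exponent
  \<open>d + 2 j\<close> is the total number of steps that two points at distance \<open>d\<close>
  need along their rays to the \<open>j\<close>-th common vertex.\<close>

definition haagerup :: "real => nat => nat => real" where
 "haagerup r N d = (\<Sum>j | d + 2 * j \<le> N. (1 - r\<^sup>2) * r ^ (d + 2 * j))"

text \<open>The omitted tail of the geometric series sums to a single power of \<open>r\<close>
  whose exponent is at least \<open>N\<close>; for \<open>d\<close> above \<open>N\<close> the whole
  series is omitted.\<close>

lemma haagerup_approx:
 assumes r: "0 \<le> r" "r < 1"
 shows "\<bar>haagerup r N d - r ^ d\<bar> \<le> r ^ N"
proof (cases "d \<le> N")
 case True
 define J where "J = (N - d) div 2 + 1"
 have "{j. d + 2 * j \<le> N} = {..<J}" using True by (auto simp: J_def)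
 then have "haagerup r N d = r ^ d * ((1 - r\<^sup>2) * (\<Sum>j<J. (r\<^sup>2) ^ j))"
  unfolding haagerup_def sum_distrib_left by (intro sum.cong) (auto simp: power_add power_mult)
 also have "(1 - r\<^sup>2) * (\<Sum>j<J. (r\<^sup>2) ^ j) = 1 - (r\<^sup>2) ^ J" by (rule one_diff_power_eq[symmetric])
 finally have "haagerup r N d - r ^ d = - (r ^ (d + 2 * J))" unfolding power_add power_mult by (simp add: right_diff_distrib)
 moreover have "r ^ (d + 2 * J) \<le> r ^ N" using r True by (intro power_decreasing) (auto simp: J_def)
 ultimately show ?thesis using r by simp
next
 case False
 then have "{j. d + 2 * j \<le> N} = {}" by auto
 moreover have "r ^ d \<le> r ^ N" using r False by (intro power_decreasing) auto
 ultimately show ?thesis using r by (simp add: haagerup_def)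
qed

text \<open>The sum over the square is an inner product of truncated vectors, but it depends on the
  two distances to the merging point separately. The triangle \<open>k + l \<le> N\<close> depends
  only on their sum, that is on the length of \<open>s t^-1\<close>, so the remaining corner is
  split off.\<close>

lemma haagerup_kernel:
 assumes s: "reduced s" and t: "reduced t"
 shows "(\<Sum>k\<le>N. \<Sum>l\<le>N. (1 - r\<^sup>2) * r ^ (k + l) * (if vertex t k = vertex s l then 1 else 0)) =
  haagerup r N (length (s \<otimes>\<^bsub>F2\<^esub> inv\<^bsub>F2\<^esub> t)) +
  (\<Sum>(k, l) | k \<le> N \<and> l \<le> N \<and> N < k + l. (1 - r\<^sup>2) * r ^ (k + l) * (if vertex t k = vertex s l then 1 else 0))"
proof -
 obtain a b where ab: "length (s \<otimes>\<^bsub>F2\<^esub> inv\<^bsub>F2\<^esub> t) = a + b"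
  "\<And>k l. vertex t k = vertex s l \<longleftrightarrow> (\<exists>j. k = b + j \<and> l = a + j)" using geodesics_merge[OF s t] by blast
 let ?g = "\<lambda>(k, l). (1 - r\<^sup>2) * r ^ (k + l) * (if vertex t k = vertex s l then 1 else 0)"
 let ?G = "{(k, l). k \<le> N \<and> l \<le> N \<and> k + l \<le> N}" and ?B = "{(k, l). k \<le> N \<and> l \<le> N \<and> N < k + l}"
 have fin: "finite ?G" "finite ?B" by (rule finite_subset[of _ "{..N} \<times> {..N}"]; auto)+
 have "(\<Sum>k\<le>N. \<Sum>l\<le>N. ?g (k, l)) = sum ?g ({..N} \<times> {..N})" by (simp add: sum.cartesian_product)
 also have "{..N} \<times> {..N} = ?G \<union> ?B" by auto
 also have "sum ?g (?G \<union> ?B) = sum ?g ?G + sum ?g ?B" by (rule sum.union_disjoint[OF fin]) auto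
 also have "sum ?g ?G = (\<Sum>p\<in>(\<lambda>j. (b + j, a + j)) ` {j. a + b + 2 * j \<le> N}. ?g p)"
  by (rule sum.mono_neutral_right[OF fin(1)]) (auto simp: ab(2) image_iff)
 also have "\<dots> = haagerup r N (a + b)"
  unfolding haagerup_def by (subst sum.reindex) (auto simp: inj_on_def ab(2) intro!: sum.cong arg_cong[of _ _ "power r"])
 finally show ?thesis unfolding ab(1) by simp
qed

text \<open>The square comes from vectors with weights \<open>sqrt (1 - r\<^sup>2) * r ^ k\<close>,
  of norm at most 1, and costs \<open>c\<close>. The corner has at most \<open>(N + 1)^2\<close>
  terms, each a Schur multiplier of norm at most 1 with weight at most \<open>r ^ N\<close>.\<close>

lemma kbd_haagerup:
 assumes K: "kbd S K c" and r: "0 \<le> r" "r < 1" and w: "\<And>p. p \<in> S ==> reduced (w p)"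
 shows "kbd S (\<lambda>p q. of_real (haagerup r N (length (w p \<otimes>\<^bsub>F2\<^esub> inv\<^bsub>F2\<^esub> (w q)))) * K p q) (c + (real N + 1)\<^sup>2 * r ^ N * c)"
proof -
 have c: "0 \<le> c" by (rule kbd_nonneg[OF K])
 have r2: "0 \<le> 1 - r\<^sup>2" "1 - r\<^sup>2 \<le> 1" using r by (auto simp: power_le_one)
 define D where "D k l p q = (if vertex (w q) k = vertex (w p) l then 1 else 0 :: complex)" for k l p q
 let ?B = "{(k, l). k \<le> N \<and> l \<le> N \<and> N < k + l}"
 have sub: "?B \<subseteq> {..N} \<times> {..N}" by auto
 have fin: "finite ?B" by (rule finite_subset[OF sub]) simp
 have sq: "(\<Sum>k\<le>N. (sqrt (1 - r\<^sup>2) * r ^ k)\<^sup>2) \<le> 1"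
 proof -
  have "(\<Sum>k\<le>N. (sqrt (1 - r\<^sup>2) * r ^ k)\<^sup>2) = (1 - r\<^sup>2) * (\<Sum>k<Suc N. (r\<^sup>2) ^ k)"
   using r2 by (simp add: power_mult_distrib sum_distrib_left lessThan_Suc_atMost power_mult[symmetric] mult.commute del: sum.lessThan_Suc)
  also have "\<dots> = 1 - (r\<^sup>2) ^ Suc N" by (rule one_diff_power_eq[symmetric])
  finally show ?thesis by simp
 qed
 have D1: "kbd S (\<lambda>p q. D k l p q * K p q) c" for k l
  using kbd_tree[OF K, of "{k}" "\<lambda>_. 1" "{l}" "\<lambda>_. 1" w] by (simp add: D_def)
 have "kbd S (\<lambda>p q. (\<Sum>k\<le>N. \<Sum>l\<le>N. of_real (sqrt (1 - r\<^sup>2) * r ^ k * (sqrt (1 - r\<^sup>2) * r ^ l)) * D k l p q) * K p q) c"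
  unfolding D_def by (rule kbd_tree[OF K _ sq _ sq]) auto
 moreover have "kbd S (\<lambda>p q. \<Sum>m\<in>?B. (case m of (k, l) => \<lambda>p q. - of_real ((1 - r\<^sup>2) * r ^ (k + l)) * (D k l p q * K p q)) p q) (\<Sum>m\<in>?B. r ^ N * c)"
 proof (rule kbd_sum[OF fin])
  fix m assume "m \<in> ?B"
  then obtain k l where m: "m = (k, l)" "N < k + l" by auto
  have "cmod (- of_real ((1 - r\<^sup>2) * r ^ (k + l))) * c \<le> r ^ N * c"
  proof (rule mult_right_mono[OF _ c])
   have "cmod (- of_real ((1 - r\<^sup>2) * r ^ (k + l))) = (1 - r\<^sup>2) * r ^ (k + l)"
    unfolding norm_minus_cancel norm_of_real using r r2 by simp
   also have "\<dots> \<le> 1 * r ^ N" using r r2 m by (intro mult_mono power_decreasing) auto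
   finally show "cmod (- of_real ((1 - r\<^sup>2) * r ^ (k + l))) \<le> r ^ N" by simp
  qed
  then show "kbd S ((case m of (k, l) => \<lambda>p q. - of_real ((1 - r\<^sup>2) * r ^ (k + l)) * (D k l p q * K p q))) (r ^ N * c)"
   unfolding m(1) prod.case by (rule kbd_mono[OF kbd_scale[OF D1]])
 qed
 ultimately have "kbd S (\<lambda>p q. (\<Sum>k\<le>N. \<Sum>l\<le>N. of_real (sqrt (1 - r\<^sup>2) * r ^ k * (sqrt (1 - r\<^sup>2) * r ^ l)) * D k l p q) * K p q +
   (\<Sum>m\<in>?B. (case m of (k, l) => \<lambda>p q. - of_real ((1 - r\<^sup>2) * r ^ (k + l)) * (D k l p q * K p q)) p q)) (c + (\<Sum>m\<in>?B. r ^ N * c))"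
  by (rule kbd_add)
 moreover have "(\<Sum>k\<le>N. \<Sum>l\<le>N. of_real (sqrt (1 - r\<^sup>2) * r ^ k * (sqrt (1 - r\<^sup>2) * r ^ l)) * D k l p q) * K p q +
   (\<Sum>m\<in>?B. (case m of (k, l) => \<lambda>p q. - of_real ((1 - r\<^sup>2) * r ^ (k + l)) * (D k l p q * K p q)) p q) =
   of_real (haagerup r N (length (w p \<otimes>\<^bsub>F2\<^esub> inv\<^bsub>F2\<^esub> (w q)))) * K p q" if "p \<in> S" "q \<in> S" for p q
 proof -
  have "sqrt (1 - r\<^sup>2) * r ^ k * (sqrt (1 - r\<^sup>2) * r ^ l) = (1 - r\<^sup>2) * r ^ (k + l)" for k l
  proof -
   have "sqrt (1 - r\<^sup>2) * r ^ k * (sqrt (1 - r\<^sup>2) * r ^ l) = (sqrt (1 - r\<^sup>2) * sqrt (1 - r\<^sup>2)) * r ^ (k + l)"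
    by (simp only: power_add mult_ac)
   then show ?thesis using r2 by simp
  qed
  then have 1: "(\<Sum>k\<le>N. \<Sum>l\<le>N. of_real (sqrt (1 - r\<^sup>2) * r ^ k * (sqrt (1 - r\<^sup>2) * r ^ l)) * D k l p q) =
   complex_of_real (\<Sum>k\<le>N. \<Sum>l\<le>N. (1 - r\<^sup>2) * r ^ (k + l) * (if vertex (w q) k = vertex (w p) l then 1 else 0))"
   unfolding of_real_sum by (intro sum.cong refl) (simp add: D_def)
  have 2: "(\<Sum>m\<in>?B. (case m of (k, l) => \<lambda>p q. - of_real ((1 - r\<^sup>2) * r ^ (k + l)) * (D k l p q * K p q)) p q) =
   - complex_of_real (\<Sum>(k, l)\<in>?B. (1 - r\<^sup>2) * r ^ (k + l) * (if vertex (w q) k = vertex (w p) l then 1 else 0)) * K p q"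
   unfolding of_real_sum sum_negf[symmetric] sum_distrib_right by (intro sum.cong refl) (auto simp: D_def)
  show ?thesis unfolding 1 2 haagerup_kernel[OF w[OF that(1)] w[OF that(2)]] by (simp add: algebra_simps)
 qed
 ultimately have "kbd S (\<lambda>p q. of_real (haagerup r N (length (w p \<otimes>\<^bsub>F2\<^esub> inv\<^bsub>F2\<^esub> (w q)))) * K p q) (c + (\<Sum>m\<in>?B. r ^ N * c))"
  by (subst (asm) kbd_cong) auto
 moreover have "(\<Sum>m\<in>?B. r ^ N * c) \<le> (real N + 1)\<^sup>2 * r ^ N * c"
 proof -
  have "card ?B \<le> card ({..N} \<times> {..N})" by (rule card_mono[OF _ sub]) simp
  then have "real (card ?B) \<le> real ((N + 1) * (N + 1))" unfolding of_nat_le_iff by (simp add: card_cartesian_product)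
  then have "real (card ?B) * (r ^ N * c) \<le> real ((N + 1) * (N + 1)) * (r ^ N * c)" using r c by (intro mult_right_mono) auto
  then show ?thesis by (simp add: power2_eq_square algebra_simps)
 qed
 ultimately show ?thesis by (rule kbd_mono[OF _ add_left_mono])
qed

definition haagerup_radius :: "nat => real" where
 "haagerup_radius m = 1 - 1 / (real m + 2)"

lemma haagerup_radius: "0 \<le> haagerup_radius m" "haagerup_radius m < 1"
 by (auto simp: haagerup_radius_def field_simps)

text \<open>With \<open>\<rho>\<close> the square root of the radius the quantity is the square of
  \<open>(N + 1) \<rho>^N\<close>, which tends to 0. The bound \<open>1 / (m + 1)\<close> is at most
  1, which controls the corner term, and tends to 0, which gives the pointwise limit.\<close>

lemma haagerup_cutoff: "\<exists>N. (real N + 1)\<^sup>2 * haagerup_radius m ^ N \<le> 1 / (real m + 1)"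
proof -
 define \<rho> where "\<rho> = sqrt (haagerup_radius m)"
 have \<rho>: "0 \<le> \<rho>" "\<rho> < 1" using haagerup_radius[of m] by (auto simp: \<rho>_def real_sqrt_lt_1_iff)
 have "(\<lambda>n. (real n * \<rho> ^ n + \<rho> ^ n)\<^sup>2) \<longlonglongrightarrow> (0 + 0)\<^sup>2"
  using \<rho> powser_times_n_limit_0[of \<rho>] by (intro tendsto_power tendsto_add LIMSEQ_power_zero) auto
 then have "(\<lambda>n. (real n * \<rho> ^ n + \<rho> ^ n)\<^sup>2) \<longlonglongrightarrow> 0" by simp
 from order_tendstoD(2)[OF this, of "1 / (real m + 1)"] obtain N where "(real N * \<rho> ^ N + \<rho> ^ N)\<^sup>2 < 1 / (real m + 1)"
  by (auto simp: eventually_sequentially)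
 moreover have "(real N * \<rho> ^ N + \<rho> ^ N)\<^sup>2 = (real N + 1)\<^sup>2 * haagerup_radius m ^ N"
 proof -
  have "real N * \<rho> ^ N + \<rho> ^ N = (real N + 1) * \<rho> ^ N" by (simp add: distrib_right)
  then have "(real N * \<rho> ^ N + \<rho> ^ N)\<^sup>2 = (real N + 1)\<^sup>2 * (\<rho> ^ N)\<^sup>2" by (simp only: power_mult_distrib)
  also have "(\<rho> ^ N)\<^sup>2 = (\<rho>\<^sup>2) ^ N" by (simp only: power_mult[symmetric] mult.commute)
  finally have "(real N * \<rho> ^ N + \<rho> ^ N)\<^sup>2 = (real N + 1)\<^sup>2 * (\<rho>\<^sup>2) ^ N" .
  then show ?thesis using haagerup_radius(1)[of m] by (simp add: \<rho>_def)
 qed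
 ultimately show ?thesis by (intro exI[of _ N]) simp
qed

definition haagerup_length :: "nat => nat" where
 "haagerup_length m = (SOME N. (real N + 1)\<^sup>2 * haagerup_radius m ^ N \<le> 1 / (real m + 1))"

lemma haagerup_length: "(real (haagerup_length m) + 1)\<^sup>2 * haagerup_radius m ^ haagerup_length m \<le> 1 / (real m + 1)"
 unfolding haagerup_length_def by (rule someI_ex[OF haagerup_cutoff])

definition haagerup_fun :: "nat => (bool \<times> bool) list => complex" where
 "haagerup_fun m s = (if reduced s then of_real (haagerup (haagerup_radius m) (haagerup_length m) (length s)) else 0)"

text \<open>The constant 2 is 1 for the square plus at most 1 for the corner. At a fixed word the
  function differs from the power of the radius by at most \<open>1 / (m + 1)\<close>, and the
  radius tends to 1.\<close>

lemma approx_group_F2: "approx_group F2 haagerup_fun 2"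
proof (rule approx_group.intro[OF group_F2], unfold_locales)
 fix m
 let ?r = "haagerup_radius m" and ?N = "haagerup_length m"
 have "{s. haagerup_fun m s \<noteq> 0} \<subseteq> {s. reduced s \<and> length s \<le> ?N}"
 proof (rule subsetI, rule CollectI, rule ccontr)
  fix s assume s: "s \<in> {s. haagerup_fun m s \<noteq> 0}" and n: "\<not> (reduced s \<and> length s \<le> ?N)"
  have "{j. length s + 2 * j \<le> ?N} = {}" if "?N < length s" using that by auto
  then show False using s n by (cases "reduced s") (auto simp: haagerup_fun_def haagerup_def not_le)
 qed
 moreover have "finite {s. reduced s \<and> length s \<le> ?N}"
  by (rule finite_subset[OF _ finite_lists_length_le[of "UNIV :: (bool \<times> bool) set" ?N]]) auto
 ultimately show "finsupp F2 (haagerup_fun m)"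
  unfolding finsupp_def F2_simps(1) using finite_subset by blast
 fix r \<alpha> c assume "F2.mbd r \<alpha> c"
 then have K: "kbd ({..<r} \<times> carrier F2) (F2.mker \<alpha>) c" by (simp add: F2.mbd_def)
 have c: "0 \<le> c" by (rule kbd_nonneg[OF K])
 have "(real ?N + 1)\<^sup>2 * ?r ^ ?N \<le> 1" using haagerup_length[of m] by (rule order_trans) (simp add: field_simps)
 then have "(real ?N + 1)\<^sup>2 * ?r ^ ?N * c \<le> 1 * c" using c by (rule mult_right_mono)
 then have le: "c + (real ?N + 1)\<^sup>2 * ?r ^ ?N * c \<le> 2 * c" by simp
 have "kbd ({..<r} \<times> carrier F2) (\<lambda>p q. of_real (haagerup ?r ?N (length (snd p \<otimes>\<^bsub>F2\<^esub> inv\<^bsub>F2\<^esub> (snd q)))) * F2.mker \<alpha> p q) (2 * c)"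
  by (rule kbd_mono[OF kbd_haagerup[OF K haagerup_radius] le]) (auto simp: F2_simps(1))
 moreover have "F2.mker (\<lambda>a b s. haagerup_fun m s * \<alpha> a b s) p q =
   of_real (haagerup ?r ?N (length (snd p \<otimes>\<^bsub>F2\<^esub> inv\<^bsub>F2\<^esub> (snd q)))) * F2.mker \<alpha> p q"
  if pq: "p \<in> {..<r} \<times> carrier F2" "q \<in> {..<r} \<times> carrier F2" for p q
 proof -
  obtain a s b t where e: "p = (a, s)" "q = (b, t)" and st: "s \<in> carrier F2" "t \<in> carrier F2"
   using pq by blast
  have "s \<otimes>\<^bsub>F2\<^esub> inv\<^bsub>F2\<^esub> t \<in> carrier F2" using st by simp
  then have "reduced (s \<otimes>\<^bsub>F2\<^esub> inv\<^bsub>F2\<^esub> t)" by (simp only: F2_simps(1) mem_Collect_eq)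
  then show ?thesis by (simp add: e F2.mker_def F2.ker_def haagerup_fun_def)
 qed
 ultimately show "F2.mbd r (\<lambda>a b s. haagerup_fun m s * \<alpha> a b s) (2 * c)"
  unfolding F2.mbd_def by (subst kbd_cong) auto
next
 fix s assume "s \<in> carrier F2"
 then have s: "reduced s" by (simp add: F2_simps)
 have b: "\<bar>haagerup (haagerup_radius m) (haagerup_length m) (length s) - haagerup_radius m ^ length s\<bar> \<le> 1 / (real m + 1)" for m
 proof -
  let ?N = "haagerup_length m"
  have "1 * haagerup_radius m ^ ?N \<le> (real ?N + 1)\<^sup>2 * haagerup_radius m ^ ?N"
   using haagerup_radius(1)[of m] by (intro mult_right_mono) auto
  then show ?thesis using haagerup_approx[OF haagerup_radius, of m ?N "length s"] haagerup_length[of m] by linarith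
 qed
 have inv0: "(\<lambda>m. 1 / (real m + 1)) \<longlonglongrightarrow> 0" using LIMSEQ_inverse_real_of_nat by (simp add: inverse_eq_divide add.commute)
 have "(\<lambda>m. haagerup (haagerup_radius m) (haagerup_length m) (length s) - haagerup_radius m ^ length s) \<longlonglongrightarrow> 0"
  by (rule Lim_null_comparison[OF _ inv0]) (simp add: b)
 moreover have "(\<lambda>m. haagerup_radius m ^ length s) \<longlonglongrightarrow> 1"
 proof -
  have "(\<lambda>m. 1 / (real (m + 1) + 1)) \<longlonglongrightarrow> 0" by (rule LIMSEQ_ignore_initial_segment[OF inv0])
  then have "(\<lambda>m. haagerup_radius m) \<longlonglongrightarrow> 1 - 0"
   unfolding haagerup_radius_def by (intro tendsto_diff tendsto_const) (simp add: add.commute add.left_commute)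
  from tendsto_power[OF this, of "length s"] show ?thesis by simp
 qed
 ultimately have "(\<lambda>m. haagerup (haagerup_radius m) (haagerup_length m) (length s)) \<longlonglongrightarrow> 1"
  using tendsto_add[of "\<lambda>m. haagerup (haagerup_radius m) (haagerup_length m) (length s) - haagerup_radius m ^ length s" 0 sequentially
    "\<lambda>m. haagerup_radius m ^ length s" 1] by simp
 then have "(\<lambda>m. complex_of_real (haagerup (haagerup_radius m) (haagerup_length m) (length s))) \<longlonglongrightarrow> of_real 1" by (rule tendsto_of_real)
 then show "(\<lambda>m. haagerup_fun m s) \<longlonglongrightarrow> 1" using s by (simp add: haagerup_fun_def)
qed

section \<open>Finite permutation representations of the free group\<close>

lemma extend_partial_permutation:
 assumes X: "finite X" and Y: "Y \<subseteq> X" "f ` Y \<subseteq> X" and f: "inj_on f Y"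
 obtains \<sigma> where "\<sigma> permutes X" "\<And>x. x \<in> Y ==> \<sigma> x = f x"
proof -
 have fin: "finite Y" using X Y(1) finite_subset by blast
 have "card (X - Y) = card (X - f ` Y)"
  using X Y fin by (simp add: card_Diff_subset card_image[OF f])
 then obtain g where g: "bij_betw g (X - Y) (X - f ` Y)"
  using finite_same_card_bij[of "X - Y" "X - f ` Y"] X by blast
 define \<sigma> where "\<sigma> x = (if x \<in> Y then f x else if x \<in> X then g x else x)" for x
 have "bij_betw \<sigma> Y (f ` Y)" using f by (auto simp: bij_betw_def \<sigma>_def inj_on_def)
 moreover have "bij_betw \<sigma> (X - Y) (X - f ` Y)"
  using g by (subst bij_betw_cong[of _ _ g]) (auto simp: \<sigma>_def)
 ultimately have "bij_betw \<sigma> (Y \<union> (X - Y)) (f ` Y \<union> (X - f ` Y))" by (rule bij_betw_combine) auto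
 moreover have "Y \<union> (X - Y) = X" "f ` Y \<union> (X - f ` Y) = X" using Y by auto
 ultimately have "\<sigma> permutes X" by (intro bij_imp_permutes) (use Y(1) in \<open>auto simp: \<sigma>_def\<close>)
 then show thesis by (rule that) (simp add: \<sigma>_def)
qed

definition word_perm :: "(bool \<times> bool => 'x => 'x) => (bool \<times> bool) list => 'x => 'x" where
 "word_perm \<sigma> w = foldr (\<lambda>x f. \<sigma> x \<circ> f) w id"

lemma word_perm_simps: "word_perm \<sigma> [] = id" "word_perm \<sigma> (x # w) = \<sigma> x \<circ> word_perm \<sigma> w"
 by (simp_all add: word_perm_def)

text \<open>The hypothesis makes the cancellations performed by \<open>push\<close> invisible to the
  permutations.\<close>

lemma word_perm_mult:
 assumes "\<And>x. \<sigma> x \<circ> \<sigma> (inv_letter x) = id"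
 shows "word_perm \<sigma> (foldr push u v) = word_perm \<sigma> u \<circ> word_perm \<sigma> v"
proof -
 have "word_perm \<sigma> (push x w) = \<sigma> x \<circ> word_perm \<sigma> w" for x w
 proof (cases w)
  case (Cons y w')
  have "\<sigma> x \<circ> (\<sigma> (inv_letter x) \<circ> word_perm \<sigma> w') = word_perm \<sigma> w'"
   by (simp only: o_assoc assms id_comp)
  then show ?thesis using Cons by (simp add: word_perm_simps)
 qed (simp add: word_perm_simps)
 then show ?thesis by (induction u) (simp_all add: word_perm_simps o_assoc)
qed

text \<open>On the ball of radius \<open>n\<close>, prefixing a letter is a partial injection and
  extends to a permutation of the ball. A reduced word of length at most \<open>n\<close>, applied
  letter by letter to \<open>[]\<close>, never leaves the ball, so the extension does not matter for
  it.\<close>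

lemma F2_ball_perm:
 obtains X \<sigma> where "finite X" "[] \<in> X" "\<And>x. \<sigma> x permutes X" "\<And>x. \<sigma> x \<circ> \<sigma> (inv_letter x) = id"
  "\<And>w. reduced w ==> length w \<le> n ==> word_perm \<sigma> w [] = w"
proof -
 define X where "X = {w. reduced w \<and> length w \<le> n}"
 have X: "finite X" unfolding X_def
  by (rule finite_subset[OF _ finite_lists_length_le[of "UNIV :: (bool \<times> bool) set" n]]) auto
 have inv_push: "push (inv_letter x) (push x w) = w" if "w \<in> X" for x w
  using push_inv_push[of w "inv_letter x"] that by (simp add: X_def)
 define Y where "Y x = {w \<in> X. push x w \<in> X}" for x
 have "\<exists>\<tau>. \<tau> permutes X \<and> (\<forall>w\<in>Y x. \<tau> w = push x w)" for x
 proof -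
  have "inj_on (push x) (Y x)"
   by (rule inj_on_inverseI[where g = "push (inv_letter x)"]) (auto simp: Y_def inv_push)
  with extend_partial_permutation[OF X, of "Y x" "push x"] show ?thesis by (auto simp: Y_def)
 qed
 then have "\<forall>x. \<exists>\<tau>. \<tau> permutes X \<and> (\<forall>w\<in>Y x. \<tau> w = push x w)" by blast
 from choice[OF this] obtain \<tau> where \<tau>: "\<And>x. \<tau> x permutes X" "\<And>x w. w \<in> Y x ==> \<tau> x w = push x w" by blast
 \<comment> \<open>Extensions chosen independently for a letter and its inverse need not be inverse
   to each other. Only the letters with \<open>snd x\<close> keep the chosen one; the others receive
   inverse permutations, which still extend \<open>push\<close>.\<close>
 define \<sigma> where "\<sigma> x = (if snd x then \<tau> x else inv_into UNIV (\<tau> (inv_letter x)))" for x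
 have \<sigma>p: "\<sigma> x permutes X" for x using \<tau>(1) by (simp add: \<sigma>_def permutes_inv)
 have \<sigma>i: "\<sigma> x \<circ> \<sigma> (inv_letter x) = id" for x
 proof -
  have "snd (inv_letter x) \<longleftrightarrow> \<not> snd x" by (simp add: inv_letter_def)
  then show ?thesis using permutes_inv_o[OF \<tau>(1)] by (simp add: \<sigma>_def)
 qed
 have \<sigma>push: "\<sigma> x w = push x w" if "w \<in> Y x" for x w
 proof (cases "snd x")
  case False
  have "push x w \<in> Y (inv_letter x)" using that by (auto simp: Y_def inv_push)
  then have "\<tau> (inv_letter x) (push x w) = w" using \<tau>(2) that by (simp add: Y_def inv_push)
  then show ?thesis using False permutes_inverses(2)[OF \<tau>(1)] by (metis \<sigma>_def)
 qed (simp add: \<sigma>_def \<tau>(2)[OF that])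
 have w: "word_perm \<sigma> w [] = w" if "reduced w" "length w \<le> n" for w
  using that
 proof (induction w)
  case (Cons x w)
  have w: "reduced w" by (rule reduced_ConsD[OF Cons.prems(1)])
  have "w \<in> Y x" using Cons.prems w by (simp add: Y_def X_def push_reduced)
  then show ?case using Cons.IH[OF w] Cons.prems by (simp add: word_perm_simps \<sigma>push push_reduced)
 qed (simp add: word_perm_simps)
 have "[] \<in> X" by (simp add: X_def reduced_def)
 show thesis by (rule that[of X \<sigma>]; fact)
qed

text \<open>Finite quotients, in the form of finite permutation representations that are free on a given finite set.\<close>

definition residually_finite :: "('g, 'm) monoid_scheme => bool" where
 "residually_finite G \<longleftrightarrow> (\<forall>S. finite S \<and> S \<subseteq> carrier G \<longrightarrow> (\<exists>(q::nat) \<pi>. 0 < q \<and>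
   (\<forall>s\<in>carrier G. bij_betw (\<pi> s) {..<q} {..<q}) \<and>
   (\<forall>s\<in>carrier G. \<forall>t\<in>carrier G. \<forall>j<q. \<pi> (s \<otimes>\<^bsub>G\<^esub> t) j = \<pi> s (\<pi> t j)) \<and>
   (\<forall>s\<in>S. \<forall>t\<in>S. \<forall>j<q. \<pi> s j = \<pi> t j \<longrightarrow> s = t)))"

text \<open>The action on a ball separates words only at the point \<open>[]\<close>. Passing to
  left composition on all permutations of the ball separates them at every point: an equation at one
  permutation can be cancelled on the right and then evaluated at \<open>[]\<close>.\<close>

lemma residually_finite_F2: "residually_finite F2"
 unfolding residually_finite_def
proof (intro allI impI, elim conjE)
 fix S assume S: "finite S" "S \<subseteq> carrier F2"
 define n where "n = Max (insert 0 (length ` S))"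
 have n: "length s \<le> n" if "s \<in> S" for s unfolding n_def using S(1) that by (intro Max_ge) auto
 obtain X \<sigma> where X: "finite X" "[] \<in> X" and \<sigma>: "\<And>x. \<sigma> x permutes X" "\<And>x. \<sigma> x \<circ> \<sigma> (inv_letter x) = id"
  and h: "\<And>w. reduced w ==> length w \<le> n ==> word_perm \<sigma> w [] = w"
  by (rule F2_ball_perm[of n]) (rule that)
 define Q where "Q = {p. p permutes X}"
 have Q: "finite Q" unfolding Q_def by (rule finite_permutations[OF X(1)])
 define q where "q = card Q"
 obtain i where i: "bij_betw i Q {..<q}" using ex_bij_betw_finite_nat[OF Q] by (auto simp: q_def atLeast0LessThan)
 define p where "p = inv_into Q i"
 have p: "bij_betw p {..<q} Q" unfolding p_def by (rule bij_betw_inv_into[OF i])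
 have ip: "i (p j) = j" if "j < q" for j using bij_betw_inv_into_right[OF i, of j] that by (simp add: p_def)
 have pi: "p (i k) = k" if "k \<in> Q" for k using bij_betw_inv_into_left[OF i that] by (simp add: p_def)
 have pQ: "p j \<in> Q" if "j < q" for j using bij_betwE[OF p] that by simp
 define W where "W = word_perm \<sigma>"
 have W: "W s permutes X" for s
  unfolding W_def
 proof (induction s)
  case Nil
  show ?case unfolding word_perm_simps by (rule permutes_id)
 next
  case (Cons x s)
  show ?case unfolding word_perm_simps by (rule permutes_compose[OF Cons \<sigma>(1)])
 qed
 have WQ: "W s \<circ> k \<in> Q" if "k \<in> Q" for s k using that permutes_compose[OF _ W, of k] by (simp add: Q_def)
 have Wm: "W (s \<otimes>\<^bsub>F2\<^esub> t) = W s \<circ> W t" for s t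
  unfolding W_def F2_simps(2) by (rule word_perm_mult[where \<sigma> = \<sigma>, OF \<sigma>(2)])
 define \<pi> where "\<pi> s j = i (W s \<circ> p j)" for s j
 have "id \<in> Q" by (simp add: Q_def permutes_id)
 then have "0 < q" using Q by (auto simp: q_def card_gt_0_iff)
 moreover have "bij_betw (\<pi> s) {..<q} {..<q}" for s
 proof -
  have "bij_betw (\<lambda>k. W s \<circ> k) Q Q"
  proof (rule bij_betwI[where g = "\<lambda>k. inv_into UNIV (W s) \<circ> k"])
   show "(\<lambda>k. inv_into UNIV (W s) \<circ> k) \<in> Q \<rightarrow> Q" using permutes_compose[OF _ permutes_inv[OF W]] by (auto simp: Q_def)
  qed (auto simp: WQ o_assoc permutes_inv_o[OF W])
  moreover have "\<pi> s = i \<circ> ((\<lambda>k. W s \<circ> k) \<circ> p)" by (rule ext) (simp add: \<pi>_def)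
  ultimately show ?thesis using bij_betw_trans[OF bij_betw_trans[OF p] i] by simp
 qed
 moreover have "\<pi> (s \<otimes>\<^bsub>F2\<^esub> t) j = \<pi> s (\<pi> t j)" if "j < q" for s t j
  by (simp add: \<pi>_def Wm pi WQ pQ that o_assoc)
 moreover have "s = t" if st: "s \<in> S" "t \<in> S" and j: "j < q" and e: "\<pi> s j = \<pi> t j" for s t j
 proof -
  have "p (\<pi> s j) = p (\<pi> t j)" using e by simp
  then have "W s \<circ> p j = W t \<circ> p j" by (simp add: \<pi>_def pi WQ pQ j)
  then have "(W s \<circ> p j) \<circ> inv_into UNIV (p j) = (W t \<circ> p j) \<circ> inv_into UNIV (p j)" by simp
  moreover have "p j permutes X" using pQ[OF j] by (simp add: Q_def)
  ultimately have "W s = W t" by (simp add: o_assoc[symmetric] permutes_inv_o)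
  then have "W s [] = W t []" by simp
  moreover have "W s [] = s" "W t [] = t" using h n st S(2) by (auto simp: W_def F2_simps(1))
  ultimately show ?thesis by simp
 qed
 ultimately show "\<exists>(q::nat) \<pi>. 0 < q \<and> (\<forall>s\<in>carrier F2. bij_betw (\<pi> s) {..<q} {..<q}) \<and>
   (\<forall>s\<in>carrier F2. \<forall>t\<in>carrier F2. \<forall>j<q. \<pi> (s \<otimes>\<^bsub>F2\<^esub> t) j = \<pi> s (\<pi> t j)) \<and>
   (\<forall>s\<in>S. \<forall>t\<in>S. \<forall>j<q. \<pi> s j = \<pi> t j \<longrightarrow> s = t)"
  by blast
qed

section \<open>Permutation matrices as matrices of multipliers\<close>

context approx_group begin

text \<open>The entry at \<open>s t^-1\<close> equals
  \<open>\<Sum>k. [\<pi> s k = i] [\<pi> t k = j]\<close>, so the kernel is a product of permutation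
  matrices depending on \<open>s\<close> and on \<open>t\<close>, and \<open>kbd_schur\<close>
  applies with both constants 1.\<close>

lemma HSm_permutation:
 fixes q :: nat
 assumes \<pi>: "\<And>s. s \<in> carrier G ==> bij_betw (\<pi> s) {..<q} {..<q}"
  and hom: "\<And>s t j. s \<in> carrier G ==> t \<in> carrier G ==> j < q ==> \<pi> (s \<otimes> t) j = \<pi> s (\<pi> t j)"
 shows "HSm q (\<lambda>i j s. if \<pi> s j = i then 1 else 0) 1"
 unfolding HSm_def
proof (intro conjI allI impI)
 fix r \<alpha> d assume "mbd r \<alpha> d"
 then have K: "kbd ({..<r} \<times> carrier G) (mker \<alpha>) d" by (simp add: mbd_def)
 let ?v = "\<lambda>i j s. if \<pi> s j = i then 1 else 0 :: complex"
 show "kbd ({..<q} \<times> {..<r} \<times> carrier G) (\<lambda>(i, a, s) (j, b, t). ker (?v i j) s t * ker (\<alpha> a b) s t) (1 * d)"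
 proof (rule kbd_localI)
  show "0 \<le> 1 * d" using kbd_nonneg[OF K] by simp
  fix F assume F: "finite F" "F \<subseteq> {..<q} \<times> {..<r} \<times> carrier G"
  define T where "T = snd ` F"
  have T: "finite T" "T \<subseteq> {..<r} \<times> carrier G" "F \<subseteq> {..<q} \<times> T" using F by (force simp: T_def)+
  define A where "A j k p = (if \<pi> (snd p) k = j then 1 else 0 :: complex)" for j k and p :: "nat \<times> 'a"
  have nA: "nrm (\<lambda>k. \<Sum>j<q. A j k p * x j) {..<q} \<le> 1 * nrm x {..<q}" if "p \<in> T" for p x
  proof -
   have b: "bij_betw (\<pi> (snd p)) {..<q} {..<q}" using \<pi> T(2) that by auto
   have "(\<Sum>j<q. A j k p * x j) = x (\<pi> (snd p) k)" if "k < q" for k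
   proof -
    have "(\<Sum>j<q. A j k p * x j) = (\<Sum>j<q. if \<pi> (snd p) k = j then x j else 0)"
     by (intro sum.cong refl) (simp add: A_def)
    then show ?thesis using bij_betwE[OF b] that by simp
   qed
   then have "nrm (\<lambda>k. \<Sum>j<q. A j k p * x j) {..<q} = nrm (\<lambda>k. x (\<pi> (snd p) k)) {..<q}"
    by (intro L2_set_cong) auto
   also have "\<dots> = nrm x {..<q}"
    unfolding L2_set_def using sum.reindex_bij_betw[OF b, of "\<lambda>k. (cmod (x k))\<^sup>2"] by simp
   finally show ?thesis by simp
  qed
  have "kbd ({..<q} \<times> T) (\<lambda>(i, p) (j, p'). (\<Sum>k<q. cnj (A i k p) * A j k p') * mker \<alpha> p p') (1 * 1 * d)"
   by (rule kbd_schur[OF kbd_subset[OF K T(2)]]) (use T nA in auto)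
  then have "kbd F (\<lambda>(i, p) (j, p'). (\<Sum>k<q. cnj (A i k p) * A j k p') * mker \<alpha> p p') d"
   using kbd_subset[OF _ T(3)] by simp
  moreover have "(\<Sum>k<q. cnj (A i k (a, s)) * A j k (b, t)) = ker (?v i j) s t"
   if "(i, a, s) \<in> F" "(j, b, t) \<in> F" for i a s j b t
  proof -
   have ij: "i < q" "j < q" and st: "s \<in> carrier G" "t \<in> carrier G" using that F(2) by auto
   have bt: "bij_betw (\<pi> t) {..<q} {..<q}" by (rule \<pi>[OF st(2)])
   then have "j \<in> \<pi> t ` {..<q}" using ij(2) by (simp add: bij_betw_def)
   then obtain k where k: "k < q" "\<pi> t k = j" by auto
   have "\<pi> t k' = j \<longleftrightarrow> k' = k" if "k' < q" for k'
    using bt k that by (auto simp: bij_betw_def inj_on_def)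
   then have "(\<Sum>k'<q. cnj (A i k' (a, s)) * A j k' (b, t)) = (\<Sum>k'<q. if k' = k then cnj (A i k (a, s)) else 0)"
    by (intro sum.cong refl) (auto simp: A_def)
   also have "\<dots> = (if \<pi> s k = i then 1 else 0)" using k(1) by (simp add: A_def)
   also have "\<pi> s k = \<pi> (s \<otimes> inv t \<otimes> t) k" using st by (simp add: m_assoc)
   also have "\<dots> = \<pi> (s \<otimes> inv t) j" using hom[of "s \<otimes> inv t" t k] st k by simp
   finally show ?thesis by (simp add: ker_def)
  qed
  ultimately show "kbd F (\<lambda>(i, a, s) (j, b, t). ker (?v i j) s t * ker (\<alpha> a b) s t) (1 * d)"
   by (subst (asm) kbd_cong[where K' = "\<lambda>(i, a, s) (j, b, t). ker (?v i j) s t * ker (\<alpha> a b) s t"]) (auto simp: mker_def)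
 qed
qed simp

lemma HSm_e_mult:
 assumes f: "HSm q f c" and e: "HS h b"
 shows "HSm q (\<lambda>i j s. h s * f i j s) (c * b)"
 unfolding HSm_def
proof (intro conjI allI impI)
 show "0 \<le> c * b" using f e by (simp add: HSm_def HS_def)
 fix r \<alpha> d assume "mbd r \<alpha> d"
 then have "mbd r (\<lambda>a b s. h s * \<alpha> a b s) (b * d)" using e by (simp add: HS_def)
 then have "kbd ({..<q} \<times> {..<r} \<times> carrier G) (\<lambda>(i, a, s) (j, b, t). ker (f i j) s t * ker (\<lambda>s. h s * \<alpha> a b s) s t) (c * (b * d))"
  using f by (auto simp: HSm_def)
 then show "kbd ({..<q} \<times> {..<r} \<times> carrier G) (\<lambda>(i, a, s) (j, b, t). ker (\<lambda>s. h s * f i j s) s t * ker (\<alpha> a b) s t) (c * b * d)"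
  by (simp add: ker_def mult_ac)
qed

end

section \<open>Bilinear maps, dual spaces and Banach limits\<close>

lemma vector_space_complex: "vector_space (smul complex_os)"
 unfolding complex_os_def by unfold_locales (auto simp: algebra_simps)

lemma lin_on_in: "lin_on V W T ==> x \<in> vecs V ==> T x \<in> vecs W"
 and lin_on_add: "lin_on V W T ==> x \<in> vecs V ==> y \<in> vecs V ==> T (x + y) = T x + T y"
 and lin_on_smul: "lin_on V W T ==> x \<in> vecs V ==> T (smul V c x) = smul W c (T x)"
 by (auto simp: lin_on_def)

lemma lin_on_diff:
 assumes V: "vector_space (smul V)" "module.subspace (smul V) (vecs V)" and W: "vector_space (smul W)"
  and T: "lin_on V W T" and xy: "x \<in> vecs V" "y \<in> vecs V"
 shows "T (x - y) = T x - T y"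
proof -
 interpret V: vector_space "smul V" by (rule V(1))
 interpret W: vector_space "smul W" by (rule W)
 have "smul V (-1) y \<in> vecs V" by (rule V.subspace_scale[OF V(2) xy(2)])
 then have "T (x + smul V (-1) y) = T x + T (smul V (-1) y)" by (rule lin_on_add[OF T xy(1)])
 also have "T (smul V (-1) y) = smul W (-1) (T y)" by (rule lin_on_smul[OF T xy(2)])
 finally show ?thesis
  by (simp only: V.scale_minus_left V.scale_one W.scale_minus_left W.scale_one diff_conv_add_uminus)
qed

lemma lin_on_0:
 assumes V: "vector_space (smul V)" "module.subspace (smul V) (vecs V)" and T: "lin_on V W T" and W: "vector_space (smul W)"
 shows "T 0 = 0"
proof -
 interpret V: vector_space "smul V" by (rule V(1))
 have "0 \<in> vecs V" by (rule V.subspace_0[OF V(2)])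
 from lin_on_diff[OF V W T this this] show ?thesis by simp
qed

lemma lin_on_sum:
 assumes V: "vector_space (smul V)" "module.subspace (smul V) (vecs V)" and T: "lin_on V W T" and W: "vector_space (smul W)"
  and I: "finite I" "\<And>i. i \<in> I ==> f i \<in> vecs V"
 shows "T (\<Sum>i\<in>I. f i) = (\<Sum>i\<in>I. T (f i))"
proof -
 interpret V: vector_space "smul V" by (rule V(1))
 show ?thesis using I
 proof (induction I rule: finite_induct)
  case empty
  show ?case using lin_on_0[OF V T W] by simp
 next
  case (insert i I)
  have "(\<Sum>i\<in>I. f i) \<in> vecs V" by (rule V.subspace_sum[OF V(2)]) (use insert in auto)
  then show ?case using insert lin_on_add[OF T] by simp
 qed
qed

text \<open>A single vector against a matrix is a tensor of a 1 by 1 and a \<open>q\<close> by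
  \<open>q\<close> matrix. Its projective norm is estimated by the trivial factorisation with
  identity matrices on both sides.\<close>

lemma cb_bilin_bound:
 assumes V: "operator_space V" and W: "operator_space W" and X: "operator_space X" and \<Phi>: "cb_bilin V W X \<Phi>"
 obtains C where "0 \<le> C"
  "\<And>x q g. x \<in> vecs V ==> g \<in> mats W q ==> mnorm X q (\<lambda>i j. \<Phi> x (g i j)) \<le> C * vnorm V x * mnorm W q g"
proof -
 interpret V: operator_space V by (rule V)
 interpret W: operator_space W by (rule W)
 interpret WS: vector_space "smul W" by (rule W.ambient)
 interpret T: vector_space "\<lambda>c (f :: (_ => _ => complex) => complex) t. c * f t" by (rule vector_space_pointwise)
 obtain L where L: "cb_on (proj_tensor V W) X L" "\<And>x y. x \<in> vecs V ==> y \<in> vecs W ==> L (tensor V W x y) = \<Phi> x y"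
  using \<Phi> unfolding cb_bilin_def by blast
 obtain C where C: "\<And>n u. u \<in> mats (proj_tensor V W) n ==> mnorm X n (\<lambda>i j. L (u i j)) \<le> C * mnorm (proj_tensor V W) n u"
  using L(1) unfolding cb_on_def by blast
 have "mnorm X q (\<lambda>i j. \<Phi> x (g i j)) \<le> \<bar>C\<bar> * vnorm V x * mnorm W q g" if x: "x \<in> vecs V" and g: "g \<in> mats W q" for x q g
 proof -
  define u where "u i j = tensor V W x (g i j)" for i j
  define I :: "nat => nat => complex" where "I i k = (if i = k then 1 else 0)" for i k
  have gv: "g i j \<in> vecs W" for i j
   using mats_in[OF g] mats_out[OF g] WS.subspace_0[OF W.subspace] by (cases "i < q \<and> j < q") auto
  have um: "u \<in> mats (proj_tensor V W) q"
  proof (rule matsI)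
   show "u i j \<in> vecs (proj_tensor V W)" for i j
    unfolding proj_tensor_def u_def by (simp, rule T.span_base) (use x gv in blast)
   show "u i j = 0" if "\<not> (i < q \<and> j < q)" for i j
    unfolding u_def mats_out[OF g that] using tensor_zero[OF V W x] by (simp add: zero_fun_def)
  qed
  have I1: "(\<Sum>k<q. I i k * f k) = (if i < q then f i else 0)" "(\<Sum>k<q. f k * I k i) = (if i < q then f i else 0)" for i and f :: "nat => complex"
  proof -
   have "(\<Sum>k<q. I i k * f k) = (\<Sum>k<q. if i = k then f k else 0)" "(\<Sum>k<q. f k * I k i) = (\<Sum>k<q. if k = i then f k else 0)"
    by (intro sum.cong refl; simp add: I_def)+
   then show "(\<Sum>k<q. I i k * f k) = (if i < q then f i else 0)" "(\<Sum>k<q. f k * I k i) = (if i < q then f i else 0)" by auto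
  qed
  have In: "cmat_norm q q I \<le> 1"
   by (rule cmat_norm_leI) (auto simp: I1 intro!: L2_set_mono)
  have ue: "u = sandwich (\<lambda>c t B. c * t B) q (1 * q) I (mat_tensor V W 1 q (pad 1 (\<lambda>i j. x)) g) I"
  proof -
   have m: "mat_tensor V W 1 q (pad 1 (\<lambda>i j. x)) g k l = u k l" if "k < q" "l < q" for k l
    using that unfolding mat_tensor_def pad_def u_def mult_1 by (simp only: div_less mod_less if_True zero_less_one simp_thms)
   define U where "U = sandwich (\<lambda>c t B. c * t B) q (1 * q) I (mat_tensor V W 1 q (pad 1 (\<lambda>i j. x)) g) I"
   have "u i j B = U i j B" for i j B
   proof (cases "i < q \<and> j < q")
    case True
    have "U i j B = (\<Sum>k<1 * q. \<Sum>l<1 * q. I i k * I l j * mat_tensor V W 1 q (pad 1 (\<lambda>i j. x)) g k l B)"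
     using True by (simp add: U_def sandwich_def pad_def[of q] sum_fun_apply)
    also have "\<dots> = (\<Sum>k<q. I i k * (\<Sum>l<q. u k l B * I l j))"
     unfolding mult_1 sum_distrib_left by (intro sum.cong refl) (simp add: m[unfolded One_nat_def])
    finally show ?thesis using True by (simp only: I1 if_True)
   next
    case False
    then show ?thesis using mats_out[OF um False] by (auto simp: U_def sandwich_def pad_def)
   qed
   then show ?thesis unfolding U_def[symmetric] by blast
  qed
  define Z where "Z = {cmat_norm q (p * r) \<alpha> * mnorm V p v * mnorm W r w * cmat_norm (p * r) q \<beta>
    | p r \<alpha> v w \<beta>. v \<in> mats V p \<and> w \<in> mats W r \<and>
      u = sandwich (\<lambda>c t B. c * t B) q (p * r) \<alpha> (mat_tensor V W p r v w) \<beta>}"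
  have xm: "pad 1 (\<lambda>i j. x) \<in> mats V 1" by (rule mats_pad) (rule x)
  have Z0: "0 \<le> z" if "z \<in> Z" for z
   using that V.norm_nonneg W.norm_nonneg unfolding Z_def by (auto intro!: mult_nonneg_nonneg cmat_norm_nonneg)
  have zZ: "cmat_norm q (1 * q) I * mnorm V 1 (pad 1 (\<lambda>i j. x)) * mnorm W q g * cmat_norm (1 * q) q I \<in> Z"
   unfolding Z_def using xm g ue by blast
  have "Inf Z \<le> cmat_norm q (1 * q) I * mnorm V 1 (pad 1 (\<lambda>i j. x)) * mnorm W q g * cmat_norm (1 * q) q I"
   by (rule cInf_lower[OF zZ bdd_belowI[of _ 0]]) (rule Z0)
  also have "\<dots> \<le> 1 * mnorm V 1 (pad 1 (\<lambda>i j. x)) * mnorm W q g * 1"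
   using In V.norm_nonneg[OF xm] W.norm_nonneg[OF g] by (intro mult_mono mult_nonneg_nonneg) (auto simp: cmat_norm_nonneg)
  finally have le: "Inf Z \<le> vnorm V x * mnorm W q g" by (simp add: vnorm_def)
  have "0 \<le> Inf Z" by (rule cInf_greatest) (use zZ Z0 in auto)
  have "mnorm X q (\<lambda>i j. L (u i j)) \<le> C * Inf Z"
   using C[OF um] by (simp add: proj_tensor_def Z_def)
  also have "\<dots> \<le> \<bar>C\<bar> * Inf Z" using \<open>0 \<le> Inf Z\<close> by (intro mult_right_mono) auto
  also have "\<dots> \<le> \<bar>C\<bar> * (vnorm V x * mnorm W q g)" using le by (intro mult_left_mono) auto
  finally show ?thesis unfolding u_def L(2)[OF x gv] by (simp only: mult.assoc)
 qed
 then show thesis by (rule that[OF abs_ge_zero])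
qed

text \<open>A bounded functional is completely bounded: the form of the matrix of values at
  \<open>a\<close>, \<open>b\<close> is the value at the vector \<open>z\<close> obtained by
  compressing \<open>y\<close> with a row and a column, and Ruan's sandwich axiom bounds that
  vector.\<close>

lemma functional_kbd:
 assumes V: "operator_space V" and \<phi>: "\<phi> \<in> vecs (os_dual V)"
 obtains c where "\<And>m y. y \<in> mats V m ==> kbd {..<m} (\<lambda>k l. \<phi> (y k l)) (c * mnorm V m y)"
proof -
 interpret V: operator_space V by (rule V)
 interpret VS: vector_space "smul V" by (rule V.ambient)
 have lin: "lin_on V complex_os \<phi>" using \<phi> by (simp add: os_dual_def)
 obtain C where C: "\<And>x. x \<in> vecs V ==> cmod (\<phi> x) \<le> C * vnorm V x"
  using \<phi> by (auto simp: os_dual_def)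
 have "kbd {..<m} (\<lambda>k l. \<phi> (y k l)) (\<bar>C\<bar> * mnorm V m y)" if y: "y \<in> mats V m" for m y
 proof (rule kbd_finiteI)
  show "0 \<le> \<bar>C\<bar> * mnorm V m y" using V.norm_nonneg[OF y] by simp
  fix a b :: "nat => complex"
  define \<alpha> \<beta> where "\<alpha> i k = cnj (b k)" and "\<beta> l j = a l" for i j k l :: nat
  define z where "z = (\<Sum>k<m. \<Sum>l<m. smul V (cnj (b k) * a l) (y k l))"
  have sm: "smul V d (y k l) \<in> vecs V" if "k < m" "l < m" for d k l
   by (rule VS.subspace_scale[OF V.subspace mats_in[OF y that]])
  have zi: "(\<Sum>l<m. smul V (cnj (b k) * a l) (y k l)) \<in> vecs V" if "k < m" for k
   by (rule VS.subspace_sum[OF V.subspace]) (use that sm in auto)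
  then have z: "z \<in> vecs V" unfolding z_def by (rule VS.subspace_sum[OF V.subspace]) simp
  have "\<phi> z = (\<Sum>k<m. \<phi> (\<Sum>l<m. smul V (cnj (b k) * a l) (y k l)))"
   unfolding z_def by (rule lin_on_sum[OF V.ambient V.subspace lin vector_space_complex]) (use zi in auto)
  also have "\<dots> = (\<Sum>k<m. \<Sum>l<m. \<phi> (y k l) * a l * cnj (b k))"
  proof (rule sum.cong[OF refl])
   fix k assume k: "k \<in> {..<m}"
   have "\<phi> (\<Sum>l<m. smul V (cnj (b k) * a l) (y k l)) = (\<Sum>l<m. \<phi> (smul V (cnj (b k) * a l) (y k l)))"
    by (rule lin_on_sum[OF V.ambient V.subspace lin vector_space_complex])
     (use k sm in auto)
   also have "\<dots> = (\<Sum>l<m. \<phi> (y k l) * a l * cnj (b k))"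
    by (rule sum.cong[OF refl]) (use k mats_in[OF y] lin_on_smul[OF lin] in \<open>simp add: complex_os_def\<close>)
   finally show "\<phi> (\<Sum>l<m. smul V (cnj (b k) * a l) (y k l)) = (\<Sum>l<m. \<phi> (y k l) * a l * cnj (b k))" .
  qed
  finally have \<phi>z: "\<phi> z = kform {..<m} (\<lambda>k l. \<phi> (y k l)) a b" by (simp add: kform_def)
  have "sandwich (smul V) 1 m \<alpha> y \<beta> = pad 1 (\<lambda>i j. z)" by (simp add: sandwich_def \<alpha>_def \<beta>_def z_def)
  then have "vnorm V z \<le> cmat_norm 1 m \<alpha> * mnorm V m y * cmat_norm m 1 \<beta>"
   using V.norm_sandwich[OF y, of 1 \<alpha> \<beta>] by (simp add: vnorm_def)
  also have "\<dots> \<le> nrm b {..<m} * mnorm V m y * nrm a {..<m}"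
  proof (intro mult_mono mult_nonneg_nonneg)
   show "cmat_norm 1 m \<alpha> \<le> nrm b {..<m}"
   proof (rule cmat_norm_leI)
    fix v
    show "nrm (\<lambda>i. \<Sum>j<m. \<alpha> i j * v j) {..<1} \<le> nrm b {..<m} * nrm v {..<m}"
     using inner_le_nrm[of v b "{..<m}"] by (simp add: L2_set_def[of _ "{0}"] lessThan_Suc \<alpha>_def mult.commute)
   qed simp
   show "cmat_norm m 1 \<beta> \<le> nrm a {..<m}"
    by (rule cmat_norm_leI) (simp_all add: \<beta>_def lessThan_Suc norm_mult L2_set_left_distrib L2_set_def[of _ "{0}"])
  qed (use V.norm_nonneg[OF y] in \<open>auto simp: cmat_norm_nonneg\<close>)
  finally have vz: "vnorm V z \<le> nrm b {..<m} * mnorm V m y * nrm a {..<m}" .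
  have "0 \<le> vnorm V z" unfolding vnorm_def by (rule V.norm_nonneg[OF mats_pad]) (rule z)
  have "cmod (\<phi> z) \<le> C * vnorm V z" by (rule C[OF z])
  also have "\<dots> \<le> \<bar>C\<bar> * vnorm V z" using \<open>0 \<le> vnorm V z\<close> by (intro mult_right_mono) auto
  also have "\<dots> \<le> \<bar>C\<bar> * (nrm b {..<m} * mnorm V m y * nrm a {..<m})" using vz by (intro mult_left_mono) auto
  finally show "cmod (kform {..<m} (\<lambda>k l. \<phi> (y k l)) a b) \<le> \<bar>C\<bar> * mnorm V m y * nrm a {..<m} * nrm b {..<m}"
   unfolding \<phi>z by (simp only: mult_ac)
 qed simp
 then show thesis by (rule that)
qed

lemma kbd_amplify:
 "kbd {..<q * m} (amplify q m F y) c \<longleftrightarrow> kbd ({..<q} \<times> {..<m}) (\<lambda>(i, k) (j, l). F i j (y k l)) c"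
proof -
 have "kbd {..<q * m} (amplify q m F y) c \<longleftrightarrow>
  kbd {..<q * m} (\<lambda>p p'. (\<lambda>(i, k) (j, l). F i j (y k l)) (p div m, p mod m) (p' div m, p' mod m)) c"
  by (rule kbd_cong) (simp add: amplify_def pad_def)
 then show ?thesis unfolding kbd_reindex_bij[OF bij_divmod] .
qed

text \<open>For \<open>y\<close> in the unit ball the estimate belongs to the supremum that defines
  the norm, which is finite by \<open>functional_kbd\<close>. Other \<open>y\<close> are rescaled,
  and one of norm 0 vanishes.\<close>

lemma os_dual_mnormD:
 assumes V: "operator_space V" and F: "\<And>i j. i < q ==> j < q ==> F i j \<in> vecs (os_dual V)"
  and c: "mnorm (os_dual V) q F \<le> c" and y: "y \<in> mats V m"
 shows "kbd ({..<q} \<times> {..<m}) (\<lambda>(i, k) (j, l). F i j (y k l)) (c * mnorm V m y)"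
proof -
 interpret V: operator_space V by (rule V)
 interpret VS: vector_space "smul V" by (rule V.ambient)
 define Z where "Z = {cmat_norm (q * m) (q * m) (amplify q m F y) | m y. y \<in> mats V m \<and> mnorm V m y \<le> 1}"
 have lin: "lin_on V complex_os (F i j)" if "i < q" "j < q" for i j using F[OF that] by (simp add: os_dual_def)
 define P where "P i j C \<longleftrightarrow> (\<forall>m. \<forall>y\<in>mats V m. kbd {..<m} (\<lambda>k l. F i j (y k l)) (C * mnorm V m y))" for i j C
 define K where "K i j = (SOME C. P i j C)" for i j
 have "P i j (K i j)" if ij: "i < q" "j < q" for i j
  unfolding K_def
 proof (rule someI_ex)
  obtain C where "\<And>m y. y \<in> mats V m ==> kbd {..<m} (\<lambda>k l. F i j (y k l)) (C * mnorm V m y)"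
   using functional_kbd[OF V F[OF ij]] by blast
  then show "\<exists>C. P i j C" unfolding P_def by blast
 qed
 then have K: "kbd {..<m} (\<lambda>k l. F i j (y k l)) (K i j * mnorm V m y)" if "i < q" "j < q" "y \<in> mats V m" for i j m y
  using that unfolding P_def by blast
 have "bdd_above Z"
 proof (rule bdd_aboveI)
  fix z assume "z \<in> Z"
  then obtain m y where z: "z = cmat_norm (q * m) (q * m) (amplify q m F y)" and y: "y \<in> mats V m" "mnorm V m y \<le> 1"
   unfolding Z_def by blast
  have "kbd ({..<q} \<times> {..<m}) (\<lambda>(i, k) (j, l). F i j (y k l)) (\<Sum>i<q. \<Sum>j<q. \<bar>K i j\<bar>)"
  proof (rule kbd_block)
   fix i j assume "i \<in> {..<q}" "j \<in> {..<q}"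
   then have ij: "i < q" "j < q" by auto
   have "K i j * mnorm V m y \<le> \<bar>K i j\<bar> * 1"
    using y(2) V.norm_nonneg[OF y(1)] by (intro mult_mono) auto
   then show "kbd {..<m} (\<lambda>k l. F i j (y k l)) \<bar>K i j\<bar>" using kbd_mono[OF K[OF ij y(1)]] by simp
  qed simp
  then show "z \<le> (\<Sum>i<q. \<Sum>j<q. \<bar>K i j\<bar>)"
   unfolding z by (subst cmat_norm_le_iff) (auto simp: kbd_amplify intro: sum_nonneg)
 qed
 moreover have "Sup Z \<le> c" using c by (simp add: Z_def os_dual_def cb_mnorm_def complex_os_def)
 ultimately have Zc: "z \<le> c" if "z \<in> Z" for z using cSup_upper[OF that] by fastforce
 have unit: "kbd ({..<q} \<times> {..<m}) (\<lambda>(i, k) (j, l). F i j (y k l)) c" if "y \<in> mats V m" "mnorm V m y \<le> 1" for m y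
 proof -
  have "cmat_norm (q * m) (q * m) (amplify q m F y) \<le> c" by (rule Zc) (use that in \<open>auto simp: Z_def\<close>)
  then show ?thesis using kbd_mono[OF kbd_cmat_norm] unfolding kbd_amplify[symmetric] by blast
 qed
 define t where "t = mnorm V m y"
 have t0: "0 \<le> t" unfolding t_def by (rule V.norm_nonneg[OF y])
 show ?thesis
 proof (cases "t = 0")
  case True
  then have "y = 0" using V.norm_eq_0[OF y] by (simp add: t_def)
  then have "F i j (y k l) = 0" if "i < q" "j < q" for i j k l
   using lin_on_0[OF V.ambient V.subspace lin[OF that] vector_space_complex] by simp
  then have "kbd ({..<q} \<times> {..<m}) (\<lambda>(i, k) (j, l). F i j (y k l)) 0 \<longleftrightarrow> kbd ({..<q} \<times> {..<m}) (\<lambda>p p'. 0) 0"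
   by (intro kbd_cong) auto
  then show ?thesis using True kbd_zero[of 0] by (simp add: t_def)
 next
  case False
  define y' where "y' i j = smul V (of_real (1 / t)) (y i j)" for i j
  have y'm: "y' \<in> mats V m"
   by (rule matsI) (use mats_in[OF y] mats_out[OF y] in \<open>auto simp: y'_def VS.subspace_scale[OF V.subspace]\<close>)
  have "mnorm V m y' = cmod (of_real (1 / t)) * t"
   unfolding y'_def t_def by (rule V.norm_smul[OF y])
  then have "mnorm V m y' \<le> 1" using t0 False by (simp add: norm_divide)
  from kbd_scale[OF unit[OF y'm this], of "of_real t"]
  have "kbd ({..<q} \<times> {..<m}) (\<lambda>p p'. of_real t * (case p of (i, k) => \<lambda>(j, l). F i j (y' k l)) p') (t * c)"
   using t0 by simp
  moreover have "of_real t * F i j (y' k l) = F i j (y k l)" if "i < q" "j < q" "k < m" "l < m" for i j k l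
   using lin_on_smul[OF lin[OF that(1,2)] mats_in[OF y that(3,4)], of "of_real (1 / t)"] False
   by (simp add: y'_def complex_os_def)
  ultimately have "kbd ({..<q} \<times> {..<m}) (\<lambda>(i, k) (j, l). F i j (y k l)) (t * c)"
   by (subst (asm) kbd_cong[where K' = "\<lambda>(i, k) (j, l). F i j (y k l)"]) auto
  then show ?thesis by (simp add: t_def mult.commute)
 qed
qed

text \<open>Hahn-Banach below the limit superior of the real parts, followed by complexification.
  The sup norm bound is recovered by rotating the value to the positive axis.\<close>

lemma Banach_limit:
 obtains L :: "(nat => complex) => complex" where
  "\<And>x y. Bseq x ==> Bseq y ==> L (\<lambda>k. x k + y k) = L x + L y" "\<And>c x. Bseq x ==> L (\<lambda>k. c * x k) = c * L x"
  "\<And>x l. x \<longlonglongrightarrow> l ==> L x = l" "\<And>x c. \<forall>k. cmod (x k) \<le> c ==> cmod (L x) \<le> c"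
proof -
 define W where "W = {x :: nat => complex. Bseq x}"
 \<comment> \<open>The eventual upper bounds of the real parts; their infimum \<open>p x\<close> is
   the limit superior.\<close>
 define S where "S x = {c. \<forall>\<^sub>F k in sequentially. Re (x k) \<le> c}" for x :: "nat => complex"
 define p where "p x = Inf (S x)" for x
 interpret complex_function_space W
 proof
  show "x + y \<in> W" if xy: "x \<in> W" "y \<in> W" for x y
  proof -
   obtain M N where "\<And>k. cmod (x k) \<le> M" "\<And>k. cmod (y k) \<le> N" using xy by (auto simp: W_def Bseq_def)
   then have "cmod (x k + y k) \<le> M + N" for k using norm_triangle_mono by blast
   then show ?thesis by (auto simp: W_def intro!: BseqI'[of "x + y" "M + N"])
  qed
  show "(\<lambda>s. c * x s) \<in> W" if "x \<in> W" for x c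
   using Bseq_mult[of "\<lambda>_. c" x] that by (simp add: W_def)
  have "(\<lambda>_. 0) \<in> W" by (simp add: W_def)
  then show "W \<noteq> {}" by blast
 qed
 have W_b: "\<exists>M. \<forall>k. cmod (x k) \<le> M" if "x \<in> W" for x using that by (auto simp: W_def Bseq_def)
 have S_ne: "S x \<noteq> {}" if "x \<in> W" for x
 proof -
  from W_b[OF that] obtain M where M: "\<forall>k. cmod (x k) \<le> M" by blast
  have "Re (x k) \<le> M" for k by (rule order_trans[OF complex_Re_le_cmod]) (simp add: M)
  then have "M \<in> S x" by (simp add: S_def)
  then show ?thesis by blast
 qed
 have S_bdd: "bdd_below (S x)" if "x \<in> W" for x
 proof -
  from W_b[OF that] obtain M where M: "\<forall>k. cmod (x k) \<le> M" by blast
  show ?thesis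
  proof (rule bdd_belowI)
   fix c assume "c \<in> S x"
   then obtain k where "Re (x k) \<le> c" by (auto simp: S_def eventually_sequentially)
   moreover have "\<bar>Re (x k)\<bar> \<le> M" by (rule order_trans[OF abs_Re_le_cmod]) (simp add: M)
   ultimately show "- M \<le> c" by linarith
  qed
 qed
 have p_le: "p x \<le> c" if "x \<in> W" "c \<in> S x" for x c unfolding p_def by (rule cInf_lower[OF that(2) S_bdd[OF that(1)]])
 have "sublinear_on W p"
  unfolding sublinear_on_def
 proof (intro conjI ballI allI impI)
  fix x y assume xy: "x \<in> W" "y \<in> W"
  have "p (x + y) \<le> c + d" if "c \<in> S x" "d \<in> S y" for c d
  proof (rule p_le[OF W_add[OF xy]])
   from that have "\<forall>\<^sub>F k in sequentially. Re (x k) \<le> c" "\<forall>\<^sub>F k in sequentially. Re (y k) \<le> d" by (auto simp: S_def)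
   then have "\<forall>\<^sub>F k in sequentially. Re ((x + y) k) \<le> c + d" by eventually_elim simp
   then show "c + d \<in> S (x + y)" by (simp add: S_def)
  qed
  then have "p (x + y) - d \<le> p x" if "d \<in> S y" for d
   unfolding p_def[of x] using that by (intro cInf_greatest[OF S_ne[OF xy(1)]]) (simp add: diff_le_eq)
  then have "p (x + y) - p x \<le> p y"
   unfolding p_def[of y] by (intro cInf_greatest[OF S_ne[OF xy(2)]]) (simp add: algebra_simps)
  then show "p (x + y) \<le> p x + p y" by simp
 next
  fix x and t :: real assume x: "x \<in> W" and t: "0 \<le> t"
  have tc: "p (\<lambda>s. complex_of_real t * x s) \<le> t * c" if "c \<in> S x" for c
  proof (rule p_le[OF W_scale[OF x]])
   from that have "\<forall>\<^sub>F k in sequentially. Re (x k) \<le> c" by (simp add: S_def)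
   then have "\<forall>\<^sub>F k in sequentially. Re (complex_of_real t * x k) \<le> t * c"
    by eventually_elim (use t in \<open>simp add: mult_left_mono\<close>)
   then show "t * c \<in> S (\<lambda>s. complex_of_real t * x s)" by (simp add: S_def)
  qed
  show "p (\<lambda>s. complex_of_real t * x s) \<le> t * p x"
  proof (cases "t = 0")
   case True
   obtain c where "c \<in> S x" using S_ne[OF x] by blast
   from tc[OF this] show ?thesis using True by simp
  next
   case False
   then have t: "0 < t" using t by simp
   have "p (\<lambda>s. complex_of_real t * x s) / t \<le> p x"
    unfolding p_def[of x] by (rule cInf_greatest[OF S_ne[OF x]]) (use tc t in \<open>simp add: field_simps\<close>)
   then show ?thesis using t by (simp add: field_simps)
  qed
 qed
 note sub = this
 obtain f where fp: "\<And>x. x \<in> W ==> f x \<le> p x" and f_add: "\<And>x y. x \<in> W ==> y \<in> W ==> f (x + y) = f x + f y"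
  and f_pos: "\<And>x t. x \<in> W ==> 0 \<le> t ==> f (\<lambda>s. complex_of_real t * x s) = t * f x"
  by (rule Hahn_Banach[OF sub W_0]) (rule that)
 have f_add': "f (\<lambda>k. x k + y k) = f x + f y" if "x \<in> W" "y \<in> W" for x y
  using f_add[OF that] by (simp add: plus_fun_def)
 have f0: "f (\<lambda>k. 0) = 0" using f_pos[OF W_0, of 0] by simp
 have f_neg: "f (\<lambda>k. - x k) = - f x" if "x \<in> W" for x
 proof -
  have "(\<lambda>k. - 1 * x k) \<in> W" by (rule W_scale[OF that])
  then have "f (\<lambda>k. x k + - x k) = f x + f (\<lambda>k. - x k)" by (intro f_add' that) simp
  then show ?thesis by (simp add: f0)
 qed
 have f_real: "f (\<lambda>k. complex_of_real t * x k) = t * f x" if x: "x \<in> W" for t x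
 proof (cases "0 \<le> t")
  case False
  have "f (\<lambda>k. - (complex_of_real (- t) * x k)) = - ((- t) * f x)"
   using False f_neg[OF W_scale[OF x, of "of_real (- t)"]] f_pos[OF x, of "- t"] by simp
  then show ?thesis by simp
 qed (rule f_pos[OF x])
 define L where "L x = Complex (f x) (- f (\<lambda>k. \<i> * x k))" for x
 have Lc: "L (\<lambda>k. c * x k) = c * L x" if x: "x \<in> W" for c x
 proof -
  have split: "f (\<lambda>k. c * x k) = Re c * f x + Im c * f (\<lambda>k. \<i> * x k)" if x: "x \<in> W" for c x
  proof -
   have "(\<lambda>k. c * x k) = (\<lambda>k. of_real (Re c) * x k + of_real (Im c) * (\<i> * x k))"
    by (rule ext) (simp add: complex_eq_iff)
   then show ?thesis using f_add'[OF W_scale[OF x] W_scale[OF W_scale[OF x]]] f_real x f_real[OF W_scale[OF x]] by simp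
  qed
  have "(\<lambda>k. \<i> * (c * x k)) = (\<lambda>k. (\<i> * c) * x k)" by (simp add: mult.assoc)
  then show ?thesis using split[OF x, of c] split[OF x, of "\<i> * c"]
   by (simp add: L_def complex_eq_iff)
 qed
 have Lb: "cmod (L x) \<le> c" if b: "\<And>k. cmod (x k) \<le> c" for x c
 proof (cases "L x = 0")
  case True
  then show ?thesis using order_trans[OF norm_ge_zero b] by simp
 next
  case False
  have x: "x \<in> W" using b by (auto simp: W_def intro: BseqI')
  define z where "z = cnj (L x) / of_real (cmod (L x))"
  have z: "cmod z = 1" using False by (simp add: z_def norm_divide)
  have zx: "(\<lambda>k. z * x k) \<in> W" by (rule W_scale[OF x])
  have "L (\<lambda>k. z * x k) = (L x * cnj (L x)) / of_real (cmod (L x))" unfolding Lc[OF x] z_def by simp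
  also have "\<dots> = of_real (cmod (L x))"
   unfolding complex_norm_square[symmetric] using False by (simp add: power2_eq_square)
  finally have "L (\<lambda>k. z * x k) = of_real (cmod (L x))" .
  then have "cmod (L x) = f (\<lambda>k. z * x k)" by (simp add: L_def complex_eq_iff)
  also have "\<dots> \<le> p (\<lambda>k. z * x k)" by (rule fp[OF zx])
  also have "\<dots> \<le> c"
  proof (rule p_le[OF zx])
   have "Re (z * x k) \<le> c" for k
    using complex_Re_le_cmod[of "z * x k"] b[of k] z by (simp add: norm_mult)
   then show "c \<in> S (\<lambda>k. z * x k)" by (simp add: S_def)
  qed
  finally show ?thesis .
 qed
 have f_lim: "f x = Re l" if xl: "x \<longlonglongrightarrow> l" for x l
 proof -
  have le: "f x \<le> Re l" if xl: "x \<longlonglongrightarrow> l" for x l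
  proof (rule field_le_epsilon)
   fix \<epsilon> :: real assume \<epsilon>: "0 < \<epsilon>"
   have x: "x \<in> W" using xl by (simp add: W_def convergent_imp_Bseq convergentI)
   have "(\<lambda>k. Re (x k)) \<longlonglongrightarrow> Re l" using xl by (rule tendsto_Re)
   then have "\<forall>\<^sub>F k in sequentially. Re (x k) < Re l + \<epsilon>" using \<epsilon> by (intro order_tendstoD(2)) auto
   then have "Re l + \<epsilon> \<in> S x" unfolding S_def by (auto elim: eventually_mono)
   then show "f x \<le> Re l + \<epsilon>" using order_trans[OF fp[OF x] p_le[OF x]] by blast
  qed
  have "x \<in> W" using xl by (simp add: W_def convergent_imp_Bseq convergentI)
  then have "- f x \<le> - Re l" using le[OF tendsto_minus[OF xl]] f_neg by simp
  then show ?thesis using le[OF xl] by simp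
 qed
 have "L x = l" if "x \<longlonglongrightarrow> l" for x l
  using f_lim[OF that] f_lim[OF tendsto_mult_left[OF that, of \<i>]] by (simp add: L_def complex_eq_iff)
 moreover have "L (\<lambda>k. x k + y k) = L x + L y" if "x \<in> W" "y \<in> W" for x y
  using f_add'[OF that] f_add'[OF W_scale[OF that(1)] W_scale[OF that(2)], of \<i> \<i>]
  by (simp add: L_def complex_eq_iff ring_distribs)
 ultimately show thesis using that[of L] Lc Lb by (auto simp: W_def)
qed

section \<open>Derivations into dual bimodules\<close>

locale bimodule_derivation = approx_group G e B for G (structure) and e and B +
 fixes E :: "('a => complex, 'e::ab_group_add) op_bimodule" and D
 assumes bimodule: "quantized_banach_bimodule (A_cb G) E"
  and derivation: "dual_derivation (A_cb G) E D"
  and cb_derivation: "cb_on (A_cb G) (os_dual E) D"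
  and residually_finite: "residually_finite G"
begin

interpretation E: quantized_banach_bimodule "A_cb G" E by (rule bimodule)
interpretation ES: vector_space "smul E" by (rule E.ambient)

abbreviation mult :: "('a => complex) => ('a => complex) => 'a => complex" where
 "mult a b \<equiv> \<lambda>s. a s * b s"

lemmas A_op = operator_space.ambient[OF operator_space_Acb] operator_space.subspace[OF operator_space_Acb]

lemma lin_ract: "x \<in> vecs E ==> lin_on (A_cb G) E (ract E x)" "a \<in> vecs (A_cb G) ==> lin_on E E (\<lambda>x. ract E x a)"
 and lin_lact: "a \<in> vecs (A_cb G) ==> lin_on E E (lact E a)"
 using E.cb_ract E.cb_lact by (auto simp: cb_bilin_def bilin_on_def)

lemma D_dual: "a \<in> vecs (A_cb G) ==> D a \<in> vecs (os_dual E)"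
 using derivation by (simp add: dual_derivation_def lin_on_def)

lemma lin_D: "a \<in> vecs (A_cb G) ==> lin_on E complex_os (D a)" "lin_on (A_cb G) complex_os (\<lambda>a. D a x)"
proof -
 show "lin_on E complex_os (D a)" if "a \<in> vecs (A_cb G)" using D_dual[OF that] by (simp add: os_dual_def)
 have l: "lin_on (A_cb G) (os_dual E) D" using derivation by (simp add: dual_derivation_def)
 show "lin_on (A_cb G) complex_os (\<lambda>a. D a x)"
  using lin_on_add[OF l] lin_on_smul[OF l] by (simp add: lin_on_def complex_os_def os_dual_def)
qed

lemmas D_simps = lin_on_diff[OF E.ambient E.subspace vector_space_complex lin_D(1)]
 lin_on_diff[OF A_op vector_space_complex lin_D(2)]
lemmas ract_in = lin_on_in[OF lin_ract(1)]
lemmas lact_in = lin_on_in[OF lin_lact]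
lemmas ract_diff = lin_on_diff[OF A_op E.ambient lin_ract(1)] lin_on_diff[OF E.ambient E.subspace E.ambient lin_ract(2)]
lemmas lact_diff = lin_on_diff[OF E.ambient E.subspace E.ambient lin_lact]

lemma E_diff: "x \<in> vecs E ==> y \<in> vecs E ==> x - y \<in> vecs E"
 by (rule ES.subspace_diff[OF E.subspace])

lemma A_diff: "a \<in> vecs (A_cb G) ==> b \<in> vecs (A_cb G) ==> a - b \<in> vecs (A_cb G)"
 by (rule A.subspace_diff[OF A.sub])

lemma D_mult:
 assumes "a \<in> vecs (A_cb G)" "b \<in> vecs (A_cb G)" "x \<in> vecs E"
 shows "D (mult a b) x = D b (ract E x a) + D a (lact E b x)"
proof -
 have "D (mult a b) = dual_lact E a (D b) + dual_ract E (D a) b"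
  using derivation assms by (simp add: dual_derivation_def Acb_simps)
 then show ?thesis using assms(3) by (simp add: dual_lact_def dual_ract_def)
qed

lemma ract_mult: "a \<in> vecs (A_cb G) ==> b \<in> vecs (A_cb G) ==> x \<in> vecs E ==> ract E (ract E x a) b = ract E x (mult a b)"
 using E.ract_assoc by (simp add: Acb_simps)

lemma ract_commute: "a \<in> vecs (A_cb G) ==> b \<in> vecs (A_cb G) ==> x \<in> vecs E ==> ract E (ract E x a) b = ract E (ract E x b) a"
 by (simp add: ract_mult mult.commute)

lemma vnorm_E_nonneg: "x \<in> vecs E ==> 0 \<le> vnorm E x"
 unfolding vnorm_def by (rule E.norm_nonneg[OF mats_pad])

lemma vnorm_E_triangle:
 assumes "x \<in> vecs E" "y \<in> vecs E" shows "vnorm E (x - y) \<le> vnorm E x + vnorm E y"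
proof -
 have p: "pad 1 (\<lambda>i j. x) \<in> mats E 1" "pad 1 (\<lambda>i j. y) \<in> mats E 1" using assms by (auto intro: mats_pad)
 have "pad 1 (\<lambda>i j. x - y) = pad 1 (\<lambda>i j. x) + (\<lambda>i j. smul E (-1) (pad 1 (\<lambda>i j. y) i j))"
  by (auto simp: fun_eq_iff pad_def)
 moreover have "(\<lambda>i j. smul E (-1) (pad 1 (\<lambda>i j. y) i j)) \<in> mats E 1"
  by (rule matsI) (use assms ES.subspace_neg[OF E.subspace] in \<open>auto simp: pad_def\<close>)
 ultimately have "vnorm E (x - y) \<le> mnorm E 1 (pad 1 (\<lambda>i j. x)) + mnorm E 1 (\<lambda>i j. smul E (-1) (pad 1 (\<lambda>i j. y) i j))"
  unfolding vnorm_def using E.norm_add[OF p(1)] by simp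
 then show ?thesis using E.norm_smul[OF p(2), of "-1"] by (simp add: vnorm_def)
qed

lemma ract_bound:
 obtains C where "0 \<le> C" "\<And>x q g. x \<in> vecs E ==> g \<in> mats (A_cb G) q ==>
   mnorm E q (\<lambda>i j. ract E x (g i j)) \<le> C * vnorm E x * mnorm (A_cb G) q g"
  "\<And>x a. x \<in> vecs E ==> a \<in> vecs (A_cb G) ==> vnorm E (ract E x a) \<le> C * vnorm E x * vnorm (A_cb G) a"
proof -
 obtain C where C: "0 \<le> C" "\<And>x q g. x \<in> vecs E ==> g \<in> mats (A_cb G) q ==>
   mnorm E q (\<lambda>i j. ract E x (g i j)) \<le> C * vnorm E x * mnorm (A_cb G) q g"
  by (rule cb_bilin_bound[OF E.operator_space_axioms operator_space_Acb E.operator_space_axioms E.cb_ract]) (rule that)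
 have "vnorm E (ract E x a) \<le> C * vnorm E x * vnorm (A_cb G) a" if x: "x \<in> vecs E" and a: "a \<in> vecs (A_cb G)" for x a
 proof -
  have "(\<lambda>i j. ract E x (pad 1 (\<lambda>i j. a) i j)) = pad 1 (\<lambda>i j. ract E x a)"
   using lin_on_0[OF A_op lin_ract(1)[OF x] E.ambient] by (auto simp: fun_eq_iff pad_def)
  then show ?thesis using C(2)[OF x pad1_mats[OF a]] by (simp add: vnorm_def)
 qed
 with C show thesis by (rule that)
qed

lemma D_bound:
 obtains C where "0 \<le> C" "\<And>q g m y. g \<in> mats (A_cb G) q ==> y \<in> mats E m ==>
   kbd ({..<q} \<times> {..<m}) (\<lambda>(i, k) (j, l). D (g i j) (y k l)) (C * mnorm (A_cb G) q g * mnorm E m y)"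
  "\<And>x a. x \<in> vecs E ==> a \<in> vecs (A_cb G) ==> cmod (D a x) \<le> C * vnorm (A_cb G) a * vnorm E x"
proof -
 obtain C where C: "\<And>q g. g \<in> mats (A_cb G) q ==> mnorm (os_dual E) q (\<lambda>i j. D (g i j)) \<le> C * mnorm (A_cb G) q g"
  using cb_derivation unfolding cb_on_def by blast
 have K: "kbd ({..<q} \<times> {..<m}) (\<lambda>(i, k) (j, l). D (g i j) (y k l)) (\<bar>C\<bar> * mnorm (A_cb G) q g * mnorm E m y)"
  if g: "g \<in> mats (A_cb G) q" and y: "y \<in> mats E m" for q g m y
 proof (rule os_dual_mnormD[OF E.operator_space_axioms _ _ y])
  show "D (g i j) \<in> vecs (os_dual E)" if "i < q" "j < q" for i j by (rule D_dual[OF mats_in[OF g that]])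
  have "C * mnorm (A_cb G) q g \<le> \<bar>C\<bar> * mnorm (A_cb G) q g"
   by (intro mult_right_mono A.mnorm_nonneg[OF g]) auto
  then show "mnorm (os_dual E) q (\<lambda>i j. D (g i j)) \<le> \<bar>C\<bar> * mnorm (A_cb G) q g" using C[OF g] by linarith
 qed
 have "cmod (D a x) \<le> \<bar>C\<bar> * vnorm (A_cb G) a * vnorm E x" if x: "x \<in> vecs E" and a: "a \<in> vecs (A_cb G)" for x a
 proof -
  have "pad 1 (\<lambda>i j. x) \<in> mats E 1" by (rule mats_pad) (rule x)
  from kbd_entry[OF K[OF pad1_mats[OF a] this], of "(0, 0)" "(0, 0)"]
  show ?thesis by (simp add: pad_def vnorm_def)
 qed
 with abs_ge_zero K show thesis by (rule that)
qed

lemma delta_A: "s \<in> carrier G ==> delta s \<in> vecs (A_cb G)"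
 using delta_finsupp[of s 1] by (intro regular_Acb regular_finsupp) simp

lemma mult_delta: "mult a (delta s) = (\<lambda>t. a s * delta s t)" "mult (delta s) a = (\<lambda>t. a s * delta s t)"
 by (auto simp: delta_def)

lemma D_scale: "a \<in> vecs (A_cb G) ==> D (\<lambda>t. c * a t) x = c * D a x"
 using lin_on_smul[OF lin_D(2)] by (simp add: Acb_simps complex_os_def)

lemma D_ract_scale:
 assumes "x \<in> vecs E" "a \<in> vecs (A_cb G)" "b \<in> vecs (A_cb G)"
 shows "D b (ract E x (\<lambda>t. c * a t)) = c * D b (ract E x a)"
 using lin_on_smul[OF lin_ract(1)[OF assms(1)] assms(2), of c] lin_on_smul[OF lin_D(1)[OF assms(3)] ract_in[OF assms(1,2)], of c]
 by (simp add: Acb_simps complex_os_def)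

section \<open>The traces of a derivation and the approximate identity\<close>

definition trace :: "nat => 'e => complex" where
 "trace k x = (\<Sum>s | e k s \<noteq> 0. e k s * e k s * D (delta s) (ract E x (delta s)))"

text \<open>If \<open>\<pi>\<close> is a permutation representation that is free on the support of \<open>e k\<close>, then the matrix with entries
 \<open>e k s\<close> at \<open>(\<pi> s j, j)\<close> tested against the vector \<open>\<Sum>j. \<delta>\<^sub>j \<otimes> \<delta>\<^sub>j\<close> yields \<open>trace k\<close>.\<close>

lemma trace_bound:
 obtains C where "0 \<le> C" "\<And>k x. x \<in> vecs E ==> cmod (trace k x) \<le> C * vnorm E x"
proof -
 obtain CR where CR: "0 \<le> CR" "\<And>x q g. x \<in> vecs E ==> g \<in> mats (A_cb G) q ==>
   mnorm E q (\<lambda>i j. ract E x (g i j)) \<le> CR * vnorm E x * mnorm (A_cb G) q g"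
  by (rule ract_bound) (rule that)
 obtain CD where CD: "0 \<le> CD" "\<And>q g m y. g \<in> mats (A_cb G) q ==> y \<in> mats E m ==>
   kbd ({..<q} \<times> {..<m}) (\<lambda>(i, k) (j, l). D (g i j) (y k l)) (CD * mnorm (A_cb G) q g * mnorm E m y)"
  by (rule D_bound) (rule that)
 have "cmod (trace k x) \<le> (CD * B * (CR * B)) * vnorm E x" if x: "x \<in> vecs E" for k x
 proof -
  define S where "S = {s. e k s \<noteq> 0}"
  have S: "finite S" "S \<subseteq> carrier G" using e_finsupp[of k] by (auto simp: S_def finsupp_def)
  have "\<exists>(q::nat) \<pi>. 0 < q \<and> (\<forall>s\<in>carrier G. bij_betw (\<pi> s) {..<q} {..<q}) \<and>
    (\<forall>s\<in>carrier G. \<forall>t\<in>carrier G. \<forall>j<q. \<pi> (s \<otimes> t) j = \<pi> s (\<pi> t j)) \<and>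
    (\<forall>s\<in>S. \<forall>t\<in>S. \<forall>j<q. \<pi> s j = \<pi> t j \<longrightarrow> s = t)"
   using spec[OF residually_finite[unfolded residually_finite_def], of S] S by simp
  then obtain q :: nat and \<pi> where q: "0 < q" and h: "\<forall>s\<in>carrier G. bij_betw (\<pi> s) {..<q} {..<q}"
   "\<forall>s\<in>carrier G. \<forall>t\<in>carrier G. \<forall>j<q. \<pi> (s \<otimes> t) j = \<pi> s (\<pi> t j)" "\<forall>s\<in>S. \<forall>t\<in>S. \<forall>j<q. \<pi> s j = \<pi> t j \<longrightarrow> s = t"
   by (elim exE conjE)
  have \<pi>: "bij_betw (\<pi> s) {..<q} {..<q}" if "s \<in> carrier G" for s using h(1) that by simp
  have hom: "\<pi> (s \<otimes> t) j = \<pi> s (\<pi> t j)" if "s \<in> carrier G" "t \<in> carrier G" "j < q" for s t j using h(2) that by simp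
  have free: "s = t" if "s \<in> S" "t \<in> S" "j < q" "\<pi> s j = \<pi> t j" for s t j using h(3) that by blast
  define f where "f i j s = e k s * (if \<pi> s j = i then 1 else 0)" for i j s
  define g where "g = pad q f"
  have gA: "g \<in> mats (A_cb G) q"
   unfolding g_def
  proof (rule mats_pad)
   fix i j
   have "{s. f i j s \<noteq> 0} \<subseteq> S" by (auto simp: f_def S_def)
   then have "finsupp G (f i j)" using S finite_subset unfolding finsupp_def by blast
   then show "f i j \<in> vecs (A_cb G)" by (intro regular_Acb regular_finsupp)
  qed
  then have gM: "g \<in> mats (M_cb G) q" using Acb_M by (auto simp: mats_def)
  \<comment> \<open>The permutation matrix has multiplier norm at most 1 whatever its size is; only
    the bound \<open>B\<close> of \<open>e k\<close> remains.\<close>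
  have "HSm q f (1 * B)"
   unfolding f_def by (rule HSm_e_mult[OF HSm_permutation[OF \<pi> hom] HS_e])
  then have "HSm q g (1 * B)"
   unfolding HSm_def
  proof (intro conjI allI impI; elim conjE)
   fix r \<alpha> d assume h: "\<forall>r \<alpha> d. mbd r \<alpha> d \<longrightarrow> kbd ({..<q} \<times> {..<r} \<times> carrier G) (\<lambda>(i, a, s) (j, b, t). ker (f i j) s t * ker (\<alpha> a b) s t) (1 * B * d)"
    and m: "mbd r \<alpha> d"
   have "kbd ({..<q} \<times> {..<r} \<times> carrier G) (\<lambda>(i, a, s) (j, b, t). ker (f i j) s t * ker (\<alpha> a b) s t) (1 * B * d)" using h m by blast
   then show "kbd ({..<q} \<times> {..<r} \<times> carrier G) (\<lambda>(i, a, s) (j, b, t). ker (g i j) s t * ker (\<alpha> a b) s t) (1 * B * d)"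
    by (rule iffD1[OF kbd_cong, rotated]) (auto simp: g_def pad_def)
  qed
  then have gn: "mnorm (A_cb G) q g \<le> B" using HSm_mnorm[OF gM] by (simp add: Acb_simps)
  define y where "y i j = ract E x (g i j)" for i j
  have gv: "g i j \<in> vecs (A_cb G)" for i j
   using mats_in[OF gA] mats_out[OF gA] A.subspace_0[OF A.sub] by (cases "i < q \<and> j < q") auto
  have yE: "y \<in> mats E q"
   unfolding y_def using mats_out[OF gA] lin_on_0[OF A_op lin_ract(1)[OF x] E.ambient]
   by (intro matsI) (auto intro: ract_in[OF x gv])
  have "mnorm E q y \<le> CR * vnorm E x * mnorm (A_cb G) q g" unfolding y_def by (rule CR(2)[OF x gA])
  also have "\<dots> \<le> CR * vnorm E x * B" using gn CR(1) vnorm_E_nonneg[OF x] by (intro mult_left_mono) auto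
  finally have yn: "mnorm E q y \<le> CR * vnorm E x * B" .
  \<comment> \<open>One factor \<open>B\<close> comes from \<open>g\<close> under \<open>D\<close>,
    the other from \<open>y\<close>, the same matrix acting on \<open>x\<close>. Neither depends on
    \<open>k\<close> or \<open>q\<close>.\<close>
  define c where "c = (CD * B * (CR * B)) * vnorm E x"
  have "CD * mnorm (A_cb G) q g * mnorm E q y \<le> CD * B * (CR * vnorm E x * B)"
   using gn yn CD(1) B_nonneg E.norm_nonneg[OF yE] by (intro mult_mono mult_nonneg_nonneg A.mnorm_nonneg[OF gA]) auto
  also have "\<dots> = c" by (simp add: c_def)
  finally have K: "kbd ({..<q} \<times> {..<q}) (\<lambda>(i, k) (j, l). D (g i j) (y k l)) c" by (rule kbd_mono[OF CD(2)[OF gA yE]])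
  \<comment> \<open>The vector of ones on the diagonal has squared norm \<open>q\<close>, so the
    bound is \<open>q\<close> times \<open>c\<close>. The form at this vector consists of
    \<open>q\<close> copies of \<open>trace k x\<close>, one for each column \<open>j\<close>, and
    \<open>q\<close> cancels.\<close>
  let ?\<Delta> = "(\<lambda>j. (j, j)) ` {..<q}"
  have inj: "inj_on (\<lambda>j. (j, j)) {..<q}" by (auto simp: inj_on_def)
  have n1: "nrm (\<lambda>_. 1) ?\<Delta> = sqrt q" by (simp add: L2_set_def card_image[OF inj])
  have "cmod (kform ?\<Delta> (\<lambda>(i, k) (j, l). D (g i j) (y k l)) (\<lambda>_. 1) (\<lambda>_. 1)) \<le> c * nrm (\<lambda>_. 1) ?\<Delta> * nrm (\<lambda>_. 1) ?\<Delta>"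
   by (rule kbdD[OF K]) auto
  also have "\<dots> = c * q" unfolding n1 by simp
  also have "kform ?\<Delta> (\<lambda>(i, k) (j, l). D (g i j) (y k l)) (\<lambda>_. 1) (\<lambda>_. 1) = (\<Sum>i<q. \<Sum>j<q. D (g i j) (y i j))"
   unfolding kform_def sum.reindex[OF inj] by simp
  also have "\<dots> = (\<Sum>j<q. \<Sum>i<q. D (g i j) (y i j))" by (rule sum.swap)
  also have "\<dots> = (\<Sum>j<q. trace k x)"
  proof (rule sum.cong[OF refl])
   fix j assume "j \<in> {..<q}"
   then have j: "j < q" by simp
   have img: "(\<lambda>s. \<pi> s j) ` S \<subseteq> {..<q}"
   proof
    fix i assume "i \<in> (\<lambda>s. \<pi> s j) ` S"
    then obtain s where s: "i = \<pi> s j" "s \<in> S" by blast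
    then have "bij_betw (\<pi> s) {..<q} {..<q}" using S(2) by (intro \<pi>) blast
    from bij_betwE[OF this] show "i \<in> {..<q}" using j s(1) by simp
   qed
   \<comment> \<open>In column \<open>j\<close> only the rows \<open>\<pi> s j\<close> with
     \<open>s \<in> S\<close> are occupied, each by a multiple of a single point mass, because the
     action is free on \<open>S\<close>.\<close>
   have "D (g i j) (y i j) = 0" if "i < q" "i \<notin> (\<lambda>s. \<pi> s j) ` S" for i
   proof -
    have "g i j = 0" using that j by (auto simp: g_def pad_def f_def S_def fun_eq_iff)
    then show ?thesis using lin_on_0[OF A_op lin_D(2) vector_space_complex] by simp
   qed
   then have "(\<Sum>i<q. D (g i j) (y i j)) = (\<Sum>i\<in>(\<lambda>s. \<pi> s j) ` S. D (g i j) (y i j))"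
    by (intro sum.mono_neutral_right) (use img in auto)
   also have "\<dots> = (\<Sum>s\<in>S. D (g (\<pi> s j) j) (y (\<pi> s j) j))"
    by (subst sum.reindex) (auto simp: inj_on_def intro: free[OF _ _ j])
   also have "\<dots> = trace k x"
    unfolding trace_def S_def[symmetric]
   proof (rule sum.cong[OF refl])
    fix s assume s: "s \<in> S"
    have sG: "s \<in> carrier G" using s S(2) by blast
    have "\<pi> s j < q" using img s by blast
    moreover have "f (\<pi> s j) j t = e k s * delta s t" for t
     using free[OF _ s j, of t] by (auto simp: f_def delta_def S_def)
    ultimately have "g (\<pi> s j) j = (\<lambda>t. e k s * delta s t)" using j by (simp add: g_def pad_def fun_eq_iff)
    then show "D (g (\<pi> s j) j) (y (\<pi> s j) j) = e k s * e k s * D (delta s) (ract E x (delta s))"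
     using D_scale[OF delta_A[OF sG]] D_ract_scale[OF x delta_A[OF sG] delta_A[OF sG]] by (simp add: y_def)
   qed
   finally show "(\<Sum>i<q. D (g i j) (y i j)) = trace k x" .
  qed
  finally have "real q * cmod (trace k x) \<le> real q * c" by (simp add: norm_mult mult.commute)
  then show ?thesis using q by (simp add: c_def)
 qed
 moreover have "0 \<le> CD * B * (CR * B)" using CR(1) CD(1) B_nonneg by simp
 ultimately show thesis using that by blast
qed

definition e2 :: "nat => 'a => complex" where "e2 k s = e k s * e k s"

lemma e2_A: "e2 k \<in> vecs (A_cb G)"
proof -
 have "{s. e2 k s \<noteq> 0} = {s. e k s \<noteq> 0}" by (auto simp: e2_def)
 then have "finsupp G (e2 k)" using e_finsupp[of k] by (simp add: finsupp_def)
 then show ?thesis by (intro regular_Acb regular_finsupp)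
qed

lemma vnorm_e2: "vnorm (A_cb G) (e2 k) \<le> B * B"
proof -
 have "HS (e2 k) (B * B)" unfolding e2_def by (rule HS_times[OF HS_e HS_e])
 from HS_vnorm[OF this] show ?thesis using M_out[OF Acb_M[OF e2_A]] by (simp add: vnorm_def Acb_simps)
qed

lemma A_vnorm_eq: "vnorm (A_cb G) = vnorm (M_cb G)"
 by (simp add: vnorm_def Acb_simps fun_eq_iff)

text \<open>By density it suffices to treat a regular \<open>u\<close>, where
  \<open>e_approx\<close> is used once for \<open>u\<close> and once more after multiplication by
  \<open>e k\<close>. The uniform bound on the squares permits the exchange of \<open>a\<close> and
  \<open>u\<close>.\<close>

lemma e2_approx:
 assumes a: "a \<in> vecs (A_cb G)"
 shows "(\<lambda>k. vnorm (A_cb G) (a - mult a (e2 k))) \<longlonglongrightarrow> 0"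
proof (rule metric_LIMSEQ_I)
 fix \<epsilon> :: real assume \<epsilon>: "0 < \<epsilon>"
 \<comment> \<open>The errors \<open>\<eta>\<close> from \<open>a\<close> to \<open>u\<close>,
   \<open>\<eta> + B * \<eta>\<close> from truncating \<open>u\<close>, and
   \<open>B * B * \<eta>\<close> from returning to \<open>a\<close> add up to
   \<open>\<epsilon> / 2\<close>.\<close>
 define \<eta> where "\<eta> = \<epsilon> / 2 / (2 + B + B * B)"
 have p: "0 < 2 + B + B * B" using B_nonneg by (simp add: add_pos_nonneg)
 have \<eta>: "0 < \<eta>" using \<epsilon> p by (simp add: \<eta>_def)
 obtain u where u: "regular u" "vnorm (M_cb G) (a - u) < \<eta>" using Acb_approx[OF a \<eta>] .
 obtain N where N: "\<And>k. N \<le> k ==> HS (\<lambda>s. u s - e k s * u s) \<eta>" by (rule e_approx[OF u(1) \<eta>]) (rule that)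
 note uM = regular_M[OF u(1)] and aM = Acb_M[OF a] and eM = Acb_M[OF e2_A]
 note d = M.subspace_diff[OF M.sub]
 have "vnorm (M_cb G) (a - mult a (e2 k)) < \<epsilon>" if k: "N \<le> k" for k
 proof -
  have "HS (\<lambda>s. (u s - e k s * u s) + e k s * (u s - e k s * u s)) (\<eta> + B * \<eta>)"
   by (intro HS_add HS_times[OF HS_e] N k)
  moreover have "(\<lambda>s. (u s - e k s * u s) + e k s * (u s - e k s * u s)) = u - mult u (e2 k)"
   by (rule ext) (simp add: e2_def algebra_simps)
  ultimately have h: "HS (u - mult u (e2 k)) (\<eta> + B * \<eta>)" by simp
  have "vnorm (M_cb G) (u - mult u (e2 k)) \<le> \<eta> + B * \<eta>"
   by (rule HS_vnorm[OF h]) (use M_out[OF uM] in auto)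
  moreover have "vnorm (M_cb G) (mult u (e2 k) - mult a (e2 k)) \<le> B * B * \<eta>"
  proof -
   have "mult u (e2 k) - mult a (e2 k) = (\<lambda>s. e2 k s * (u - a) s)" by (rule ext) (simp add: algebra_simps)
   then have "vnorm (M_cb G) (mult u (e2 k) - mult a (e2 k)) \<le> vnorm (M_cb G) (e2 k) * vnorm (M_cb G) (u - a)"
    using vnorm_mult[OF eM d[OF uM aM]] by simp
   also have "\<dots> \<le> B * B * \<eta>"
    using vnorm_e2[of k] u(2) M.vnorm_minus_commute[OF uM aM] M.vnorm_nonneg[OF d[OF uM aM]] M.vnorm_nonneg[OF eM] B_nonneg
    unfolding A_vnorm_eq by (intro mult_mono) auto
   finally show ?thesis .
  qed
  moreover have "vnorm (M_cb G) (a - mult a (e2 k)) \<le> vnorm (M_cb G) (a - u) + vnorm (M_cb G) (u - mult a (e2 k))"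
   by (rule M.vnorm_triangle[OF aM uM M_mult(1)[OF aM eM]])
  moreover have "vnorm (M_cb G) (u - mult a (e2 k)) \<le> vnorm (M_cb G) (u - mult u (e2 k)) + vnorm (M_cb G) (mult u (e2 k) - mult a (e2 k))"
   by (rule M.vnorm_triangle[OF uM M_mult(1)[OF uM eM] M_mult(1)[OF aM eM]])
  ultimately have "vnorm (M_cb G) (a - mult a (e2 k)) \<le> \<eta> + (\<eta> + B * \<eta> + B * B * \<eta>)" using u(2) by linarith
  also have "\<dots> = \<eta> * (2 + B + B * B)" by (simp add: algebra_simps)
  also have "\<dots> = \<epsilon> / 2"
   unfolding \<eta>_def by (rule nonzero_eq_divide_eq[THEN iffD1, OF _ refl]) (use p in simp)
  finally show ?thesis using \<epsilon> by simp
 qed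
 then show "\<exists>no. \<forall>n\<ge>no. dist (vnorm (A_cb G) (a - mult a (e2 n))) 0 < \<epsilon>"
  unfolding A_vnorm_eq using M.vnorm_nonneg[OF d[OF aM M_mult(1)[OF aM eM]]] by (intro exI[of _ N]) (simp add: dist_real_def)
qed

text \<open>\<open>delta s\<close> is idempotent and multiplies \<open>a\<close> to the scalar
  \<open>a s\<close>. The derivation rule expands \<open>D\<close> of the product of
  \<open>delta s\<close> and \<open>a\<close>, at the right translate of \<open>x\<close> by
  \<open>delta s\<close>, into the wanted term plus the summand belonging to
  \<open>lact E a x\<close>; the scalar rule identifies the same value with the summand belonging to
  \<open>ract E x a\<close>.\<close>

lemma trace_commutator:
 assumes a: "a \<in> vecs (A_cb G)" and x: "x \<in> vecs E"
 shows "trace k (ract E x a) - trace k (lact E a x) = D a (ract E x (e2 k))"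
proof -
 define S where "S = {s. e k s \<noteq> 0}"
 have S: "finite S" "S \<subseteq> carrier G" using e_finsupp[of k] by (auto simp: S_def finsupp_def)
 have "D (delta s) (ract E (ract E x a) (delta s)) - D (delta s) (ract E (lact E a x) (delta s)) = D a (ract E x (delta s))"
  if s: "s \<in> S" for s
 proof -
  have \<delta>: "delta s \<in> vecs (A_cb G)" by (rule delta_A[OF subsetD[OF S(2) s]])
  note y = ract_in[OF x \<delta>]
  have "ract E (ract E x (delta s)) (delta s) = ract E x (delta s)"
   unfolding ract_mult[OF \<delta> \<delta> x] mult_delta(1)[of "delta s" s] by (simp add: delta_def[of s, THEN fun_cong, of s])
  then have "D (mult (delta s) a) (ract E x (delta s)) = D a (ract E x (delta s)) + D (delta s) (ract E (lact E a x) (delta s))"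
   using D_mult[OF \<delta> a y] E.lact_ract[OF a \<delta> x] by simp
  moreover have "D (mult (delta s) a) (ract E x (delta s)) = a s * D (delta s) (ract E x (delta s))"
   unfolding mult_delta(2)[of s a] by (rule D_scale[OF \<delta>])
  moreover have "D (delta s) (ract E (ract E x a) (delta s)) = a s * D (delta s) (ract E x (delta s))"
   unfolding ract_mult[OF a \<delta> x] mult_delta(1)[of a s] by (rule D_ract_scale[OF x \<delta> \<delta>])
  ultimately show ?thesis by simp
 qed
 then have "trace k (ract E x a) - trace k (lact E a x) = (\<Sum>s\<in>S. e2 k s * D a (ract E x (delta s)))"
  unfolding trace_def S_def[symmetric] sum_subtractf[symmetric] right_diff_distrib[symmetric] e2_def by simp
 also have "\<dots> = (\<Sum>s\<in>S. D a (ract E x (\<lambda>t. e2 k s * delta s t)))"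
  by (rule sum.cong[OF refl]) (use D_ract_scale[OF x delta_A a] S(2) in auto)
 also have "\<dots> = D a (ract E x (\<Sum>s\<in>S. (\<lambda>t. e2 k s * delta s t)))"
 proof -
  have m: "(\<lambda>t. e2 k s * delta s t) \<in> vecs (A_cb G)" if "s \<in> S" for s
   using delta_finsupp that S(2) by (intro regular_Acb regular_finsupp) auto
  have "ract E x (\<Sum>s\<in>S. (\<lambda>t. e2 k s * delta s t)) = (\<Sum>s\<in>S. ract E x (\<lambda>t. e2 k s * delta s t))"
   by (rule lin_on_sum[OF A_op lin_ract(1)[OF x] E.ambient S(1) m])
  also have "D a \<dots> = (\<Sum>s\<in>S. D a (ract E x (\<lambda>t. e2 k s * delta s t)))"
   by (rule lin_on_sum[OF E.ambient E.subspace lin_D(1)[OF a] vector_space_complex S(1) ract_in[OF x m]])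
  finally show ?thesis by simp
 qed
 also have "(\<Sum>s\<in>S. (\<lambda>t. e2 k s * delta s t)) = e2 k"
 proof
  fix t
  have "(\<Sum>s\<in>S. e2 k s * delta s t) = (\<Sum>s\<in>S. if s = t then e2 k t else 0)"
   by (intro sum.cong refl) (auto simp: delta_def)
  also have "\<dots> = e2 k t" using S(1) by (auto simp: S_def e2_def)
  finally show "(\<Sum>s\<in>S. (\<lambda>t. e2 k s * delta s t)) t = e2 k t" by (simp add: sum_fun_apply)
 qed
 finally show ?thesis .
qed

text \<open>The traces implement \<open>D a\<close> only up to the defect \<open>z\<close>, the
  Banach limit of \<open>D a (Y j x)\<close>. The second functional reproduces \<open>z\<close>: for
  a module with trivial right action a limit of \<open>D\<close> at an approximate identity
  implements \<open>D\<close> up to sign, and the remainders \<open>Y j x\<close> behave like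
  elements of such a module in the limit.\<close>

theorem inner: "inner_derivation (A_cb G) E D"
proof -
 obtain L :: "(nat => complex) => complex" where
  L_add: "\<And>x y. Bseq x ==> Bseq y ==> L (\<lambda>k. x k + y k) = L x + L y"
  and L_scale: "\<And>c x. Bseq x ==> L (\<lambda>k. c * x k) = c * L x"
  and L_lim: "\<And>x l. x \<longlonglongrightarrow> l ==> L x = l" and L_bound': "\<And>x c. \<forall>k. cmod (x k) \<le> c ==> cmod (L x) \<le> c"
  by (rule Banach_limit) (rule that)
 have L_bound: "cmod (L x) \<le> c" if "\<And>k. cmod (x k) \<le> c" for x c using L_bound' that by blast
 have L_diff: "L (\<lambda>k. x k - y k) = L x - L y" if "Bseq x" "Bseq y" for x y
 proof -
  have "Bseq (\<lambda>k. - 1 * y k)" using that(2) by (simp add: Bseq_def)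
  then have "L (\<lambda>k. x k + - 1 * y k) = L x + - 1 * L y"
   unfolding L_scale[OF that(2), symmetric] by (rule L_add[OF that(1)])
  then show ?thesis by simp
 qed
 obtain CT where CT: "0 \<le> CT" "\<And>k x. x \<in> vecs E ==> cmod (trace k x) \<le> CT * vnorm E x"
  by (rule trace_bound) (rule that)
 obtain CR where CR: "0 \<le> CR" "\<And>x a. x \<in> vecs E ==> a \<in> vecs (A_cb G) ==> vnorm E (ract E x a) \<le> CR * vnorm E x * vnorm (A_cb G) a"
  by (rule ract_bound) (rule that)
 obtain CD where CD: "0 \<le> CD" "\<And>x a. x \<in> vecs E ==> a \<in> vecs (A_cb G) ==> cmod (D a x) \<le> CD * vnorm (A_cb G) a * vnorm E x"
  by (rule D_bound) (rule that)
 \<comment> \<open>\<open>Y j x\<close> is what the right action of the approximate identity misses.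
   Acting on it from the right with a fixed element gives something that tends to 0 in
   \<open>j\<close>.\<close>
 define Y where "Y j x = x - ract E x (e2 j)" for j x
 have Y: "Y j x \<in> vecs E" if "x \<in> vecs E" for j x
  unfolding Y_def by (rule E_diff[OF that ract_in[OF that e2_A]])
 define CY where "CY = 1 + CR * (B * B)"
 have CY0: "0 \<le> CY" using CR(1) B_nonneg by (simp add: CY_def)
 have Yn: "vnorm E (Y j x) \<le> CY * vnorm E x" if x: "x \<in> vecs E" for j x
 proof -
  have "CR * vnorm E x * vnorm (A_cb G) (e2 j) \<le> CR * vnorm E x * (B * B)"
   using CR(1) vnorm_E_nonneg[OF x] vnorm_e2 by (intro mult_left_mono) auto
  then have "vnorm E (Y j x) \<le> vnorm E x + CR * vnorm E x * (B * B)"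
   using vnorm_E_triangle[OF x ract_in[OF x e2_A[of j]]] CR(2)[OF x e2_A[of j]] unfolding Y_def by linarith
  then show ?thesis by (simp add: CY_def algebra_simps)
 qed
 have DYn: "cmod (D a (Y j x)) \<le> CD * vnorm (A_cb G) a * (CY * vnorm E x)" if "a \<in> vecs (A_cb G)" "x \<in> vecs E" for a j x
 proof -
  have "CD * vnorm (A_cb G) a * vnorm E (Y j x) \<le> CD * vnorm (A_cb G) a * (CY * vnorm E x)"
   using CD(1) A.vnorm_nonneg[OF that(1)] Yn[OF that(2)] by (intro mult_left_mono) auto
  then show ?thesis using CD(2)[OF Y[OF that(2)] that(1), of j] by linarith
 qed
 have B_trace: "Bseq (\<lambda>k. trace k x)" if "x \<in> vecs E" for x by (rule BseqI'[OF CT(2)[OF that]])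
 have B_Y: "Bseq (\<lambda>j. D a (Y j x))" if "a \<in> vecs (A_cb G)" "x \<in> vecs E" for a x by (rule BseqI'[OF DYn[OF that]])
 have B_null: "Bseq z" if "z \<longlonglongrightarrow> 0" for z :: "nat => complex" using that by (simp add: convergent_imp_Bseq convergentI)
 \<comment> \<open>The limit over \<open>j\<close> comes before the one over \<open>k\<close>: for
   fixed \<open>k\<close> it removes the terms in which \<open>e2 k\<close> acts on the remainders
   from the right.\<close>
 define \<rho> where "\<rho> k x = L (\<lambda>j. D (e2 k) (Y j x))" for k x
 have \<rho>n: "cmod (\<rho> k x) \<le> CD * (B * B) * (CY * vnorm E x)" if x: "x \<in> vecs E" for k x
  unfolding \<rho>_def
 proof (rule L_bound)
  fix j
  have "CD * vnorm (A_cb G) (e2 k) * (CY * vnorm E x) \<le> CD * (B * B) * (CY * vnorm E x)"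
   using CD(1) vnorm_e2 CY0 vnorm_E_nonneg[OF x] by (intro mult_right_mono mult_left_mono) auto
  then show "cmod (D (e2 k) (Y j x)) \<le> CD * (B * B) * (CY * vnorm E x)" using DYn[OF e2_A x, of k j] by linarith
 qed
 have B_\<rho>: "Bseq (\<lambda>k. \<rho> k x)" if "x \<in> vecs E" for x by (rule BseqI'[OF \<rho>n[OF that]])
 define \<Phi> where "\<Phi> x = (if x \<in> vecs E then L (\<lambda>k. trace k x) - L (\<lambda>k. \<rho> k x) else 0)" for x

 have Y_add: "Y j (x + y) = Y j x + Y j y" if "x \<in> vecs E" "y \<in> vecs E" for j x y
  unfolding Y_def using lin_on_add[OF lin_ract(2)[OF e2_A] that] by (simp add: algebra_simps)
 have Y_smul: "Y j (smul E c x) = smul E c (Y j x)" if "x \<in> vecs E" for j c x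
  unfolding Y_def using lin_on_smul[OF lin_ract(2)[OF e2_A] that] by (simp add: ES.scale_right_diff_distrib)
 have tr_lin: "trace k (x + y) = trace k x + trace k y" "trace k (smul E c x) = c * trace k x"
  if x: "x \<in> vecs E" and y: "y \<in> vecs E" for k x y c
 proof -
  have d: "delta s \<in> vecs (A_cb G)" if "e k s \<noteq> 0" for s using delta_A e_finsupp[of k] that by (auto simp: finsupp_def)
  have "D (delta s) (ract E (x + y) (delta s)) = D (delta s) (ract E x (delta s)) + D (delta s) (ract E y (delta s))"
   "D (delta s) (ract E (smul E c x) (delta s)) = c * D (delta s) (ract E x (delta s))" if "e k s \<noteq> 0" for s
  proof -
   note d = d[OF that]
   show "D (delta s) (ract E (x + y) (delta s)) = D (delta s) (ract E x (delta s)) + D (delta s) (ract E y (delta s))"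
    using lin_on_add[OF lin_ract(2)[OF d] x y] lin_on_add[OF lin_D(1)[OF d] ract_in[OF x d] ract_in[OF y d]] by simp
   show "D (delta s) (ract E (smul E c x) (delta s)) = c * D (delta s) (ract E x (delta s))"
    using lin_on_smul[OF lin_ract(2)[OF d] x, of c] lin_on_smul[OF lin_D(1)[OF d] ract_in[OF x d], of c] by (simp add: complex_os_def)
  qed
  then show "trace k (x + y) = trace k x + trace k y" "trace k (smul E c x) = c * trace k x"
   unfolding trace_def sum.distrib[symmetric] sum_distrib_left by (auto simp: algebra_simps intro!: sum.cong)
 qed
 have \<rho>_add: "\<rho> k (x + y) = \<rho> k x + \<rho> k y" if x: "x \<in> vecs E" and y: "y \<in> vecs E" for k x y
  unfolding \<rho>_def Y_add[OF x y] lin_on_add[OF lin_D(1)[OF e2_A] Y[OF x] Y[OF y]] by (intro L_add B_Y e2_A x y)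
 have \<rho>_smul: "\<rho> k (smul E c x) = c * \<rho> k x" if x: "x \<in> vecs E" for k x c
 proof -
  have "D (e2 k) (Y j (smul E c x)) = c * D (e2 k) (Y j x)" for j
   unfolding Y_smul[OF x] using lin_on_smul[OF lin_D(1)[OF e2_A] Y[OF x]] by (simp add: complex_os_def)
  then show ?thesis unfolding \<rho>_def using L_scale[OF B_Y[OF e2_A x]] by simp
 qed
 have \<Phi>_dual: "\<Phi> \<in> vecs (os_dual E)"
 proof -
  have "lin_on E complex_os \<Phi>"
   unfolding lin_on_def
  proof (intro conjI ballI allI)
   fix x y assume x: "x \<in> vecs E" and y: "y \<in> vecs E"
   have xy: "x + y \<in> vecs E" by (rule ES.subspace_add[OF E.subspace x y])
   have "\<Phi> (x + y) = L (\<lambda>k. trace k x + trace k y) - L (\<lambda>k. \<rho> k x + \<rho> k y)"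
    using xy by (simp add: \<Phi>_def tr_lin(1)[OF x y] \<rho>_add[OF x y])
   then show "\<Phi> (x + y) = \<Phi> x + \<Phi> y"
    using L_add[OF B_trace[OF x] B_trace[OF y]] L_add[OF B_\<rho>[OF x] B_\<rho>[OF y]] x y by (simp add: \<Phi>_def)
  next
   fix c x assume x: "x \<in> vecs E"
   have cx: "smul E c x \<in> vecs E" by (rule ES.subspace_scale[OF E.subspace x])
   have "\<Phi> (smul E c x) = L (\<lambda>k. c * trace k x) - L (\<lambda>k. c * \<rho> k x)"
    using cx by (simp add: \<Phi>_def tr_lin(2)[OF x x] \<rho>_smul[OF x])
   then show "\<Phi> (smul E c x) = smul complex_os c (\<Phi> x)"
    using L_scale[OF B_trace[OF x]] L_scale[OF B_\<rho>[OF x]] x by (simp add: \<Phi>_def complex_os_def algebra_simps)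
  qed (simp add: complex_os_def)
  moreover have "cmod (\<Phi> x) \<le> (CT + CD * (B * B) * CY) * vnorm E x" if x: "x \<in> vecs E" for x
  proof -
   have "cmod (\<Phi> x) \<le> cmod (L (\<lambda>k. trace k x)) + cmod (L (\<lambda>k. \<rho> k x))"
    using x by (simp add: \<Phi>_def norm_triangle_ineq4)
   moreover have "cmod (L (\<lambda>k. trace k x)) \<le> CT * vnorm E x" by (rule L_bound[OF CT(2)[OF x]])
   moreover have "cmod (L (\<lambda>k. \<rho> k x)) \<le> CD * (B * B) * (CY * vnorm E x)" by (rule L_bound[OF \<rho>n[OF x]])
   ultimately show ?thesis by (simp add: algebra_simps)
  qed
  ultimately show ?thesis unfolding os_dual_def by (auto simp: \<Phi>_def)
 qed

 have ract_null: "(\<lambda>j. D b (ract E x (a - mult a (e2 j)))) \<longlonglongrightarrow> 0"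
  if a: "a \<in> vecs (A_cb G)" and b: "b \<in> vecs (A_cb G)" and x: "x \<in> vecs E" for a b x
 proof (rule Lim_null_comparison)
  have "(\<lambda>j. CD * vnorm (A_cb G) b * (CR * vnorm E x * vnorm (A_cb G) (a - mult a (e2 j)))) \<longlonglongrightarrow> CD * vnorm (A_cb G) b * (CR * vnorm E x * 0)"
   by (intro tendsto_mult tendsto_const e2_approx[OF a])
  then show "(\<lambda>j. CD * vnorm (A_cb G) b * (CR * vnorm E x * vnorm (A_cb G) (a - mult a (e2 j)))) \<longlonglongrightarrow> 0" by simp
  have "cmod (D b (ract E x (a - mult a (e2 j)))) \<le> CD * vnorm (A_cb G) b * (CR * vnorm E x * vnorm (A_cb G) (a - mult a (e2 j)))" for j
  proof -
   have d: "a - mult a (e2 j) \<in> vecs (A_cb G)" by (rule A_diff[OF a Acb_mult[OF a e2_A]])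
   have "CD * vnorm (A_cb G) b * vnorm E (ract E x (a - mult a (e2 j))) \<le> CD * vnorm (A_cb G) b * (CR * vnorm E x * vnorm (A_cb G) (a - mult a (e2 j)))"
    using CD(1) A.vnorm_nonneg[OF b] CR(2)[OF x d] by (intro mult_left_mono) auto
   then show ?thesis using CD(2)[OF ract_in[OF x d] b] by linarith
  qed
  then show "\<forall>\<^sub>F j in sequentially. norm (D b (ract E x (a - mult a (e2 j)))) \<le> CD * vnorm (A_cb G) b * (CR * vnorm E x * vnorm (A_cb G) (a - mult a (e2 j)))"
   by simp
 qed

 have Yr: "ract E (Y j x) a = ract E x (a - mult a (e2 j))" if a: "a \<in> vecs (A_cb G)" and x: "x \<in> vecs E" for a x j
  unfolding Y_def ract_diff(1)[OF x a Acb_mult[OF a e2_A]] ract_diff(2)[OF a x ract_in[OF x e2_A]]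
  by (simp add: ract_mult[OF e2_A a x] mult.commute)

 have inner: "D a x = \<Phi> (ract E x a) - \<Phi> (lact E a x)" if a: "a \<in> vecs (A_cb G)" and x: "x \<in> vecs E" for a x
 proof -
  note xa = ract_in[OF x a] and ax = lact_in[OF a x]
  \<comment> \<open>Three values are combined: the traces contribute \<open>D a x - z\<close>, the
    limit of \<open>\<rho> k\<close> is 0 at \<open>ract E x a\<close> and \<open>z\<close> at
    \<open>lact E a x\<close>.\<close>
  define z where "z = L (\<lambda>j. D a (Y j x))"
  have tr: "L (\<lambda>k. trace k (ract E x a)) - L (\<lambda>k. trace k (lact E a x)) = L (\<lambda>k. D a (ract E x (e2 k)))"
   unfolding L_diff[OF B_trace[OF xa] B_trace[OF ax], symmetric] trace_commutator[OF a x] ..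
  have "z = D a x - L (\<lambda>k. D a (ract E x (e2 k)))"
  proof -
   have "cmod (D a (ract E x (e2 k))) \<le> cmod (D a x) + CD * vnorm (A_cb G) a * (CY * vnorm E x)" for k
    using norm_triangle_ineq4[of "D a x" "D a (Y k x)"] DYn[OF a x, of k]
    unfolding Y_def D_simps(1)[OF a x ract_in[OF x e2_A]] by simp
   then have b: "Bseq (\<lambda>k. D a (ract E x (e2 k)))" by (rule BseqI')
   have "L (\<lambda>k. D a x - D a (ract E x (e2 k))) = L (\<lambda>k. D a x) - L (\<lambda>k. D a (ract E x (e2 k)))"
    by (rule L_diff[OF _ b]) simp
   then show ?thesis
    unfolding z_def Y_def D_simps(1)[OF a x ract_in[OF x e2_A]] using L_lim[OF tendsto_const, of "D a x"] by simp
  qed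
  moreover have "L (\<lambda>k. \<rho> k (ract E x a)) = 0"
  proof -
   \<comment> \<open>\<open>Y j\<close> commutes with the right action of \<open>a\<close>, so
     \<open>a\<close> acts on the remainder of \<open>x\<close>, and the result vanishes in the
     limit over \<open>j\<close>.\<close>
   have "D (e2 k) (Y j (ract E x a)) = D (e2 k) (ract E x (a - mult a (e2 j)))" for k j
    unfolding Yr[OF a x, symmetric] Y_def ract_diff(2)[OF a x ract_in[OF x e2_A]] ract_commute[OF e2_A a x] ..
   then have "\<rho> k (ract E x a) = 0" for k
    unfolding \<rho>_def using L_lim[OF ract_null[OF a e2_A x]] by simp
   then show ?thesis using L_lim[OF tendsto_const, of 0] by simp
  qed
  moreover have "L (\<lambda>k. \<rho> k (lact E a x)) = z"
  proof (rule L_lim)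
   \<comment> \<open>After the limit over \<open>j\<close> only \<open>D\<close> at the difference
     between \<open>a\<close> and its product with \<open>e2 k\<close> is left, which is small in
     norm uniformly over the remainders.\<close>
   have e: "\<rho> k (lact E a x) - z = L (\<lambda>j. D (mult (e2 k) a - a) (Y j x))" for k
   proof -
    have ka: "mult (e2 k) a \<in> vecs (A_cb G)" by (rule Acb_mult[OF e2_A a])
    \<comment> \<open>The derivation rule for the product of \<open>e2 k\<close> and
      \<open>a\<close> at \<open>Y j x\<close>, solved for the term with the left action of
      \<open>a\<close>.\<close>
    have "D (e2 k) (Y j (lact E a x)) = D (mult (e2 k) a) (Y j x) - D a (ract E x (e2 k - mult (e2 k) (e2 j)))" for j
    proof -
     have "Y j (lact E a x) = lact E a (Y j x)"
      unfolding Y_def lact_diff[OF a x ract_in[OF x e2_A]] E.lact_ract[OF a e2_A x] ..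
     then show ?thesis using D_mult[OF e2_A a Y[OF x], of k j] Yr[OF e2_A x, of j k] by simp
    qed
    then have "\<rho> k (lact E a x) = L (\<lambda>j. D (mult (e2 k) a) (Y j x) - D a (ract E x (e2 k - mult (e2 k) (e2 j))))"
     unfolding \<rho>_def by simp
    also have "\<dots> = L (\<lambda>j. D (mult (e2 k) a) (Y j x)) - L (\<lambda>j. D a (ract E x (e2 k - mult (e2 k) (e2 j))))"
     by (intro L_diff B_Y ka x B_null ract_null e2_A a)
    also have "L (\<lambda>j. D a (ract E x (e2 k - mult (e2 k) (e2 j)))) = 0" by (rule L_lim[OF ract_null[OF e2_A a x]])
    finally have "\<rho> k (lact E a x) - z = L (\<lambda>j. D (mult (e2 k) a) (Y j x)) - L (\<lambda>j. D a (Y j x))" by (simp add: z_def)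
    then show ?thesis unfolding L_diff[OF B_Y[OF ka x] B_Y[OF a x], symmetric] D_simps(2)[OF ka a] .
   qed
   have "(\<lambda>k. \<rho> k (lact E a x) - z) \<longlonglongrightarrow> 0"
   proof (rule Lim_null_comparison)
    have "(\<lambda>k. CD * vnorm (A_cb G) (a - mult a (e2 k)) * (CY * vnorm E x)) \<longlonglongrightarrow> CD * 0 * (CY * vnorm E x)"
     by (intro tendsto_mult tendsto_const e2_approx[OF a])
    then show "(\<lambda>k. CD * vnorm (A_cb G) (a - mult a (e2 k)) * (CY * vnorm E x)) \<longlonglongrightarrow> 0" by simp
    have "cmod (\<rho> k (lact E a x) - z) \<le> CD * vnorm (A_cb G) (a - mult a (e2 k)) * (CY * vnorm E x)" for k
    proof -
     have ka: "mult a (e2 k) \<in> vecs (A_cb G)" by (rule Acb_mult[OF a e2_A])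
     have "mult (e2 k) a = mult a (e2 k)" by (simp add: mult.commute)
     then show ?thesis
      unfolding e A.vnorm_minus_commute[OF a ka] using DYn[OF A_diff[OF ka a] x] by (auto intro!: L_bound)
    qed
    then show "\<forall>\<^sub>F k in sequentially. norm (\<rho> k (lact E a x) - z) \<le> CD * vnorm (A_cb G) (a - mult a (e2 k)) * (CY * vnorm E x)" by simp
   qed
   then show "(\<lambda>k. \<rho> k (lact E a x)) \<longlonglongrightarrow> z" by (rule LIM_zero_cancel)
  qed
  ultimately show ?thesis using xa ax by (simp add: \<Phi>_def tr[symmetric])
 qed
 show ?thesis
  unfolding inner_derivation_def
 proof (intro bexI[OF _ \<Phi>_dual] ballI)
  fix a assume a: "a \<in> vecs (A_cb G)"
  show "D a = dual_lact E a \<Phi> - dual_ract E \<Phi> a"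
  proof
   fix x
   have "D a x = 0" if "x \<notin> vecs E" using D_dual[OF a] that by (simp add: os_dual_def)
   then show "D a x = (dual_lact E a \<Phi> - dual_ract E \<Phi> a) x"
    using inner[OF a] by (simp add: dual_lact_def dual_ract_def)
  qed
 qed
qed

end

theorem mainTheorem2:
 shows "operator_amenable TYPE('e::ab_group_add) (A_cb F2)"
proof -
 interpret approx_group F2 haagerup_fun 2 by (rule approx_group_F2)
 show ?thesis
  unfolding operator_amenable_def
 proof (intro conjI allI impI quantized_banach_algebra_Acb; elim conjE)
  fix E :: "((bool \<times> bool) list => complex, 'e) op_bimodule" and D
  assume "quantized_banach_bimodule (A_cb F2) E" "dual_derivation (A_cb F2) E D" "cb_on (A_cb F2) (os_dual E) D"
  then have "bimodule_derivation F2 haagerup_fun 2 E D"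
   by (intro bimodule_derivation.intro[OF approx_group_F2] bimodule_derivation_axioms.intro residually_finite_F2)
  then show "inner_derivation (A_cb F2) E D" by (rule bimodule_derivation.inner)
 qed
qed

end
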